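(* Let $p,p_d$ and the Wigner matrices $H=H^{(N)}$ satisfy the noise assumptions listed in the context. Define $$F := \int_{-\infty}^{\infty} \frac{(p'(x))^2}{p(x)}\,dx,\qquad F_d := \int_{-\infty}^{\infty} \frac{(p_d'(x))^2}{p_d(x)}\,dx,\qquad G := \int_{-\infty}^{\infty} \frac{(p''(x))^2}{p(x)}\,dx ,$$ let $\omega>0$ be a fixed constant with $\omega F<1$, and let $$\rho := -\frac14\left(\log(1-\omega F)+\omega(F-2F_d)+\frac{\omega^2}{4}(2F^2-G)\right).$$ Then the error probability of the likelihood ratio test (which rejects $\boldsymbol H_0$ if and only if $\mathcal L(M;\omega)>1$), $$\mathrm{err}(\omega):=\mathbb P(\text{reject }\boldsymbol H_0\mid\boldsymbol H_0)+\mathbb P(\text{do not reject }\boldsymbol H_0\mid\boldsymbol H_1),$$ converges, as $N\to\infty$, to $$\mathrm{erfc}\left(\frac{\sqrt\rho}{2}\right)=\frac{2}{\sqrt\pi}\int_{\sqrt\rho/2}^{\infty}e^{-x^2}\,dx .$$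
   Context: Noise. $H=(H_{ij})$ is an $N\times N$ real symmetric random matrix (a Wigner matrix) such that $H_{ij}$, $1\le i\le j\le N$, are independent centered real random variables with $N\,\mathbb E[H_{ij}^2]=1$ for $i<j$ and $N\,\mathbb E[H_{ii}^2]=w_2$ for some constant $w_2$ independent of $N$; for every $D>0$ there is a constant $C_D$ independent of $N$ with $N^{D/2}\,\mathbb E[|H_{ij}|^D]\le C_D$ for all $1\le i\le j\le N$. The normalized off-diagonal entries $\sqrt N H_{ij}$ ($i<j$) all have density $p$ and the normalized diagonal entries $\sqrt N H_{ii}$ all have density $p_d$, where $p,p_d$ do not depend on $N$ and satisfy: (1) $p$ and $p_d$ are smooth, positive everywhere, and symmetric about $0$; (2) $p$, $p_d$ and all their derivatives vanish at infinity; (3) for every positive integer $s$ there are constants $C_s,r_s>0$, independent of $N$, with $|p^{(s)}(x)/p(x)|,\ |p_d^{(s)}(x)/p_d(x)|\le C_s(1+|x|^{r_s})$ for all $x\in\mathbb R$, where $p^{(s)},p_d^{(s)}$ are the $s$-th derivatives. Spike and hypotheses. $\boldsymbol x=(x_1,\dots,x_N)$ is a random vector, independent of $H$, with $\sqrt N x_i$ i.i.d. Rademacher ($\pm1$ with probability $1/2$ each). The data matrix is $M=H+\sqrt\lambda\,\boldsymbol x\boldsymbol x^T$; $\boldsymbol H_0:\lambda=0$ and $\boldsymbol H_1:\lambda=\omega>0$. $\mathbb P(\cdot\mid\boldsymbol H_i)$ denotes probability when $M$ is generated under $\boldsymbol H_i$. Likelihood ratio (of the law of $M$ under $\boldsymbol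 H_1$ with respect to its law under $\boldsymbol H_0$): $$\mathcal L(M;\omega)=\frac1{2^N}\sum_{\boldsymbol x\in\{\pm1/\sqrt N\}^N}\ \prod_{i<j}\frac{p(\sqrt N M_{ij}-\sqrt{\omega N}\,x_ix_j)}{p(\sqrt N M_{ij})}\ \prod_{k}\frac{p_d(\sqrt N M_{kk}-\sqrt{\omega N}\,x_k^2)}{p_d(\sqrt N M_{kk})}.$$ *)

theory Defs
  imports "HOL-Probability.Probability"
begin

definition noise_densities :: "(real \<Rightarrow> real) \<Rightarrow> (real \<Rightarrow> real) \<Rightarrow> bool" where
  "noise_densities p pd \<longleftrightarrow>
     (\<forall>q \<in> {p, pd}.
        (\<forall>n x. (deriv ^^ n) q differentiable (at x)) \<and>
        (\<forall>x. q x > 0) \<and>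
        (\<forall>x. q (- x) = q x) \<and>
        (\<forall>n. ((deriv ^^ n) q \<longlongrightarrow> 0) at_infinity)) \<and>
     (\<forall>s\<ge>1. \<exists>C>0. \<exists>r>0. \<forall>x. \<forall>q \<in> {p, pd}.
        \<bar>(deriv ^^ s) q x / q x\<bar> \<le> C * (1 + \<bar>x\<bar> powr r))"

definition upper_pairs :: "nat \<Rightarrow> (nat \<times> nat) set" where
  "upper_pairs N = {(i, j). 1 \<le> i \<and> i \<le> j \<and> j \<le> N}"

definition strict_upper_pairs :: "nat \<Rightarrow> (nat \<times> nat) set" where
  "strict_upper_pairs N = {(i, j). 1 \<le> i \<and> i < j \<and> j \<le> N}"

text \<open>
  For each \<open>N \<ge> 1\<close>, the matrix \<open>H N\<close> lives on its own probability space \<open>P N\<close>, with rows and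
  columns indexed by \<open>{1..N}\<close>.  The constants \<open>w2\<close> and \<open>C\<close> are chosen before \<open>N\<close>.  Integrability is
  stated explicitly since the Bochner integral of a non-integrable function is 0; the exponents
  1 and 2 cover the first and second moments.
\<close>

definition wigner_noise ::
  "(nat \<Rightarrow> 'a measure) \<Rightarrow> (nat \<Rightarrow> nat \<Rightarrow> nat \<Rightarrow> 'a \<Rightarrow> real) \<Rightarrow> (real \<Rightarrow> real) \<Rightarrow> (real \<Rightarrow> real) \<Rightarrow> bool"
where
  "wigner_noise P H p pd \<longleftrightarrow>
     (\<forall>N\<ge>1. prob_space (P N) \<and>
        (\<forall>i\<in>{1..N}. \<forall>j\<in>{1..N}. \<forall>\<xi>\<in>space (P N). H N i j \<xi> = H N j i \<xi>) \<and>
        prob_space.indep_vars (P N) (\<lambda>_. borel) (\<lambda>(i, j). H N i j) (upper_pairs N) \<and>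
        (\<forall>(i, j)\<in>upper_pairs N. prob_space.expectation (P N) (H N i j) = 0) \<and>
        (\<forall>(i, j)\<in>strict_upper_pairs N.
           real N * prob_space.expectation (P N) (\<lambda>\<xi>. (H N i j \<xi>)\<^sup>2) = 1) \<and>
        (\<forall>(i, j)\<in>strict_upper_pairs N.
           distributed (P N) lborel (\<lambda>\<xi>. sqrt (real N) * H N i j \<xi>) (\<lambda>x. ennreal (p x))) \<and>
        (\<forall>i\<in>{1..N}.
           distributed (P N) lborel (\<lambda>\<xi>. sqrt (real N) * H N i i \<xi>) (\<lambda>x. ennreal (pd x)))) \<and>
     (\<exists>w2. \<forall>N\<ge>1. \<forall>i\<in>{1..N}.
        real N * prob_space.expectation (P N) (\<lambda>\<xi>. (H N i i \<xi>)\<^sup>2) = w2) \<and>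
     (\<forall>D>0. \<exists>C. \<forall>N\<ge>1. \<forall>(i, j)\<in>upper_pairs N.
        integrable (P N) (\<lambda>\<xi>. \<bar>H N i j \<xi>\<bar> powr D) \<and>
        real N powr (D / 2) * prob_space.expectation (P N) (\<lambda>\<xi>. \<bar>H N i j \<xi>\<bar> powr D) \<le> C)"

text \<open>
  The library's \<open>indep_var\<close> needs both variables to have the same value type, so independence of
  the matrix and the vector is stated for the \<open>\<sigma>\<close>-algebras they generate.
\<close>

definition rademacher_spike ::
  "(nat \<Rightarrow> 'a measure) \<Rightarrow> (nat \<Rightarrow> nat \<Rightarrow> nat \<Rightarrow> 'a \<Rightarrow> real) \<Rightarrow> (nat \<Rightarrow> nat \<Rightarrow> 'a \<Rightarrow> real) \<Rightarrow> bool"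
where
  "rademacher_spike P H X \<longleftrightarrow>
     (\<forall>N\<ge>1.
        prob_space.indep_vars (P N) (\<lambda>_. borel) (X N) {1..N} \<and>
        (\<forall>i\<in>{1..N}.
           measure (P N) {\<xi> \<in> space (P N). sqrt (real N) * X N i \<xi> = 1} = 1 / 2 \<and>
           measure (P N) {\<xi> \<in> space (P N). sqrt (real N) * X N i \<xi> = - 1} = 1 / 2) \<and>
        prob_space.indep_set (P N)
          (sets (vimage_algebra (space (P N))
             (\<lambda>\<xi>. \<lambda>(i, j)\<in>upper_pairs N. H N i j \<xi>) (PiM (upper_pairs N) (\<lambda>_. borel))))
          (sets (vimage_algebra (space (P N))
             (\<lambda>\<xi>. \<lambda>i\<in>{1..N}. X N i \<xi>) (PiM {1..N} (\<lambda>_. borel)))))"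

definition data_matrix ::
  "real \<Rightarrow> (nat \<Rightarrow> nat \<Rightarrow> 'a \<Rightarrow> real) \<Rightarrow> (nat \<Rightarrow> 'a \<Rightarrow> real) \<Rightarrow> 'a \<Rightarrow> nat \<Rightarrow> nat \<Rightarrow> real"
where
  "data_matrix lam H X \<xi> i j = H i j \<xi> + sqrt lam * X i \<xi> * X j \<xi>"

definition likelihood_ratio ::
  "(real \<Rightarrow> real) \<Rightarrow> (real \<Rightarrow> real) \<Rightarrow> nat \<Rightarrow> real \<Rightarrow> (nat \<Rightarrow> nat \<Rightarrow> real) \<Rightarrow> real"
where
  "likelihood_ratio p pd N \<omega> M =
     1 / 2 ^ N *
     (\<Sum>x \<in> {1..N} \<rightarrow>\<^sub>E {1 / sqrt (real N), - 1 / sqrt (real N)}.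
        (\<Prod>(i, j)\<in>strict_upper_pairs N.
           p (sqrt (real N) * M i j - sqrt (\<omega> * real N) * x i * x j) / p (sqrt (real N) * M i j)) *
        (\<Prod>k\<in>{1..N}.
           pd (sqrt (real N) * M k k - sqrt (\<omega> * real N) * (x k)\<^sup>2) / pd (sqrt (real N) * M k k)))"

definition lrt_rejects ::
  "(real \<Rightarrow> real) \<Rightarrow> (real \<Rightarrow> real) \<Rightarrow> nat \<Rightarrow> real \<Rightarrow> (nat \<Rightarrow> nat \<Rightarrow> real) \<Rightarrow> bool"
where
  "lrt_rejects p pd N \<omega> M \<longleftrightarrow> likelihood_ratio p pd N \<omega> M > 1"

text \<open>The null hypothesis is \<open>lam = 0\<close>, the alternative \<open>lam = \<omega>\<close>.\<close>

definition lrt_error ::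
  "(nat \<Rightarrow> 'a measure) \<Rightarrow> (nat \<Rightarrow> nat \<Rightarrow> nat \<Rightarrow> 'a \<Rightarrow> real) \<Rightarrow> (nat \<Rightarrow> nat \<Rightarrow> 'a \<Rightarrow> real) \<Rightarrow>
   (real \<Rightarrow> real) \<Rightarrow> (real \<Rightarrow> real) \<Rightarrow> real \<Rightarrow> nat \<Rightarrow> real"
where
  "lrt_error P H X p pd \<omega> N =
     measure (P N) {\<xi> \<in> space (P N). lrt_rejects p pd N \<omega> (data_matrix 0 (H N) (X N) \<xi>)} +
     measure (P N) {\<xi> \<in> space (P N). \<not> lrt_rejects p pd N \<omega> (data_matrix \<omega> (H N) (X N) \<xi>)}"

definition info_F :: "(real \<Rightarrow> real) \<Rightarrow> real" where
  "info_F q = (\<integral>x. (deriv q x)\<^sup>2 / q x \<partial>lborel)"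

definition info_G :: "(real \<Rightarrow> real) \<Rightarrow> real" where
  "info_G q = (\<integral>x. (deriv (deriv q) x)\<^sup>2 / q x \<partial>lborel)"

definition lrt_rho :: "(real \<Rightarrow> real) \<Rightarrow> (real \<Rightarrow> real) \<Rightarrow> real \<Rightarrow> real" where
  "lrt_rho p pd \<omega> =
     (let F = info_F p; Fd = info_F pd; G = info_G p
      in - (1 / 4) * (ln (1 - \<omega> * F) + \<omega> * (F - 2 * Fd) + \<omega>\<^sup>2 / 4 * (2 * F\<^sup>2 - G)))"

definition erfc :: "real \<Rightarrow> real" where
  "erfc z = 2 / sqrt pi * (LINT x:{z..}|lborel. exp (- x\<^sup>2))"

end

theory Submission
  imports Defs
begin

text \<open>Under the null hypothesis \<open>L\<close> has mean one, and a change of measure turns the error probability into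
  the expectation of \<open>min 1 L\<close> under the null hypothesis (\<open>lrt_error_eq\<close>). If \<open>L\<close> were log-normal,
  \<open>L = exp (sqrt v * Z - v / 2)\<close> with \<open>Z\<close> standard Gaussian, this expectation would be
  \<open>erfc (sqrt (v / 8))\<close>. The limit is the value for
  \<open>v = 2 * \<rho>\<close>, with \<open>\<rho>\<close> the constant of the theorem.

  No limit theorem for \<open>L\<close> is proved. Instead, \<open>min 1\<close> is replaced by the Black--Scholes function
  \<open>bs l v\<close>, the expectation of \<open>min 1 (l * exp (sqrt v * Z - v / 2))\<close>, which satisfies
  \<open>\<partial>bs / \<partial>v = l\<^sup>2 / 2 * \<partial>\<^sup>2bs / \<partial>l\<^sup>2\<close> (\<open>DERIV_bs_v\<close>). The matrix entries are revealed one row at a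
  time. If a new row adds to \<open>L\<close> an increment of conditional mean zero and conditional variance
  \<open>\<sigma>\<^sup>2 * L\<^sup>2\<close>, then lowering the variance parameter by \<open>\<sigma>\<^sup>2\<close> at the same time leaves the expectation of
  \<open>bs\<close> unchanged to second order (\<open>bs_row_step\<close>, \<open>bs_diag_step\<close>), and telescoping leaves
  \<open>bs 1\<close> of the total variance.

  The conditional variance of the increment from \<open>k\<close> to \<open>k + 1\<close> rows is quadratic in the spin
  correlations \<open>m i j\<close>, the sums of \<open>x i * x j\<close> over spin vectors weighted by their contributions to
  \<open>L\<close>. It is not a multiple of \<open>L\<^sup>2\<close>, but it behaves like one inside expectations against functions of
  \<open>L\<close> (\<open>concentration\<close>): indices are exchangeable, so the sum of all
  \<open>(m i j)\<^sup>2\<close> can be expressed by the correlations with the last index, and those are, up to the factor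
  \<open>C\<close> of order \<open>1 / N\<close>, the sum of all \<open>(m i j)\<^sup>2\<close> one step earlier. This recursion is a contraction exactly
  because the limit \<open>\<omega> * F\<close> of \<open>N * C\<close> is below one. The same condition bounds the exponential moments of the
  squared overlap of two spin vectors (\<open>replica_exp_bound\<close>), which controls all error terms. Summing the
  variances of the rows gives the logarithm in \<open>\<rho>\<close> (\<open>tail_approx\<close>); the diagonal contributes
  \<open>N\<close> independent factors (\<open>bs_diag\<close>).

  The density ratios are unbounded. They are therefore replaced by \<open>1\<close> outside a slowly growing window and
  rescaled to mean one, which changes \<open>L\<close> by a factor tending to one outside an event of vanishing
  probability (\<open>truncation_error\<close>).\<close>

section \<open>The complementary error function\<close>

lemmas lint_cong = Bochner_Integration.integral_cong

lemma integrable_gauss_half_line: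
  fixes A :: "real set"
  assumes "A \<in> sets borel"
  shows "set_integrable lborel A (\<lambda>x::real. exp (- x\<^sup>2))"
proof -
  have 1: "has_bochner_integral lborel (\<lambda>x::real. exp (- x\<^sup>2)) (2 *\<^sub>R (sqrt pi / 2))"
    by (rule has_bochner_integral_even_function[OF gaussian_moment_0]) simp
  then have "integrable lborel (\<lambda>x::real. exp (- x\<^sup>2))"
    using has_bochner_integral_iff by blast
  then show ?thesis
    using assms unfolding set_integrable_def
    by (intro integrable_mult_indicator) auto
qed

lemma gauss_total: "(\<integral>x. exp (- x\<^sup>2) \<partial>lborel) = sqrt pi"
proof -
  have 1: "has_bochner_integral lborel (\<lambda>x::real. exp (- x\<^sup>2)) (2 *\<^sub>R (sqrt pi / 2))"
    by (rule has_bochner_integral_even_function[OF gaussian_moment_0]) simp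
  then show ?thesis using has_bochner_integral_iff by fastforce
qed

lemma erfc_diff:
  assumes "a \<le> b"
  shows "erfc a - erfc b = 2 / sqrt pi * integral {a..b} (\<lambda>x. exp (- x\<^sup>2))"
proof -
  have "(LINT x:{a..}|lborel. exp (- x\<^sup>2)) = (LINT x:{a..b} \<union> {b<..}|lborel. exp (- x\<^sup>2))"
    using assms by (intro arg_cong[where f="\<lambda>A. LINT x:A|lborel. exp (- x\<^sup>2)"]) auto
  also have "\<dots> = (LINT x:{a..b}|lborel. exp (- x\<^sup>2)) + (LINT x:{b<..}|lborel. exp (- x\<^sup>2))"
    by (intro set_integral_Un integrable_gauss_half_line) auto
  also have "(LINT x:{b<..}|lborel. exp (- x\<^sup>2)) = (LINT x:{b..}|lborel. exp (- x\<^sup>2))"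
    unfolding set_lebesgue_integral_def
    by (intro integral_cong_AE)
       (auto intro!: AE_I[of _ _ "{b}"] simp: indicator_def split: if_splits)
  also have "(LINT x:{a..b}|lborel. exp (- x\<^sup>2)) = integral {a..b} (\<lambda>x. exp (- x\<^sup>2))"
    by (intro set_borel_integral_eq_integral integrable_gauss_half_line) auto
  finally show ?thesis unfolding erfc_def by (simp add: algebra_simps)
qed

lemma DERIV_erfc: "(erfc has_real_derivative - (2 / sqrt pi * exp (- z\<^sup>2))) (at z)"
proof -
  have "((\<lambda>u. integral {z - 1..u} (\<lambda>x::real. exp (- x\<^sup>2))) has_real_derivative exp (- z\<^sup>2))
          (at z within {z - 1..z + 1})"
    by (rule integral_has_real_derivative) (auto intro!: continuous_intros)
  then have 1: "((\<lambda>u. integral {z - 1..u} (\<lambda>x::real. exp (- x\<^sup>2))) has_real_derivative exp (- z\<^sup>2)) (at z)"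
    by (subst (asm) at_within_interior) auto
  have 2: "((\<lambda>u. erfc (z - 1) - 2 / sqrt pi * integral {z - 1..u} (\<lambda>x::real. exp (- x\<^sup>2)))
      has_real_derivative - (2 / sqrt pi * exp (- z\<^sup>2))) (at z)"
    using DERIV_diff[OF DERIV_const DERIV_cmult[OF 1, of "2 / sqrt pi"], of "erfc (z - 1)"] by simp
  show ?thesis
  proof (rule has_field_derivative_transform_within[OF 2, of 1])
    fix u assume "dist u z < 1"
    then have "z - 1 \<le> u" by (auto simp: dist_real_def)
    from erfc_diff[OF this] show "erfc (z - 1) - 2 / sqrt pi * integral {z - 1..u} (\<lambda>x. exp (- x\<^sup>2)) = erfc u"
      by simp
  qed auto
qed

lemma DERIV_erfc_chain [derivative_intros]:
  "(g has_real_derivative g') (at x within s) \<Longrightarrow>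
   ((\<lambda>x. erfc (g x)) has_real_derivative - (2 / sqrt pi * exp (- (g x)\<^sup>2)) * g') (at x within s)"
  using DERIV_chain2[OF DERIV_erfc] by blast

lemma erfc_nonneg: "0 \<le> erfc z"
  unfolding erfc_def set_lebesgue_integral_def by (intro mult_nonneg_nonneg integral_nonneg) auto

lemma continuous_erfc: "continuous_on A erfc"
  by (meson DERIV_erfc DERIV_continuous continuous_at_imp_continuous_on)

lemma borel_measurable_erfc [measurable]: "erfc \<in> borel_measurable borel"
  by (rule borel_measurable_continuous_onI[OF continuous_erfc])

lemma erfc_minus: "erfc (- z) = 2 - erfc z"
proof -
  have "(LINT x:{-z..}|lborel. exp (- x\<^sup>2)) = (\<integral>x. indicator {-z..} (-x) * exp (- x\<^sup>2) \<partial>lborel)"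
    unfolding set_lebesgue_integral_def
    using lborel_integral_real_affine[of "-1" "\<lambda>x. indicator {-z..} x * exp (- x\<^sup>2)" 0] by simp
  also have "\<dots> = (LINT x:{..z}|lborel. exp (- x\<^sup>2))"
    unfolding set_lebesgue_integral_def
    by (intro lint_cong) (auto simp: indicator_def)
  finally have 1: "(LINT x:{-z..}|lborel. exp (- x\<^sup>2)) = (LINT x:{..z}|lborel. exp (- x\<^sup>2))" .
  have "(LINT x:{..z} \<union> {z<..}|lborel. exp (- x\<^sup>2)) =
        (LINT x:{..z}|lborel. exp (- x\<^sup>2)) + (LINT x:{z<..}|lborel. exp (- x\<^sup>2))"
    by (intro set_integral_Un integrable_gauss_half_line) auto
  moreover have "{..z} \<union> {z<..} = (UNIV::real set)" by auto
  moreover have "(LINT x:{z<..}|lborel. exp (- x\<^sup>2)) = (LINT x:{z..}|lborel. exp (- x\<^sup>2))"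
    unfolding set_lebesgue_integral_def
    by (intro integral_cong_AE)
       (auto intro!: AE_I[of _ _ "{z}"] simp: indicator_def split: if_splits)
  moreover have "(LINT x:UNIV|lborel. exp (- x\<^sup>2)) = sqrt pi"
    unfolding set_lebesgue_integral_def using gauss_total by simp
  ultimately have 2: "(LINT x:{..z}|lborel. exp (- x\<^sup>2)) = sqrt pi - (LINT x:{z..}|lborel. exp (- x\<^sup>2))"
    by simp
  show ?thesis unfolding erfc_def 1 2 by (simp add: field_simps)
qed

lemma erfc_le_2: "erfc z \<le> 2"
  using erfc_nonneg[of "- z"] erfc_minus[of z] by simp

lemma erfc_at_top: "(erfc \<longlongrightarrow> 0) at_top"
proof -
  have "((\<lambda>z. LINT x:{z..}|lborel. exp (- x\<^sup>2)) \<longlongrightarrow> (\<integral>x. 0 \<partial>(lborel::real measure))) (at_top::real filter)"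
    unfolding set_lebesgue_integral_def
  proof (rule integral_dominated_convergence_at_top[where w = "\<lambda>x::real. exp (- x\<^sup>2)"])
    show "integrable lborel (\<lambda>x::real. exp (- x\<^sup>2))"
      using integrable_gauss_half_line[of UNIV] by (simp add: set_integrable_def)
    show "\<forall>\<^sub>F z in at_top. AE x in lborel. norm (indicator {z..} x *\<^sub>R exp (- x\<^sup>2)) \<le> exp (- x\<^sup>2)" for z :: real
      by (auto simp: indicator_def)
    show "AE x in lborel. ((\<lambda>z. indicator {z..} x *\<^sub>R exp (- x\<^sup>2)) \<longlongrightarrow> 0) (at_top::real filter)"
    proof (rule AE_I2)
      fix x :: real
      show "((\<lambda>z. indicator {z..} x *\<^sub>R exp (- x\<^sup>2)) \<longlongrightarrow> 0) (at_top::real filter)"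
        by (rule tendsto_eventually, rule eventually_mono[OF eventually_gt_at_top[of x]]) auto
    qed
  qed (auto simp: indicator_def)
  then have "((\<lambda>z. 2 / sqrt pi * (LINT x:{z..}|lborel. exp (- x\<^sup>2))) \<longlongrightarrow> 2 / sqrt pi * 0) (at_top::real filter)"
    by (intro tendsto_intros) simp
  then show ?thesis by (simp add: erfc_def[abs_def])
qed

lemma erfc_at_bot: "(erfc \<longlongrightarrow> 2) at_bot"
proof -
  have "((\<lambda>z. 2 - erfc (- z)) \<longlongrightarrow> 2 - 0) at_bot"
    by (intro tendsto_intros filterlim_compose[OF erfc_at_top filterlim_uminus_at_top_at_bot])
  then show ?thesis by (simp add: erfc_minus)
qed

lemma erfc_lipschitz: "\<bar>erfc a - erfc b\<bar> \<le> 2 * \<bar>a - b\<bar>"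
proof -
  have "norm (erfc a - erfc b) \<le> 2 * norm (a - b)"
  proof (rule field_differentiable_bound[of UNIV erfc "\<lambda>z. - (2 / sqrt pi * exp (- z\<^sup>2))"])
    fix z :: real
    have "1 \<le> sqrt pi" using pi_gt3 by simp
    moreover have "exp (- z\<^sup>2) \<le> 1" by simp
    ultimately have "exp (- z\<^sup>2) \<le> sqrt pi" by linarith
    then show "norm (- (2 / sqrt pi * exp (- z\<^sup>2))) \<le> 2"
      using \<open>1 \<le> sqrt pi\<close> by (simp add: divide_simps abs_mult)
  next
    show "(erfc has_real_derivative - (2 / sqrt pi * exp (- z\<^sup>2))) (at z within UNIV)" for z
      by (rule DERIV_erfc)
  qed auto
  then show ?thesis by simp
qed

section \<open>A smooth surrogate for \<open>min 1\<close>\<close>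

text \<open>The Black--Scholes function: the expectation of \<open>min 1 (l * exp (sqrt v * Z - v / 2))\<close> for a standard
  Gaussian \<open>Z\<close>, split according to which argument of \<open>min\<close> is the smaller one. The functions
  \<open>bs_delta\<close> and \<open>bs_gamma\<close> are its first two derivatives in \<open>l\<close>.\<close>

definition bs :: "real \<Rightarrow> real \<Rightarrow> real" where
  "bs l v = (l * erfc ((ln l + v / 2) / sqrt (2 * v)) + erfc ((v / 2 - ln l) / sqrt (2 * v))) / 2"

definition bs_delta :: "real \<Rightarrow> real \<Rightarrow> real" where
  "bs_delta l v = erfc ((ln l + v / 2) / sqrt (2 * v)) / 2"

definition bs_gamma :: "real \<Rightarrow> real \<Rightarrow> real" where
  "bs_gamma l v = - (exp (- ((ln l + v / 2) / sqrt (2 * v))\<^sup>2) / (l * sqrt (2 * pi * v)))"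

lemma bs_at_1: "v > 0 \<Longrightarrow> bs 1 v = erfc (sqrt (v / 8))"
proof -
  assume v: "v > 0"
  have "(v / 2) / sqrt (2 * v) = sqrt (v / 8)"
  proof (rule power2_eq_imp_eq)
    show "((v / 2) / sqrt (2 * v))\<^sup>2 = (sqrt (v / 8))\<^sup>2"
      using v by (simp add: power_divide power2_eq_square)
  qed (use v in auto)
  then show ?thesis by (simp add: bs_def)
qed

text \<open>Makes the contributions of the two Gaussian densities to the first derivative cancel.\<close>

lemma bs_exp_swap:
  assumes "l > 0" "v > 0"
  shows "exp (- ((v / 2 - ln l) / sqrt (2 * v))\<^sup>2) = l * exp (- ((ln l + v / 2) / sqrt (2 * v))\<^sup>2)"
proof -
  have "- ((v / 2 - ln l) / sqrt (2 * v))\<^sup>2 = ln l + - ((ln l + v / 2) / sqrt (2 * v))\<^sup>2"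
    using assms by (simp add: power_divide power2_eq_square field_simps)
  then show ?thesis using assms by (simp only: exp_add exp_ln)
qed

lemma sqrt_pi_mult: "sqrt (2 * pi * v) = sqrt pi * sqrt (2 * v)"
  by (metis mult.commute mult.left_commute real_sqrt_mult)

lemma DERIV_bs:
  assumes "l > 0" "v > 0"
  shows "((\<lambda>l. bs l v) has_real_derivative bs_delta l v) (at l)"
proof -
  let ?p = "(ln l + v / 2) / sqrt (2 * v)" and ?q = "(v / 2 - ln l) / sqrt (2 * v)"
  have alg: "(1 * e + l * (- (2 / P * E) * ((1 / l) / s)) + (- (2 / P * (l * E)) * ((- (1 / l)) / s))) / 2 = e / 2"
    if "s > 0" "P > 0" for s P E e :: real
    using that assms by (simp add: field_simps)
  have dp: "((\<lambda>l. (ln l + v / 2) / sqrt (2 * v)) has_real_derivative (1 / l) / sqrt (2 * v)) (at l)"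
    using assms by (intro DERIV_cdivide) (auto intro!: derivative_eq_intros)
  have dq: "((\<lambda>l. (v / 2 - ln l) / sqrt (2 * v)) has_real_derivative (- (1 / l)) / sqrt (2 * v)) (at l)"
    using assms by (intro DERIV_cdivide) (auto intro!: derivative_eq_intros)
  have "((\<lambda>l. bs l v) has_real_derivative
     (1 * erfc ?p + l * (- (2 / sqrt pi * exp (- ?p\<^sup>2)) * ((1 / l) / sqrt (2 * v)))
      + (- (2 / sqrt pi * exp (- ?q\<^sup>2)) * ((- (1 / l)) / sqrt (2 * v)))) / 2) (at l)"
    unfolding bs_def[abs_def]
    using DERIV_cdivide[OF DERIV_add[OF DERIV_mult[OF DERIV_ident DERIV_erfc_chain[OF dp]]
      DERIV_erfc_chain[OF dq]], of 2] by (simp add: mult.commute add.commute)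
  also have "(1 * erfc ?p + l * (- (2 / sqrt pi * exp (- ?p\<^sup>2)) * ((1 / l) / sqrt (2 * v)))
      + (- (2 / sqrt pi * exp (- ?q\<^sup>2)) * ((- (1 / l)) / sqrt (2 * v)))) / 2 = bs_delta l v"
    unfolding bs_exp_swap[OF assms] bs_delta_def using assms by (intro alg) auto
  finally show ?thesis .
qed

lemma DERIV_bs_delta:
  assumes "l > 0" "v > 0"
  shows "((\<lambda>l. bs_delta l v) has_real_derivative bs_gamma l v) (at l)"
proof -
  let ?p = "(ln l + v / 2) / sqrt (2 * v)"
  have dp: "((\<lambda>l. (ln l + v / 2) / sqrt (2 * v)) has_real_derivative (1 / l) / sqrt (2 * v)) (at l)"
    using assms by (intro DERIV_cdivide) (auto intro!: derivative_eq_intros)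
  have "((\<lambda>l. bs_delta l v) has_real_derivative
     (- (2 / sqrt pi * exp (- ?p\<^sup>2)) * ((1 / l) / sqrt (2 * v))) / 2) (at l)"
    unfolding bs_delta_def[abs_def]
    using DERIV_cdivide[OF DERIV_erfc_chain[OF dp], of 2] by simp
  also have "(- (2 / sqrt pi * exp (- ?p\<^sup>2)) * ((1 / l) / sqrt (2 * v))) / 2 = bs_gamma l v"
    unfolding bs_gamma_def sqrt_pi_mult by simp
  finally show ?thesis .
qed

text \<open>The Black--Scholes equation, by which a change of the variance parameter compensates the variance of a
  multiplicative increment.\<close>

lemma DERIV_bs_v:
  assumes "l > 0" "v > 0"
  shows "((\<lambda>v. bs l v) has_real_derivative l\<^sup>2 * bs_gamma l v / 2) (at v)"
proof -
  let ?p = "(ln l + v / 2) / sqrt (2 * v)" and ?q = "(v / 2 - ln l) / sqrt (2 * v)"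
  have alg: "(l * (- (2 / P * E) * ((1 / 2 * r - (y + v / 2) * t) / (2 * v)))
      + (- (2 / P * (l * E)) * ((1 / 2 * r - (v / 2 - y) * t) / (2 * v)))) / 2
      = - (l * E) / (P * (2 * v)) * (r - v * t)"
    if "P > 0" for P E r y t :: real
    using that assms by (simp add: field_simps)
  have s: "sqrt (2 * v) > 0" "sqrt (2 * v) * sqrt (2 * v) = 2 * v" using assms by auto
  have d: "((\<lambda>v. sqrt (2 * v)) has_real_derivative 1 / sqrt (2 * v)) (at v)"
    using assms by (auto intro!: derivative_eq_intros simp: divide_simps)
  have np: "((\<lambda>v. ln l + v / 2) has_real_derivative 1 / 2) (at v)"
    and nq: "((\<lambda>v. v / 2 - ln l) has_real_derivative 1 / 2) (at v)"
    by (auto intro!: derivative_eq_intros)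
  have dp: "((\<lambda>v. (ln l + v / 2) / sqrt (2 * v)) has_real_derivative
      (1 / 2 * sqrt (2 * v) - (ln l + v / 2) * (1 / sqrt (2 * v))) / (2 * v)) (at v)"
    by (rule DERIV_cong[OF DERIV_divide[OF np d]]) (use s in auto)
  have dq: "((\<lambda>v. (v / 2 - ln l) / sqrt (2 * v)) has_real_derivative
      (1 / 2 * sqrt (2 * v) - (v / 2 - ln l) * (1 / sqrt (2 * v))) / (2 * v)) (at v)"
    by (rule DERIV_cong[OF DERIV_divide[OF nq d]]) (use s in auto)
  have "((\<lambda>v. bs l v) has_real_derivative
     (l * (- (2 / sqrt pi * exp (- ?p\<^sup>2)) * ((1 / 2 * sqrt (2 * v) - (ln l + v / 2) * (1 / sqrt (2 * v))) / (2 * v)))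
      + (- (2 / sqrt pi * exp (- ?q\<^sup>2)) * ((1 / 2 * sqrt (2 * v) - (v / 2 - ln l) * (1 / sqrt (2 * v))) / (2 * v)))) / 2) (at v)"
    unfolding bs_def[abs_def]
    by (intro DERIV_cdivide DERIV_add DERIV_cmult DERIV_erfc_chain dp dq)
  also have "(l * (- (2 / sqrt pi * exp (- ?p\<^sup>2)) * ((1 / 2 * sqrt (2 * v) - (ln l + v / 2) * (1 / sqrt (2 * v))) / (2 * v)))
      + (- (2 / sqrt pi * exp (- ?q\<^sup>2)) * ((1 / 2 * sqrt (2 * v) - (v / 2 - ln l) * (1 / sqrt (2 * v))) / (2 * v)))) / 2
     = - (l * exp (- ?p\<^sup>2)) / (sqrt pi * (2 * v)) * (sqrt (2 * v) - v * (1 / sqrt (2 * v)))"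
    unfolding bs_exp_swap[OF assms] using assms by (intro alg) auto
  also have "sqrt (2 * v) - v * (1 / sqrt (2 * v)) = v / sqrt (2 * v)"
    using s by (simp add: field_simps)
  also have "- (l * exp (- ?p\<^sup>2)) / (sqrt pi * (2 * v)) * (v / sqrt (2 * v)) = l\<^sup>2 * bs_gamma l v / 2"
  proof -
    have "- (l * E) / (P * (2 * v)) * (v / r) = l\<^sup>2 * - (E / (l * (P * r))) / 2" if "P > 0" "r > 0" for P E r
      using that assms by (simp add: field_simps power2_eq_square)
    then show ?thesis unfolding bs_gamma_def sqrt_pi_mult using assms by simp
  qed
  finally show ?thesis .
qed

text \<open>In the variable \<open>y = ln l\<close> the second derivative is a multiple of a Gaussian density.\<close>

lemma bs_gamma_eq:
  assumes "l > 0" "v > 0"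
  shows "bs_gamma l v = - (exp v / sqrt (2 * pi * v) * exp (- ((ln l + 3 * v / 2) / sqrt v)\<^sup>2 / 2))"
proof -
  have sq: "((ln l + v / 2) / sqrt (2 * v))\<^sup>2 = (ln l + v / 2)\<^sup>2 / (2 * v)"
    "((ln l + 3 * v / 2) / sqrt v)\<^sup>2 = (ln l + 3 * v / 2)\<^sup>2 / v"
    using assms by (simp_all add: power_divide)
  have "- ((ln l + v / 2) / sqrt (2 * v))\<^sup>2 - ln l = v + - ((ln l + 3 * v / 2) / sqrt v)\<^sup>2 / 2"
    unfolding sq using assms by (simp add: power2_eq_square field_simps)
  then have "exp (- ((ln l + v / 2) / sqrt (2 * v))\<^sup>2 - ln l) = exp v * exp (- ((ln l + 3 * v / 2) / sqrt v)\<^sup>2 / 2)"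
    by (simp only: exp_add)
  moreover have "exp (- ((ln l + v / 2) / sqrt (2 * v))\<^sup>2 - ln l) = exp (- ((ln l + v / 2) / sqrt (2 * v))\<^sup>2) / l"
    using assms by (simp only: exp_diff exp_ln)
  ultimately have "exp (- ((ln l + v / 2) / sqrt (2 * v))\<^sup>2) / l = exp v * exp (- ((ln l + 3 * v / 2) / sqrt v)\<^sup>2 / 2)"
    by (simp only:)
  moreover have "- (E / (l * r)) = - (E / l / r)" for E r by simp
  ultimately show ?thesis unfolding bs_gamma_def by (simp only: times_divide_eq_left)
qed

lemma bs_theta_eq:
  assumes "l > 0" "v > 0"
  shows "l\<^sup>2 * bs_gamma l v / 2 = - (1 / (2 * sqrt (2 * pi * v)) * exp (- (v / 2 - ln l)\<^sup>2 / (2 * v)))"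
proof -
  have 1: "((v / 2 - ln l) / sqrt (2 * v))\<^sup>2 = (v / 2 - ln l)\<^sup>2 / (2 * v)"
    using assms by (simp add: power_divide)
  have "l\<^sup>2 * bs_gamma l v = - (l * exp (- ((ln l + v / 2) / sqrt (2 * v))\<^sup>2)) / sqrt (2 * pi * v)"
    unfolding bs_gamma_def using assms by (simp add: power2_eq_square)
  also have "l * exp (- ((ln l + v / 2) / sqrt (2 * v))\<^sup>2) = exp (- (v / 2 - ln l)\<^sup>2 / (2 * v))"
    unfolding bs_exp_swap[OF assms, symmetric] 1 by simp
  finally show ?thesis by simp
qed

lemma abs_mult_exp_le: "\<bar>x\<bar> * exp (- x\<^sup>2 / 2) \<le> (1::real)"
proof -
  have "\<bar>x\<bar> \<le> 1 + x\<^sup>2 / 2"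
    using sum_squares_bound[of "\<bar>x\<bar>" 1] by (simp add: power2_eq_square)
  also have "\<dots> \<le> exp (x\<^sup>2 / 2)" by simp
  finally show ?thesis by (simp add: exp_minus field_simps)
qed

lemma square_mult_exp_le: "x\<^sup>2 * exp (- x\<^sup>2 / 2) \<le> (2::real)"
proof -
  have "x\<^sup>2 / 2 \<le> exp (x\<^sup>2 / 2)" using exp_ge_add_one_self[of "x\<^sup>2 / 2"] by linarith
  then show ?thesis by (simp add: exp_minus field_simps)
qed

text \<open>What the telescoping argument uses of the second derivative: it is bounded, and it is Lipschitz in the logarithmic
  variable, with constants that are uniform as long as the variance parameter stays in a compact
  subinterval of the positive half line.\<close>

definition gentle :: "real \<Rightarrow> (real \<Rightarrow> real) \<Rightarrow> bool" where
  "gentle K h \<longleftrightarrow> h \<in> borel_measurable borel \<and> (\<forall>l>0. \<bar>h l\<bar> \<le> K) \<and>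
     (\<forall>l>0. \<forall>l'>0. \<bar>h l' - h l\<bar> \<le> K * \<bar>l' - l\<bar> / l)"

lemma borel_measurable_bs [measurable]: "(\<lambda>l. bs l v) \<in> borel_measurable borel"
  unfolding bs_def by measurable

lemma borel_measurable_bs_gamma [measurable]: "(\<lambda>l. bs_gamma l v) \<in> borel_measurable borel"
  unfolding bs_gamma_def by measurable

text \<open>When \<open>l\<close> at most halves, \<open>ln l\<close> moves by at most a multiple of the relative increment;
  when it drops further, the relative increment is at least \<open>1 / 2\<close> and boundedness suffices.\<close>

lemma gentle_log_lipschitz:
  fixes H :: "real \<Rightarrow> real"
  assumes m: "(\<lambda>l. H (ln l)) \<in> borel_measurable borel"
    and b: "\<And>y. \<bar>H y\<bar> \<le> K" and L: "\<And>x y. \<bar>H x - H y\<bar> \<le> K * \<bar>x - y\<bar>"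
  shows "gentle (4 * K) (\<lambda>l. H (ln l))"
proof -
  have K: "K \<ge> 0" using b[of 0] by linarith
  have "\<bar>H (ln l') - H (ln l)\<bar> \<le> 4 * K * \<bar>l' - l\<bar> / l" if l: "l > 0" "l' > 0" for l l'
  proof (cases "l' \<ge> l / 2")
    case True
    define x where "x = (l' - l) / l"
    have x: "l' = l * (1 + x)" "x \<ge> - 1 / 2" using l True by (auto simp: x_def field_simps)
    have "ln l' - ln l = ln (1 + x)" using x l by (simp add: ln_mult)
    moreover have "ln (1 + x) \<le> x" using x by (intro ln_add_one_self_le_self2) auto
    moreover have "- ln (1 + x) \<le> 2 * \<bar>x\<bar>"
    proof -
      have "- ln (1 + x) = ln (1 + (- x / (1 + x)))" using x by (simp add: ln_inverse[symmetric] field_simps)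
      also have "\<dots> \<le> - x / (1 + x)" using x by (intro ln_add_one_self_le_self2) (auto simp: field_simps)
      also have "\<dots> \<le> 2 * \<bar>x\<bar>"
      proof -
        have "\<bar>x\<bar> \<le> 2 * \<bar>x\<bar> * (1 + x)" using mult_left_mono[of "1 / 2" "1 + x" "2 * \<bar>x\<bar>"] x by simp
        then show ?thesis using x by (simp add: divide_simps)
      qed
      finally show ?thesis .
    qed
    ultimately have "\<bar>ln l' - ln l\<bar> \<le> 2 * \<bar>x\<bar>" by linarith
    then have "K * \<bar>ln l' - ln l\<bar> \<le> K * (4 * \<bar>x\<bar>)" using K by (intro mult_left_mono) auto
    moreover have "K * (4 * \<bar>x\<bar>) = 4 * K * \<bar>l' - l\<bar> / l" using l by (simp add: x_def)
    ultimately show ?thesis using L[of "ln l'" "ln l"] by linarith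
  next
    case False
    then have "1 / 2 \<le> \<bar>l' - l\<bar> / l" using l by (simp add: field_simps)
    from mult_left_mono[OF this, of "4 * K"] K have "2 * K \<le> 4 * K * \<bar>l' - l\<bar> / l" by simp
    moreover have "\<bar>H (ln l') - H (ln l)\<bar> \<le> 2 * K" using b[of "ln l'"] b[of "ln l"] by linarith
    ultimately show ?thesis by linarith
  qed
  moreover have "\<bar>H y\<bar> \<le> 4 * K" for y using b[of y] K by linarith
  ultimately show ?thesis unfolding gentle_def using m by blast
qed

lemma gentle_cong: "(\<And>l. l > 0 \<Longrightarrow> h l = h' l) \<Longrightarrow> h' \<in> borel_measurable borel \<Longrightarrow> gentle K h \<Longrightarrow> gentle K h'"
  unfolding gentle_def by simp

lemma bs_gamma_gentle:
  assumes "\<tau> > 0"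
  obtains K where "K > 0" "\<And>v. \<tau> \<le> v \<Longrightarrow> v \<le> V \<Longrightarrow> gentle K (\<lambda>l. bs_gamma l v)"
proof -
  define K where "K = exp V * (1 / sqrt \<tau> + 1 / \<tau>)"
  have K: "K > 0" using assms by (auto simp: K_def intro!: mult_pos_pos add_pos_pos)
  have "gentle (4 * K) (\<lambda>l. bs_gamma l v)" if v: "\<tau> \<le> v" "v \<le> V" for v
  proof -
    define c where "c = exp v / sqrt (2 * pi * v)"
    define H where "H y = - (c * exp (- ((y + 3 * v / 2) / sqrt v)\<^sup>2 / 2))" for y
    have v0: "v > 0" using assms v by simp
    have c0: "c > 0" unfolding c_def using v0 by simp
    have "sqrt v \<le> sqrt (2 * pi * v)" using v0 pi_gt3 by simp
    then have "c \<le> exp V / sqrt v" unfolding c_def using v v0 by (intro frac_le) auto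
    moreover have "exp V / sqrt v \<le> exp V / sqrt \<tau>" using v assms by (intro divide_left_mono) auto
    moreover have "exp V / sqrt v / sqrt v \<le> exp V / \<tau>" using v assms by (simp add: divide_left_mono)
    moreover have "c / sqrt v \<le> exp V / sqrt v / sqrt v" using \<open>c \<le> exp V / sqrt v\<close> v0 by (intro divide_right_mono) auto
    moreover have "exp V / sqrt \<tau> \<ge> 0" "exp V / \<tau> \<ge> 0" using assms by auto
    ultimately have cK: "c \<le> K" "c / sqrt v \<le> K" unfolding K_def by (auto simp: algebra_simps)
    have H1: "\<bar>H y\<bar> \<le> K" for y
    proof -
      have "\<bar>H y\<bar> = c * exp (- ((y + 3 * v / 2) / sqrt v)\<^sup>2 / 2)" using c0 by (simp add: H_def abs_mult)
      also have "\<dots> \<le> c * 1" using c0 by (intro mult_left_mono) auto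
      finally show ?thesis using cK by simp
    qed
    have d: "(H has_real_derivative c * exp (- ((y + 3 * v / 2) / sqrt v)\<^sup>2 / 2) * (((y + 3 * v / 2) / sqrt v) / sqrt v)) (at y)" for y
    proof -
      have 1: "((\<lambda>y. (y + 3 * v / 2) / sqrt v) has_real_derivative 1 / sqrt v) (at y)"
        by (intro DERIV_cdivide) (auto intro!: derivative_eq_intros)
      have "(H has_real_derivative - (c * (exp (- ((y + 3 * v / 2) / sqrt v)\<^sup>2 / 2) *
          (- (2 * ((y + 3 * v / 2) / sqrt v) * (1 / sqrt v)) / 2)))) (at y)"
        unfolding H_def[abs_def]
        by (intro DERIV_minus DERIV_cmult DERIV_fun_exp DERIV_cdivide)
           (use DERIV_power[OF 1, of 2] in \<open>simp add: mult.commute mult.left_commute\<close>)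
      moreover have "- (c * (E * (- (2 * t * (1 / s)) / 2))) = c * E * (t / s)" for E t s :: real by simp
      ultimately show ?thesis by metis
    qed
    have H2: "\<bar>H x - H y\<bar> \<le> K * \<bar>x - y\<bar>" for x y
    proof -
      have "norm (H x - H y) \<le> K * norm (x - y)"
      proof (rule field_differentiable_bound[of UNIV])
        fix z
        define t where "t = (z + 3 * v / 2) / sqrt v"
        show "(H has_real_derivative c * exp (- ((z + 3 * v / 2) / sqrt v)\<^sup>2 / 2) * (((z + 3 * v / 2) / sqrt v) / sqrt v)) (at z within UNIV)"
          using d by simp
        have "norm (c * exp (- t\<^sup>2 / 2) * (t / sqrt v)) = (c / sqrt v) * (\<bar>t\<bar> * exp (- t\<^sup>2 / 2))"
          using c0 v0 by (simp add: abs_mult)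
        also have "\<dots> \<le> (c / sqrt v) * 1" using c0 v0 by (intro mult_left_mono abs_mult_exp_le) auto
        finally show "norm (c * exp (- ((z + 3 * v / 2) / sqrt v)\<^sup>2 / 2) * (((z + 3 * v / 2) / sqrt v) / sqrt v)) \<le> K"
          using cK by (simp add: t_def)
      qed auto
      then show ?thesis by simp
    qed
    have "gentle (4 * K) (\<lambda>l. H (ln l))"
      by (rule gentle_log_lipschitz[OF _ H1 H2]) (simp add: H_def)
    then show ?thesis
      by (rule gentle_cong[rotated 2]) (use v0 in \<open>auto simp: H_def c_def bs_gamma_eq\<close>)
  qed
  with K show ?thesis by (intro that[of "4 * K"]) auto
qed

text \<open>Increasing the variance parameter by \<open>s\<close> acts to first order like adding independent noise of
  variance \<open>s\<close> to the logarithm.\<close>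

lemma bs_variance_shift:
  assumes "\<tau> > 0"
  obtains K where "K > 0"
    "\<And>l v s. l > 0 \<Longrightarrow> \<tau> \<le> v \<Longrightarrow> 0 \<le> s \<Longrightarrow> \<bar>bs l (v + s) - bs l v - s * (l\<^sup>2 * bs_gamma l v / 2)\<bar> \<le> K * s\<^sup>2"
proof -
  define K where "K = 2 / (\<tau> * sqrt \<tau>) + 1 / \<tau>"
  have K: "K > 0" using assms by (auto simp: K_def intro!: add_pos_pos)
  show ?thesis
  proof (rule that[OF K])
    fix l v s :: real assume l: "l > 0" and v: "\<tau> \<le> v" and s: "0 \<le> s"
    define \<theta> where "\<theta> u = - (1 / (2 * sqrt (2 * pi * u)) * exp (- (u / 2 - ln l)\<^sup>2 / (2 * u)))" for u
    define \<theta>' where "\<theta>' u = exp (- (u / 2 - ln l)\<^sup>2 / (2 * u)) / (2 * sqrt (2 * pi * u)) *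
        (1 / (2 * u) + (u / 2 - ln l) / (2 * u) - (u / 2 - ln l)\<^sup>2 / (2 * u\<^sup>2))" for u
    have th: "l\<^sup>2 * bs_gamma l u / 2 = \<theta> u" if "u > 0" for u
      using bs_theta_eq[OF l that] by (simp add: \<theta>_def)
    have dth: "(\<theta> has_real_derivative \<theta>' u) (at u)" if u: "u > 0" for u
    proof -
      have a: "((\<lambda>u. 1 / (2 * sqrt (2 * pi * u))) has_real_derivative - (1 / (2 * sqrt (2 * pi * u)) / (2 * u))) (at u)"
      proof -
        have "((\<lambda>u. sqrt (2 * pi * u)) has_real_derivative (inverse (sqrt (2 * pi * u)) / 2 * (2 * pi))) (at u)"
          by (rule DERIV_chain2[where f = sqrt]) (use u in \<open>auto intro!: derivative_eq_intros DERIV_real_sqrt\<close>)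
        note sq = this
        have "- (2 * (inverse r / 2 * (2 * pi)) * inverse ((2 * r) ^ Suc (Suc 0))) = - (1 / (2 * r) / (2 * u))"
          if "r > 0" "r * r = 2 * pi * u" for r
        proof -
          have "- (2 * (inverse r / 2 * (2 * pi)) * inverse ((2 * r) ^ Suc (Suc 0))) = - (1 / (2 * r)) * (pi / (r * r))"
            using that(1) by (simp add: field_simps)
          also have "pi / (r * r) = 1 / (2 * u)" unfolding that using u by simp
          finally show ?thesis by simp
        qed
        from this[of "sqrt (2 * pi * u)"] u
        have "((\<lambda>u. inverse (2 * sqrt (2 * pi * u))) has_real_derivative - (1 / (2 * sqrt (2 * pi * u)) / (2 * u))) (at u)"
          by (intro DERIV_cong[OF DERIV_inverse_fun[OF DERIV_cmult[OF sq, of 2]]]) auto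
        then show ?thesis by (simp only: inverse_eq_divide)
      qed
      have b: "((\<lambda>u. - (u / 2 - ln l)\<^sup>2 / (2 * u)) has_real_derivative
          - ((u / 2 - ln l) / (2 * u) - (u / 2 - ln l)\<^sup>2 / (2 * u\<^sup>2))) (at u)"
      proof -
        have "((\<lambda>u. - (u / 2 - ln l)\<^sup>2 / (2 * u)) has_real_derivative
          (- (2 * (u / 2 - ln l) * (1 / 2)) * (2 * u) - - (u / 2 - ln l)\<^sup>2 * 2) / (2 * u * (2 * u))) (at u)"
        proof (rule DERIV_cong[OF DERIV_divide])
          show "((\<lambda>u. - (u / 2 - ln l)\<^sup>2) has_real_derivative - (2 * (u / 2 - ln l) * (1 / 2))) (at u)"
            by (auto intro!: derivative_eq_intros)
          show "((\<lambda>u. 2 * u) has_real_derivative 2) (at u)" by (auto intro!: derivative_eq_intros)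
        qed (use u in auto)
        also have "(- (2 * (u / 2 - ln l) * (1 / 2)) * (2 * u) - - (u / 2 - ln l)\<^sup>2 * 2) / (2 * u * (2 * u)) =
          - ((u / 2 - ln l) / (2 * u) - (u / 2 - ln l)\<^sup>2 / (2 * u\<^sup>2))"
        proof -
          have "(- (2 * y * (1 / 2)) * (2 * u) - - y\<^sup>2 * 2) / (2 * u * (2 * u)) = - (y / (2 * u) - y\<^sup>2 / (2 * u\<^sup>2))" for y
            using u by (simp add: field_simps power2_eq_square)
          then show ?thesis .
        qed
        finally show ?thesis .
      qed
      have "(\<theta> has_real_derivative - (- (1 / (2 * sqrt (2 * pi * u)) / (2 * u)) * exp (- (u / 2 - ln l)\<^sup>2 / (2 * u)) +
         exp (- (u / 2 - ln l)\<^sup>2 / (2 * u)) * - ((u / 2 - ln l) / (2 * u) - (u / 2 - ln l)\<^sup>2 / (2 * u\<^sup>2)) * (1 / (2 * sqrt (2 * pi * u))))) (at u)"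
        unfolding \<theta>_def[abs_def] by (intro DERIV_minus DERIV_mult a DERIV_fun_exp b)
      also have "- (- (1 / (2 * sqrt (2 * pi * u)) / (2 * u)) * exp (- (u / 2 - ln l)\<^sup>2 / (2 * u)) +
         exp (- (u / 2 - ln l)\<^sup>2 / (2 * u)) * - ((u / 2 - ln l) / (2 * u) - (u / 2 - ln l)\<^sup>2 / (2 * u\<^sup>2)) * (1 / (2 * sqrt (2 * pi * u)))) = \<theta>' u"
      proof -
        have gen: "- (- (q / (2 * u)) * E + E * - (a - b) * q) = E * q * (1 / (2 * u) + a - b)" for q E a b :: real
          by (simp add: algebra_simps)
        have "- (- (1 / (2 * r) / (2 * u)) * E + E * - (a - b) * (1 / (2 * r))) = E / (2 * r) * (1 / (2 * u) + a - b)"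
          for r E a b :: real
        proof -
          have 1: "E / (2 * r) = E * (1 / (2 * r))" by simp
          show ?thesis unfolding 1 by (rule gen)
        qed
        then show ?thesis unfolding \<theta>'_def .
      qed
      finally show ?thesis .
    qed
    have bth: "\<bar>\<theta>' u\<bar> \<le> K" if u: "\<tau> \<le> u" for u
    proof -
      have u0: "u > 0" using u assms by simp
      define t where "t = (u / 2 - ln l) / sqrt u"
      have t1: "(u / 2 - ln l)\<^sup>2 / (2 * u) = t\<^sup>2 / 2" using u0 by (simp add: t_def power_divide)
      have t2: "(u / 2 - ln l)\<^sup>2 / (2 * u\<^sup>2) = t\<^sup>2 / (2 * u)"
        using u0 by (simp add: t_def power_divide power2_eq_square)
      have t3: "(u / 2 - ln l) / (2 * u) = t / (2 * sqrt u)"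
        using u0 by (simp add: t_def field_simps)
      have eq: "\<theta>' u = (exp (- t\<^sup>2 / 2) / (2 * u) + (t * exp (- t\<^sup>2 / 2)) / (2 * sqrt u) - (t\<^sup>2 * exp (- t\<^sup>2 / 2)) / (2 * u)) / (2 * sqrt (2 * pi * u))"
        unfolding \<theta>'_def t2 t3 minus_divide_left[symmetric] t1 by (simp add: algebra_simps add_divide_distrib diff_divide_distrib)
      have "\<bar>\<theta>' u\<bar> = \<bar>exp (- t\<^sup>2 / 2) / (2 * u) + (t * exp (- t\<^sup>2 / 2)) / (2 * sqrt u) - (t\<^sup>2 * exp (- t\<^sup>2 / 2)) / (2 * u)\<bar> / (2 * sqrt (2 * pi * u))"
        unfolding eq using u0 by (simp add: abs_divide)
      also have "\<dots> \<le> (1 / (2 * u) + 1 / (2 * sqrt u) + 2 / (2 * u)) / sqrt u"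
      proof (rule frac_le)
        have "\<bar>exp (- t\<^sup>2 / 2) / (2 * u)\<bar> \<le> 1 / (2 * u)" using u0 by (simp add: divide_right_mono)
        moreover have "\<bar>(t * exp (- t\<^sup>2 / 2)) / (2 * sqrt u)\<bar> \<le> 1 / (2 * sqrt u)"
          using u0 abs_mult_exp_le[of t] by (simp add: abs_mult divide_right_mono)
        moreover have "\<bar>(t\<^sup>2 * exp (- t\<^sup>2 / 2)) / (2 * u)\<bar> \<le> 2 / (2 * u)"
          using u0 divide_right_mono[OF square_mult_exp_le[of t], of "2 * u"] by (simp add: abs_mult)
        ultimately show "\<bar>exp (- t\<^sup>2 / 2) / (2 * u) + (t * exp (- t\<^sup>2 / 2)) / (2 * sqrt u) - (t\<^sup>2 * exp (- t\<^sup>2 / 2)) / (2 * u)\<bar> \<le>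
            1 / (2 * u) + 1 / (2 * sqrt u) + 2 / (2 * u)" by linarith
        have "sqrt u \<le> sqrt (2 * pi * u)" using u0 pi_gt3 by simp
        moreover have "0 \<le> sqrt (2 * pi * u)" using u0 by simp
        ultimately show "sqrt u \<le> 2 * sqrt (2 * pi * u)" by linarith
      qed (use u0 in auto)
      also have "\<dots> = (3 / 2) / (u * sqrt u) + (1 / 2) / u"
      proof -
        have "(1 / (2 * u) + 1 / (2 * r) + 2 / (2 * u)) / r = (3 / 2) / (u * r) + (1 / 2) / (r * r)" if "r > 0" for r
          using that u0 by (simp add: field_simps)
        from this[of "sqrt u"] show ?thesis using u0 by simp
      qed
      also have "\<dots> \<le> 2 / (\<tau> * sqrt \<tau>) + 1 / \<tau>"
        using u assms by (intro add_mono frac_le mult_mono mult_pos_pos) auto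
      finally show ?thesis by (simp add: K_def)
    qed
    have lip: "\<bar>\<theta> u - \<theta> v\<bar> \<le> K * \<bar>u - v\<bar>" if "\<tau> \<le> u" for u
    proof -
      have "norm (\<theta> u - \<theta> v) \<le> K * norm (u - v)"
        by (rule field_differentiable_bound[of "{\<tau>..}" \<theta> \<theta>'])
           (use that v assms dth bth in \<open>auto intro: has_field_derivative_at_within\<close>)
      then show ?thesis by simp
    qed
    show "\<bar>bs l (v + s) - bs l v - s * (l\<^sup>2 * bs_gamma l v / 2)\<bar> \<le> K * s\<^sup>2"
    proof (cases "s = 0")
      case False
      then have s0: "s > 0" using s by simp
      obtain z where z: "v < z" "z < v + s" "bs l (v + s) - bs l v = (v + s - v) * (l\<^sup>2 * bs_gamma l z / 2)"
        using MVT2[of v "v + s" "\<lambda>v. bs l v" "\<lambda>v. l\<^sup>2 * bs_gamma l v / 2"] s0 v assms DERIV_bs_v[OF l] by fastforce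
      have "bs l (v + s) - bs l v - s * (l\<^sup>2 * bs_gamma l v / 2) = s * (\<theta> z - \<theta> v)"
        unfolding z(3) using th[of z] th[of v] z v assms by (simp add: algebra_simps)
      also have "\<bar>\<dots>\<bar> \<le> s * (K * \<bar>z - v\<bar>)"
        using s lip[of z] z v by (simp add: abs_mult mult_left_mono)
      also have "\<dots> \<le> s * (K * s)" using z s K by (intro mult_left_mono) auto
      finally show ?thesis by (simp add: power2_eq_square mult_ac)
    qed simp
  qed
qed

text \<open>Second order Taylor expansion; the minimum in the remainder lets the increment be split into
  a part with small second moment and a part with small fourth moment.\<close>

lemma bs_taylor:
  assumes "v > 0" and g: "gentle K (\<lambda>l. bs_gamma l v)" and l: "l > 0" "l' > 0"
  shows "\<bar>bs l' v - bs l v - bs_delta l v * (l' - l) - bs_gamma l v * (l' - l)\<^sup>2 / 2\<bar>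
     \<le> K * min ((l' - l)\<^sup>2) (\<bar>l' - l\<bar> ^ 3 / l)"
proof (cases "l' = l")
  case False
  obtain \<xi> where xi: "if l' < l then l' < \<xi> \<and> \<xi> < l else l < \<xi> \<and> \<xi> < l'"
    and eq: "bs l' v = bs l v + bs_delta l v * (l' - l) + bs_gamma \<xi> v / 2 * (l' - l)\<^sup>2"
  proof -
    define D where "D m = (if m = 0 then (\<lambda>l. bs l v) else if m = 1 then (\<lambda>l. bs_delta l v) else (\<lambda>l. bs_gamma l v))" for m :: nat
    have "\<exists>t. (if l' < l then l' < t \<and> t < l else l < t \<and> t < l') \<and>
      bs l' v = (\<Sum>m<2. D m l / fact m * (l' - l) ^ m) + D 2 t / fact 2 * (l' - l) ^ 2"
    proof (rule Taylor[of 2 D "\<lambda>l. bs l v" "min l l'" "max l l'"])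
      show "\<forall>m t. m < 2 \<and> min l l' \<le> t \<and> t \<le> max l l' \<longrightarrow> (D m has_real_derivative D (Suc m) t) (at t)"
        using l assms(1) DERIV_bs DERIV_bs_delta by (auto simp: D_def less_2_cases_iff)
    qed (use False in \<open>auto simp: D_def\<close>)
    then show ?thesis using that by (auto simp: D_def numeral_2_eq_2 lessThan_Suc)
  qed
  have xi': "\<xi> > 0" "\<bar>\<xi> - l\<bar> \<le> \<bar>l' - l\<bar>" using xi l by (auto split: if_splits)
  have K: "\<bar>bs_gamma \<xi> v\<bar> \<le> K" "\<bar>bs_gamma l v\<bar> \<le> K" "\<bar>bs_gamma \<xi> v - bs_gamma l v\<bar> \<le> K * \<bar>\<xi> - l\<bar> / l"
    using g l xi' unfolding gentle_def by auto
  have K0: "K \<ge> 0" using K by linarith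
  have "K * \<bar>\<xi> - l\<bar> / l \<le> K * \<bar>l' - l\<bar> / l" using xi' l K0 by (intro divide_right_mono mult_left_mono) auto
  with K have K3: "\<bar>bs_gamma \<xi> v - bs_gamma l v\<bar> \<le> K * \<bar>l' - l\<bar> / l" by linarith
  have eq2: "bs l' v - bs l v - bs_delta l v * (l' - l) - bs_gamma l v * (l' - l)\<^sup>2 / 2 =
     (bs_gamma \<xi> v - bs_gamma l v) / 2 * (l' - l)\<^sup>2" unfolding eq by (simp add: algebra_simps diff_divide_distrib)
  have *: "\<bar>bs l' v - bs l v - bs_delta l v * (l' - l) - bs_gamma l v * (l' - l)\<^sup>2 / 2\<bar> =
     \<bar>bs_gamma \<xi> v - bs_gamma l v\<bar> / 2 * (l' - l)\<^sup>2" unfolding eq2 by (simp add: abs_mult)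
  have minI: "x \<le> K * a \<Longrightarrow> x \<le> K * b \<Longrightarrow> x \<le> K * min a b" for x a b by (simp add: min_def)
  have c1: "\<bar>bs_gamma \<xi> v - bs_gamma l v\<bar> / 2 * (l' - l)\<^sup>2 \<le> K * (l' - l)\<^sup>2"
    using K by (intro mult_right_mono) auto
  have c2: "\<bar>bs_gamma \<xi> v - bs_gamma l v\<bar> / 2 * (l' - l)\<^sup>2 \<le> (K * \<bar>l' - l\<bar> / l) * (l' - l)\<^sup>2"
  proof (rule mult_right_mono)
    have "a / 2 \<le> b" if "a \<le> b" "0 \<le> a" for a b :: real using that by linarith
    from this[OF K3] show "\<bar>bs_gamma \<xi> v - bs_gamma l v\<bar> / 2 \<le> K * \<bar>l' - l\<bar> / l" by simp
  qed simp
  have c3: "(K * \<bar>l' - l\<bar> / l) * (l' - l)\<^sup>2 = K * (\<bar>l' - l\<bar> ^ 3 / l)"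
    by (simp add: power3_eq_cube power2_eq_square abs_mult_self_eq mult.assoc)
  show ?thesis unfolding * by (rule minI[OF c1 order_trans[OF c2 eq_refl[OF c3]]])
qed simp

text \<open>Letting the variance parameter tend to \<open>0\<close> recovers the payoff \<open>min 1\<close>.\<close>

lemma bs_tendsto_min:
  assumes l: "l > 0"
  shows "((\<lambda>v. bs l v) \<longlongrightarrow> min 1 l) (at_right 0)"
proof -
  have lim: "LIM v at_right (0::real). (c + v / 2) / sqrt (2 * v) :> at_top" if "c > 0" for c :: real
  proof (rule filterlim_at_top_mono[of "\<lambda>v. c * inverse (sqrt (2 * v))"])
    have 1: "LIM v at_right (0::real). sqrt (2 * v) :> at_right 0"
      unfolding filterlim_at
    proof
      show "((\<lambda>v. sqrt (2 * v)) \<longlongrightarrow> 0) (at_right (0::real))"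
        by (rule tendsto_eq_intros refl | simp)+
    qed (auto simp: eventually_at_right_less eventually_at_filter)
    show "LIM v at_right (0::real). c * inverse (sqrt (2 * v)) :> at_top"
      by (rule filterlim_tendsto_pos_mult_at_top[OF tendsto_const \<open>c > 0\<close> filterlim_compose[OF filterlim_inverse_at_top_right 1]])
    show "\<forall>\<^sub>F v in at_right (0::real). c * inverse (sqrt (2 * v)) \<le> (c + v / 2) / sqrt (2 * v)"
      by (auto simp: eventually_at_filter divide_simps)
  qed
  have pos: "((\<lambda>v. erfc ((c + v / 2) / sqrt (2 * v))) \<longlongrightarrow> 0) (at_right 0)" if "c > 0" for c
    by (rule filterlim_compose[OF erfc_at_top lim[OF that]])
  have neg: "((\<lambda>v. erfc ((c + v / 2) / sqrt (2 * v))) \<longlongrightarrow> 2) (at_right 0)" if c: "c < 0" for c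
  proof -
    have "LIM v at_right (0::real). (- c / 2 + v / 2) / sqrt (2 * v) :> at_top"
      using c by (intro lim) auto
    then have "LIM v at_right (0::real). - ((c + v / 2) / sqrt (2 * v)) :> at_top"
    proof (rule filterlim_at_top_mono)
      have "\<forall>\<^sub>F v in at_right (0::real). v \<in> {0<..<- c / 2}"
        using c by (intro eventually_at_right_real) auto
      then show "\<forall>\<^sub>F v in at_right (0::real). (- c / 2 + v / 2) / sqrt (2 * v) \<le> - ((c + v / 2) / sqrt (2 * v))"
      proof eventually_elim
        case (elim v)
        then have "(- c / 2 + v / 2) / sqrt (2 * v) \<le> (- (c + v / 2)) / sqrt (2 * v)"
          by (intro divide_right_mono) auto
        then show ?case by (simp only: minus_divide_left)
      qed
    qed
    then have "LIM v at_right (0::real). (c + v / 2) / sqrt (2 * v) :> at_bot"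
      by (simp add: filterlim_uminus_at_bot)
    then show ?thesis by (rule filterlim_compose[OF erfc_at_bot])
  qed
  have split: "bs l v = (l * erfc ((ln l + v / 2) / sqrt (2 * v)) + erfc ((- ln l + v / 2) / sqrt (2 * v))) / 2" for v
    by (simp add: bs_def)
  consider "l < 1" | "l = 1" | "l > 1" by linarith
  then show ?thesis
  proof cases
    case 1
    then have "((\<lambda>v. bs l v) \<longlongrightarrow> (l * 2 + 0) / 2) (at_right 0)"
      unfolding split using l by (intro tendsto_intros neg pos) auto
    then show ?thesis using 1 by simp
  next
    case 2
    have "((\<lambda>v. erfc (sqrt (v / 8))) \<longlongrightarrow> erfc (sqrt (0 / 8))) (at_right 0)"
      by (intro isCont_tendsto_compose[of _ erfc] DERIV_isCont[OF DERIV_erfc] tendsto_intros)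
         (auto intro: tendsto_eq_intros)
    moreover have "erfc 0 = 1" using erfc_minus[of 0] by simp
    ultimately have "((\<lambda>v. erfc (sqrt (v / 8))) \<longlongrightarrow> 1) (at_right 0)" by simp
    moreover have "\<forall>\<^sub>F v in at_right 0. erfc (sqrt (v / 8)) = bs l v"
      using 2 by (auto simp: eventually_at_filter bs_at_1)
    ultimately have "((\<lambda>v. bs l v) \<longlongrightarrow> 1) (at_right 0)" by (rule Lim_transform_eventually)
    then show ?thesis using 2 by simp
  next
    case 3
    then have "((\<lambda>v. bs l v) \<longlongrightarrow> (l * 0 + 2) / 2) (at_right 0)"
      unfolding split using l by (intro tendsto_intros neg pos) auto
    then show ?thesis using 3 by simp
  qed
qed

text \<open>By the Black--Scholes equation the derivative in \<open>v\<close> is a Gaussian density up to a factor, hence at most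
  that of \<open>sqrt v\<close>, uniformly in \<open>l\<close>.\<close>

lemma bs_near_min:
  assumes l: "l > 0" and v: "v > 0"
  shows "\<bar>bs l v - min 1 l\<bar> \<le> sqrt v"
proof -
  have d: "\<bar>l\<^sup>2 * bs_gamma l u / 2\<bar> \<le> 1 / (2 * sqrt u)" if "u > 0" for u
  proof -
    have "\<bar>l\<^sup>2 * bs_gamma l u / 2\<bar> = 1 / (2 * sqrt (2 * pi * u)) * exp (- (u / 2 - ln l)\<^sup>2 / (2 * u))"
      unfolding bs_theta_eq[OF l that] using that by (simp add: abs_mult)
    also have "\<dots> \<le> 1 / (2 * sqrt u) * 1"
      using that pi_gt3 by (intro mult_mono divide_left_mono) auto
    finally show ?thesis by simp
  qed
  have d': "l\<^sup>2 * bs_gamma l u / 2 - inverse (sqrt u) / 2 \<le> 0" "l\<^sup>2 * bs_gamma l u / 2 + inverse (sqrt u) / 2 \<ge> 0" if "u > 0" for u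
  proof -
    have "inverse (sqrt u) / 2 = 1 / (2 * sqrt u)" by (simp add: inverse_eq_divide)
    then show "l\<^sup>2 * bs_gamma l u / 2 - inverse (sqrt u) / 2 \<le> 0" "l\<^sup>2 * bs_gamma l u / 2 + inverse (sqrt u) / 2 \<ge> 0"
      using d[OF that] by linarith+
  qed
  have "\<bar>bs l v - bs l u\<bar> \<le> sqrt v" if u: "0 < u" "u < v" for u
  proof -
    have "bs l v - sqrt v \<le> bs l u - sqrt u"
    proof (rule DERIV_nonpos_imp_nonincreasing[of u v "\<lambda>v. bs l v - sqrt v"])
      fix x assume x: "u \<le> x" "x \<le> v"
      have "((\<lambda>v. bs l v - sqrt v) has_real_derivative l\<^sup>2 * bs_gamma l x / 2 - inverse (sqrt x) / 2) (at x)"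
        using x u l by (intro DERIV_diff DERIV_bs_v DERIV_real_sqrt) auto
      then show "\<exists>y. ((\<lambda>v. bs l v - sqrt v) has_real_derivative y) (at x) \<and> y \<le> 0"
        using d'[of x] x u by (intro exI conjI) auto
    qed (use u in auto)
    moreover have "bs l u + sqrt u \<le> bs l v + sqrt v"
    proof (rule DERIV_nonneg_imp_nondecreasing[of u v "\<lambda>v. bs l v + sqrt v"])
      fix x assume x: "u \<le> x" "x \<le> v"
      have "((\<lambda>v. bs l v + sqrt v) has_real_derivative l\<^sup>2 * bs_gamma l x / 2 + inverse (sqrt x) / 2) (at x)"
        using x u l by (intro DERIV_add DERIV_bs_v DERIV_real_sqrt) auto
      then show "\<exists>y. ((\<lambda>v. bs l v + sqrt v) has_real_derivative y) (at x) \<and> y \<ge> 0"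
        using d'[of x] x u by (intro exI conjI) auto
    qed (use u in auto)
    moreover have "sqrt u \<ge> 0" using u by simp
    ultimately show ?thesis by linarith
  qed
  then have "\<forall>\<^sub>F u in at_right 0. \<bar>bs l v - bs l u\<bar> \<le> sqrt v"
    using v eventually_at_right_real[of 0 v] by (auto elim!: eventually_mono)
  moreover have "((\<lambda>u. \<bar>bs l v - bs l u\<bar>) \<longlongrightarrow> \<bar>bs l v - min 1 l\<bar>) (at_right 0)"
    by (intro tendsto_intros bs_tendsto_min l)
  ultimately show ?thesis
    by (intro tendsto_upperbound[of _ _ "at_right (0::real)"]) auto
qed

text \<open>Index sets start at \<open>1\<close>, which must not be rewritten to \<open>Suc 0\<close>.\<close>

declare One_nat_def [simp del]

section \<open>Bounded measurable functions and product measures\<close>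

definition bounded_meas :: "'a measure \<Rightarrow> ('a \<Rightarrow> real) \<Rightarrow> bool" where
  "bounded_meas M f \<longleftrightarrow> f \<in> borel_measurable M \<and> (\<exists>c. \<forall>x\<in>space M. \<bar>f x\<bar> \<le> c)"

named_theorems bm

lemma bounded_measI: "f \<in> borel_measurable M \<Longrightarrow> (\<And>x. x \<in> space M \<Longrightarrow> \<bar>f x\<bar> \<le> c) \<Longrightarrow> bounded_meas M f"
  unfolding bounded_meas_def by blast

lemma bounded_meas_measurable: "bounded_meas M f \<Longrightarrow> f \<in> borel_measurable M"
  unfolding bounded_meas_def by blast

lemma bounded_measE:
  assumes "bounded_meas M f"
  obtains c where "c \<ge> 0" "\<And>x. x \<in> space M \<Longrightarrow> \<bar>f x\<bar> \<le> c"
proof -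
  obtain c where "\<forall>x\<in>space M. \<bar>f x\<bar> \<le> c" using assms unfolding bounded_meas_def by blast
  then show ?thesis using that[of "max c 0"] by (auto simp: le_max_iff_disj)
qed

lemma bm_const [bm]: "bounded_meas M (\<lambda>_. c)"
  by (rule bounded_measI[of _ _ "\<bar>c\<bar>"]) auto

lemma bm_add [bm]:
  assumes "bounded_meas M f" "bounded_meas M g" shows "bounded_meas M (\<lambda>x. f x + g x)"
proof -
  obtain a where a: "\<And>x. x \<in> space M \<Longrightarrow> \<bar>f x\<bar> \<le> a" using bounded_measE[OF assms(1)] by blast
  obtain b where b: "\<And>x. x \<in> space M \<Longrightarrow> \<bar>g x\<bar> \<le> b" using bounded_measE[OF assms(2)] by blast
  show ?thesis
  proof (rule bounded_measI[of _ _ "a + b"])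
    show "\<bar>f x + g x\<bar> \<le> a + b" if "x \<in> space M" for x using a[OF that] b[OF that] by linarith
  qed (use assms[THEN bounded_meas_measurable] in measurable)
qed

lemma bm_mult [bm]:
  assumes "bounded_meas M f" "bounded_meas M g" shows "bounded_meas M (\<lambda>x. f x * g x)"
proof -
  obtain a where a: "a \<ge> 0" "\<And>x. x \<in> space M \<Longrightarrow> \<bar>f x\<bar> \<le> a" using bounded_measE[OF assms(1)] by blast
  obtain b where b: "b \<ge> 0" "\<And>x. x \<in> space M \<Longrightarrow> \<bar>g x\<bar> \<le> b" using bounded_measE[OF assms(2)] by blast
  show ?thesis
  proof (rule bounded_measI[of _ _ "a * b"])
    show "\<bar>f x * g x\<bar> \<le> a * b" if "x \<in> space M" for x
      using a b that by (simp add: abs_mult mult_mono)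
  qed (use assms[THEN bounded_meas_measurable] in measurable)
qed

lemma bm_minus [bm]: "bounded_meas M f \<Longrightarrow> bounded_meas M (\<lambda>x. - f x)"
  using bm_mult[OF bm_const[of M "-1"]] by fastforce

lemma bm_diff [bm]: "bounded_meas M f \<Longrightarrow> bounded_meas M g \<Longrightarrow> bounded_meas M (\<lambda>x. f x - g x)"
  using bm_add[OF _ bm_minus] by fastforce

lemma bm_divide [bm]: "bounded_meas M f \<Longrightarrow> bounded_meas M (\<lambda>x. f x / c)"
  using bm_mult[OF _ bm_const[of M "1 / c"]] by fastforce

lemma bm_power [bm]: "bounded_meas M f \<Longrightarrow> bounded_meas M (\<lambda>x. f x ^ n)"
  by (induction n) (auto intro: bm)

lemma bm_abs [bm]: "bounded_meas M f \<Longrightarrow> bounded_meas M (\<lambda>x. \<bar>f x\<bar>)"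
  unfolding bounded_meas_def by auto

lemma bm_sum [bm]: "(\<And>i. i \<in> I \<Longrightarrow> bounded_meas M (f i)) \<Longrightarrow> bounded_meas M (\<lambda>x. \<Sum>i\<in>I. f i x)"
  by (induction I rule: infinite_finite_induct) (auto intro: bm)

lemma bm_prod [bm]: "(\<And>i. i \<in> I \<Longrightarrow> bounded_meas M (f i)) \<Longrightarrow> bounded_meas M (\<lambda>x. \<Prod>i\<in>I. f i x)"
  by (induction I rule: infinite_finite_induct) (auto intro: bm)

lemma bm_compose:
  assumes "bounded_meas N f" "g \<in> M \<rightarrow>\<^sub>M N" shows "bounded_meas M (\<lambda>x. f (g x))"
proof -
  obtain a where a: "\<And>x. x \<in> space N \<Longrightarrow> \<bar>f x\<bar> \<le> a" using bounded_measE[OF assms(1)] by blast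
  show ?thesis
    by (rule bounded_measI[of _ _ a])
       (use a measurable_space[OF assms(2)] measurable_compose[OF assms(2) bounded_meas_measurable[OF assms(1)]] in auto)
qed

lemma bm_component [bm]:
  "bounded_meas (M i) f \<Longrightarrow> i \<in> I \<Longrightarrow> bounded_meas (PiM I M) (\<lambda>y. f (y i))"
  by (rule bm_compose[OF _ measurable_component_singleton])

lemma bm_integrable:
  assumes "prob_space M" "bounded_meas M f" shows "integrable M f"
proof -
  interpret prob_space M by fact
  obtain c where c: "\<And>x. x \<in> space M \<Longrightarrow> \<bar>f x\<bar> \<le> c" using bounded_measE[OF assms(2)] by blast
  show ?thesis
    by (rule integrable_const_bound[of _ c]) (use c bounded_meas_measurable[OF assms(2)] in auto)
qed

text \<open>All functions integrated below are bounded, so integrability is discharged once and for all by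
  restricting the linearity rules of the integral to them.\<close>

locale bm_prob = prob_space
begin

lemma bm_int_add: "bounded_meas M f \<Longrightarrow> bounded_meas M g \<Longrightarrow> (\<integral>x. f x + g x \<partial>M) = (\<integral>x. f x \<partial>M) + (\<integral>x. g x \<partial>M)"
  by (intro Bochner_Integration.integral_add bm_integrable prob_space_axioms)

lemma bm_int_diff: "bounded_meas M f \<Longrightarrow> bounded_meas M g \<Longrightarrow> (\<integral>x. f x - g x \<partial>M) = (\<integral>x. f x \<partial>M) - (\<integral>x. g x \<partial>M)"
  by (intro Bochner_Integration.integral_diff bm_integrable prob_space_axioms)

lemma bm_int_sum: "(\<And>i. i \<in> I \<Longrightarrow> bounded_meas M (f i)) \<Longrightarrow> (\<integral>x. (\<Sum>i\<in>I. f i x) \<partial>M) = (\<Sum>i\<in>I. \<integral>x. f i x \<partial>M)"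
  by (intro Bochner_Integration.integral_sum bm_integrable prob_space_axioms)

lemma bm_int_mono: "bounded_meas M f \<Longrightarrow> bounded_meas M g \<Longrightarrow> (\<And>x. x \<in> space M \<Longrightarrow> f x \<le> g x) \<Longrightarrow> (\<integral>x. f x \<partial>M) \<le> (\<integral>x. g x \<partial>M)"
  by (intro integral_mono bm_integrable prob_space_axioms)

lemma bm_int_abs_mono:
  assumes "bounded_meas M f" "bounded_meas M g" "\<And>x. x \<in> space M \<Longrightarrow> \<bar>f x\<bar> \<le> g x"
  shows "\<bar>\<integral>x. f x \<partial>M\<bar> \<le> (\<integral>x. g x \<partial>M)"
  using integral_abs_bound[of M f] bm_int_mono[OF bm_abs[OF assms(1)] assms(2,3)] by linarith

lemmas [simp] = prob_space

end

lemma bm_probI: "prob_space M \<Longrightarrow> bm_prob M" unfolding bm_prob_def .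

section \<open>Moments of linear and quadratic forms in independent variables\<close>

locale noise_law = bm_prob \<nu> for \<nu> :: "real measure"
begin

abbreviation pw :: "'i set \<Rightarrow> ('i \<Rightarrow> real) measure" where
  "pw J \<equiv> PiM J (\<lambda>_. \<nu>)"

lemma product_sigma_finite_pw: "product_sigma_finite (\<lambda>_. \<nu>)"
  by (rule product_sigma_finite.intro) (rule sigma_finite_measure_axioms)

lemma prob_space_pw: "prob_space (pw J)"
  by (rule prob_space_PiM) (rule prob_space_axioms)

lemma bm_prob_pw: "bm_prob (pw J)"
  by (rule bm_probI[OF prob_space_pw])

lemma pw_prod:
  assumes "finite J" "\<And>j. j \<in> J \<Longrightarrow> bounded_meas \<nu> (f j)"
  shows "(\<integral>y. (\<Prod>j\<in>J. f j (y j)) \<partial>pw J) = (\<Prod>j\<in>J. \<integral>t. f j t \<partial>\<nu>)"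
  by (rule product_sigma_finite.product_integral_prod[OF product_sigma_finite_pw])
     (use assms bm_integrable[OF prob_space_axioms] in auto)

lemma pw_insert:
  assumes "finite J" "i \<notin> J" "bounded_meas (pw (insert i J)) f"
  shows "(\<integral>y. f y \<partial>pw (insert i J)) = (\<integral>y. (\<integral>t. f (y(i := t)) \<partial>\<nu>) \<partial>pw J)"
  by (rule product_sigma_finite.product_integral_insert[OF product_sigma_finite_pw])
     (use assms bm_integrable[OF prob_space_pw] in auto)

text \<open>Only squares survive in the second moment, and only pairs of squares and fourth powers in the fourth, as
  for Gaussian variables up to the excess kurtosis.\<close>

lemma pw_linear_moments:
  fixes c :: "'i \<Rightarrow> real"
  assumes f: "bounded_meas \<nu> f" and f1: "(\<integral>t. f t \<partial>\<nu>) = 0"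
    and J: "finite J"
  shows "(\<integral>y. (\<Sum>j\<in>J. c j * f (y j)) \<partial>pw J) = 0"
    and "(\<integral>y. (\<Sum>j\<in>J. c j * f (y j))\<^sup>2 \<partial>pw J) = (\<integral>t. (f t)\<^sup>2 \<partial>\<nu>) * (\<Sum>j\<in>J. (c j)\<^sup>2)"
    and "(\<integral>y. (\<Sum>j\<in>J. c j * f (y j)) ^ 4 \<partial>pw J) \<le>
      (3 * (\<integral>t. (f t)\<^sup>2 \<partial>\<nu>)\<^sup>2 + (\<integral>t. f t ^ 4 \<partial>\<nu>)) * (\<Sum>j\<in>J. (c j)\<^sup>2)\<^sup>2"
  using J
proof (induction J)
  case empty
  interpret P: bm_prob "pw ({} :: 'i set)" by (rule bm_prob_pw)
  { case 1 show ?case by simp }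
  { case 2 show ?case by simp }
  { case 3 show ?case by simp }
next
  case (insert i J)
  interpret P: bm_prob "pw J" by (rule bm_prob_pw)
  let ?X = "\<lambda>y. \<Sum>j\<in>J. c j * f (y j)"
  have bX: "bounded_meas (pw J) ?X" using f by (auto intro!: bm)
  have bXi: "bounded_meas (pw (insert i J)) (\<lambda>y. \<Sum>j\<in>insert i J. c j * f (y j))" using f by (intro bm) auto
  have upd: "(\<Sum>j\<in>insert i J. c j * f ((y(i := t)) j)) = ?X y + c i * f t" for y t
    using insert.hyps by (auto simp: add.commute intro!: sum.cong)
  have si: "(\<Sum>j\<in>insert i J. (c j)\<^sup>2) = (\<Sum>j\<in>J. (c j)\<^sup>2) + (c i)\<^sup>2" using insert.hyps by simp
  define m2 where "m2 = (\<integral>t. (f t)\<^sup>2 \<partial>\<nu>)"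
  define m3 where "m3 = (\<integral>t. f t ^ 3 \<partial>\<nu>)"
  define m4 where "m4 = (\<integral>t. f t ^ 4 \<partial>\<nu>)"
  have m: "m2 \<ge> 0" "m4 \<ge> 0" by (auto simp: m2_def m4_def)
  have i1: "(\<integral>t. x + a * f t \<partial>\<nu>) = x" for x a
    using f by (simp add: bm_int_add bm f1)
  have i2: "(\<integral>t. (x + a * f t)\<^sup>2 \<partial>\<nu>) = x\<^sup>2 + a\<^sup>2 * m2" for x a
  proof -
    have "(\<integral>t. (x + a * f t)\<^sup>2 \<partial>\<nu>) = (\<integral>t. x\<^sup>2 + (2 * x * a * f t + a\<^sup>2 * (f t)\<^sup>2) \<partial>\<nu>)"
      by (intro lint_cong refl) (simp add: power2_eq_square algebra_simps)
    also have "\<dots> = x\<^sup>2 + a\<^sup>2 * m2"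
      using f by (simp add: bm_int_add bm f1 m2_def)
    finally show ?thesis .
  qed
  have i4: "(\<integral>t. (x + a * f t) ^ 4 \<partial>\<nu>) = x ^ 4 + (6 * a\<^sup>2 * m2 * x\<^sup>2 + (4 * a ^ 3 * m3 * x + a ^ 4 * m4))" for x a
  proof -
    have "(\<integral>t. (x + a * f t) ^ 4 \<partial>\<nu>) = (\<integral>t. x ^ 4 + (4 * x ^ 3 * a * f t + (6 * x\<^sup>2 * a\<^sup>2 * (f t)\<^sup>2 + (4 * x * a ^ 3 * f t ^ 3 + a ^ 4 * f t ^ 4))) \<partial>\<nu>)"
      by (intro lint_cong refl) (simp add: power2_eq_square power3_eq_cube power4_eq_xxxx algebra_simps)
    also have "\<dots> = x ^ 4 + (6 * a\<^sup>2 * m2 * x\<^sup>2 + (4 * a ^ 3 * m3 * x + a ^ 4 * m4))"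
      using f by (simp add: bm_int_add bm f1 m2_def m3_def m4_def)
    finally show ?thesis .
  qed
  { case 1
    show ?case unfolding pw_insert[OF insert.hyps bXi] upd i1 using insert by simp }
  { case 2
    have "(\<integral>y. (\<Sum>j\<in>insert i J. c j * f (y j))\<^sup>2 \<partial>pw (insert i J)) = (\<integral>y. (?X y)\<^sup>2 + (c i)\<^sup>2 * m2 \<partial>pw J)"
      unfolding pw_insert[OF insert.hyps bm_power[OF bXi]] upd i2 ..
    also have "\<dots> = m2 * (\<Sum>j\<in>insert i J. (c j)\<^sup>2)"
      using bX insert unfolding si by (simp add: P.bm_int_add bm m2_def algebra_simps)
    finally show ?case by (simp add: m2_def) }
  { case 3
    have "(\<integral>y. (\<Sum>j\<in>insert i J. c j * f (y j)) ^ 4 \<partial>pw (insert i J)) =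
       (\<integral>y. ?X y ^ 4 + (6 * (c i)\<^sup>2 * m2 * (?X y)\<^sup>2 + (4 * c i ^ 3 * m3 * ?X y + c i ^ 4 * m4)) \<partial>pw J)"
      unfolding pw_insert[OF insert.hyps bm_power[OF bXi]] upd i4 ..
    also have "\<dots> = (\<integral>y. ?X y ^ 4 \<partial>pw J) + (6 * (c i)\<^sup>2 * m2 * (\<integral>y. (?X y)\<^sup>2 \<partial>pw J) + (4 * c i ^ 3 * m3 * (\<integral>y. ?X y \<partial>pw J) + c i ^ 4 * m4))"
      using bX by (simp add: P.bm_int_add bm)
    also have "\<dots> = (\<integral>y. ?X y ^ 4 \<partial>pw J) + (6 * (c i)\<^sup>2 * m2 * (m2 * (\<Sum>j\<in>J. (c j)\<^sup>2)) + c i ^ 4 * m4)"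
      using insert by (simp add: m2_def)
    also have "\<dots> \<le> (3 * m2\<^sup>2 + m4) * (\<Sum>j\<in>J. (c j)\<^sup>2)\<^sup>2 + (6 * (c i)\<^sup>2 * m2 * (m2 * (\<Sum>j\<in>J. (c j)\<^sup>2)) + c i ^ 4 * m4)"
      using insert by (simp add: m2_def m4_def)
    also have "\<dots> \<le> (3 * m2\<^sup>2 + m4) * (\<Sum>j\<in>insert i J. (c j)\<^sup>2)\<^sup>2"
    proof -
      have "0 \<le> 3 * m2\<^sup>2 * a\<^sup>2 + 2 * m4 * s * a" if "s \<ge> 0" "a \<ge> 0" for s a
        using m that by (intro add_nonneg_nonneg mult_nonneg_nonneg) auto
      then have "(3 * m2\<^sup>2 + m4) * s\<^sup>2 + (6 * a * m2 * (m2 * s) + a\<^sup>2 * m4) \<le> (3 * m2\<^sup>2 + m4) * (s + a)\<^sup>2" if "s \<ge> 0" "a \<ge> 0" for s a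
        using that by (fastforce simp: power2_eq_square algebra_simps)
      from this[of "\<Sum>j\<in>J. (c j)\<^sup>2" "(c i)\<^sup>2"] show ?thesis unfolding si by (simp add: sum_nonneg)
    qed
    finally show ?case by (simp add: m2_def m4_def) }
qed

text \<open>The off-diagonal quadratic form of a symmetric matrix, grouped so that the coefficient of the entry
  \<open>j\<close> depends on earlier entries only. This makes it a sum of martingale increments.\<close>

definition lower_form :: "(nat \<Rightarrow> nat \<Rightarrow> real) \<Rightarrow> (real \<Rightarrow> real) \<Rightarrow> nat \<Rightarrow> (nat \<Rightarrow> real) \<Rightarrow> real" where
  "lower_form m f n y = (\<Sum>j\<in>{1..n}. (\<Sum>i\<in>{1..<j}. m i j * f (y i)) * f (y j))"

lemma bm_lower_form [bm]: "bounded_meas \<nu> f \<Longrightarrow> bounded_meas (pw {1..n}) (lower_form m f n)"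
  unfolding lower_form_def by (intro bm) auto

text \<open>Induction on the number of entries: conditionally on the earlier ones the last increment is a linear form in one
  variable, and a vanishing third moment removes the cross term that is not a product of even powers.\<close>

lemma pw_quadratic_moments:
  assumes f: "bounded_meas \<nu> f" and f1: "(\<integral>t. f t \<partial>\<nu>) = 0" and f3: "(\<integral>t. f t ^ 3 \<partial>\<nu>) = 0"
    and c: "(\<integral>t. (f t)\<^sup>2 \<partial>\<nu>) \<le> c" "(\<integral>t. f t ^ 4 \<partial>\<nu>) \<le> c\<^sup>2"
  shows "(\<integral>y. (lower_form m f n y)\<^sup>2 \<partial>pw {1..n}) = (\<integral>t. (f t)\<^sup>2 \<partial>\<nu>)\<^sup>2 * (\<Sum>j\<in>{1..n}. \<Sum>i\<in>{1..<j}. (m i j)\<^sup>2)"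
    and "(\<integral>y. lower_form m f n y ^ 4 \<partial>pw {1..n}) \<le> (6 * c\<^sup>2 * (\<Sum>j\<in>{1..n}. \<Sum>i\<in>{1..<j}. (m i j)\<^sup>2))\<^sup>2"
proof (induction n)
  case 0
  interpret P: bm_prob "pw ({} :: nat set)" by (rule bm_prob_pw)
  { case 1 show ?case by (simp add: lower_form_def) }
  { case 2 show ?case by (simp add: lower_form_def) }
next
  case (Suc n)
  interpret P: bm_prob "pw {1..n}" by (rule bm_prob_pw)
  let ?Q = "lower_form m f n"
  define X where "X y = (\<Sum>i\<in>{1..n}. m i (Suc n) * f (y i))" for y :: "nat \<Rightarrow> real"
  have bQ: "bounded_meas (pw {1..n}) ?Q" using f by (rule bm)
  have bX: "bounded_meas (pw {1..n}) X" using f unfolding X_def by (intro bm) auto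
  have bQS: "bounded_meas (pw (insert (Suc n) {1..n})) (lower_form m f (Suc n))"
    using bm_lower_form[OF f, of "Suc n"] by (simp add: atLeastAtMostSuc_conv)
  have ins: "{1..Suc n} = insert (Suc n) {1..n}" by auto
  have nn: "finite {1..n}" "Suc n \<notin> {1..n}" by auto
  have upd: "lower_form m f (Suc n) (y(Suc n := t)) = ?Q y + X y * f t" for y t
  proof -
    have "(\<Sum>i\<in>{1..<j}. m i j * f ((y(Suc n := t)) i)) * f ((y(Suc n := t)) j) = (\<Sum>i\<in>{1..<j}. m i j * f (y i)) * f (y j)"
      if "j \<in> {1..n}" for j using that by (auto intro!: sum.cong)
    then have "(\<Sum>j\<in>{1..n}. (\<Sum>i\<in>{1..<j}. m i j * f ((y(Suc n := t)) i)) * f ((y(Suc n := t)) j)) = ?Q y"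
      unfolding lower_form_def by (rule sum.cong[OF refl])
    moreover have "(\<Sum>i\<in>{1..<Suc n}. m i (Suc n) * f ((y(Suc n := t)) i)) = X y"
      unfolding X_def by (intro sum.cong) auto
    ultimately show ?thesis unfolding lower_form_def by simp
  qed
  define m2 where "m2 = (\<integral>t. (f t)\<^sup>2 \<partial>\<nu>)"
  define m4 where "m4 = (\<integral>t. f t ^ 4 \<partial>\<nu>)"
  have m: "m2 \<ge> 0" "m4 \<ge> 0" "m2 \<le> c" "m4 \<le> c\<^sup>2" using c by (auto simp: m2_def m4_def)
  have c0: "c \<ge> 0" using m by linarith
  have i2: "(\<integral>t. (x + a * f t)\<^sup>2 \<partial>\<nu>) = x\<^sup>2 + m2 * a\<^sup>2" for x a
  proof -
    have "(\<integral>t. (x + a * f t)\<^sup>2 \<partial>\<nu>) = (\<integral>t. x\<^sup>2 + (2 * x * a * f t + a\<^sup>2 * (f t)\<^sup>2) \<partial>\<nu>)"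
      by (intro lint_cong refl) (simp add: power2_eq_square algebra_simps)
    also have "\<dots> = x\<^sup>2 + m2 * a\<^sup>2"
      using f by (simp add: bm_int_add bm f1 m2_def)
    finally show ?thesis .
  qed
  have i4: "(\<integral>t. (x + a * f t) ^ 4 \<partial>\<nu>) = x ^ 4 + (6 * m2 * (x\<^sup>2 * a\<^sup>2) + m4 * a ^ 4)" for x a
  proof -
    have "(\<integral>t. (x + a * f t) ^ 4 \<partial>\<nu>) = (\<integral>t. x ^ 4 + (4 * x ^ 3 * a * f t + (6 * x\<^sup>2 * a\<^sup>2 * (f t)\<^sup>2 + (4 * x * a ^ 3 * f t ^ 3 + a ^ 4 * f t ^ 4))) \<partial>\<nu>)"
      by (intro lint_cong refl) (simp add: power2_eq_square power3_eq_cube power4_eq_xxxx algebra_simps)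
    also have "\<dots> = x ^ 4 + (6 * m2 * (x\<^sup>2 * a\<^sup>2) + m4 * a ^ 4)"
      using f by (simp add: bm_int_add bm f1 f3 m2_def m4_def)
    finally show ?thesis .
  qed
  define s where "s = (\<Sum>j\<in>{1..n}. \<Sum>i\<in>{1..<j}. (m i j)\<^sup>2)"
  define \<mu> where "\<mu> = (\<Sum>i\<in>{1..n}. (m i (Suc n))\<^sup>2)"
  have s0: "s \<ge> 0" "\<mu> \<ge> 0" by (auto simp: s_def \<mu>_def intro!: sum_nonneg)
  have sS: "(\<Sum>j\<in>{1..Suc n}. \<Sum>i\<in>{1..<j}. (m i j)\<^sup>2) = s + \<mu>"
    by (simp add: s_def \<mu>_def atLeastLessThanSuc_atLeastAtMost)
  have X2: "(\<integral>y. (X y)\<^sup>2 \<partial>pw {1..n}) = m2 * \<mu>"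
    unfolding X_def m2_def \<mu>_def by (rule pw_linear_moments[OF f f1]) simp
  have X4: "(\<integral>y. X y ^ 4 \<partial>pw {1..n}) \<le> 4 * c\<^sup>2 * \<mu>\<^sup>2"
  proof -
    have "(\<integral>y. X y ^ 4 \<partial>pw {1..n}) \<le> (3 * m2\<^sup>2 + m4) * \<mu>\<^sup>2"
      unfolding X_def m2_def m4_def \<mu>_def by (rule pw_linear_moments[OF f f1]) simp
    also have "\<dots> \<le> 4 * c\<^sup>2 * \<mu>\<^sup>2"
    proof (rule mult_right_mono)
      show "3 * m2\<^sup>2 + m4 \<le> 4 * c\<^sup>2" using m(4) power_mono[OF m(3,1), of 2] by linarith
    qed simp
    finally show ?thesis .
  qed
  { case 1
    have "(\<integral>y. (lower_form m f (Suc n) y)\<^sup>2 \<partial>pw {1..Suc n}) = (\<integral>y. (?Q y)\<^sup>2 + m2 * (X y)\<^sup>2 \<partial>pw {1..n})"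
      unfolding ins pw_insert[OF nn bm_power[OF bQS]] upd i2 ..
    also have "\<dots> = m2\<^sup>2 * s + m2 * (m2 * \<mu>)"
      using bQ bX Suc(1) X2 by (simp add: P.bm_int_add bm m2_def s_def)
    finally show ?case unfolding sS by (simp add: m2_def algebra_simps power2_eq_square) }
  { case 2
    have QX: "(\<integral>y. (?Q y)\<^sup>2 * (X y)\<^sup>2 \<partial>pw {1..n}) \<le> 12 * c ^ 3 * s * \<mu>"
    proof (cases "s = 0 \<or> \<mu> = 0 \<or> c = 0")
      case True
      have 4: "x\<^sup>2 * z\<^sup>2 \<le> (1 / 2) * (l * x ^ 4 + z ^ 4 / l)" if "l > 0" for x z l :: real
      proof -
        have "0 \<le> (l * x\<^sup>2 - z\<^sup>2)\<^sup>2 / l" using that by simp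
        also have "\<dots> = l * x ^ 4 + z ^ 4 / l - 2 * (x\<^sup>2 * z\<^sup>2)"
          using that by (simp add: power2_eq_square power4_eq_xxxx field_simps)
        finally show ?thesis by simp
      qed
      have z: "?Q y = 0 \<or> X y = 0 \<or> c = 0" for y
      proof -
        have "s = 0 \<Longrightarrow> j \<in> {1..n} \<Longrightarrow> i \<in> {1..<j} \<Longrightarrow> m i j = 0" for i j
        proof -
          assume s: "s = 0" and j: "j \<in> {1..n}" and i: "i \<in> {1..<j}"
          have "(\<Sum>i\<in>{1..<j}. (m i j)\<^sup>2) = 0"
            using s j unfolding s_def by (subst (asm) sum_nonneg_eq_0_iff) (auto intro!: sum_nonneg)
          then have "(m i j)\<^sup>2 = 0" using i by (subst (asm) sum_nonneg_eq_0_iff) auto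
          then show "m i j = 0" by simp
        qed
        then have "s = 0 \<Longrightarrow> ?Q y = 0" unfolding lower_form_def by (intro sum.neutral ballI) simp
        moreover have "\<mu> = 0 \<Longrightarrow> X y = 0"
          unfolding X_def \<mu>_def by (subst (asm) sum_nonneg_eq_0_iff) auto
        ultimately show ?thesis using True by blast
      qed
      show ?thesis
      proof (cases "c = 0")
        case False
        then have "(\<lambda>y. (?Q y)\<^sup>2 * (X y)\<^sup>2) = (\<lambda>_. 0)" using z by auto
        then have "(\<integral>y. (?Q y)\<^sup>2 * (X y)\<^sup>2 \<partial>pw {1..n}) = 0" by simp
        then show ?thesis using s0 c0 by simp
      next
        case True
        have "(\<integral>y. (?Q y)\<^sup>2 * (X y)\<^sup>2 \<partial>pw {1..n}) \<le> (\<integral>y. (1 / 2) * (1 * ?Q y ^ 4 + X y ^ 4 / 1) \<partial>pw {1..n})"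
          using bQ bX by (intro P.bm_int_mono bm_mult bm_add bm_power bm_const bm_divide 4) auto
        also have "\<dots> = (1 / 2) * ((\<integral>y. ?Q y ^ 4 \<partial>pw {1..n}) + (\<integral>y. X y ^ 4 \<partial>pw {1..n}))"
          using bQ bX by (simp add: P.bm_int_add bm)
        also have "\<dots> \<le> 0" using Suc(2) X4 True by simp
        finally show ?thesis using True by simp
      qed
    next
      case False
      then have pos: "s > 0" "\<mu> > 0" "c > 0" using s0 c0 by auto
      define l where "l = 2 * c * \<mu> / (6 * c\<^sup>2 * s)"
      have l: "l > 0" using pos by (simp add: l_def)
      have 4: "x\<^sup>2 * z\<^sup>2 \<le> (1 / 2) * (l * x ^ 4 + z ^ 4 / l)" for x z :: real
      proof -
        have "0 \<le> (l * x\<^sup>2 - z\<^sup>2)\<^sup>2 / l" using l by simp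
        also have "\<dots> = l * x ^ 4 + z ^ 4 / l - 2 * (x\<^sup>2 * z\<^sup>2)"
          using l by (simp add: power2_eq_square power4_eq_xxxx field_simps)
        finally show ?thesis by simp
      qed
      have "(\<integral>y. (?Q y)\<^sup>2 * (X y)\<^sup>2 \<partial>pw {1..n}) \<le> (\<integral>y. (1 / 2) * (l * ?Q y ^ 4 + X y ^ 4 / l) \<partial>pw {1..n})"
        using bQ bX by (intro P.bm_int_mono bm_mult bm_add bm_power bm_const bm_divide 4) auto
      also have "\<dots> = (1 / 2) * (l * (\<integral>y. ?Q y ^ 4 \<partial>pw {1..n}) + (\<integral>y. X y ^ 4 \<partial>pw {1..n}) / l)"
        using bQ bX by (simp add: P.bm_int_add bm)
      also have "\<dots> \<le> (1 / 2) * (l * (6 * c\<^sup>2 * s)\<^sup>2 + (4 * c\<^sup>2 * \<mu>\<^sup>2) / l)"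
        using Suc(2) X4 l by (intro mult_left_mono add_mono divide_right_mono) (auto simp: s_def)
      also have "l * (6 * c\<^sup>2 * s)\<^sup>2 = 12 * c ^ 3 * s * \<mu>"
        using pos by (simp add: l_def field_simps power2_eq_square power3_eq_cube)
      also have "(4 * c\<^sup>2 * \<mu>\<^sup>2) / l = 12 * c ^ 3 * s * \<mu>"
        using pos by (simp add: l_def field_simps power2_eq_square power3_eq_cube)
      finally show ?thesis by (simp add: mult_ac)
    qed
    have "(\<integral>y. lower_form m f (Suc n) y ^ 4 \<partial>pw {1..Suc n}) =
       (\<integral>y. ?Q y ^ 4 + (6 * m2 * ((?Q y)\<^sup>2 * (X y)\<^sup>2) + m4 * X y ^ 4) \<partial>pw {1..n})"
      unfolding ins pw_insert[OF nn bm_power[OF bQS]] upd i4 ..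
    also have "\<dots> = (\<integral>y. ?Q y ^ 4 \<partial>pw {1..n}) + (6 * m2 * (\<integral>y. (?Q y)\<^sup>2 * (X y)\<^sup>2 \<partial>pw {1..n}) + m4 * (\<integral>y. X y ^ 4 \<partial>pw {1..n}))"
      using bQ bX by (simp add: P.bm_int_add bm)
    also have "\<dots> \<le> (6 * c\<^sup>2 * s)\<^sup>2 + (6 * c * (12 * c ^ 3 * s * \<mu>) + c\<^sup>2 * (4 * c\<^sup>2 * \<mu>\<^sup>2))"
      using Suc(2) QX X4 m c0 by (intro add_mono mult_mono) (auto simp: s_def)
    also have "\<dots> = (6 * c\<^sup>2 * s)\<^sup>2 + 72 * c ^ 4 * s * \<mu> + 4 * c ^ 4 * \<mu>\<^sup>2"
      by (simp add: power2_eq_square power4_eq_xxxx power3_eq_cube)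
    also have "\<dots> \<le> (6 * c\<^sup>2 * s)\<^sup>2 + 72 * c ^ 4 * s * \<mu> + 36 * c ^ 4 * \<mu>\<^sup>2"
      by (intro add_left_mono mult_right_mono) auto
    also have "\<dots> = (6 * c\<^sup>2 * (s + \<mu>))\<^sup>2"
      by (simp add: power2_eq_square power4_eq_xxxx algebra_simps)
    finally show ?case unfolding sS . }
qed

end

section \<open>Elementary estimates\<close>

text \<open>With \<open>u, u' \<in> {1, -1}\<close> the factors \<open>1 + A + u u' C\<close> take two values, so their logarithm is affine in
  \<open>u u'\<close> and the product over a row depends on the overlap \<open>S\<close> only.\<close>

definition pair_c0 :: "real \<Rightarrow> real \<Rightarrow> real" where
  "pair_c0 A C = (ln (1 + A + C) + ln (1 + A - C)) / 2"

definition pair_theta :: "real \<Rightarrow> real \<Rightarrow> real" where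
  "pair_theta A C = (ln (1 + A + C) - ln (1 + A - C)) / 2"

lemma pair_factor:
  assumes "A \<ge> 0" "0 \<le> C" "C < 1" "u \<in> {1, - 1}"
  shows "1 + A + u * C = exp (pair_c0 A C + u * pair_theta A C)"
proof -
  have "1 + A + C > 0" "1 + A - C > 0" using assms by auto
  then show ?thesis using assms(4) by (auto simp: pair_c0_def pair_theta_def field_simps)
qed

lemma pair_c0_bound:
  assumes "0 \<le> A" "A \<le> c\<^sup>2" "0 \<le> C" "C \<le> c" "c \<le> 1 / 4"
  shows "\<bar>pair_c0 A C - (A - C\<^sup>2 / 2)\<bar> \<le> 17 * c ^ 4"
proof -
  define x where "x = 2 * A + A\<^sup>2 - C\<^sup>2"
  have c: "0 \<le> c" using assms by linarith
  have c2: "c\<^sup>2 \<le> 1 / 16" using power_mono[OF assms(5) c, of 2] by (simp add: power2_eq_square)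
  have A2: "A\<^sup>2 \<le> c ^ 4" using power_mono[OF assms(2,1), of 2] by simp
  have C2: "C\<^sup>2 \<le> c\<^sup>2" using power_mono[OF assms(4,3), of 2] by simp
  have "c ^ 4 = c\<^sup>2 * c\<^sup>2" by (simp add: power2_eq_square power4_eq_xxxx)
  also have "\<dots> \<le> c\<^sup>2 * (1 / 16)" using c2 by (intro mult_left_mono) auto
  finally have c4: "c ^ 4 \<le> c\<^sup>2 / 16" by simp
  have A0: "A\<^sup>2 \<ge> 0" "C\<^sup>2 \<ge> 0" by auto
  then have x: "\<bar>x\<bar> \<le> 4 * c\<^sup>2" unfolding x_def using assms A2 C2 c4 by linarith
  then have x2: "\<bar>x\<bar> \<le> 1 / 2" using c2 by linarith
  have "(1 + A + C) * (1 + A - C) = 1 + x" by (simp add: x_def power2_eq_square algebra_simps)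
  moreover have "1 + A + C > 0" "1 + A - C > 0" using assms c by auto
  ultimately have "ln (1 + x) = ln (1 + A + C) + ln (1 + A - C)"
    by (metis ln_mult_pos)
  then have "pair_c0 A C = ln (1 + x) / 2" by (simp add: pair_c0_def)
  moreover have "\<bar>ln (1 + x) - x\<bar> \<le> 2 * x\<^sup>2"
    using abs_ln_one_plus_x_minus_x_bound[OF x2] .
  moreover have "x\<^sup>2 \<le> 16 * c ^ 4"
    using power_mono[OF x, of 2] by (simp add: power2_eq_square power4_eq_xxxx)
  moreover have "x = 2 * (A - C\<^sup>2 / 2) + A\<^sup>2" by (simp add: x_def)
  ultimately have "\<bar>2 * pair_c0 A C - x\<bar> \<le> 32 * c ^ 4" "x = 2 * (A - C\<^sup>2 / 2) + A\<^sup>2" by auto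
  moreover have "0 \<le> c ^ 4" using c by simp
  ultimately show ?thesis using A2 A0(1) by argo
qed

lemma pair_theta_bound:
  assumes "0 \<le> A" "A \<le> c\<^sup>2" "0 \<le> C" "C \<le> c" "c \<le> 1 / 4"
  shows "\<bar>pair_theta A C - C\<bar> \<le> 4 * c\<^sup>2"
proof -
  have c: "0 \<le> c" using assms by linarith
  have "c\<^sup>2 \<le> (1 / 4) * c" using mult_right_mono[OF assms(5) c] by (simp add: power2_eq_square)
  then have cc: "c\<^sup>2 \<le> c / 4" by simp
  have A2: "A\<^sup>2 \<le> c\<^sup>2"
    using assms cc c by (intro power_mono) linarith+
  have C2: "C\<^sup>2 \<le> c\<^sup>2" using power_mono[OF assms(4,3), of 2] by simp
  have 1: "\<bar>A + C\<bar> \<le> 1 / 2" "\<bar>A - C\<bar> \<le> 1 / 2" using assms c cc by linarith+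
  have e: "1 + A + C = 1 + (A + C)" "1 + A - C = 1 + (A - C)" by auto
  have "\<bar>ln (1 + A + C) - (A + C)\<bar> \<le> 2 * (A + C)\<^sup>2" "\<bar>ln (1 + A - C) - (A - C)\<bar> \<le> 2 * (A - C)\<^sup>2"
    unfolding e by (rule abs_ln_one_plus_x_minus_x_bound[OF 1(1)], rule abs_ln_one_plus_x_minus_x_bound[OF 1(2)])
  moreover have "2 * (A + C)\<^sup>2 + 2 * (A - C)\<^sup>2 = 4 * A\<^sup>2 + 4 * C\<^sup>2" by (simp add: power2_eq_square algebra_simps)
  ultimately show ?thesis unfolding pair_theta_def using A2 C2 by argo
qed

lemma exp_bounds:
  fixes x :: real assumes "\<bar>x\<bar> \<le> b"
  shows "\<bar>exp x - 1\<bar> \<le> \<bar>x\<bar> * exp b" "\<bar>exp x - 1 - x\<bar> \<le> x\<^sup>2 * exp b"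
    "\<bar>cosh x - 1 - x\<^sup>2 / 2\<bar> \<le> x ^ 4 * exp b" "\<bar>sinh x - x\<bar> \<le> \<bar>x\<bar> ^ 3 * exp b"
    "\<bar>sinh x\<bar> \<le> \<bar>x\<bar> * exp b" "\<bar>cosh x\<bar> \<le> exp b"
proof -
  have R: "\<bar>exp z - (\<Sum>m<n. z ^ m / fact m)\<bar> \<le> \<bar>z\<bar> ^ n / fact n * exp b" if "\<bar>z\<bar> \<le> b" for z n
  proof -
    obtain t where t: "\<bar>t\<bar> \<le> \<bar>z\<bar>" "exp z = (\<Sum>m<n. z ^ m / fact m) + exp t / fact n * z ^ n"
      using Maclaurin_exp_le[of z n] by blast
    have "exp t \<le> exp b" using t that by auto
    then have "exp t * (\<bar>z\<bar> ^ n / fact n) \<le> exp b * (\<bar>z\<bar> ^ n / fact n)" by (intro mult_right_mono) auto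
    then show ?thesis unfolding t(2) by (simp add: abs_mult power_abs mult.commute)
  qed
  have x': "\<bar>- x\<bar> \<le> b" using assms by simp
  have p: "0 \<le> \<bar>x\<bar> ^ n * exp b" for n by simp
  show "\<bar>exp x - 1\<bar> \<le> \<bar>x\<bar> * exp b" using R[OF assms, of 1] by simp
  show "\<bar>exp x - 1 - x\<bar> \<le> x\<^sup>2 * exp b"
  proof -
    have "\<bar>exp x - (1 + x)\<bar> \<le> \<bar>x\<bar>\<^sup>2 / 2 * exp b"
      using R[OF assms, of 2] by (simp add: numeral_eq_Suc lessThan_Suc algebra_simps)
    moreover have "\<bar>x\<bar>\<^sup>2 / 2 * exp b = x\<^sup>2 * exp b / 2" by simp
    moreover have "0 \<le> x\<^sup>2 * exp b" by simp
    ultimately show ?thesis by linarith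
  qed
  show "\<bar>cosh x - 1 - x\<^sup>2 / 2\<bar> \<le> x ^ 4 * exp b"
  proof -
    have gen: "\<bar>u + v\<bar> \<le> 2 * t" if "\<bar>u\<bar> \<le> t / 24" "\<bar>v\<bar> \<le> t / 24" "0 \<le> t" for u v t :: real
      using that by linarith
    have 4: "\<bar>exp x - (1 + x + x\<^sup>2 / 2 + x ^ 3 / 6)\<bar> \<le> x ^ 4 / 24 * exp b"
      using R[OF assms, of 4] by (simp add: numeral_eq_Suc lessThan_Suc algebra_simps)
    have 5: "\<bar>exp (- x) - (1 - x + x\<^sup>2 / 2 - x ^ 3 / 6)\<bar> \<le> x ^ 4 / 24 * exp b"
      using R[OF x', of 4] by (simp add: numeral_eq_Suc lessThan_Suc algebra_simps)
    have "\<bar>(exp x - (1 + x + x\<^sup>2 / 2 + x ^ 3 / 6)) + (exp (- x) - (1 - x + x\<^sup>2 / 2 - x ^ 3 / 6))\<bar> \<le> 2 * (x ^ 4 * exp b)"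
      by (rule gen) (use 4 5 in auto)
    then have "\<bar>((exp x - (1 + x + x\<^sup>2 / 2 + x ^ 3 / 6)) + (exp (- x) - (1 - x + x\<^sup>2 / 2 - x ^ 3 / 6))) / 2\<bar> \<le> x ^ 4 * exp b"
      unfolding abs_divide by simp
    moreover have "((exp x - (1 + x + x\<^sup>2 / 2 + x ^ 3 / 6)) + (exp (- x) - (1 - x + x\<^sup>2 / 2 - x ^ 3 / 6))) / 2 = cosh x - 1 - x\<^sup>2 / 2"
      by (simp add: cosh_field_def field_simps)
    ultimately show ?thesis by simp
  qed
  show "\<bar>sinh x - x\<bar> \<le> \<bar>x\<bar> ^ 3 * exp b"
  proof -
    have 4: "\<bar>exp x - (1 + x + x\<^sup>2 / 2)\<bar> \<le> \<bar>x\<bar> ^ 3 / 6 * exp b"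
      using R[OF assms, of 3] by (simp add: numeral_eq_Suc lessThan_Suc algebra_simps)
    have 5: "\<bar>exp (- x) - (1 - x + x\<^sup>2 / 2)\<bar> \<le> \<bar>x\<bar> ^ 3 / 6 * exp b"
      using R[OF x', of 3] by (simp add: numeral_eq_Suc lessThan_Suc algebra_simps)
    have "\<bar>u - v\<bar> \<le> 2 * t" if "\<bar>u\<bar> \<le> t / 6" "\<bar>v\<bar> \<le> t / 6" "0 \<le> t" for u v t :: real
      using that by linarith
    note gen = this
    have "\<bar>(exp x - (1 + x + x\<^sup>2 / 2)) - (exp (- x) - (1 - x + x\<^sup>2 / 2))\<bar> \<le> 2 * (\<bar>x\<bar> ^ 3 * exp b)"
      by (rule gen[OF _ _ p]) (use 4 5 in auto)
    then have "\<bar>((exp x - (1 + x + x\<^sup>2 / 2)) - (exp (- x) - (1 - x + x\<^sup>2 / 2))) / 2\<bar> \<le> \<bar>x\<bar> ^ 3 * exp b"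
      unfolding abs_divide by simp
    moreover have "((exp x - (1 + x + x\<^sup>2 / 2)) - (exp (- x) - (1 - x + x\<^sup>2 / 2))) / 2 = sinh x - x"
      by (simp add: sinh_field_def field_simps)
    ultimately show ?thesis by simp
  qed
  show "\<bar>sinh x\<bar> \<le> \<bar>x\<bar> * exp b"
    using R[OF assms, of 1] R[OF x', of 1] p[of 1] unfolding sinh_field_def by simp
  show "\<bar>cosh x\<bar> \<le> exp b"
  proof -
    have "exp x \<le> exp b" "exp (- x) \<le> exp b" using assms by auto
    then have "exp x + exp (- x) \<le> 2 * exp b" by linarith
    then have "cosh x \<le> exp b" unfolding cosh_field_def by simp
    then show ?thesis using cosh_real_pos[of x] by linarith
  qed
qed

text \<open>Here \<open>c\<close> has the order of magnitude of the inverse matrix size, and \<open>S\<close> is typically of order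
  \<open>1 / sqrt c\<close>, which makes both errors negligible.\<close>

lemma pair_expansion:
  fixes A C c B S :: real and k :: nat
  assumes A: "0 \<le> A" "A \<le> c\<^sup>2" and C: "0 \<le> C" "C \<le> c" and c: "c \<le> 1 / 4"
    and k: "real k * c \<le> B" and S: "\<bar>S\<bar> \<le> real k"
  defines "K \<equiv> 9 * B\<^sup>2 * (exp (3 * B) + 1) + 16 * ((1 + B) * exp (2 * B) + 1) + 17 * B + 3"
  defines "K' \<equiv> 6 * B * exp (3 * B) + 8 * exp (2 * B) + 4"
  shows "\<bar>exp (k * pair_c0 A C) * cosh (pair_theta A C * S) - 1 - (k * A - k * C\<^sup>2 / 2) - C\<^sup>2 * S\<^sup>2 / 2\<bar> \<le> K * (c\<^sup>2 + c ^ 4 * S ^ 4)"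
    and "\<bar>S * (exp (k * pair_c0 A C) * sinh (pair_theta A C * S)) - C * S\<^sup>2\<bar> \<le> K' * (c\<^sup>2 * S\<^sup>2 + c ^ 3 * S ^ 4)"
proof -
  have c0: "0 \<le> c" using C by linarith
  have B: "0 \<le> B" using k c0 mult_nonneg_nonneg[of "real k" c] by linarith
  have c2: "c\<^sup>2 \<le> c / 4" using mult_right_mono[OF c c0] by (simp add: power2_eq_square)
  have c3: "c ^ 3 \<le> c\<^sup>2 / 4" using mult_right_mono[OF c, of "c\<^sup>2"] by (simp add: power2_eq_square power3_eq_cube)
  have c4: "c ^ 4 \<le> c\<^sup>2 / 16"
    using mult_right_mono[OF c, of "c ^ 3"] c3 c0 by (simp add: power4_eq_xxxx power3_eq_cube)
  define \<kappa> where "\<kappa> = k * pair_c0 A C"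
  define \<theta> where "\<theta> = pair_theta A C"
  define z where "z = \<theta> * S"
  note b0 = pair_c0_bound[OF A C c] and bt = pair_theta_bound[OF A C c]
  have C2: "0 \<le> C\<^sup>2" "C\<^sup>2 \<le> c\<^sup>2" using C by (auto intro!: power_mono)
  have "\<bar>pair_c0 A C\<bar> \<le> 3 * c\<^sup>2" using b0 A C2 c4 by linarith
  then have "\<bar>\<kappa>\<bar> \<le> real k * (3 * c\<^sup>2)" by (simp add: \<kappa>_def abs_mult mult_left_mono)
  also have "\<dots> = (real k * c) * (3 * c)" by (simp add: power2_eq_square)
  also have "\<dots> \<le> B * (3 * c)" using k c0 by (intro mult_right_mono) auto
  finally have kap: "\<bar>\<kappa>\<bar> \<le> 3 * B * c" by simp
  have kapB: "\<bar>\<kappa>\<bar> \<le> B" using kap mult_left_mono[OF c, of "3 * B"] B by linarith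
  have kap2: "\<kappa>\<^sup>2 \<le> 9 * B\<^sup>2 * c\<^sup>2"
    using power_mono[OF kap, of 2] by (simp add: power_mult_distrib)
  have th: "\<bar>\<theta>\<bar> \<le> 2 * c" "\<theta> \<ge> - (2 * c)" using bt C c2 by (auto simp: \<theta>_def)
  have z1: "\<bar>z\<bar> \<le> 2 * c * \<bar>S\<bar>" using th by (simp add: z_def abs_mult mult_right_mono)
  have zB: "\<bar>z\<bar> \<le> 2 * B"
    using z1 mult_left_mono[OF S, of "2 * c"] c0 k by (simp add: mult.commute mult.left_commute)
  have z4: "z ^ 4 \<le> 16 * (c ^ 4 * S ^ 4)"
    using power_mono[OF z1, of 4] by (simp add: power_mult_distrib)
  have z3: "\<bar>z\<bar> ^ 3 \<le> 8 * c ^ 3 * \<bar>S\<bar> ^ 3"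
    using power_mono[OF z1, of 3] by (simp add: power_mult_distrib)
  note ek = exp_bounds[OF kapB] and ez = exp_bounds[OF zB]
  have e3: "exp B * exp (2 * B) = exp (3 * B)" by (simp add: exp_add[symmetric])
  have S2: "S\<^sup>2 \<ge> 0" "S ^ 4 \<ge> 0" "c ^ 4 * S ^ 4 \<ge> 0" by auto
  have cS: "c ^ 3 * S\<^sup>2 \<le> (c\<^sup>2 + c ^ 4 * S ^ 4) / 2"
  proof -
    have "0 \<le> (c - c\<^sup>2 * S\<^sup>2)\<^sup>2" by simp
    also have "\<dots> = c\<^sup>2 + c ^ 4 * S ^ 4 - 2 * (c ^ 3 * S\<^sup>2)"
      by (simp add: power2_eq_square power4_eq_xxxx power3_eq_cube algebra_simps)
    finally show ?thesis by simp
  qed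
  show "\<bar>exp (k * pair_c0 A C) * cosh (pair_theta A C * S) - 1 - (k * A - k * C\<^sup>2 / 2) - C\<^sup>2 * S\<^sup>2 / 2\<bar> \<le> K * (c\<^sup>2 + c ^ 4 * S ^ 4)"
  proof -
    have "exp \<kappa> * cosh z - 1 - \<kappa> - z\<^sup>2 / 2 = (exp \<kappa> - 1 - \<kappa>) * cosh z + (1 + \<kappa>) * (cosh z - 1 - z\<^sup>2 / 2) + \<kappa> * z\<^sup>2 / 2"
      by (simp add: algebra_simps)
    moreover have "\<bar>(exp \<kappa> - 1 - \<kappa>) * cosh z\<bar> \<le> \<kappa>\<^sup>2 * exp (3 * B)"
      unfolding e3[symmetric] using mult_mono[OF ek(2) ez(6)] by (simp add: abs_mult)
    moreover have "\<bar>(1 + \<kappa>) * (cosh z - 1 - z\<^sup>2 / 2)\<bar> \<le> (1 + B) * (z ^ 4 * exp (2 * B))"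
      unfolding abs_mult using kapB B by (intro mult_mono ez(3)) auto
    moreover have "\<bar>\<kappa> * z\<^sup>2 / 2\<bar> \<le> \<kappa>\<^sup>2 + z ^ 4"
    proof -
      have "0 \<le> (\<bar>\<kappa>\<bar> - z\<^sup>2)\<^sup>2" by simp
      also have "\<dots> = \<kappa>\<^sup>2 + z ^ 4 - 2 * \<bar>\<kappa> * z\<^sup>2\<bar>"
        by (simp add: power2_eq_square power4_eq_xxxx abs_mult algebra_simps)
      finally have "2 * \<bar>\<kappa> * z\<^sup>2\<bar> \<le> \<kappa>\<^sup>2 + z ^ 4" by simp
      then show ?thesis by simp
    qed
    ultimately have "\<bar>exp \<kappa> * cosh z - 1 - \<kappa> - z\<^sup>2 / 2\<bar> \<le> \<kappa>\<^sup>2 * exp (3 * B) + (1 + B) * (z ^ 4 * exp (2 * B)) + (\<kappa>\<^sup>2 + z ^ 4)"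
      by linarith
    also have "\<dots> = \<kappa>\<^sup>2 * (exp (3 * B) + 1) + z ^ 4 * ((1 + B) * exp (2 * B) + 1)"
      by (simp add: algebra_simps)
    finally have 1: "\<bar>exp \<kappa> * cosh z - 1 - \<kappa> - z\<^sup>2 / 2\<bar> \<le> \<kappa>\<^sup>2 * (exp (3 * B) + 1) + z ^ 4 * ((1 + B) * exp (2 * B) + 1)" .
    have 2: "\<kappa>\<^sup>2 * (exp (3 * B) + 1) \<le> 9 * B\<^sup>2 * (exp (3 * B) + 1) * c\<^sup>2"
      using mult_right_mono[OF kap2, of "exp (3 * B) + 1"] by (simp add: mult_ac add_nonneg_nonneg)
    have 3: "z ^ 4 * ((1 + B) * exp (2 * B) + 1) \<le> 16 * ((1 + B) * exp (2 * B) + 1) * (c ^ 4 * S ^ 4)"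
      using mult_right_mono[OF z4, of "(1 + B) * exp (2 * B) + 1"] B by (simp only: mult_ac) (simp add: mult_ac)
    have 4: "\<bar>\<kappa> - (k * A - k * C\<^sup>2 / 2)\<bar> \<le> 17 * B * c\<^sup>2"
    proof -
      have "\<bar>\<kappa> - (k * A - k * C\<^sup>2 / 2)\<bar> = real k * \<bar>pair_c0 A C - (A - C\<^sup>2 / 2)\<bar>"
        unfolding \<kappa>_def by (subst abs_of_nat[symmetric], subst abs_mult[symmetric]) (simp add: algebra_simps)
      also have "\<dots> \<le> real k * (17 * c ^ 4)" using b0 by (intro mult_left_mono) auto
      also have "\<dots> = 17 * ((real k * c) * c ^ 3)" by (simp add: power4_eq_xxxx power3_eq_cube)
      also have "\<dots> \<le> 17 * (B * c\<^sup>2)"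
      proof (intro mult_left_mono mult_mono k)
        have "0 \<le> c\<^sup>2" by simp
        then show "c ^ 3 \<le> c\<^sup>2" using c3 by linarith
      qed (use c0 B in auto)
      finally show ?thesis by simp
    qed
    have 5: "\<bar>z\<^sup>2 / 2 - C\<^sup>2 * S\<^sup>2 / 2\<bar> \<le> 3 * (c\<^sup>2 + c ^ 4 * S ^ 4)"
    proof -
      have "z\<^sup>2 / 2 - C\<^sup>2 * S\<^sup>2 / 2 = (\<theta> - C) * (\<theta> + C) * (S\<^sup>2 / 2)"
        by (simp add: z_def power2_eq_square algebra_simps diff_divide_distrib)
      also have "\<bar>\<dots>\<bar> = \<bar>\<theta> - C\<bar> * \<bar>\<theta> + C\<bar> * (S\<^sup>2 / 2)" by (simp add: abs_mult)
      also have "\<dots> \<le> (4 * c\<^sup>2) * (3 * c) * (S\<^sup>2 / 2)"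
        using bt th C by (intro mult_right_mono mult_mono) (auto simp: \<theta>_def)
      also have "\<dots> = 6 * (c ^ 3 * S\<^sup>2)" by (simp add: power2_eq_square power3_eq_cube)
      also have "\<dots> \<le> 3 * (c\<^sup>2 + c ^ 4 * S ^ 4)" using cS by linarith
      finally show ?thesis .
    qed
    have "\<bar>exp \<kappa> * cosh z - 1 - (k * A - k * C\<^sup>2 / 2) - C\<^sup>2 * S\<^sup>2 / 2\<bar> \<le>
       9 * B\<^sup>2 * (exp (3 * B) + 1) * c\<^sup>2 + 16 * ((1 + B) * exp (2 * B) + 1) * (c ^ 4 * S ^ 4) + 17 * B * c\<^sup>2 + 3 * (c\<^sup>2 + c ^ 4 * S ^ 4)"
      using 1 2 3 4 5 by linarith
    also have "\<dots> \<le> K * (c\<^sup>2 + c ^ 4 * S ^ 4)"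
    proof -
      have "a * x + b * y + d * x + 3 * (x + y) \<le> (a + b + d + 3) * (x + y)"
        if "a \<ge> 0" "b \<ge> 0" "d \<ge> 0" "x \<ge> 0" "y \<ge> 0" for a b d x y :: real
      proof -
        have "0 \<le> a * y + b * x + d * y" using that by (intro add_nonneg_nonneg mult_nonneg_nonneg)
        then show ?thesis by (simp add: algebra_simps)
      qed
      from this[of "9 * B\<^sup>2 * (exp (3 * B) + 1)" "16 * ((1 + B) * exp (2 * B) + 1)" "17 * B" "c\<^sup>2" "c ^ 4 * S ^ 4"]
      show ?thesis unfolding K_def using B by (simp only: mult_nonneg_nonneg add_nonneg_nonneg zero_le_power2 exp_ge_zero zero_le_one S2 zero_le_numeral)
    qed
    finally show ?thesis by (simp add: \<kappa>_def z_def \<theta>_def)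
  qed
  show "\<bar>S * (exp (k * pair_c0 A C) * sinh (pair_theta A C * S)) - C * S\<^sup>2\<bar> \<le> K' * (c\<^sup>2 * S\<^sup>2 + c ^ 3 * S ^ 4)"
  proof -
    have 1: "\<bar>exp \<kappa> * sinh z - z\<bar> \<le> \<bar>\<kappa>\<bar> * \<bar>z\<bar> * exp (3 * B) + \<bar>z\<bar> ^ 3 * exp (2 * B)"
    proof -
      have "exp \<kappa> * sinh z - z = (exp \<kappa> - 1) * sinh z + (sinh z - z)" by (simp add: algebra_simps)
      moreover have "\<bar>(exp \<kappa> - 1) * sinh z\<bar> \<le> \<bar>\<kappa>\<bar> * \<bar>z\<bar> * exp (3 * B)"
        unfolding e3[symmetric] using mult_mono[OF ek(1) ez(5)] by (simp add: abs_mult mult_ac)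
      ultimately show ?thesis using ez(4) by linarith
    qed
    have 2: "\<bar>\<kappa>\<bar> * \<bar>z\<bar> * exp (3 * B) \<le> (3 * B * c) * (2 * c * \<bar>S\<bar>) * exp (3 * B)"
      using kap z1 B c0 by (intro mult_right_mono mult_mono) auto
    have 3: "\<bar>z\<bar> ^ 3 * exp (2 * B) \<le> 8 * c ^ 3 * \<bar>S\<bar> ^ 3 * exp (2 * B)"
      using z3 by (intro mult_right_mono) auto
    have "\<bar>S * (exp \<kappa> * sinh z) - z * S\<bar> = \<bar>S\<bar> * \<bar>exp \<kappa> * sinh z - z\<bar>"
      by (simp add: abs_mult[symmetric] algebra_simps)
    also have "\<dots> \<le> \<bar>S\<bar> * ((3 * B * c) * (2 * c * \<bar>S\<bar>) * exp (3 * B) + 8 * c ^ 3 * \<bar>S\<bar> ^ 3 * exp (2 * B))"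
    proof (rule mult_left_mono)
      show "\<bar>exp \<kappa> * sinh z - z\<bar> \<le> (3 * B * c) * (2 * c * \<bar>S\<bar>) * exp (3 * B) + 8 * c ^ 3 * \<bar>S\<bar> ^ 3 * exp (2 * B)"
        using 1 2 3 by linarith
    qed simp
    also have "\<dots> = 6 * B * exp (3 * B) * (c\<^sup>2 * \<bar>S\<bar>\<^sup>2) + 8 * exp (2 * B) * (c ^ 3 * \<bar>S\<bar> ^ 4)"
      by (simp only: power2_eq_square power3_eq_cube power4_eq_xxxx) (simp add: algebra_simps del: abs_mult_self_eq)
    finally have 4: "\<bar>S * (exp \<kappa> * sinh z) - z * S\<bar> \<le> 6 * B * exp (3 * B) * (c\<^sup>2 * S\<^sup>2) + 8 * exp (2 * B) * (c ^ 3 * S ^ 4)"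
      by simp
    have 5: "\<bar>z * S - C * S\<^sup>2\<bar> \<le> 4 * (c\<^sup>2 * S\<^sup>2)"
    proof -
      have "z * S - C * S\<^sup>2 = (\<theta> - C) * S\<^sup>2" by (simp add: z_def power2_eq_square algebra_simps)
      also have "\<bar>\<dots>\<bar> \<le> 4 * c\<^sup>2 * S\<^sup>2" using bt by (simp add: abs_mult \<theta>_def mult_right_mono)
      finally show ?thesis by simp
    qed
    have "\<bar>S * (exp \<kappa> * sinh z) - C * S\<^sup>2\<bar> \<le> 6 * B * exp (3 * B) * (c\<^sup>2 * S\<^sup>2) + 8 * exp (2 * B) * (c ^ 3 * S ^ 4) + 4 * (c\<^sup>2 * S\<^sup>2)"
      using 4 5 by linarith
    also have "\<dots> \<le> K' * (c\<^sup>2 * S\<^sup>2 + c ^ 3 * S ^ 4)"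
    proof -
      have "a * x + b * y + 4 * x \<le> (a + b + 4) * (x + y)"
        if "a \<ge> 0" "b \<ge> 0" "x \<ge> 0" "y \<ge> 0" for a b x y :: real
      proof -
        have "0 \<le> a * y + b * x + 4 * y" using that by (intro add_nonneg_nonneg mult_nonneg_nonneg) auto
        then show ?thesis by (simp add: algebra_simps)
      qed
      from this[of "6 * B * exp (3 * B)" "8 * exp (2 * B)" "c\<^sup>2 * S\<^sup>2" "c ^ 3 * S ^ 4"]
      show ?thesis unfolding K'_def using B c0 by simp
    qed
    finally show ?thesis by (simp add: \<kappa>_def z_def \<theta>_def)
  qed
qed

section \<open>Adding one row\<close>

definition kch :: "real \<Rightarrow> real" where
  "kch B = 9 * B\<^sup>2 * (exp (3 * B) + 1) + 16 * ((1 + B) * exp (2 * B) + 1) + 17 * B + 3"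

definition ksh :: "real \<Rightarrow> real" where
  "ksh B = 6 * B * exp (3 * B) + 8 * exp (2 * B) + 4"

lemma bm_bs [bm]:
  assumes "bounded_meas M f" shows "bounded_meas M (\<lambda>x. bs (f x) v)"
proof -
  obtain a where a: "\<And>x. x \<in> space M \<Longrightarrow> \<bar>f x\<bar> \<le> a" using bounded_measE[OF assms] by blast
  have b: "\<bar>bs l v\<bar> \<le> \<bar>l\<bar> + 1" for l
  proof -
    have 1: "\<bar>l * erfc z\<bar> \<le> \<bar>l\<bar> * 2" for z
      unfolding abs_mult using erfc_nonneg[of z] erfc_le_2[of z] by (intro mult_left_mono) auto
    have 2: "\<bar>erfc z\<bar> \<le> 2" for z using erfc_nonneg[of z] erfc_le_2[of z] by auto
    have "\<bar>l * erfc z + erfc z'\<bar> \<le> 2 * \<bar>l\<bar> + 2" for z z'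
      using 1[of z] 2[of z'] abs_triangle_ineq[of "l * erfc z" "erfc z'"] by linarith
    from this[of "(ln l + v / 2) / sqrt (2 * v)" "(v / 2 - ln l) / sqrt (2 * v)"] show ?thesis unfolding bs_def by simp
  qed
  show ?thesis
  proof (rule bounded_measI[of _ _ "a + 1"])
    show "(\<lambda>x. bs (f x) v) \<in> borel_measurable M"
      using measurable_compose[OF bounded_meas_measurable[OF assms] borel_measurable_bs] .
    show "\<bar>bs (f x) v\<bar> \<le> a + 1" if "x \<in> space M" for x using b[of "f x"] a[OF that] by linarith
  qed
qed

lemma bm_gentle:
  assumes "gentle K h" "bounded_meas M f" "\<And>x. x \<in> space M \<Longrightarrow> f x > 0"
  shows "bounded_meas M (\<lambda>x. h (f x))"
proof (rule bounded_measI[of _ _ K])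
  show "(\<lambda>x. h (f x)) \<in> borel_measurable M"
    using assms(1) measurable_compose[OF bounded_meas_measurable[OF assms(2)]] unfolding gentle_def by blast
qed (use assms in \<open>auto simp: gentle_def\<close>)

text \<open>One entry of the matrix contributes the factor \<open>1 + ev t + u * od t\<close> when \<open>u\<close> is the product of the two spins:
  \<open>ev\<close> and \<open>od\<close> are the parts of the density ratio that are even and odd under reversal of the
  signal. The scale \<open>c\<close> stands for a constant divided by the size of the matrix, and the moment bounds
  state that \<open>od\<close> has order \<open>sqrt c\<close> and \<open>ev\<close> has order \<open>c\<close>.\<close>

locale edge_law = noise_law +
  fixes ev od :: "real \<Rightarrow> real" and c :: real
  assumes bm_ev [bm]: "bounded_meas \<nu> ev" and bm_od [bm]: "bounded_meas \<nu> od"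
    and edge_pos: "\<And>t u. u \<in> {1, - 1} \<Longrightarrow> 0 < 1 + ev t + u * od t"
    and int_ev: "(\<integral>t. ev t \<partial>\<nu>) = 0" and int_od: "(\<integral>t. od t \<partial>\<nu>) = 0"
    and int_evod: "(\<integral>t. ev t * od t \<partial>\<nu>) = 0" and int_od3: "(\<integral>t. od t ^ 3 \<partial>\<nu>) = 0"
    and od2_le: "(\<integral>t. (od t)\<^sup>2 \<partial>\<nu>) \<le> c" and od4_le: "(\<integral>t. od t ^ 4 \<partial>\<nu>) \<le> c\<^sup>2"
    and ev2_le: "(\<integral>t. (ev t)\<^sup>2 \<partial>\<nu>) \<le> c\<^sup>2" and ev4_le: "(\<integral>t. ev t ^ 4 \<partial>\<nu>) \<le> c ^ 4"
    and c_pos: "0 < c" and c_le: "c \<le> 1 / 4"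
begin

definition C where "C = (\<integral>t. (od t)\<^sup>2 \<partial>\<nu>)"
definition A where "A = (\<integral>t. (ev t)\<^sup>2 \<partial>\<nu>)"

lemma C_bounds: "0 \<le> C" "C \<le> c" "C < 1" and A_bounds: "0 \<le> A" "A \<le> c\<^sup>2"
  using od2_le ev2_le c_le by (auto simp: C_def A_def)

text \<open>The factor contributed by a new row \<open>y\<close> when the new spin is \<open>u\<close>.\<close>

definition rho :: "nat \<Rightarrow> real \<Rightarrow> (nat \<Rightarrow> real) \<Rightarrow> (nat \<Rightarrow> real) \<Rightarrow> real" where
  "rho k u x y = (\<Prod>j\<in>{1..k}. 1 + ev (y j) + u * x j * od (y j))"

lemma bm_rho [bm]: "bounded_meas (pw {1..k}) (\<lambda>y. rho k u x y)"
  unfolding rho_def by (intro bm) auto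

lemma bm_ev' [bm]: "j \<in> J \<Longrightarrow> bounded_meas (pw J) (\<lambda>y. ev (y j))"
  and bm_od' [bm]: "j \<in> J \<Longrightarrow> bounded_meas (pw J) (\<lambda>y. od (y j))"
  by (intro bm; simp)+

lemma edge_int1: "(\<integral>t. 1 + ev t + a * od t \<partial>\<nu>) = 1"
  by (simp add: bm_int_add bm int_ev int_od)

lemma edge_int2: "(\<integral>t. (1 + ev t + a * od t) * (1 + ev t + b * od t) \<partial>\<nu>) = 1 + A + a * b * C"
proof -
  have "(\<integral>t. (1 + ev t + a * od t) * (1 + ev t + b * od t) \<partial>\<nu>) =
     (\<integral>t. 1 + (2 * ev t + ((ev t)\<^sup>2 + ((a + b) * od t + ((a + b) * (ev t * od t) + a * b * (od t)\<^sup>2)))) \<partial>\<nu>)"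
    by (intro lint_cong refl) (simp add: power2_eq_square algebra_simps)
  also have "\<dots> = 1 + A + a * b * C"
    by (simp add: bm_int_add bm int_ev int_od int_evod A_def C_def)
  finally show ?thesis .
qed

lemma edge_int_ev: "(\<integral>t. (1 + ev t + a * od t) * ev t \<partial>\<nu>) = A"
proof -
  have "(\<integral>t. (1 + ev t + a * od t) * ev t \<partial>\<nu>) = (\<integral>t. ev t + ((ev t)\<^sup>2 + a * (ev t * od t)) \<partial>\<nu>)"
    by (intro lint_cong refl) (simp add: power2_eq_square algebra_simps)
  also have "\<dots> = A" by (simp add: bm_int_add bm int_ev int_od int_evod A_def)
  finally show ?thesis .
qed

lemma edge_int_od: "(\<integral>t. (1 + ev t + a * od t) * od t \<partial>\<nu>) = a * C"
proof -
  have "(\<integral>t. (1 + ev t + a * od t) * od t \<partial>\<nu>) = (\<integral>t. od t + (ev t * od t + a * (od t)\<^sup>2) \<partial>\<nu>)"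
    by (intro lint_cong refl) (simp add: power2_eq_square algebra_simps)
  also have "\<dots> = a * C" by (simp add: bm_int_add bm int_ev int_od int_evod C_def)
  finally show ?thesis .
qed

lemma rho_weighted:
  assumes F: "F \<subseteq> {1..k}" and g: "bounded_meas \<nu> g"
  shows "(\<integral>y. rho k u x y * (\<Prod>l\<in>F. g (y l)) \<partial>pw {1..k}) = (\<Prod>l\<in>F. \<integral>t. (1 + ev t + u * x l * od t) * g t \<partial>\<nu>)"
proof -
  define f where "f j t = (1 + ev t + u * x j * od t) * (if j \<in> F then g t else 1)" for j t
  have i: "{1..k} \<inter> F = F" using F by auto
  have "rho k u x y * (\<Prod>l\<in>F. g (y l)) = (\<Prod>j\<in>{1..k}. f j (y j))" for y
  proof -
    have "(\<Prod>l\<in>F. g (y l)) = (\<Prod>j\<in>{1..k}. if j \<in> F then g (y j) else 1)"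
      by (subst prod.inter_restrict[symmetric]) (auto simp: i)
    then show ?thesis by (simp add: rho_def f_def prod.distrib)
  qed
  moreover have "(\<integral>y. (\<Prod>j\<in>{1..k}. f j (y j)) \<partial>pw {1..k}) = (\<Prod>j\<in>{1..k}. \<integral>t. f j t \<partial>\<nu>)"
  proof (rule pw_prod)
    show "bounded_meas \<nu> (f j)" for j
      using g unfolding f_def[abs_def] by (cases "j \<in> F") (auto intro!: bm)
  qed simp
  moreover have "(\<integral>t. f j t \<partial>\<nu>) = (if j \<in> F then \<integral>t. (1 + ev t + u * x j * od t) * g t \<partial>\<nu> else 1)" for j
    by (simp add: f_def edge_int1)
  moreover have "(\<Prod>j\<in>{1..k}. if j \<in> F then \<integral>t. (1 + ev t + u * x j * od t) * g t \<partial>\<nu> else 1) =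
      (\<Prod>l\<in>F. \<integral>t. (1 + ev t + u * x l * od t) * g t \<partial>\<nu>)"
    by (subst prod.inter_restrict[symmetric]) (auto simp: i)
  ultimately show ?thesis by simp
qed

lemma rho_int: "(\<integral>y. rho k u x y \<partial>pw {1..k}) = 1"
  using rho_weighted[of "{}" k "\<lambda>_. 1" u x] by (simp add: bm)

lemma rho_ev: "l \<in> {1..k} \<Longrightarrow> (\<integral>y. rho k u x y * ev (y l) \<partial>pw {1..k}) = A"
  using rho_weighted[of "{l}" k ev u x] by (simp add: bm edge_int_ev)

lemma rho_od: "l \<in> {1..k} \<Longrightarrow> (\<integral>y. rho k u x y * od (y l) \<partial>pw {1..k}) = u * x l * C"
  using rho_weighted[of "{l}" k od u x] by (simp add: bm edge_int_od)

lemma rho_odod: "i \<in> {1..k} \<Longrightarrow> l \<in> {1..k} \<Longrightarrow> i \<noteq> l \<Longrightarrow>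
   (\<integral>y. rho k u x y * (od (y i) * od (y l)) \<partial>pw {1..k}) = u\<^sup>2 * (x i * x l) * C\<^sup>2"
  using rho_weighted[of "{i, l}" k od u x] by (simp add: bm edge_int_od) (simp add: power2_eq_square mult_ac)

definition overlap :: "nat \<Rightarrow> (nat \<Rightarrow> real) \<Rightarrow> (nat \<Rightarrow> real) \<Rightarrow> real" where
  "overlap k x x' = (\<Sum>j\<in>{1..k}. x j * x' j)"

lemma overlap_le:
  assumes "\<And>j. j \<in> {1..k} \<Longrightarrow> x j \<in> {1, - 1}" "\<And>j. j \<in> {1..k} \<Longrightarrow> x' j \<in> {1, - 1}"
  shows "\<bar>overlap k x x'\<bar> \<le> real k"
proof -
  have "\<bar>overlap k x x'\<bar> \<le> (\<Sum>j\<in>{1..k}. 1)"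
    unfolding overlap_def by (intro order_trans[OF sum_abs] sum_mono) (use assms in \<open>fastforce simp: abs_mult\<close>)
  then show ?thesis by simp
qed

text \<open>Averaging over the row makes two replicas interact, through their overlap alone.\<close>

lemma rho_pair:
  assumes x: "\<And>j. j \<in> {1..k} \<Longrightarrow> x j \<in> {1, - 1}" "\<And>j. j \<in> {1..k} \<Longrightarrow> x' j \<in> {1, - 1}"
    and u: "u \<in> {1, - 1}" "u' \<in> {1, - 1}"
  shows "(\<integral>y. rho k u x y * rho k u' x' y \<partial>pw {1..k}) =
    exp (k * pair_c0 A C) * exp (u * u' * (pair_theta A C * overlap k x x'))"
proof -
  have "(\<integral>y. rho k u x y * rho k u' x' y \<partial>pw {1..k}) =
     (\<integral>y. (\<Prod>j\<in>{1..k}. (1 + ev (y j) + u * x j * od (y j)) * (1 + ev (y j) + u' * x' j * od (y j))) \<partial>pw {1..k})"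
    by (simp add: rho_def prod.distrib)
  also have "\<dots> = (\<Prod>j\<in>{1..k}. \<integral>t. (1 + ev t + u * x j * od t) * (1 + ev t + u' * x' j * od t) \<partial>\<nu>)"
    by (rule pw_prod) (auto intro!: bm)
  also have "\<dots> = (\<Prod>j\<in>{1..k}. exp (pair_c0 A C + u * u' * (x j * x' j) * pair_theta A C))"
  proof (rule prod.cong[OF refl])
    fix j assume j: "j \<in> {1..k}"
    have "u * u' * (x j * x' j) \<in> {1, - 1}" using x(1)[OF j] x(2)[OF j] u by auto
    from pair_factor[OF A_bounds(1) C_bounds(1,3) this]
    show "(\<integral>t. (1 + ev t + u * x j * od t) * (1 + ev t + u' * x' j * od t) \<partial>\<nu>) = exp (pair_c0 A C + u * u' * (x j * x' j) * pair_theta A C)"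
      unfolding edge_int2 by (simp add: mult_ac)
  qed
  also have "\<dots> = exp (\<Sum>j\<in>{1..k}. pair_c0 A C + u * u' * (x j * x' j) * pair_theta A C)"
    by (simp add: exp_sum)
  also have "(\<Sum>j\<in>{1..k}. pair_c0 A C + u * u' * (x j * x' j) * pair_theta A C) = k * pair_c0 A C + u * u' * (pair_theta A C * overlap k x x')"
    by (simp add: sum.distrib overlap_def sum_distrib_left mult_ac)
  finally show ?thesis by (simp add: exp_add)
qed

end

text \<open>The state before a row is added: \<open>W\<close> is the set of spin vectors and \<open>w\<close> gives their contributions to the
  likelihood ratio \<open>L\<close>, which depend on the earlier rows only.\<close>

locale row_step = edge_law +
  fixes k :: nat and W :: "(nat \<Rightarrow> real) set" and w :: "(nat \<Rightarrow> real) \<Rightarrow> real" and B :: real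
  assumes finW: "finite W" and spins: "\<And>x j. x \<in> W \<Longrightarrow> j \<in> {1..k} \<Longrightarrow> x j \<in> {1, - 1}"
    and w_nonneg: "\<And>x. x \<in> W \<Longrightarrow> 0 \<le> w x" and w_total: "0 < (\<Sum>x\<in>W. w x)"
    and kcB: "real k * c \<le> B"
begin

text \<open>The average over the new spin turns the row factor into its \<open>cosh_part\<close>, so that \<open>L1\<close> is the likelihood ratio
  after the step; \<open>g i\<close> is the new correlation of the index \<open>i\<close> with the added index, and \<open>m\<close> is
  the matrix of the old correlations. \<open>Lam2\<close> and \<open>Lam4\<close> are moments of the overlap of two replicas.
  All errors of a step are measured by \<open>energy\<close>, in which the three terms have the same order because the
  overlap is typically of order \<open>1 / sqrt c\<close>.\<close>

definition L where "L = (\<Sum>x\<in>W. w x)"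
definition cosh_part where "cosh_part x y = (rho k 1 x y + rho k (- 1) x y) / 2"
definition sinh_part where "sinh_part x y = (rho k 1 x y - rho k (- 1) x y) / 2"
definition L1 where "L1 y = (\<Sum>x\<in>W. w x * cosh_part x y)"
definition g where "g i y = (\<Sum>x\<in>W. w x * x i * sinh_part x y)"
definition m where "m i j = (\<Sum>x\<in>W. w x * (x i * x j))"
definition Lam2 where "Lam2 = (\<Sum>i\<in>{1..k}. \<Sum>j\<in>{1..k}. (m i j)\<^sup>2)"
definition Lam4 where "Lam4 = (\<Sum>x\<in>W. \<Sum>x'\<in>W. w x * w x' * overlap k x x' ^ 4)"
definition energy where "energy = L\<^sup>2 + c * Lam2 + c\<^sup>2 * Lam4"

sublocale R: bm_prob "pw {1..k}" by (rule bm_prob_pw)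

lemma L_pos: "L > 0" using w_total by (simp add: L_def)

lemma B_nonneg: "0 \<le> B"
  using kcB c_pos mult_nonneg_nonneg[of "real k" c] by linarith

lemma bm_parts [bm]: "bounded_meas (pw {1..k}) (cosh_part x)" "bounded_meas (pw {1..k}) (sinh_part x)"
  unfolding cosh_part_def[abs_def] sinh_part_def[abs_def] by (intro bm)+

lemma bm_L1 [bm]: "bounded_meas (pw {1..k}) L1" and bm_g [bm]: "bounded_meas (pw {1..k}) (g i)"
  unfolding L1_def[abs_def] g_def[abs_def] by (intro bm)+

lemma rho_pos: "x \<in> W \<Longrightarrow> u \<in> {1, - 1} \<Longrightarrow> 0 < rho k u x y"
  unfolding rho_def by (intro prod_pos ballI edge_pos) (use spins in fastforce)

lemma L1_pos: "L1 y > 0"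
proof -
  have p: "cosh_part x y > 0" if "x \<in> W" for x
    unfolding cosh_part_def using rho_pos[OF that] by (simp add: add_pos_pos)
  have "\<exists>x\<in>W. w x > 0"
  proof (rule ccontr)
    assume "\<not> ?thesis"
    then have "(\<Sum>x\<in>W. w x) \<le> 0" by (intro sum_nonpos) force
    then show False using w_total by simp
  qed
  then obtain x where "x \<in> W" "w x > 0" by blast
  then show ?thesis unfolding L1_def using finW p w_nonneg
    by (intro sum_pos2[of _ x]) (auto simp: less_imp_le)
qed

lemma pair_sum:
  "(\<Sum>x\<in>W. w x * f x) * (\<Sum>x\<in>W. w x * f' x) = (\<Sum>x\<in>W. \<Sum>x'\<in>W. w x * w x' * (f x * f' x'))"
  by (simp add: sum_product mult_ac)

lemma L_sq: "L\<^sup>2 = (\<Sum>x\<in>W. \<Sum>x'\<in>W. w x * w x')"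
  using pair_sum[of "\<lambda>_. 1" "\<lambda>_. 1"] by (simp add: L_def power2_eq_square)

lemma Lam2_eq: "Lam2 = (\<Sum>x\<in>W. \<Sum>x'\<in>W. w x * w x' * (overlap k x x')\<^sup>2)"
proof -
  have "(m i j)\<^sup>2 = (\<Sum>x\<in>W. \<Sum>x'\<in>W. w x * w x' * ((x i * x' i) * (x j * x' j)))" for i j
    unfolding power2_eq_square m_def pair_sum by (simp add: mult_ac)
  then have "Lam2 = (\<Sum>i\<in>{1..k}. \<Sum>j\<in>{1..k}. \<Sum>x\<in>W. \<Sum>x'\<in>W. w x * w x' * ((x i * x' i) * (x j * x' j)))"
    by (simp add: Lam2_def)
  also have "\<dots> = (\<Sum>i\<in>{1..k}. \<Sum>x\<in>W. \<Sum>j\<in>{1..k}. \<Sum>x'\<in>W. w x * w x' * ((x i * x' i) * (x j * x' j)))"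
    by (intro sum.cong refl sum.swap)
  also have "\<dots> = (\<Sum>x\<in>W. \<Sum>i\<in>{1..k}. \<Sum>j\<in>{1..k}. \<Sum>x'\<in>W. w x * w x' * ((x i * x' i) * (x j * x' j)))"
    by (rule sum.swap)
  also have "\<dots> = (\<Sum>x\<in>W. \<Sum>i\<in>{1..k}. \<Sum>x'\<in>W. \<Sum>j\<in>{1..k}. w x * w x' * ((x i * x' i) * (x j * x' j)))"
    by (intro sum.cong refl sum.swap)
  also have "\<dots> = (\<Sum>x\<in>W. \<Sum>x'\<in>W. \<Sum>i\<in>{1..k}. \<Sum>j\<in>{1..k}. w x * w x' * ((x i * x' i) * (x j * x' j)))"
    by (intro sum.cong refl sum.swap)
  also have "\<dots> = (\<Sum>x\<in>W. \<Sum>x'\<in>W. w x * w x' * (overlap k x x')\<^sup>2)"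
    unfolding overlap_def power2_eq_square sum_product by (simp only: sum_distrib_left)
  finally show ?thesis .
qed

lemma sum_pair_mono:
  assumes "\<And>x x'. x \<in> W \<Longrightarrow> x' \<in> W \<Longrightarrow> f x x' \<le> h x x'"
  shows "(\<Sum>x\<in>W. \<Sum>x'\<in>W. w x * w x' * f x x') \<le> (\<Sum>x\<in>W. \<Sum>x'\<in>W. w x * w x' * h x x')"
  using assms w_nonneg by (intro sum_mono mult_left_mono) auto

lemma sum_pair_abs:
  assumes "\<And>x x'. x \<in> W \<Longrightarrow> x' \<in> W \<Longrightarrow> \<bar>f x x'\<bar> \<le> h x x'"
  shows "\<bar>\<Sum>x\<in>W. \<Sum>x'\<in>W. w x * w x' * f x x'\<bar> \<le> (\<Sum>x\<in>W. \<Sum>x'\<in>W. w x * w x' * h x x')"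
proof -
  have "(\<Sum>x\<in>W. \<Sum>x'\<in>W. w x * w x' * f x x') \<le> (\<Sum>x\<in>W. \<Sum>x'\<in>W. w x * w x' * h x x')"
    by (rule sum_pair_mono) (use assms in fastforce)
  moreover have "(\<Sum>x\<in>W. \<Sum>x'\<in>W. w x * w x' * (- f x x')) \<le> (\<Sum>x\<in>W. \<Sum>x'\<in>W. w x * w x' * h x x')"
    by (rule sum_pair_mono) (use assms in fastforce)
  ultimately show ?thesis by (simp add: sum_negf)
qed

lemma Lam2_nonneg: "0 \<le> Lam2" and Lam4_nonneg: "0 \<le> Lam4"
  unfolding Lam2_def Lam4_def by (intro sum_nonneg mult_nonneg_nonneg w_nonneg; simp)+

text \<open>Jensen's inequality for the overlap.\<close>

lemma Lam2_sq_le: "Lam2\<^sup>2 \<le> L\<^sup>2 * Lam4"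
proof -
  define t where "t = Lam2 / L\<^sup>2"
  have "0 \<le> (\<Sum>x\<in>W. \<Sum>x'\<in>W. w x * w x' * ((overlap k x x')\<^sup>2 - t)\<^sup>2)"
    by (intro sum_nonneg mult_nonneg_nonneg w_nonneg) auto
  also have "\<dots> = (\<Sum>x\<in>W. \<Sum>x'\<in>W. w x * w x' * overlap k x x' ^ 4 + ((- 2 * t) * (w x * w x' * (overlap k x x')\<^sup>2) + t\<^sup>2 * (w x * w x')))"
    by (intro sum.cong refl) (simp add: power2_eq_square power4_eq_xxxx algebra_simps)
  also have "\<dots> = Lam4 + ((- 2 * t) * Lam2 + t\<^sup>2 * L\<^sup>2)"
    by (simp only: sum.distrib sum_distrib_left[symmetric] Lam4_def Lam2_eq L_sq)
  also have "\<dots> = Lam4 - Lam2\<^sup>2 / L\<^sup>2"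
    using L_pos by (simp add: t_def power2_eq_square)
  finally show ?thesis using L_pos by (simp add: field_simps)
qed

lemma energy_ge: "L\<^sup>2 \<le> energy" "c * Lam2 \<le> energy" "c\<^sup>2 * Lam4 \<le> energy" "0 \<le> energy"
  using Lam2_nonneg Lam4_nonneg c_pos by (auto simp: energy_def)

lemma parts_int: "(\<integral>y. cosh_part x y \<partial>pw {1..k}) = 1" "(\<integral>y. sinh_part x y \<partial>pw {1..k}) = 0"
  unfolding cosh_part_def sinh_part_def by (simp_all add: R.bm_int_add R.bm_int_diff bm rho_int)

lemma parts_pair:
  assumes "x \<in> W" "x' \<in> W"
  shows "(\<integral>y. cosh_part x y * cosh_part x' y \<partial>pw {1..k}) = exp (k * pair_c0 A C) * cosh (pair_theta A C * overlap k x x')"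
    and "(\<integral>y. sinh_part x y * sinh_part x' y \<partial>pw {1..k}) = exp (k * pair_c0 A C) * sinh (pair_theta A C * overlap k x x')"
proof -
  have p: "(\<integral>y. rho k u x y * rho k u' x' y \<partial>pw {1..k}) =
    exp (k * pair_c0 A C) * exp (u * u' * (pair_theta A C * overlap k x x'))" if "u \<in> {1, - 1}" "u' \<in> {1, - 1}" for u u'
    by (rule rho_pair) (use spins assms that in auto)
  have "(\<integral>y. cosh_part x y * cosh_part x' y \<partial>pw {1..k}) = (\<integral>y. (rho k 1 x y * rho k 1 x' y + (rho k 1 x y * rho k (-1) x' y + (rho k (-1) x y * rho k 1 x' y + rho k (-1) x y * rho k (-1) x' y))) / 4 \<partial>pw {1..k})"
    by (intro lint_cong refl) (simp add: cosh_part_def field_simps)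
  also have "\<dots> = exp (k * pair_c0 A C) * cosh (pair_theta A C * overlap k x x')"
    by (simp add: R.bm_int_add bm p) (simp add: cosh_field_def field_simps)
  finally show "(\<integral>y. cosh_part x y * cosh_part x' y \<partial>pw {1..k}) = exp (k * pair_c0 A C) * cosh (pair_theta A C * overlap k x x')" .
  have "(\<integral>y. sinh_part x y * sinh_part x' y \<partial>pw {1..k}) = (\<integral>y. ((rho k 1 x y * rho k 1 x' y + rho k (-1) x y * rho k (-1) x' y) - (rho k 1 x y * rho k (-1) x' y + rho k (-1) x y * rho k 1 x' y)) / 4 \<partial>pw {1..k})"
    by (intro lint_cong refl) (simp add: sinh_part_def field_simps)
  also have "\<dots> = exp (k * pair_c0 A C) * sinh (pair_theta A C * overlap k x x')"
    by (simp add: R.bm_int_add R.bm_int_diff bm p) (simp add: sinh_field_def field_simps)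
  finally show "(\<integral>y. sinh_part x y * sinh_part x' y \<partial>pw {1..k}) = exp (k * pair_c0 A C) * sinh (pair_theta A C * overlap k x x')" .
qed

lemma int_L1: "(\<integral>y. L1 y \<partial>pw {1..k}) = L"
  unfolding L1_def L_def by (simp add: R.bm_int_sum bm parts_int)

lemma int_L1_sq: "(\<integral>y. (L1 y)\<^sup>2 \<partial>pw {1..k}) =
   (\<Sum>x\<in>W. \<Sum>x'\<in>W. w x * w x' * (exp (k * pair_c0 A C) * cosh (pair_theta A C * overlap k x x')))"
proof -
  have "(\<integral>y. (L1 y)\<^sup>2 \<partial>pw {1..k}) = (\<integral>y. (\<Sum>x\<in>W. \<Sum>x'\<in>W. w x * w x' * (cosh_part x y * cosh_part x' y)) \<partial>pw {1..k})"
    unfolding L1_def power2_eq_square pair_sum ..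
  also have "\<dots> = (\<Sum>x\<in>W. \<Sum>x'\<in>W. w x * w x' * (\<integral>y. cosh_part x y * cosh_part x' y \<partial>pw {1..k}))"
    by (simp add: R.bm_int_sum bm)
  finally show ?thesis by (simp add: parts_pair)
qed

lemma int_g_sq: "(\<integral>y. (\<Sum>i\<in>{1..k}. (g i y)\<^sup>2) \<partial>pw {1..k}) =
   (\<Sum>x\<in>W. \<Sum>x'\<in>W. w x * w x' * (overlap k x x' * (exp (k * pair_c0 A C) * sinh (pair_theta A C * overlap k x x'))))"
proof -
  have "(\<integral>y. (g i y)\<^sup>2 \<partial>pw {1..k}) = (\<Sum>x\<in>W. \<Sum>x'\<in>W. w x * w x' * (x i * x' i * (exp (k * pair_c0 A C) * sinh (pair_theta A C * overlap k x x'))))" for i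
  proof -
    have "(g i y)\<^sup>2 = (\<Sum>x\<in>W. \<Sum>x'\<in>W. w x * w x' * (x i * x' i * (sinh_part x y * sinh_part x' y)))" for y
      unfolding g_def power2_eq_square using pair_sum[of "\<lambda>x. x i * sinh_part x y" "\<lambda>x. x i * sinh_part x y"]
      by (simp add: mult_ac)
    then have "(\<integral>y. (g i y)\<^sup>2 \<partial>pw {1..k}) = (\<Sum>x\<in>W. \<Sum>x'\<in>W. w x * w x' * (x i * x' i * (\<integral>y. sinh_part x y * sinh_part x' y \<partial>pw {1..k})))"
      by (simp add: R.bm_int_sum bm)
    then show ?thesis by (simp add: parts_pair)
  qed
  then have "(\<integral>y. (\<Sum>i\<in>{1..k}. (g i y)\<^sup>2) \<partial>pw {1..k}) = (\<Sum>i\<in>{1..k}. \<Sum>x\<in>W. \<Sum>x'\<in>W. w x * w x' * (x i * x' i * (exp (k * pair_c0 A C) * sinh (pair_theta A C * overlap k x x'))))"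
    by (simp add: R.bm_int_sum bm)
  also have "\<dots> = (\<Sum>x\<in>W. \<Sum>i\<in>{1..k}. \<Sum>x'\<in>W. w x * w x' * (x i * x' i * (exp (k * pair_c0 A C) * sinh (pair_theta A C * overlap k x x'))))"
    by (rule sum.swap)
  also have "\<dots> = (\<Sum>x\<in>W. \<Sum>x'\<in>W. \<Sum>i\<in>{1..k}. w x * w x' * (x i * x' i * (exp (k * pair_c0 A C) * sinh (pair_theta A C * overlap k x x'))))"
    by (intro sum.cong refl sum.swap)
  also have "\<dots> = (\<Sum>x\<in>W. \<Sum>x'\<in>W. w x * w x' * (overlap k x x' * (exp (k * pair_c0 A C) * sinh (pair_theta A C * overlap k x x'))))"
    by (simp add: overlap_def sum_distrib_left sum_distrib_right)
  finally show ?thesis .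
qed

lemma kch_nonneg: "0 \<le> kch B" and ksh_nonneg: "0 \<le> ksh B"
  using B_nonneg by (auto simp: kch_def ksh_def intro!: add_nonneg_nonneg mult_nonneg_nonneg)

definition row_var where "row_var = (k * A - k * C\<^sup>2 / 2) * L\<^sup>2 + C\<^sup>2 / 2 * Lam2"

text \<open>The second moment of the new likelihood ratio is a sum over pairs of replicas, to which the
  expansion in the overlap applies term by term.\<close>

lemma variance_expansion:
  "\<bar>(\<integral>y. (L1 y - L)\<^sup>2 \<partial>pw {1..k}) - row_var\<bar> \<le> kch B * (c\<^sup>2 * energy)"
proof -
  have "(\<integral>y. (L1 y - L)\<^sup>2 \<partial>pw {1..k}) = (\<integral>y. (L1 y)\<^sup>2 - (2 * L * L1 y - L\<^sup>2) \<partial>pw {1..k})"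
    by (intro lint_cong refl) (simp add: power2_eq_square algebra_simps)
  also have "\<dots> = (\<integral>y. (L1 y)\<^sup>2 \<partial>pw {1..k}) - L\<^sup>2"
    by (simp add: R.bm_int_diff bm int_L1 power2_eq_square)
  also have "\<dots> = (\<Sum>x\<in>W. \<Sum>x'\<in>W. w x * w x' * (exp (k * pair_c0 A C) * cosh (pair_theta A C * overlap k x x') - 1))"
    unfolding int_L1_sq L_sq by (simp add: right_diff_distrib sum_subtractf)
  finally have 1: "(\<integral>y. (L1 y - L)\<^sup>2 \<partial>pw {1..k}) = \<dots>" .
  have 2: "row_var = (\<Sum>x\<in>W. \<Sum>x'\<in>W. w x * w x' * ((k * A - k * C\<^sup>2 / 2) + C\<^sup>2 * (overlap k x x')\<^sup>2 / 2))"
  proof -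
    have "row_var = (\<Sum>x\<in>W. \<Sum>x'\<in>W. (k * A - k * C\<^sup>2 / 2) * (w x * w x')) + (\<Sum>x\<in>W. \<Sum>x'\<in>W. C\<^sup>2 / 2 * (w x * w x' * (overlap k x x')\<^sup>2))"
      unfolding row_var_def L_sq Lam2_eq by (simp only: sum_distrib_left)
    then show ?thesis unfolding sum.distrib[symmetric] by (simp add: algebra_simps)
  qed
  have eq: "(\<integral>y. (L1 y - L)\<^sup>2 \<partial>pw {1..k}) - row_var = (\<Sum>x\<in>W. \<Sum>x'\<in>W. w x * w x' *
      (exp (k * pair_c0 A C) * cosh (pair_theta A C * overlap k x x') - 1 - (k * A - k * C\<^sup>2 / 2) - C\<^sup>2 * (overlap k x x')\<^sup>2 / 2))"
    unfolding 1 2 sum_subtractf[symmetric] by (intro sum.cong refl) (simp add: algebra_simps)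
  have "\<bar>(\<integral>y. (L1 y - L)\<^sup>2 \<partial>pw {1..k}) - row_var\<bar> \<le> (\<Sum>x\<in>W. \<Sum>x'\<in>W. w x * w x' * (kch B * (c\<^sup>2 + c ^ 4 * overlap k x x' ^ 4)))"
    unfolding eq kch_def
    by (intro sum_pair_abs pair_expansion(1) A_bounds C_bounds c_le kcB overlap_le spins)
  also have "\<dots> = kch B * (c\<^sup>2 * L\<^sup>2 + c ^ 4 * Lam4)"
    unfolding L_sq Lam4_def by (simp add: sum_distrib_left sum.distrib[symmetric] algebra_simps)
  also have "\<dots> \<le> kch B * (c\<^sup>2 * energy)"
  proof (rule mult_left_mono[OF _ kch_nonneg])
    have "0 \<le> c\<^sup>2 * (c * Lam2)" using c_pos Lam2_nonneg by simp
    then show "c\<^sup>2 * L\<^sup>2 + c ^ 4 * Lam4 \<le> c\<^sup>2 * energy"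
      by (simp add: energy_def algebra_simps power2_eq_square power4_eq_xxxx)
  qed
  finally show ?thesis .
qed

lemma field_expansion:
  "\<bar>(\<integral>y. (\<Sum>i\<in>{1..k}. (g i y)\<^sup>2) \<partial>pw {1..k}) - C * Lam2\<bar> \<le> ksh B * (c * energy)"
proof -
  have eq: "(\<integral>y. (\<Sum>i\<in>{1..k}. (g i y)\<^sup>2) \<partial>pw {1..k}) - C * Lam2 = (\<Sum>x\<in>W. \<Sum>x'\<in>W. w x * w x' *
      (overlap k x x' * (exp (k * pair_c0 A C) * sinh (pair_theta A C * overlap k x x')) - C * (overlap k x x')\<^sup>2))"
    unfolding int_g_sq Lam2_eq by (simp add: sum_distrib_left sum_subtractf[symmetric] algebra_simps)
  have "\<bar>(\<integral>y. (\<Sum>i\<in>{1..k}. (g i y)\<^sup>2) \<partial>pw {1..k}) - C * Lam2\<bar> \<le> (\<Sum>x\<in>W. \<Sum>x'\<in>W. w x * w x' * (ksh B * (c\<^sup>2 * (overlap k x x')\<^sup>2 + c ^ 3 * overlap k x x' ^ 4)))"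
    unfolding eq ksh_def
    by (intro sum_pair_abs pair_expansion(2) A_bounds C_bounds c_le kcB overlap_le spins)
  also have "\<dots> = ksh B * (c\<^sup>2 * Lam2 + c ^ 3 * Lam4)"
    unfolding Lam2_eq Lam4_def by (simp add: sum_distrib_left sum.distrib[symmetric] algebra_simps)
  also have "\<dots> \<le> ksh B * (c * energy)"
  proof (rule mult_left_mono[OF _ ksh_nonneg])
    have "0 \<le> c * L\<^sup>2" using c_pos by simp
    then show "c\<^sup>2 * Lam2 + c ^ 3 * Lam4 \<le> c * energy"
      by (simp add: energy_def algebra_simps power2_eq_square power3_eq_cube)
  qed
  finally show ?thesis .
qed

text \<open>At most one of the two factors \<open>od\<close> shares its variable with \<open>\<phi>\<close>; the other one integrates to zero.\<close>

lemma odod_orth: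
  assumes \<phi>: "bounded_meas \<nu> \<phi>" and "l \<in> {1..k}" "i \<in> {1..k}" "j \<in> {1..k}" "i \<noteq> j"
  shows "(\<integral>y. \<phi> (y l) * (od (y i) * od (y j)) \<partial>pw {1..k}) = 0"
proof -
  define f where "f q t = (if q = l then \<phi> t else 1) * (if q \<in> {i, j} then od t else 1)" for q t
  have i: "{1..k} \<inter> {i, j} = {i, j}" using assms by auto
  have "\<phi> (y l) * (od (y i) * od (y j)) = (\<Prod>q\<in>{1..k}. f q (y q))" for y
  proof -
    have "(\<Prod>q\<in>{1..k}. if q \<in> {i, j} then od (y q) else 1) = (\<Prod>q\<in>{i, j}. od (y q))"
      by (subst prod.inter_restrict[symmetric]) (simp_all only: i finite_atLeastAtMost)
    then show ?thesis using assms by (simp add: f_def prod.distrib prod.delta)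
  qed
  moreover have "(\<integral>y. (\<Prod>q\<in>{1..k}. f q (y q)) \<partial>pw {1..k}) = (\<Prod>q\<in>{1..k}. \<integral>t. f q t \<partial>\<nu>)"
  proof (rule pw_prod)
    show "bounded_meas \<nu> (f q)" for q
      unfolding f_def[abs_def] using \<phi> by (cases "q = l"; cases "q \<in> {i, j}") (auto intro!: bm)
  qed simp
  moreover have "(\<Prod>q\<in>{1..k}. \<integral>t. f q t \<partial>\<nu>) = 0"
  proof (rule prod_zero)
    have "(if i = l then j else i) \<in> {1..k}" "(\<integral>t. f (if i = l then j else i) t \<partial>\<nu>) = 0"
      using assms int_od by (auto simp: f_def)
    then show "\<exists>q\<in>{1..k}. (\<integral>t. f q t \<partial>\<nu>) = 0" by blast
  qed simp
  ultimately show ?thesis by simp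
qed

text \<open>The leading part of the increment \<open>L1 - L\<close>: its second moment captures that of the whole
  increment, and, being a polynomial of degree two in the new row, it has a fourth moment of the order of the
  square of its second moment. The fourth moment of the full increment would involve the overlaps of four
  replicas.\<close>

definition D1 where "D1 y = L * (\<Sum>j\<in>{1..k}. ev (y j)) + lower_form m od k y"

definition s2 where "s2 = (\<Sum>j\<in>{1..k}. \<Sum>i\<in>{1..<j}. (m i j)\<^sup>2)"

lemma m_diag: "i \<in> {1..k} \<Longrightarrow> m i i = L"
  unfolding m_def L_def by (intro sum.cong refl) (use spins in fastforce)

lemma m_sym: "m i j = m j i"
  unfolding m_def by (simp add: mult.commute)

lemma Lam2_s2: "Lam2 = 2 * s2 + k * L\<^sup>2"
proof -
  have "(\<Sum>i\<in>{1..n}. \<Sum>j\<in>{1..n}. f i j) = 2 * (\<Sum>j\<in>{1..n}. \<Sum>i\<in>{1..<j}. f i j) + (\<Sum>i\<in>{1..n}. f i i)"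
    if "\<And>i j. f i j = f j i" for f :: "nat \<Rightarrow> nat \<Rightarrow> real" and n
  proof (induction n)
    case (Suc n)
    have "(\<Sum>i\<in>{1..Suc n}. \<Sum>j\<in>{1..Suc n}. f i j) = (\<Sum>i\<in>{1..n}. \<Sum>j\<in>{1..n}. f i j) + 2 * (\<Sum>i\<in>{1..n}. f i (Suc n)) + f (Suc n) (Suc n)"
    proof -
      have "(\<Sum>j\<in>{1..n}. f (Suc n) j) = (\<Sum>j\<in>{1..n}. f j (Suc n))" by (intro sum.cong refl that)
      then show ?thesis by (simp add: sum.distrib)
    qed
    then show ?case using Suc by (simp add: atLeastLessThanSuc_atLeastAtMost)
  qed simp
  note gen = this
  have "Lam2 = 2 * s2 + (\<Sum>i\<in>{1..k}. (m i i)\<^sup>2)"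
    unfolding Lam2_def s2_def by (rule gen) (subst m_sym, rule refl)
  then show ?thesis by (simp add: m_diag)
qed

lemma s2_bounds: "0 \<le> s2" "s2 \<le> Lam2 / 2"
  using L_pos unfolding Lam2_s2 by (auto simp: s2_def intro!: sum_nonneg)

lemma bm_D1 [bm]: "bounded_meas (pw {1..k}) D1"
  unfolding D1_def[abs_def] by (intro bm)

lemma ev_sum_moments:
  "(\<integral>y. (\<Sum>j\<in>{1..k}. ev (y j)) \<partial>pw {1..k}) = 0"
  "(\<integral>y. (\<Sum>j\<in>{1..k}. ev (y j))\<^sup>2 \<partial>pw {1..k}) = k * A"
  "(\<integral>y. (\<Sum>j\<in>{1..k}. ev (y j)) ^ 4 \<partial>pw {1..k}) \<le> 4 * B\<^sup>2 * c\<^sup>2"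
proof -
  note M = pw_linear_moments[OF bm_ev int_ev, of "{1..k}" "\<lambda>_. 1", simplified]
  show "(\<integral>y. (\<Sum>j\<in>{1..k}. ev (y j)) \<partial>pw {1..k}) = 0" using M(1) .
  show "(\<integral>y. (\<Sum>j\<in>{1..k}. ev (y j))\<^sup>2 \<partial>pw {1..k}) = k * A" using M(2) by (simp add: A_def)
  have "(\<integral>y. (\<Sum>j\<in>{1..k}. ev (y j)) ^ 4 \<partial>pw {1..k}) \<le> (3 * A\<^sup>2 + (\<integral>t. ev t ^ 4 \<partial>\<nu>)) * (real k)\<^sup>2"
    using M(3) by (simp add: A_def)
  also have "\<dots> \<le> (4 * c ^ 4) * (real k)\<^sup>2"
    using ev4_le power_mono[OF A_bounds(2,1), of 2] by (intro mult_right_mono) auto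
  also have "\<dots> = 4 * (real k * c)\<^sup>2 * c\<^sup>2"
    by (simp add: power2_eq_square power4_eq_xxxx)
  also have "\<dots> \<le> 4 * B\<^sup>2 * c\<^sup>2"
    using kcB c_pos by (intro mult_right_mono mult_left_mono power_mono) auto
  finally show "(\<integral>y. (\<Sum>j\<in>{1..k}. ev (y j)) ^ 4 \<partial>pw {1..k}) \<le> 4 * B\<^sup>2 * c\<^sup>2" .
qed

lemmas low_moments = pw_quadratic_moments[OF bm_od int_od int_od3 od2_le od4_le, where m = m and n = k, folded s2_def C_def]

lemma int_weighted_low:
  assumes "bounded_meas (pw {1..k}) f"
    and "\<And>i j. i \<in> {1..k} \<Longrightarrow> j \<in> {1..k} \<Longrightarrow> i \<noteq> j \<Longrightarrow> (\<integral>y. f y * (od (y i) * od (y j)) \<partial>pw {1..k}) = a i j"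
  shows "(\<integral>y. f y * lower_form m od k y \<partial>pw {1..k}) = (\<Sum>j\<in>{1..k}. \<Sum>i\<in>{1..<j}. m i j * a i j)"
proof -
  have "f y * lower_form m od k y = (\<Sum>j\<in>{1..k}. \<Sum>i\<in>{1..<j}. m i j * (f y * (od (y i) * od (y j))))" for y
    unfolding lower_form_def by (simp add: sum_distrib_left sum_distrib_right mult_ac)
  moreover have "(\<integral>y. (\<Sum>j\<in>{1..k}. \<Sum>i\<in>{1..<j}. m i j * (f y * (od (y i) * od (y j)))) \<partial>pw {1..k}) =
     (\<Sum>j\<in>{1..k}. (\<integral>y. (\<Sum>i\<in>{1..<j}. m i j * (f y * (od (y i) * od (y j)))) \<partial>pw {1..k}))"
    using assms(1) by (intro R.bm_int_sum bm) auto
  moreover have "\<dots> = (\<Sum>j\<in>{1..k}. \<Sum>i\<in>{1..<j}. (\<integral>y. m i j * (f y * (od (y i) * od (y j))) \<partial>pw {1..k}))"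
    using assms(1) by (intro sum.cong refl R.bm_int_sum bm) auto
  ultimately show ?thesis using assms(2) by simp
qed

lemma int_low: "(\<integral>y. lower_form m od k y \<partial>pw {1..k}) = 0"
proof -
  have "(\<integral>y. 1 * lower_form m od k y \<partial>pw {1..k}) = (\<Sum>j\<in>{1..k}. \<Sum>i\<in>{1..<j}. m i j * 0)"
    by (rule int_weighted_low[OF bm_const]) (use odod_orth[OF bm_const[of _ 1]] in simp)
  then show ?thesis by simp
qed

lemma int_ev_low: "(\<integral>y. (\<Sum>j\<in>{1..k}. ev (y j)) * lower_form m od k y \<partial>pw {1..k}) = 0"
proof -
  have "(\<integral>y. ev (y l) * lower_form m od k y \<partial>pw {1..k}) = 0" if l: "l \<in> {1..k}" for l
  proof -
    have "(\<integral>y. ev (y l) * lower_form m od k y \<partial>pw {1..k}) = (\<Sum>j\<in>{1..k}. \<Sum>i\<in>{1..<j}. m i j * 0)"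
      by (rule int_weighted_low[OF bm_ev'[OF l]]) (rule odod_orth[OF bm_ev l])
    then show ?thesis by simp
  qed
  then show ?thesis unfolding sum_distrib_right by (subst R.bm_int_sum) (auto intro!: bm)
qed

lemma int_D1: "(\<integral>y. D1 y \<partial>pw {1..k}) = 0"
  unfolding D1_def by (subst R.bm_int_add) (auto intro!: bm simp: int_low ev_sum_moments)

lemma row_var_eq: "row_var = L\<^sup>2 * (k * A) + C\<^sup>2 * s2"
  unfolding row_var_def Lam2_s2 by (simp add: algebra_simps)

lemma int_D1_sq: "(\<integral>y. (D1 y)\<^sup>2 \<partial>pw {1..k}) = row_var"
proof -
  have "(\<integral>y. (D1 y)\<^sup>2 \<partial>pw {1..k}) = (\<integral>y. L\<^sup>2 * (\<Sum>j\<in>{1..k}. ev (y j))\<^sup>2 +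
     (2 * L * ((\<Sum>j\<in>{1..k}. ev (y j)) * lower_form m od k y) + (lower_form m od k y)\<^sup>2) \<partial>pw {1..k})"
    unfolding D1_def by (intro lint_cong refl) (simp add: power2_eq_square algebra_simps)
  also have "\<dots> = L\<^sup>2 * (\<integral>y. (\<Sum>j\<in>{1..k}. ev (y j))\<^sup>2 \<partial>pw {1..k}) +
     (2 * L * (\<integral>y. (\<Sum>j\<in>{1..k}. ev (y j)) * lower_form m od k y \<partial>pw {1..k}) + (\<integral>y. (lower_form m od k y)\<^sup>2 \<partial>pw {1..k}))"
    by (subst R.bm_int_add, intro bm, assumption, intro bm, assumption, subst R.bm_int_add) (auto intro!: bm)
  also have "\<dots> = row_var"
    unfolding ev_sum_moments int_ev_low low_moments(1) row_var_eq by simp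
  finally show ?thesis .
qed

lemma int_L1_D1: "(\<integral>y. L1 y * D1 y \<partial>pw {1..k}) = row_var"
proof -
  have c: "(\<integral>y. cosh_part x y * ev (y l) \<partial>pw {1..k}) = A" if "l \<in> {1..k}" for x l
  proof -
    have "(\<integral>y. cosh_part x y * ev (y l) \<partial>pw {1..k}) = (\<integral>y. (rho k 1 x y * ev (y l) + rho k (- 1) x y * ev (y l)) / 2 \<partial>pw {1..k})"
      by (intro lint_cong refl) (simp add: cosh_part_def field_simps)
    then show ?thesis using that by (simp add: R.bm_int_add bm rho_ev)
  qed
  have c2: "(\<integral>y. cosh_part x y * (od (y i) * od (y j)) \<partial>pw {1..k}) = x i * x j * C\<^sup>2" if "i \<in> {1..k}" "j \<in> {1..k}" "i \<noteq> j" for x i j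
  proof -
    have "(\<integral>y. cosh_part x y * (od (y i) * od (y j)) \<partial>pw {1..k}) = (\<integral>y. (rho k 1 x y * (od (y i) * od (y j)) + rho k (- 1) x y * (od (y i) * od (y j))) / 2 \<partial>pw {1..k})"
      by (intro lint_cong refl) (simp add: cosh_part_def field_simps)
    then show ?thesis using that by (simp add: R.bm_int_add bm rho_odod)
  qed
  have Le: "(\<integral>y. L1 y * ev (y l) \<partial>pw {1..k}) = L * A" if l: "l \<in> {1..k}" for l
  proof -
    have "(\<integral>y. L1 y * ev (y l) \<partial>pw {1..k}) = (\<integral>y. (\<Sum>x\<in>W. w x * (cosh_part x y * ev (y l))) \<partial>pw {1..k})"
      by (intro lint_cong refl) (simp add: L1_def sum_distrib_left sum_distrib_right mult_ac)
    also have "\<dots> = (\<Sum>x\<in>W. w x * (\<integral>y. cosh_part x y * ev (y l) \<partial>pw {1..k}))"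
      using l by (simp add: R.bm_int_sum bm)
    finally show ?thesis using l by (simp add: c L_def sum_distrib_right)
  qed
  have Lo: "(\<integral>y. L1 y * (od (y i) * od (y j)) \<partial>pw {1..k}) = m i j * C\<^sup>2" if l: "i \<in> {1..k}" "j \<in> {1..k}" "i \<noteq> j" for i j
  proof -
    have "(\<integral>y. L1 y * (od (y i) * od (y j)) \<partial>pw {1..k}) = (\<integral>y. (\<Sum>x\<in>W. w x * (cosh_part x y * (od (y i) * od (y j)))) \<partial>pw {1..k})"
      by (intro lint_cong refl) (simp add: L1_def sum_distrib_left sum_distrib_right mult_ac)
    also have "\<dots> = (\<Sum>x\<in>W. w x * (\<integral>y. cosh_part x y * (od (y i) * od (y j)) \<partial>pw {1..k}))"
      using l by (simp add: R.bm_int_sum bm)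
    finally show ?thesis using l by (simp add: c2) (simp add: m_def sum_distrib_left sum_distrib_right mult_ac)
  qed
  have "(\<integral>y. L1 y * D1 y \<partial>pw {1..k}) = (\<integral>y. L * (\<Sum>j\<in>{1..k}. L1 y * ev (y j)) + L1 y * lower_form m od k y \<partial>pw {1..k})"
    unfolding D1_def by (intro lint_cong refl) (simp add: algebra_simps sum_distrib_left)
  also have "\<dots> = L * (\<integral>y. (\<Sum>j\<in>{1..k}. L1 y * ev (y j)) \<partial>pw {1..k}) + (\<integral>y. L1 y * lower_form m od k y \<partial>pw {1..k})"
    by (subst R.bm_int_add) (auto intro!: bm)
  also have "(\<integral>y. (\<Sum>j\<in>{1..k}. L1 y * ev (y j)) \<partial>pw {1..k}) = k * (L * A)"
    by (subst R.bm_int_sum) (auto intro!: bm simp: Le)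
  also have "(\<integral>y. L1 y * lower_form m od k y \<partial>pw {1..k}) = (\<Sum>j\<in>{1..k}. \<Sum>i\<in>{1..<j}. m i j * (m i j * C\<^sup>2))"
    by (rule int_weighted_low[OF bm_L1 Lo])
  also have "\<dots> = C\<^sup>2 * s2"
    by (simp add: s2_def sum_distrib_left power2_eq_square mult_ac)
  finally show ?thesis unfolding row_var_eq by (simp add: power2_eq_square mult_ac)
qed

text \<open>The leading part is an orthogonal projection: its inner product with \<open>L1\<close> equals its own second moment.
  Hence the remainder is controlled by the difference of the two second moments.\<close>

lemma int_D2_sq: "(\<integral>y. (L1 y - L - D1 y)\<^sup>2 \<partial>pw {1..k}) \<le> kch B * (c\<^sup>2 * energy)"
proof -
  have "(\<integral>y. (L1 y - L - D1 y)\<^sup>2 \<partial>pw {1..k}) =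
     (\<integral>y. (L1 y - L)\<^sup>2 - (2 * (L1 y * D1 y) - (2 * L * D1 y + (D1 y)\<^sup>2)) \<partial>pw {1..k})"
    by (intro lint_cong refl) (simp add: power2_eq_square algebra_simps)
  also have "\<dots> = (\<integral>y. (L1 y - L)\<^sup>2 \<partial>pw {1..k}) - row_var"
    by (simp add: R.bm_int_diff R.bm_int_add bm int_L1_D1 int_D1 int_D1_sq)
  finally show ?thesis using variance_expansion by linarith
qed

lemma row_var_bounds: "0 \<le> row_var" "row_var \<le> (B + 1) * (c * energy)"
proof -
  have kA: "real k * A \<le> B * c"
  proof -
    have "real k * A \<le> real k * c\<^sup>2" using A_bounds by (intro mult_left_mono) auto
    also have "\<dots> = (real k * c) * c" by (simp add: power2_eq_square)
    also have "\<dots> \<le> B * c" using kcB c_pos by (intro mult_right_mono) auto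
    finally show ?thesis .
  qed
  have C2: "C\<^sup>2 \<le> c\<^sup>2" using C_bounds by (intro power_mono) auto
  show "0 \<le> row_var" unfolding row_var_eq using A_bounds s2_bounds by simp
  have "row_var \<le> L\<^sup>2 * (B * c) + c\<^sup>2 * (Lam2 / 2)"
    unfolding row_var_eq by (intro add_mono mult_left_mono[OF kA] mult_mono[OF C2 s2_bounds(2)]) (use s2_bounds in auto)
  also have "\<dots> \<le> B * (c * L\<^sup>2) + c * (c * Lam2)"
    using Lam2_nonneg c_pos by (simp add: power2_eq_square mult_ac)
  also have "\<dots> \<le> B * (c * energy) + c * energy"
    using energy_ge B_nonneg c_pos by (intro add_mono mult_left_mono) auto
  finally show "row_var \<le> (B + 1) * (c * energy)" by (simp add: algebra_simps)
qed

lemma int_D1_4: "(\<integral>y. D1 y ^ 4 \<partial>pw {1..k}) \<le> L\<^sup>2 * ((32 * B\<^sup>2 + 72) * (c\<^sup>2 * energy))"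
proof -
  have four: "(a + b) ^ 4 \<le> 8 * (a ^ 4 + b ^ 4)" for a b :: real
  proof -
    have "(a + b)\<^sup>2 \<le> 2 * (a\<^sup>2 + b\<^sup>2)"
      using sum_squares_bound[of a b] by (simp add: power2_eq_square algebra_simps)
    then have "((a + b)\<^sup>2)\<^sup>2 \<le> (2 * (a\<^sup>2 + b\<^sup>2))\<^sup>2" by (intro power_mono) auto
    also have "\<dots> = 4 * (a\<^sup>2 + b\<^sup>2)\<^sup>2" by (simp only: power_mult_distrib) simp
    also have "(a\<^sup>2 + b\<^sup>2)\<^sup>2 \<le> 2 * (a ^ 4 + b ^ 4)"
      using sum_squares_bound[of "a\<^sup>2" "b\<^sup>2"] by (simp add: power2_eq_square power4_eq_xxxx algebra_simps)
    finally show ?thesis by simp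
  qed
  have "(\<integral>y. D1 y ^ 4 \<partial>pw {1..k}) \<le> (\<integral>y. 8 * (L ^ 4 * (\<Sum>j\<in>{1..k}. ev (y j)) ^ 4 + lower_form m od k y ^ 4) \<partial>pw {1..k})"
    unfolding D1_def using four[of "L * (\<Sum>j\<in>{1..k}. ev (y j))" "lower_form m od k y" for y]
    by (intro R.bm_int_mono) (auto intro!: bm simp: power_mult_distrib)
  also have "\<dots> = 8 * (L ^ 4 * (\<integral>y. (\<Sum>j\<in>{1..k}. ev (y j)) ^ 4 \<partial>pw {1..k}) + (\<integral>y. lower_form m od k y ^ 4 \<partial>pw {1..k}))"
    by (subst integral_mult_right_zero, subst R.bm_int_add) (auto intro!: bm)
  also have "\<dots> \<le> 8 * (L ^ 4 * (4 * B\<^sup>2 * c\<^sup>2) + (6 * c\<^sup>2 * s2)\<^sup>2)"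
    using ev_sum_moments(3) low_moments(2) by (intro mult_left_mono add_mono) auto
  also have "\<dots> = 8 * (L\<^sup>2 * (4 * B\<^sup>2 * (c\<^sup>2 * L\<^sup>2)) + 36 * c ^ 4 * s2\<^sup>2)"
    by (simp add: power2_eq_square power4_eq_xxxx)
  also have "\<dots> \<le> 8 * (L\<^sup>2 * (4 * B\<^sup>2 * (c\<^sup>2 * L\<^sup>2)) + 36 * c ^ 4 * (L\<^sup>2 * Lam4 / 4))"
  proof (intro mult_left_mono add_left_mono)
    have "s2\<^sup>2 \<le> (Lam2 / 2)\<^sup>2" using s2_bounds by (intro power_mono) auto
    also have "(Lam2 / 2)\<^sup>2 \<le> L\<^sup>2 * Lam4 / 4" using Lam2_sq_le by (simp add: power_divide)
    finally show "s2\<^sup>2 \<le> L\<^sup>2 * Lam4 / 4" .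
  qed auto
  also have "8 * (L\<^sup>2 * (4 * B\<^sup>2 * (c\<^sup>2 * L\<^sup>2)) + 36 * c ^ 4 * (L\<^sup>2 * Lam4 / 4)) = L\<^sup>2 * (32 * B\<^sup>2 * (c\<^sup>2 * L\<^sup>2) + 72 * (c\<^sup>2 * (c\<^sup>2 * Lam4)))"
    by (simp add: power2_eq_square power4_eq_xxxx algebra_simps)
  also have "\<dots> \<le> L\<^sup>2 * (32 * B\<^sup>2 * (c\<^sup>2 * energy) + 72 * (c\<^sup>2 * energy))"
    using energy_ge by (intro mult_left_mono add_mono) auto
  finally show ?thesis by (simp add: algebra_simps)
qed

definition kvar where "kvar = kch B + B + 1"

lemma increment_sq: "(\<integral>y. (L1 y - L)\<^sup>2 \<partial>pw {1..k}) \<le> kvar * (c * energy)"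
proof -
  have "c\<^sup>2 * energy \<le> c * energy"
    using c_pos c_le energy_ge(4) by (intro mult_right_mono) (auto simp: power2_eq_square)
  then have "kch B * (c\<^sup>2 * energy) \<le> kch B * (c * energy)" using kch_nonneg by (intro mult_left_mono)
  then have "(\<integral>y. (L1 y - L)\<^sup>2 \<partial>pw {1..k}) \<le> kch B * (c * energy) + (B + 1) * (c * energy)"
    using variance_expansion row_var_bounds by linarith
  then show ?thesis by (simp add: kvar_def algebra_simps)
qed

text \<open>One row changes the expectation of the smoothed payoff by half its second derivative times the
  conditional variance.\<close>

definition ktay where "ktay = 9 * kch B + 4 * (B + 1) + 4 * (32 * B\<^sup>2 + 72)"

lemma row_taylor:
  assumes v: "v > 0" and G: "gentle G (\<lambda>l. bs_gamma l v)"
  shows "\<bar>(\<integral>y. bs (L1 y) v \<partial>pw {1..k}) - bs L v - bs_gamma L v / 2 * row_var\<bar> \<le> G * ktay * (c * sqrt c * energy)"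
proof -
  let ?r = "sqrt c"
  have r: "?r > 0" "?r * ?r = c" "c \<le> ?r"
  proof -
    show "?r > 0" "?r * ?r = c" using c_pos by auto
    have "?r * ?r \<le> ?r * 1" using c_pos c_le by (intro mult_left_mono) auto
    then show "c \<le> ?r" using c_pos by simp
  qed
  define rem where "rem y = bs (L1 y) v - bs L v - bs_delta L v * (L1 y - L) - bs_gamma L v * (L1 y - L)\<^sup>2 / 2" for y
  have brem: "bounded_meas (pw {1..k}) rem" unfolding rem_def[abs_def] by (intro bm)
  have G0: "G \<ge> 0" "\<bar>bs_gamma L v\<bar> \<le> G" using G L_pos unfolding gentle_def by fastforce+
  \<comment> \<open>Where the leading part dominates, the cubic remainder is split by the inequality
    \<open>2 * z ^ 3 / L \<le> sqrt c * z\<^sup>2 + z ^ 4 / (sqrt c * L\<^sup>2)\<close>, whose terms have the same order.\<close>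
  define bd where "bd y = 4 * (L1 y - L - D1 y)\<^sup>2 + 4 * (?r * (D1 y)\<^sup>2 + D1 y ^ 4 / (?r * L\<^sup>2))" for y
  have bbd: "bounded_meas (pw {1..k}) bd" unfolding bd_def[abs_def] by (intro bm)
  have pt: "\<bar>rem y\<bar> \<le> G * bd y" for y
  proof -
    define d where "d = L1 y - L"
    have "min (d\<^sup>2) (\<bar>d\<bar> ^ 3 / L) \<le> bd y"
    proof (cases "\<bar>D1 y\<bar> \<le> \<bar>d - D1 y\<bar>")
      case True
      have "\<bar>d\<bar> \<le> 2 * \<bar>d - D1 y\<bar>" using True abs_triangle_ineq[of "D1 y" "d - D1 y"] by simp
      from power_mono[OF this, of 2] have "d\<^sup>2 \<le> 4 * (d - D1 y)\<^sup>2" by (simp add: power_mult_distrib)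
      moreover have "0 \<le> ?r * (D1 y)\<^sup>2 + D1 y ^ 4 / (?r * L\<^sup>2)" using r L_pos by simp
      ultimately show ?thesis by (simp add: bd_def d_def min_le_iff_disj)
    next
      case False
      have "\<bar>d\<bar> \<le> 2 * \<bar>D1 y\<bar>" using False abs_triangle_ineq[of "D1 y" "d - D1 y"] by simp
      from power_mono[OF this, of 3] have "\<bar>d\<bar> ^ 3 \<le> 8 * \<bar>D1 y\<bar> ^ 3" by (simp add: power_mult_distrib)
      then have "\<bar>d\<bar> ^ 3 / L \<le> 8 * \<bar>D1 y\<bar> ^ 3 / L" using L_pos by (intro divide_right_mono) auto
      also have "\<dots> \<le> 4 * (?r * (D1 y)\<^sup>2 + D1 y ^ 4 / (?r * L\<^sup>2))"
      proof -
        define z where "z = \<bar>D1 y\<bar>"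
        have z2: "(D1 y)\<^sup>2 = z\<^sup>2" "D1 y ^ 4 = z ^ 4" by (auto simp: z_def)
        have "0 \<le> ?r * (z - z\<^sup>2 / (?r * L))\<^sup>2" using r by simp
        also have "\<dots> = ?r * z\<^sup>2 + z ^ 4 / (?r * L\<^sup>2) - 2 * z ^ 3 / L"
          using r L_pos by (simp add: power2_eq_square power3_eq_cube power4_eq_xxxx field_simps)
        finally have "2 * z ^ 3 / L \<le> ?r * z\<^sup>2 + z ^ 4 / (?r * L\<^sup>2)" by simp
        then show ?thesis unfolding z2 z_def[symmetric] by simp
      qed
      also have "\<dots> \<le> bd y" by (simp add: bd_def)
      finally show ?thesis by (simp add: min_le_iff_disj)
    qed
    from mult_left_mono[OF this G0(1)] bs_taylor[OF v G L_pos L1_pos[of y]]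
    show ?thesis unfolding rem_def d_def by linarith
  qed
  have "\<bar>\<integral>y. rem y \<partial>pw {1..k}\<bar> \<le> (\<integral>y. G * bd y \<partial>pw {1..k})"
    by (rule R.bm_int_abs_mono[OF brem bm_mult[OF bm_const bbd] pt])
  also have "\<dots> = G * (4 * (\<integral>y. (L1 y - L - D1 y)\<^sup>2 \<partial>pw {1..k}) + 4 * (?r * (\<integral>y. (D1 y)\<^sup>2 \<partial>pw {1..k}) + (\<integral>y. D1 y ^ 4 \<partial>pw {1..k}) / (?r * L\<^sup>2)))"
    unfolding bd_def by (simp add: R.bm_int_add bm)
  also have "\<dots> \<le> G * (4 * (kch B * (c\<^sup>2 * energy)) + 4 * (?r * ((B + 1) * (c * energy)) + (L\<^sup>2 * ((32 * B\<^sup>2 + 72) * (c\<^sup>2 * energy))) / (?r * L\<^sup>2)))"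
    unfolding int_D1_sq using int_D2_sq row_var_bounds int_D1_4 r L_pos G0
    by (intro mult_left_mono add_mono divide_right_mono) auto
  also have "(L\<^sup>2 * ((32 * B\<^sup>2 + 72) * (c\<^sup>2 * energy))) / (?r * L\<^sup>2) = (32 * B\<^sup>2 + 72) * (c * ?r * energy)"
  proof -
    have "c\<^sup>2 = c * ?r * ?r" using r by (simp add: power2_eq_square)
    then show ?thesis using L_pos r by (simp only:) simp
  qed
  also have "4 * (kch B * (c\<^sup>2 * energy)) \<le> 4 * (kch B * (c * ?r * energy))"
    using r c_pos energy_ge kch_nonneg by (intro mult_left_mono mult_right_mono) (auto simp: power2_eq_square)
  finally have 1: "\<bar>\<integral>y. rem y \<partial>pw {1..k}\<bar> \<le> G * (4 * (kch B * (c * ?r * energy)) + 4 * (?r * ((B + 1) * (c * energy)) + (32 * B\<^sup>2 + 72) * (c * ?r * energy)))"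
    using G0 by (simp add: mult_left_mono)
  have 2: "(\<integral>y. rem y \<partial>pw {1..k}) = (\<integral>y. bs (L1 y) v \<partial>pw {1..k}) - bs L v - bs_gamma L v / 2 * (\<integral>y. (L1 y - L)\<^sup>2 \<partial>pw {1..k})"
    unfolding rem_def by (simp add: R.bm_int_diff bm int_L1)
  have "\<bar>bs_gamma L v / 2 * ((\<integral>y. (L1 y - L)\<^sup>2 \<partial>pw {1..k}) - row_var)\<bar> \<le> G * (kch B * (c\<^sup>2 * energy))"
    unfolding abs_mult using G0 variance_expansion by (intro mult_mono) auto
  also have "\<dots> \<le> G * (kch B * (c * ?r * energy))"
    using r c_pos energy_ge kch_nonneg G0 by (intro mult_left_mono mult_right_mono) (auto simp: power2_eq_square)
  finally have 3: "\<bar>bs_gamma L v / 2 * ((\<integral>y. (L1 y - L)\<^sup>2 \<partial>pw {1..k}) - row_var)\<bar> \<le> G * (kch B * (c * ?r * energy))" .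
  have "(\<integral>y. bs (L1 y) v \<partial>pw {1..k}) - bs L v - bs_gamma L v / 2 * row_var =
     (\<integral>y. rem y \<partial>pw {1..k}) + bs_gamma L v / 2 * ((\<integral>y. (L1 y - L)\<^sup>2 \<partial>pw {1..k}) - row_var)"
    unfolding 2 by (simp add: algebra_simps)
  then have "\<bar>(\<integral>y. bs (L1 y) v \<partial>pw {1..k}) - bs L v - bs_gamma L v / 2 * row_var\<bar> \<le>
     G * (4 * (kch B * (c * ?r * energy)) + 4 * (?r * ((B + 1) * (c * energy)) + (32 * B\<^sup>2 + 72) * (c * ?r * energy))) + G * (kch B * (c * ?r * energy))"
    using 1 3 by linarith
  also have "\<dots> \<le> G * ktay * (c * ?r * energy)"
  proof -
    have "0 \<le> G * (kch B * (c * ?r * energy))" using G0 kch_nonneg c_pos r energy_ge by simp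
    then show ?thesis by (simp add: ktay_def algebra_simps)
  qed
  finally show ?thesis .
qed

lemma sqrt_c: "sqrt c > 0" "sqrt c * sqrt c = c" "c \<le> sqrt c"
proof -
  show "sqrt c > 0" "sqrt c * sqrt c = c" using c_pos by auto
  have "sqrt c * sqrt c \<le> sqrt c * 1" using c_pos c_le by (intro mult_left_mono) auto
  then show "c \<le> sqrt c" using c_pos by simp
qed

text \<open>A gentle function of the likelihood ratio can be frozen at its value before the new row is
  added, even in the presence of a quadratic observable of that row. The linear part of the observable has
  a controlled fourth moment and the rest is small in mean square.\<close>

definition kfrz where "kfrz = 4 * ksh B + kvar + 4 + 4 * ksh B + ksh B"

lemma freeze_field:
  assumes h: "gentle G h"
  shows "\<bar>(\<integral>y. h (L1 y) * (\<Sum>i\<in>{1..k}. (g i y)\<^sup>2) \<partial>pw {1..k}) - h L * (C * Lam2)\<bar> \<le> G * kfrz * (sqrt c * energy)"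
proof -
  let ?r = "sqrt c"
  note r = sqrt_c
  have G: "G \<ge> 0" "\<bar>h L\<bar> \<le> G" using h L_pos unfolding gentle_def by fastforce+
  \<comment> \<open>The linear part of the new correlations, again an orthogonal projection.\<close>
  define lin where "lin i y = (\<Sum>j\<in>{1..k}. m i j * od (y j))" for i y
  define M where "M i = (\<Sum>j\<in>{1..k}. (m i j)\<^sup>2)" for i
  define Lin where "Lin y = (\<Sum>i\<in>{1..k}. (lin i y)\<^sup>2)" for y
  define Rem where "Rem y = (\<Sum>i\<in>{1..k}. (g i y - lin i y)\<^sup>2)" for y
  define gg where "gg y = (\<Sum>i\<in>{1..k}. (g i y)\<^sup>2)" for y
  have blin: "bounded_meas (pw {1..k}) (lin i)" for i unfolding lin_def[abs_def] by (intro bm)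
  have bLin: "bounded_meas (pw {1..k}) Lin" unfolding Lin_def[abs_def] by (intro bm blin)
  have bRem: "bounded_meas (pw {1..k}) Rem" unfolding Rem_def[abs_def] by (intro bm blin)
  have bgg: "bounded_meas (pw {1..k}) gg" unfolding gg_def[abs_def] by (intro bm)
  have bh: "bounded_meas (pw {1..k}) (\<lambda>y. h (L1 y))" by (rule bm_gentle[OF h bm_L1 L1_pos])
  have M_pos: "i \<in> {1..k} \<Longrightarrow> M i > 0" for i
  proof -
    assume i: "i \<in> {1..k}"
    have "0 < (m i i)\<^sup>2" using m_diag[OF i] L_pos by simp
    also have "\<dots> \<le> M i" unfolding M_def using i by (intro member_le_sum) auto
    finally show "M i > 0" .
  qed
  have LM: "(\<Sum>i\<in>{1..k}. M i) = Lam2" by (simp add: M_def Lam2_def)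
  have lin2: "(\<integral>y. (lin i y)\<^sup>2 \<partial>pw {1..k}) = C * M i" for i
    unfolding lin_def M_def C_def by (rule pw_linear_moments[OF bm_od int_od]) simp
  have lin4: "(\<integral>y. lin i y ^ 4 \<partial>pw {1..k}) \<le> 4 * c\<^sup>2 * (M i)\<^sup>2" for i
  proof -
    have "(\<integral>y. lin i y ^ 4 \<partial>pw {1..k}) \<le> (3 * C\<^sup>2 + (\<integral>t. od t ^ 4 \<partial>\<nu>)) * (M i)\<^sup>2"
      unfolding lin_def M_def C_def by (rule pw_linear_moments[OF bm_od int_od]) simp
    also have "\<dots> \<le> (4 * c\<^sup>2) * (M i)\<^sup>2"
    proof (rule mult_right_mono)
      have "C\<^sup>2 \<le> c\<^sup>2" using C_bounds by (intro power_mono) auto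
      then show "3 * C\<^sup>2 + (\<integral>t. od t ^ 4 \<partial>\<nu>) \<le> 4 * c\<^sup>2" using od4_le by linarith
    qed simp
    finally show ?thesis .
  qed
  have glin: "(\<integral>y. g i y * lin i y \<partial>pw {1..k}) = C * M i" if i: "i \<in> {1..k}" for i
  proof -
    have s: "(\<integral>y. sinh_part x y * od (y j) \<partial>pw {1..k}) = x j * C" if "j \<in> {1..k}" for x j
    proof -
      have "(\<integral>y. sinh_part x y * od (y j) \<partial>pw {1..k}) = (\<integral>y. (rho k 1 x y * od (y j) - rho k (- 1) x y * od (y j)) / 2 \<partial>pw {1..k})"
        by (intro lint_cong refl) (simp add: sinh_part_def field_simps)
      then show ?thesis using that by (simp add: R.bm_int_diff bm rho_od)
    qed
    have go: "(\<integral>y. g i y * od (y j) \<partial>pw {1..k}) = C * m i j" if j: "j \<in> {1..k}" for j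
    proof -
      have "(\<integral>y. g i y * od (y j) \<partial>pw {1..k}) = (\<integral>y. (\<Sum>x\<in>W. w x * x i * (sinh_part x y * od (y j))) \<partial>pw {1..k})"
        by (intro lint_cong refl) (simp add: g_def sum_distrib_left sum_distrib_right mult_ac)
      also have "\<dots> = (\<Sum>x\<in>W. w x * x i * (\<integral>y. sinh_part x y * od (y j) \<partial>pw {1..k}))"
        using j by (simp add: R.bm_int_sum bm)
      finally show ?thesis using j by (simp add: s) (simp add: m_def sum_distrib_left sum_distrib_right mult_ac)
    qed
    have "(\<integral>y. g i y * lin i y \<partial>pw {1..k}) = (\<integral>y. (\<Sum>j\<in>{1..k}. m i j * (g i y * od (y j))) \<partial>pw {1..k})"
      by (intro lint_cong refl) (simp add: lin_def sum_distrib_left sum_distrib_right mult_ac)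
    also have "\<dots> = (\<Sum>j\<in>{1..k}. m i j * (\<integral>y. g i y * od (y j) \<partial>pw {1..k}))"
      by (subst R.bm_int_sum) (auto intro!: bm)
    finally show ?thesis by (simp add: go) (simp add: M_def sum_distrib_left power2_eq_square mult_ac)
  qed
  have intRem: "(\<integral>y. Rem y \<partial>pw {1..k}) \<le> ksh B * (c * energy)"
  proof -
    have "(\<integral>y. (g i y - lin i y)\<^sup>2 \<partial>pw {1..k}) = (\<integral>y. (g i y)\<^sup>2 \<partial>pw {1..k}) - C * M i" if i: "i \<in> {1..k}" for i
    proof -
      have "(\<integral>y. (g i y - lin i y)\<^sup>2 \<partial>pw {1..k}) = (\<integral>y. (g i y)\<^sup>2 - (2 * (g i y * lin i y) - (lin i y)\<^sup>2) \<partial>pw {1..k})"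
        by (intro lint_cong refl) (simp add: power2_eq_square algebra_simps)
      also have "\<dots> = (\<integral>y. (g i y)\<^sup>2 \<partial>pw {1..k}) - (2 * (\<integral>y. g i y * lin i y \<partial>pw {1..k}) - (\<integral>y. (lin i y)\<^sup>2 \<partial>pw {1..k}))"
        by (simp add: R.bm_int_diff bm blin)
      finally show ?thesis using glin[OF i] lin2 by simp
    qed
    then have "(\<integral>y. Rem y \<partial>pw {1..k}) = (\<integral>y. gg y \<partial>pw {1..k}) - C * Lam2"
      unfolding Rem_def gg_def LM[symmetric] by (simp add: R.bm_int_sum bm blin sum_subtractf sum_distrib_left)
    then show ?thesis using field_expansion unfolding gg_def by linarith
  qed
  have Lin2: "(\<integral>y. (Lin y)\<^sup>2 \<partial>pw {1..k}) \<le> 4 * c\<^sup>2 * Lam2\<^sup>2"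
  proof -
    have pr: "(\<integral>y. (lin i y)\<^sup>2 * (lin j y)\<^sup>2 \<partial>pw {1..k}) \<le> 4 * c\<^sup>2 * (M i * M j)" if ij: "i \<in> {1..k}" "j \<in> {1..k}" for i j
    proof -
      define t where "t = M j / M i"
      have t: "t > 0" using M_pos ij by (simp add: t_def)
      have "x\<^sup>2 * z\<^sup>2 \<le> (1 / 2) * (t * x ^ 4 + z ^ 4 / t)" for x z :: real
      proof -
        have "0 \<le> (t * x\<^sup>2 - z\<^sup>2)\<^sup>2 / t" using t by simp
        also have "\<dots> = t * x ^ 4 + z ^ 4 / t - 2 * (x\<^sup>2 * z\<^sup>2)"
          using t by (simp add: power2_eq_square power4_eq_xxxx field_simps)
        finally show ?thesis by simp
      qed
      then have "(\<integral>y. (lin i y)\<^sup>2 * (lin j y)\<^sup>2 \<partial>pw {1..k}) \<le> (\<integral>y. (1 / 2) * (t * lin i y ^ 4 + lin j y ^ 4 / t) \<partial>pw {1..k})"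
        by (intro R.bm_int_mono bm blin)
      also have "\<dots> = (1 / 2) * (t * (\<integral>y. lin i y ^ 4 \<partial>pw {1..k}) + (\<integral>y. lin j y ^ 4 \<partial>pw {1..k}) / t)"
        by (simp add: R.bm_int_add bm blin)
      also have "\<dots> \<le> (1 / 2) * (t * (4 * c\<^sup>2 * (M i)\<^sup>2) + (4 * c\<^sup>2 * (M j)\<^sup>2) / t)"
        using lin4 t by (intro mult_left_mono add_mono divide_right_mono) auto
      also have "\<dots> = 4 * c\<^sup>2 * (M i * M j)"
        using M_pos[OF ij(1)] M_pos[OF ij(2)] by (simp add: t_def field_simps power2_eq_square)
      finally show ?thesis .
    qed
    have "(\<integral>y. (Lin y)\<^sup>2 \<partial>pw {1..k}) = (\<integral>y. (\<Sum>i\<in>{1..k}. \<Sum>j\<in>{1..k}. (lin i y)\<^sup>2 * (lin j y)\<^sup>2) \<partial>pw {1..k})"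
      by (simp only: Lin_def power2_eq_square[of "sum _ _"] sum_product)
    also have "\<dots> = (\<Sum>i\<in>{1..k}. \<Sum>j\<in>{1..k}. \<integral>y. (lin i y)\<^sup>2 * (lin j y)\<^sup>2 \<partial>pw {1..k})"
      by (simp add: R.bm_int_sum bm blin)
    also have "\<dots> \<le> (\<Sum>i\<in>{1..k}. \<Sum>j\<in>{1..k}. 4 * c\<^sup>2 * (M i * M j))"
      by (intro sum_mono pr)
    also have "\<dots> = 4 * c\<^sup>2 * Lam2\<^sup>2"
      unfolding LM[symmetric] power2_eq_square[of "sum _ _"] sum_product by (simp only: sum_distrib_left)
    finally show ?thesis .
  qed
  define bd where "bd y = 4 * Rem y + ((L1 y - L)\<^sup>2 / ?r + ?r * ((Lin y)\<^sup>2 / L\<^sup>2))" for y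
  have bbd: "bounded_meas (pw {1..k}) bd" unfolding bd_def[abs_def] by (intro bm bRem bLin)
  have pt: "\<bar>(h (L1 y) - h L) * gg y\<bar> \<le> G * bd y" for y
  proof -
    have gle: "gg y \<le> 2 * Lin y + 2 * Rem y"
    proof -
      have "(g i y)\<^sup>2 \<le> 2 * (lin i y)\<^sup>2 + 2 * (g i y - lin i y)\<^sup>2" for i
      proof -
        have "0 \<le> (g i y - 2 * lin i y)\<^sup>2" by simp
        then show ?thesis by (simp add: power2_eq_square algebra_simps)
      qed
      then have "gg y \<le> (\<Sum>i\<in>{1..k}. 2 * (lin i y)\<^sup>2 + 2 * (g i y - lin i y)\<^sup>2)" unfolding gg_def by (rule sum_mono)
      then show ?thesis by (simp add: Lin_def Rem_def sum.distrib sum_distrib_left)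
    qed
    have nn: "0 \<le> gg y" "0 \<le> Lin y" "0 \<le> Rem y" by (auto simp: gg_def Lin_def Rem_def intro!: sum_nonneg)
    have d1: "\<bar>h (L1 y) - h L\<bar> \<le> G * \<bar>L1 y - L\<bar> / L" using h L_pos L1_pos[of y] unfolding gentle_def by blast
    have d2: "\<bar>h (L1 y) - h L\<bar> \<le> 2 * G"
    proof -
      have "\<bar>h (L1 y)\<bar> \<le> G" using h L1_pos[of y] unfolding gentle_def by blast
      then show ?thesis using G by linarith
    qed
    have "\<bar>(h (L1 y) - h L) * gg y\<bar> \<le> \<bar>h (L1 y) - h L\<bar> * (2 * Lin y + 2 * Rem y)"
      using gle nn by (simp add: abs_mult mult_left_mono)
    also have "\<dots> = \<bar>h (L1 y) - h L\<bar> * (2 * Lin y) + \<bar>h (L1 y) - h L\<bar> * (2 * Rem y)" by (simp add: algebra_simps)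
    also have "\<dots> \<le> (G * \<bar>L1 y - L\<bar> / L) * (2 * Lin y) + (2 * G) * (2 * Rem y)"
      using d1 d2 nn by (intro add_mono mult_right_mono) auto
    also have "(G * \<bar>L1 y - L\<bar> / L) * (2 * Lin y) \<le> G * ((L1 y - L)\<^sup>2 / ?r + ?r * ((Lin y)\<^sup>2 / L\<^sup>2))"
    proof -
      have "0 \<le> (\<bar>L1 y - L\<bar> - ?r * (Lin y / L))\<^sup>2 / ?r" using r by simp
      also have "\<dots> = (L1 y - L)\<^sup>2 / ?r + ?r * ((Lin y)\<^sup>2 / L\<^sup>2) - 2 * \<bar>L1 y - L\<bar> * Lin y / L"
      proof -
        have "(a - q * (b / l))\<^sup>2 / q = a\<^sup>2 / q + q * (b\<^sup>2 / l\<^sup>2) - 2 * a * b / l" if "q > 0" "l > 0" for a b q l :: real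
          using that by (simp add: power2_eq_square field_simps)
        from this[OF r(1) L_pos, of "\<bar>L1 y - L\<bar>" "Lin y"] show ?thesis by simp
      qed
      finally have "2 * \<bar>L1 y - L\<bar> * Lin y / L \<le> (L1 y - L)\<^sup>2 / ?r + ?r * ((Lin y)\<^sup>2 / L\<^sup>2)" by simp
      from mult_left_mono[OF this G(1)] show ?thesis by (simp add: mult_ac)
    qed
    finally show ?thesis by (simp add: bd_def algebra_simps)
  qed
  have "\<bar>\<integral>y. (h (L1 y) - h L) * gg y \<partial>pw {1..k}\<bar> \<le> (\<integral>y. G * bd y \<partial>pw {1..k})"
    by (rule R.bm_int_abs_mono[OF bm_mult[OF bm_diff[OF bh bm_const] bgg] bm_mult[OF bm_const bbd] pt])
  also have "\<dots> = G * (4 * (\<integral>y. Rem y \<partial>pw {1..k}) + ((\<integral>y. (L1 y - L)\<^sup>2 \<partial>pw {1..k}) / ?r + ?r * ((\<integral>y. (Lin y)\<^sup>2 \<partial>pw {1..k}) / L\<^sup>2)))"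
    unfolding bd_def by (simp add: R.bm_int_add bm bRem bLin)
  also have "\<dots> \<le> G * (4 * (ksh B * (c * energy)) + ((kvar * (c * energy)) / ?r + ?r * ((4 * c\<^sup>2 * Lam2\<^sup>2) / L\<^sup>2)))"
    using intRem increment_sq Lin2 r G by (intro mult_left_mono add_mono divide_right_mono) auto
  also have "\<dots> \<le> G * (4 * (ksh B * (?r * energy)) + (kvar * (?r * energy) + ?r * (4 * energy)))"
  proof (intro mult_left_mono add_mono)
    show "c * energy \<le> ?r * energy" using r energy_ge by (intro mult_right_mono) auto
    show "(kvar * (c * energy)) / ?r \<le> kvar * (?r * energy)"
      using r by (simp add: field_simps) (metis (no_types, lifting) eq_iff mult.assoc mult.commute r(2))
    have "(4 * c\<^sup>2 * Lam2\<^sup>2) / L\<^sup>2 \<le> (4 * c\<^sup>2 * (L\<^sup>2 * Lam4)) / L\<^sup>2"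
      using Lam2_sq_le by (intro divide_right_mono mult_left_mono) auto
    also have "\<dots> = 4 * (c\<^sup>2 * Lam4)" using L_pos by simp
    also have "\<dots> \<le> 4 * energy" using energy_ge by simp
    finally show "(4 * c\<^sup>2 * Lam2\<^sup>2) / L\<^sup>2 \<le> 4 * energy" .
  qed (use G ksh_nonneg r in auto)
  finally have 1: "\<bar>\<integral>y. (h (L1 y) - h L) * gg y \<partial>pw {1..k}\<bar> \<le> G * (4 * (ksh B * (?r * energy)) + (kvar * (?r * energy) + ?r * (4 * energy)))" .
  have "\<bar>h L * ((\<integral>y. gg y \<partial>pw {1..k}) - C * Lam2)\<bar> \<le> G * (ksh B * (c * energy))"
    unfolding abs_mult using G field_expansion unfolding gg_def by (intro mult_mono) auto
  also have "\<dots> \<le> G * (ksh B * (?r * energy))"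
    using r energy_ge ksh_nonneg G by (intro mult_left_mono mult_right_mono) auto
  finally have 2: "\<bar>h L * ((\<integral>y. gg y \<partial>pw {1..k}) - C * Lam2)\<bar> \<le> G * (ksh B * (?r * energy))" .
  have "(\<integral>y. h (L1 y) * gg y \<partial>pw {1..k}) = (\<integral>y. (h (L1 y) - h L) * gg y + h L * gg y \<partial>pw {1..k})"
    by (intro lint_cong refl) (simp add: algebra_simps)
  also have "\<dots> = (\<integral>y. (h (L1 y) - h L) * gg y \<partial>pw {1..k}) + h L * (\<integral>y. gg y \<partial>pw {1..k})"
    by (subst R.bm_int_add) (auto intro!: bm bh bgg)
  finally have 3: "(\<integral>y. h (L1 y) * gg y \<partial>pw {1..k}) - h L * (C * Lam2) = (\<integral>y. (h (L1 y) - h L) * gg y \<partial>pw {1..k}) + h L * ((\<integral>y. gg y \<partial>pw {1..k}) - C * Lam2)"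
    by (simp add: algebra_simps)
  have "\<bar>(\<integral>y. h (L1 y) * gg y \<partial>pw {1..k}) - h L * (C * Lam2)\<bar> \<le> G * (4 * (ksh B * (?r * energy)) + (kvar * (?r * energy) + ?r * (4 * energy))) + G * (ksh B * (?r * energy))"
    unfolding 3 using 1 2 by linarith
  also have "\<dots> \<le> G * kfrz * (?r * energy)"
  proof -
    have "0 \<le> G * (ksh B * (?r * energy))" using G ksh_nonneg r energy_ge by simp
    then show ?thesis by (simp add: kfrz_def algebra_simps)
  qed
  finally show ?thesis unfolding gg_def .
qed

text \<open>The analogue for the squared likelihood ratio, where the second moment of the increment suffices.\<close>

lemma freeze_square:
  assumes h: "gentle G h"
  shows "\<bar>(\<integral>y. h (L1 y) * (L1 y)\<^sup>2 \<partial>pw {1..k}) - h L * L\<^sup>2\<bar> \<le> G * (6 * kvar + 1) * (sqrt c * energy)"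
proof -
  let ?r = "sqrt c"
  note r = sqrt_c
  have G: "G \<ge> 0" "\<bar>h L\<bar> \<le> G" using h L_pos unfolding gentle_def by fastforce+
  have bh: "bounded_meas (pw {1..k}) (\<lambda>y. h (L1 y))" by (rule bm_gentle[OF h bm_L1 L1_pos])
  define bd where "bd y = (L1 y - L)\<^sup>2 / ?r + (?r * L\<^sup>2 + 4 * (L1 y - L)\<^sup>2)" for y
  have bbd: "bounded_meas (pw {1..k}) bd" unfolding bd_def[abs_def] by (intro bm)
  have pt: "\<bar>(h (L1 y) - h L) * (L1 y)\<^sup>2\<bar> \<le> G * bd y" for y
  proof -
    have d1: "\<bar>h (L1 y) - h L\<bar> \<le> G * \<bar>L1 y - L\<bar> / L" using h L_pos L1_pos[of y] unfolding gentle_def by blast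
    have d2: "\<bar>h (L1 y) - h L\<bar> \<le> 2 * G"
    proof -
      have "\<bar>h (L1 y)\<bar> \<le> G" using h L1_pos[of y] unfolding gentle_def by blast
      then show ?thesis using G by linarith
    qed
    have "0 \<le> (L1 y - 2 * L)\<^sup>2" by simp
    then have "(L1 y)\<^sup>2 \<le> 2 * L\<^sup>2 + 2 * (L1 y - L)\<^sup>2" by (simp add: power2_eq_square algebra_simps)
    then have "\<bar>(h (L1 y) - h L) * (L1 y)\<^sup>2\<bar> \<le> \<bar>h (L1 y) - h L\<bar> * (2 * L\<^sup>2 + 2 * (L1 y - L)\<^sup>2)"
      by (simp add: abs_mult mult_left_mono)
    also have "\<dots> = \<bar>h (L1 y) - h L\<bar> * (2 * L\<^sup>2) + \<bar>h (L1 y) - h L\<bar> * (2 * (L1 y - L)\<^sup>2)" by (simp add: algebra_simps)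
    also have "\<dots> \<le> (G * \<bar>L1 y - L\<bar> / L) * (2 * L\<^sup>2) + (2 * G) * (2 * (L1 y - L)\<^sup>2)"
      using d1 d2 by (intro add_mono mult_right_mono) auto
    also have "(G * \<bar>L1 y - L\<bar> / L) * (2 * L\<^sup>2) = G * (2 * \<bar>L1 y - L\<bar> * L)"
      using L_pos by (simp add: power2_eq_square)
    also have "G * (2 * \<bar>L1 y - L\<bar> * L) \<le> G * ((L1 y - L)\<^sup>2 / ?r + ?r * L\<^sup>2)"
    proof (rule mult_left_mono[OF _ G(1)])
      have "0 \<le> (\<bar>L1 y - L\<bar> - ?r * L)\<^sup>2 / ?r" using r by simp
      also have "\<dots> = (L1 y - L)\<^sup>2 / ?r + ?r * L\<^sup>2 - 2 * \<bar>L1 y - L\<bar> * L"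
      proof -
        have "(a - q * l)\<^sup>2 / q = a\<^sup>2 / q + q * l\<^sup>2 - 2 * a * l" if "q > 0" for a q l :: real
          using that by (simp add: power2_eq_square field_simps)
        from this[OF r(1), of "\<bar>L1 y - L\<bar>"] show ?thesis by simp
      qed
      finally show "2 * \<bar>L1 y - L\<bar> * L \<le> (L1 y - L)\<^sup>2 / ?r + ?r * L\<^sup>2" by simp
    qed
    finally show ?thesis by (simp add: bd_def algebra_simps)
  qed
  have kv: "0 \<le> kvar" using kch_nonneg B_nonneg by (simp add: kvar_def)
  have inc: "(\<integral>y. (L1 y - L)\<^sup>2 \<partial>pw {1..k}) \<le> kvar * (?r * energy)"
  proof -
    have "kvar * (c * energy) \<le> kvar * (?r * energy)"
      using r energy_ge kv by (intro mult_left_mono mult_right_mono) auto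
    then show ?thesis using increment_sq by linarith
  qed
  have incr: "(\<integral>y. (L1 y - L)\<^sup>2 \<partial>pw {1..k}) / ?r \<le> kvar * (?r * energy)"
  proof -
    have "(\<integral>y. (L1 y - L)\<^sup>2 \<partial>pw {1..k}) \<le> kvar * (?r * energy) * ?r"
    proof -
      have "kvar * (?r * energy) * ?r = kvar * ((?r * ?r) * energy)" by (simp only: mult_ac)
      then have "kvar * (?r * energy) * ?r = kvar * (c * energy)" unfolding r(2) .
      then show ?thesis using increment_sq by linarith
    qed
    then show ?thesis using r by (simp add: divide_le_eq)
  qed
  have "\<bar>\<integral>y. (h (L1 y) - h L) * (L1 y)\<^sup>2 \<partial>pw {1..k}\<bar> \<le> (\<integral>y. G * bd y \<partial>pw {1..k})"
    by (rule R.bm_int_abs_mono[OF bm_mult[OF bm_diff[OF bh bm_const] bm_power[OF bm_L1]] bm_mult[OF bm_const bbd] pt])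
  also have "\<dots> = G * ((\<integral>y. (L1 y - L)\<^sup>2 \<partial>pw {1..k}) / ?r + (?r * L\<^sup>2 + 4 * (\<integral>y. (L1 y - L)\<^sup>2 \<partial>pw {1..k})))"
    unfolding bd_def by (simp add: R.bm_int_add bm)
  also have "\<dots> \<le> G * (kvar * (?r * energy) + (?r * energy + 4 * (kvar * (?r * energy))))"
    using inc incr energy_ge r G by (intro mult_left_mono add_mono) auto
  finally have 1: "\<bar>\<integral>y. (h (L1 y) - h L) * (L1 y)\<^sup>2 \<partial>pw {1..k}\<bar> \<le> G * (kvar * (?r * energy) + (?r * energy + 4 * (kvar * (?r * energy))))" .
  have sq: "(\<integral>y. (L1 y - L)\<^sup>2 \<partial>pw {1..k}) = (\<integral>y. (L1 y)\<^sup>2 \<partial>pw {1..k}) - L\<^sup>2"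
  proof -
    have "(\<integral>y. (L1 y - L)\<^sup>2 \<partial>pw {1..k}) = (\<integral>y. (L1 y)\<^sup>2 - (2 * L * L1 y - L\<^sup>2) \<partial>pw {1..k})"
      by (intro lint_cong refl) (simp add: power2_eq_square algebra_simps)
    also have "\<dots> = (\<integral>y. (L1 y)\<^sup>2 \<partial>pw {1..k}) - L\<^sup>2"
      by (simp add: R.bm_int_diff bm int_L1 power2_eq_square)
    finally show ?thesis .
  qed
  have 2: "\<bar>h L * (\<integral>y. (L1 y - L)\<^sup>2 \<partial>pw {1..k})\<bar> \<le> G * (kvar * (?r * energy))"
    unfolding abs_mult using G inc by (intro mult_mono) auto
  have "(\<integral>y. h (L1 y) * (L1 y)\<^sup>2 \<partial>pw {1..k}) = (\<integral>y. (h (L1 y) - h L) * (L1 y)\<^sup>2 + h L * (L1 y)\<^sup>2 \<partial>pw {1..k})"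
    by (intro lint_cong refl) (simp add: algebra_simps)
  also have "\<dots> = (\<integral>y. (h (L1 y) - h L) * (L1 y)\<^sup>2 \<partial>pw {1..k}) + h L * (\<integral>y. (L1 y)\<^sup>2 \<partial>pw {1..k})"
    by (subst R.bm_int_add) (auto intro!: bm bh)
  finally have 3: "(\<integral>y. h (L1 y) * (L1 y)\<^sup>2 \<partial>pw {1..k}) - h L * L\<^sup>2 = (\<integral>y. (h (L1 y) - h L) * (L1 y)\<^sup>2 \<partial>pw {1..k}) + h L * (\<integral>y. (L1 y - L)\<^sup>2 \<partial>pw {1..k})"
    unfolding sq by (simp add: algebra_simps)
  have "\<bar>(\<integral>y. h (L1 y) * (L1 y)\<^sup>2 \<partial>pw {1..k}) - h L * L\<^sup>2\<bar> \<le> G * (kvar * (?r * energy) + (?r * energy + 4 * (kvar * (?r * energy)))) + G * (kvar * (?r * energy))"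
    unfolding 3 using 1 2 by linarith
  also have "\<dots> = G * (6 * kvar + 1) * (?r * energy)" by (simp add: algebra_simps)
  finally show ?thesis .
qed

end

section \<open>The off-diagonal likelihood ratio\<close>

lemma finite_sup: "finite (strict_upper_pairs k)"
  by (rule finite_subset[of _ "{1..k} \<times> {1..k}"]) (auto simp: strict_upper_pairs_def)

definition new_pairs :: "nat \<Rightarrow> (nat \<times> nat) set" where
  "new_pairs k = (\<lambda>i. (i, Suc k)) ` {1..k}"

lemma sup_Suc: "strict_upper_pairs (Suc k) = strict_upper_pairs k \<union> new_pairs k"
  "strict_upper_pairs k \<inter> new_pairs k = {}" "finite (new_pairs k)"
  by (auto simp: strict_upper_pairs_def new_pairs_def image_iff le_Suc_eq)

definition spin_vecs :: "nat \<Rightarrow> (nat \<Rightarrow> real) set" where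
  "spin_vecs k = {1..k} \<rightarrow>\<^sub>E {1, - 1}"

lemma finite_spin_vecs: "finite (spin_vecs k)"
  unfolding spin_vecs_def by (intro finite_PiE) auto

lemma spin_vecsD: "x \<in> spin_vecs k \<Longrightarrow> j \<in> {1..k} \<Longrightarrow> x j \<in> {1, - 1}"
  unfolding spin_vecs_def by auto

lemma sum_spin_vecs_Suc:
  "(\<Sum>x\<in>spin_vecs (Suc k). F x) = (\<Sum>x\<in>spin_vecs k. F (x(Suc k := 1)) + F (x(Suc k := - 1)))"
proof -
  have ins: "{1..Suc k} = insert (Suc k) {1..k}" by auto
  have "spin_vecs (Suc k) = (\<lambda>(u, x). x(Suc k := u)) ` ({1, - 1} \<times> spin_vecs k)"
    unfolding spin_vecs_def ins PiE_insert_eq ..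
  moreover have "inj_on (\<lambda>(u, x). x(Suc k := u)) ({1, - 1} \<times> spin_vecs k)"
    unfolding spin_vecs_def by (rule inj_combinator) simp
  ultimately have "(\<Sum>x\<in>spin_vecs (Suc k). F x) = (\<Sum>p\<in>{1, - 1} \<times> spin_vecs k. F ((\<lambda>(u, x). x(Suc k := u)) p))"
    by (simp only: sum.reindex comp_def)
  also have "\<dots> = (\<Sum>(u, x)\<in>{1, - 1} \<times> spin_vecs k. F (x(Suc k := u)))"
    by (rule sum.cong) auto
  also have "\<dots> = (\<Sum>u\<in>{1, - 1}. \<Sum>x\<in>spin_vecs k. F (x(Suc k := u)))"
    by (rule sum.cartesian_product[symmetric])
  also have "\<dots> = (\<Sum>x\<in>spin_vecs k. F (x(Suc k := 1)) + F (x(Suc k := - 1)))"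
    by (simp add: sum.distrib)
  finally show ?thesis .
qed

text \<open>The matrix with index set \<open>{1..Suc k}\<close> assembled from the one with index set \<open>{1..k}\<close> and a new row.\<close>

definition glue :: "nat \<Rightarrow> (nat \<times> nat \<Rightarrow> real) \<Rightarrow> (nat \<Rightarrow> real) \<Rightarrow> nat \<times> nat \<Rightarrow> real" where
  "glue k z y = merge (strict_upper_pairs k) (new_pairs k) (z, \<lambda>e\<in>new_pairs k. y (fst e))"

lemma glue_old: "e \<in> strict_upper_pairs k \<Longrightarrow> glue k z y e = z e"
  unfolding glue_def by (simp add: merge_def)

lemma glue_new: "i \<in> {1..k} \<Longrightarrow> glue k z y (i, Suc k) = y i"
  unfolding glue_def using sup_Suc(2)[of k] by (auto simp: merge_def new_pairs_def)

abbreviation tr :: "nat \<Rightarrow> nat \<Rightarrow> nat \<Rightarrow> nat" where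
  "tr \<equiv> Transposition.transpose"

text \<open>The transposition of two indices acts on the entries of a symmetric matrix.\<close>

definition swap_pair :: "nat \<Rightarrow> nat \<Rightarrow> nat \<times> nat \<Rightarrow> nat \<times> nat" where
  "swap_pair a b e = (min (tr a b (fst e)) (tr a b (snd e)), max (tr a b (fst e)) (tr a b (snd e)))"

lemma transpose_in: "a \<in> {1..k} \<Longrightarrow> b \<in> {1..k} \<Longrightarrow> i \<in> {1..k} \<Longrightarrow> tr a b i \<in> {1..k}"
  by (auto simp: Transposition.transpose_def)

lemma swap_pair_in:
  assumes "a \<in> {1..k}" "b \<in> {1..k}" "e \<in> strict_upper_pairs k"
  shows "swap_pair a b e \<in> strict_upper_pairs k"
proof -
  obtain i j where e: "e = (i, j)" "1 \<le> i" "i < j" "j \<le> k" using assms by (auto simp: strict_upper_pairs_def)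
  have "tr a b i \<in> {1..k}" "tr a b j \<in> {1..k}" using e assms by (auto intro!: transpose_in simp del: atLeastAtMost_iff) auto
  moreover have "tr a b i \<noteq> tr a b j" using e by (metis nat_less_le transpose_involutory)
  ultimately show ?thesis by (auto simp: swap_pair_def e(1) strict_upper_pairs_def min_def max_def)
qed

lemma swap_pair_invol: "e \<in> strict_upper_pairs k \<Longrightarrow> swap_pair a b (swap_pair a b e) = e"
  by (cases e) (auto simp: swap_pair_def strict_upper_pairs_def min_def max_def)

definition pair_weight ::
  "(real \<Rightarrow> real) \<Rightarrow> (real \<Rightarrow> real) \<Rightarrow> nat \<Rightarrow> (nat \<times> nat \<Rightarrow> real) \<Rightarrow> (nat \<Rightarrow> real) \<Rightarrow> real" where
  "pair_weight a b k z x = (\<Prod>e\<in>strict_upper_pairs k. 1 + a (z e) + x (fst e) * x (snd e) * b (z e)) / 2 ^ k"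

definition pair_LR :: "(real \<Rightarrow> real) \<Rightarrow> (real \<Rightarrow> real) \<Rightarrow> nat \<Rightarrow> (nat \<times> nat \<Rightarrow> real) \<Rightarrow> real" where
  "pair_LR a b k z = (\<Sum>x\<in>spin_vecs k. pair_weight a b k z x)"

context edge_law
begin

abbreviation "wt \<equiv> pair_weight ev od"
abbreviation "LR \<equiv> pair_LR ev od"

lemmas wt_def = pair_weight_def[of ev od]
lemmas LR_def = pair_LR_def[of ev od]

definition corr :: "nat \<Rightarrow> (nat \<times> nat \<Rightarrow> real) \<Rightarrow> nat \<Rightarrow> nat \<Rightarrow> real" where
  "corr k z i j = (\<Sum>x\<in>spin_vecs k. wt k z x * (x i * x j))"

abbreviation "PS k \<equiv> pw (strict_upper_pairs k)"

lemma bm_wt [bm]: "bounded_meas (PS k) (\<lambda>z. wt k z x)"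
  unfolding wt_def by (intro bm)

lemma bm_LR [bm]: "bounded_meas (PS k) (LR k)"
  unfolding LR_def[abs_def] by (intro bm)

lemma bm_corr [bm]: "bounded_meas (PS k) (\<lambda>z. corr k z i j)"
  unfolding corr_def by (intro bm)

lemma wt_pos:
  assumes "x \<in> spin_vecs k" shows "wt k z x > 0"
proof -
  have "x (fst e) * x (snd e) \<in> {1, - 1}" if "e \<in> strict_upper_pairs k" for e
  proof -
    have "fst e \<in> {1..k}" "snd e \<in> {1..k}" using that by (auto simp: strict_upper_pairs_def)
    from spin_vecsD[OF assms this(1)] spin_vecsD[OF assms this(2)] show ?thesis by auto
  qed
  then show ?thesis unfolding wt_def by (intro divide_pos_pos prod_pos edge_pos) auto
qed

lemma LR_pos: "LR k z > 0"
proof -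
  have "spin_vecs k \<noteq> {}" unfolding spin_vecs_def by (simp add: PiE_eq_empty_iff)
  then show ?thesis unfolding LR_def using finite_spin_vecs wt_pos by (intro sum_pos) auto
qed

lemma glue_measurable [measurable]:
  assumes "z \<in> space (PS k)"
  shows "glue k z \<in> pw {1..k} \<rightarrow>\<^sub>M PS (Suc k)"
proof -
  have 1: "(\<lambda>y. \<lambda>e\<in>new_pairs k. y (fst e)) \<in> pw {1..k} \<rightarrow>\<^sub>M pw (new_pairs k)"
    by (rule measurable_restrict) (auto simp: new_pairs_def)
  have "(\<lambda>y. (z, \<lambda>e\<in>new_pairs k. y (fst e))) \<in> pw {1..k} \<rightarrow>\<^sub>M PS k \<Otimes>\<^sub>M pw (new_pairs k)"
    using assms 1 by measurable
  from measurable_compose[OF this measurable_merge] show ?thesis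
    unfolding glue_def[abs_def] sup_Suc(1) .
qed

text \<open>The law of the enlarged matrix is the product of the laws of the old one and of the new row.\<close>

lemma row_fubini:
  assumes f: "bounded_meas (PS (Suc k)) f"
  shows "(\<integral>z. f z \<partial>PS (Suc k)) = (\<integral>z. (\<integral>y. f (glue k z y) \<partial>pw {1..k}) \<partial>PS k)"
proof -
  let ?D = "distr (pw {1..k}) (pw (new_pairs k)) (\<lambda>y. \<lambda>e\<in>new_pairs k. y (fst e))"
  have inj: "inj_on fst (new_pairs k)" "fst \<in> new_pairs k \<rightarrow> {1..k}"
    by (auto simp: new_pairs_def inj_on_def)
  have D: "?D = pw (new_pairs k)"
    using distr_PiM_reindex[OF _ inj, of "\<lambda>_. \<nu>"] prob_space_axioms by simp
  have m1: "(\<lambda>y. \<lambda>e\<in>new_pairs k. y (fst e)) \<in> pw {1..k} \<rightarrow>\<^sub>M pw (new_pairs k)"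
    by (rule measurable_restrict) (auto simp: new_pairs_def)
  have fm: "f \<in> borel_measurable (pw (strict_upper_pairs k \<union> new_pairs k))"
    using bounded_meas_measurable[OF f] unfolding sup_Suc(1) .
  have "(\<integral>z. f z \<partial>PS (Suc k)) = (\<integral>z. (\<integral>y. f (merge (strict_upper_pairs k) (new_pairs k) (z, y)) \<partial>pw (new_pairs k)) \<partial>PS k)"
    unfolding sup_Suc(1)
    by (rule product_sigma_finite.product_integral_fold[OF product_sigma_finite_pw sup_Suc(2) finite_sup sup_Suc(3)])
       (use bm_integrable[OF prob_space_pw f] in \<open>simp add: sup_Suc(1)\<close>)
  also have "\<dots> = (\<integral>z. (\<integral>y. f (glue k z y) \<partial>pw {1..k}) \<partial>PS k)"
  proof (rule lint_cong[OF refl])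
    fix z assume z: "z \<in> space (PS k)"
    have m2: "(\<lambda>y. f (merge (strict_upper_pairs k) (new_pairs k) (z, y))) \<in> borel_measurable (pw (new_pairs k))"
      using z fm by measurable
    have "(\<integral>y. f (merge (strict_upper_pairs k) (new_pairs k) (z, y)) \<partial>pw (new_pairs k)) =
       (\<integral>y. f (merge (strict_upper_pairs k) (new_pairs k) (z, y)) \<partial>?D)" unfolding D ..
    also have "\<dots> = (\<integral>y. f (glue k z y) \<partial>pw {1..k})"
      unfolding glue_def by (rule integral_distr[OF m1 m2])
    finally show "(\<integral>y. f (merge (strict_upper_pairs k) (new_pairs k) (z, y)) \<partial>pw (new_pairs k)) = (\<integral>y. f (glue k z y) \<partial>pw {1..k})" .
  qed
  finally show ?thesis .
qed

lemma wt_glue: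
  assumes x: "x \<in> spin_vecs k"
  shows "wt (Suc k) (glue k z y) (x(Suc k := u)) = wt k z x * rho k u x y / 2"
proof -
  let ?f = "\<lambda>e. 1 + ev (glue k z y e) + (x(Suc k := u)) (fst e) * (x(Suc k := u)) (snd e) * od (glue k z y e)"
  have "prod ?f (strict_upper_pairs k) = (\<Prod>e\<in>strict_upper_pairs k. 1 + ev (z e) + x (fst e) * x (snd e) * od (z e))"
    by (rule prod.cong[OF refl]) (auto simp: glue_old strict_upper_pairs_def)
  moreover have "prod ?f (new_pairs k) = rho k u x y"
    unfolding new_pairs_def rho_def by (subst prod.reindex) (auto intro!: prod.cong simp: inj_on_def glue_new mult.commute)
  ultimately show ?thesis
    unfolding wt_def sup_Suc(1) by (subst prod.union_disjoint) (auto simp: sup_Suc finite_sup)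
qed

lemma LR_0: "LR 0 z = 1"
proof -
  have "strict_upper_pairs 0 = {}" by (auto simp: strict_upper_pairs_def)
  then show ?thesis by (simp add: LR_def wt_def spin_vecs_def)
qed

lemma reindex_swap:
  assumes ab: "a \<in> {1..k}" "b \<in> {1..k}"
    and f: "bounded_meas (PS k) f"
  shows "(\<integral>z. f (\<lambda>e\<in>strict_upper_pairs k. z (swap_pair a b e)) \<partial>PS k) = (\<integral>z. f z \<partial>PS k)"
proof -
  have inj: "inj_on (swap_pair a b) (strict_upper_pairs k)" by (metis inj_onI swap_pair_invol)
  have into: "swap_pair a b \<in> strict_upper_pairs k \<rightarrow> strict_upper_pairs k" using swap_pair_in[OF ab] by auto
  have D: "distr (PS k) (PS k) (\<lambda>z. \<lambda>e\<in>strict_upper_pairs k. z (swap_pair a b e)) = PS k"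
    using distr_PiM_reindex[OF _ inj into, of "\<lambda>_. \<nu>"] prob_space_axioms by simp
  have m: "(\<lambda>z. \<lambda>e\<in>strict_upper_pairs k. z (swap_pair a b e)) \<in> PS k \<rightarrow>\<^sub>M PS k"
    by (rule measurable_restrict) (rule measurable_component_singleton, rule swap_pair_in[OF ab])
  have "(\<integral>z. f z \<partial>PS k) = (\<integral>z. f z \<partial>distr (PS k) (PS k) (\<lambda>z. \<lambda>e\<in>strict_upper_pairs k. z (swap_pair a b e)))"
    unfolding D ..
  also have "\<dots> = (\<integral>z. f (\<lambda>e\<in>strict_upper_pairs k. z (swap_pair a b e)) \<partial>PS k)"
    by (rule integral_distr[OF m bounded_meas_measurable[OF f]])
  finally show ?thesis ..
qed

lemma wt_swap:
  assumes ab: "a \<in> {1..k}" "b \<in> {1..k}"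
  shows "wt k (\<lambda>e\<in>strict_upper_pairs k. z (swap_pair a b e)) x = wt k z (x \<circ> tr a b)"
proof -
  let ?f = "\<lambda>e. 1 + ev (z e) + (x \<circ> tr a b) (fst e) * (x \<circ> tr a b) (snd e) * od (z e)"
  have bij: "bij_betw (swap_pair a b) (strict_upper_pairs k) (strict_upper_pairs k)"
    by (rule bij_betw_byWitness[where f' = "swap_pair a b"])
       (use swap_pair_invol swap_pair_in[OF ab] in auto)
  have "(\<Prod>e\<in>strict_upper_pairs k. ?f e) = (\<Prod>e\<in>strict_upper_pairs k. ?f (swap_pair a b e))"
    by (rule prod.reindex_bij_betw[OF bij, symmetric])
  also have "\<dots> = (\<Prod>e\<in>strict_upper_pairs k. 1 + ev (z (swap_pair a b e)) + x (fst e) * x (snd e) * od (z (swap_pair a b e)))"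
    by (rule prod.cong[OF refl]) (auto simp: swap_pair_def min_def max_def mult.commute)
  finally show ?thesis unfolding wt_def by simp
qed

lemma spin_vecs_swap:
  assumes ab: "a \<in> {1..k}" "b \<in> {1..k}"
  shows "bij_betw (\<lambda>x. x \<circ> tr a b) (spin_vecs k) (spin_vecs k)"
proof (rule bij_betw_byWitness[where f' = "\<lambda>x. x \<circ> tr a b"])
  have "x \<circ> tr a b \<in> spin_vecs k" if x: "x \<in> spin_vecs k" for x
  proof -
    have 1: "(x \<circ> tr a b) i \<in> {1, - 1}" if "i \<in> {1..k}" for i
      using spin_vecsD[OF x transpose_in[OF ab that]] by simp
    have 2: "(x \<circ> tr a b) i = undefined" if "i \<notin> {1..k}" for i
    proof -
      have "tr a b i = i" using that ab by (auto simp: Transposition.transpose_def)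
      then show ?thesis using x that unfolding spin_vecs_def by (simp add: PiE_def extensional_def)
    qed
    show ?thesis unfolding spin_vecs_def by (rule PiE_I) (rule 1, assumption, rule 2)
  qed
  then show "(\<lambda>x. x \<circ> tr a b) ` spin_vecs k \<subseteq> spin_vecs k" by auto
  then show "(\<lambda>x. x \<circ> tr a b) ` spin_vecs k \<subseteq> spin_vecs k" .
qed (auto simp: comp_assoc)

lemma corr_swap:
  assumes ab: "a \<in> {1..k}" "b \<in> {1..k}"
  shows "corr k (\<lambda>e\<in>strict_upper_pairs k. z (swap_pair a b e)) i j = corr k z (tr a b i) (tr a b j)"
    and "LR k (\<lambda>e\<in>strict_upper_pairs k. z (swap_pair a b e)) = LR k z"
proof -
  have "corr k (\<lambda>e\<in>strict_upper_pairs k. z (swap_pair a b e)) i j =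
     (\<Sum>x\<in>spin_vecs k. (\<lambda>x. wt k z x * (x (tr a b i) * x (tr a b j))) (x \<circ> tr a b))"
    unfolding corr_def wt_swap[OF ab] by simp
  also have "\<dots> = corr k z (tr a b i) (tr a b j)"
    unfolding corr_def by (rule sum.reindex_bij_betw[OF spin_vecs_swap[OF ab]])
  finally show "corr k (\<lambda>e\<in>strict_upper_pairs k. z (swap_pair a b e)) i j = corr k z (tr a b i) (tr a b j)" .
  show "LR k (\<lambda>e\<in>strict_upper_pairs k. z (swap_pair a b e)) = LR k z"
    unfolding LR_def wt_swap[OF ab] by (rule sum.reindex_bij_betw[OF spin_vecs_swap[OF ab]])
qed

text \<open>Exchangeability of the indices expresses the full overlap through the correlations with the
  last index.\<close>

lemma exchange_overlap:
  assumes h: "bounded_meas (PS k) (\<lambda>z. h (LR k z))"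
  shows "(\<integral>z. h (LR k z) * (\<Sum>i\<in>{1..k}. \<Sum>j\<in>{1..k}. (corr k z i j)\<^sup>2) \<partial>PS k) =
    k * ((\<integral>z. h (LR k z) * (LR k z)\<^sup>2 \<partial>PS k) + (\<integral>z. h (LR k z) * (\<Sum>i\<in>{1..<k}. (corr k z i k)\<^sup>2) \<partial>PS k))"
proof -
  interpret P: bm_prob "PS k" by (rule bm_prob_pw)
  define a where "a j = (\<integral>z. h (LR k z) * (\<Sum>i\<in>{1..k}. (corr k z i j)\<^sup>2) \<partial>PS k)" for j
  have aj: "a j = a k" if j: "j \<in> {1..k}" for j
  proof -
    have k: "k \<in> {1..k}" using j by auto
    have bij: "bij_betw (tr j k) {1..k} {1..k}"
      by (rule bij_betw_byWitness[where f' = "tr j k"]) (use transpose_in[OF j k] in auto)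
    have "a j = (\<integral>z. (\<lambda>z. h (LR k z) * (\<Sum>i\<in>{1..k}. (corr k z i j)\<^sup>2)) (\<lambda>e\<in>strict_upper_pairs k. z (swap_pair j k e)) \<partial>PS k)"
      unfolding a_def by (rule reindex_swap[OF j k, symmetric]) (intro bm h)
    also have "\<dots> = (\<integral>z. h (LR k z) * (\<Sum>i\<in>{1..k}. (corr k z (tr j k i) k)\<^sup>2) \<partial>PS k)"
      by (simp add: corr_swap[OF j k])
    also have "\<dots> = a k"
    proof -
      have "(\<Sum>i\<in>{1..k}. (corr k z (tr j k i) k)\<^sup>2) = (\<Sum>i\<in>{1..k}. (corr k z i k)\<^sup>2)" for z
        by (rule sum.reindex_bij_betw[OF bij])
      then show ?thesis unfolding a_def by presburger
    qed
    finally show ?thesis .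
  qed
  have "(\<Sum>j\<in>{1..k}. a j) = (\<Sum>j\<in>{1..k}. a k)" by (rule sum.cong[OF refl aj])
  then have "(\<Sum>j\<in>{1..k}. a j) = k * a k" by simp
  moreover have "(\<integral>z. h (LR k z) * (\<Sum>i\<in>{1..k}. \<Sum>j\<in>{1..k}. (corr k z i j)\<^sup>2) \<partial>PS k) = (\<Sum>j\<in>{1..k}. a j)"
  proof -
    have "(\<integral>z. h (LR k z) * (\<Sum>i\<in>{1..k}. \<Sum>j\<in>{1..k}. (corr k z i j)\<^sup>2) \<partial>PS k) =
       (\<integral>z. (\<Sum>j\<in>{1..k}. h (LR k z) * (\<Sum>i\<in>{1..k}. (corr k z i j)\<^sup>2)) \<partial>PS k)"
      by (subst sum.swap) (simp add: sum_distrib_left)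
    also have "\<dots> = (\<Sum>j\<in>{1..k}. a j)"
      unfolding a_def by (intro P.bm_int_sum bm h)
    finally show ?thesis .
  qed
  moreover have "k * a k = k * ((\<integral>z. h (LR k z) * (LR k z)\<^sup>2 \<partial>PS k) + (\<integral>z. h (LR k z) * (\<Sum>i\<in>{1..<k}. (corr k z i k)\<^sup>2) \<partial>PS k))"
  proof (cases "k = 0")
    case False
    then have ins: "{1..k} = insert k {1..<k}" by auto
    have d: "corr k z k k = LR k z" for z
      unfolding corr_def LR_def by (intro sum.cong refl) (use spin_vecsD[of _ k k] False in fastforce)
    have "a k = (\<integral>z. h (LR k z) * (LR k z)\<^sup>2 + h (LR k z) * (\<Sum>i\<in>{1..<k}. (corr k z i k)\<^sup>2) \<partial>PS k)"
      unfolding a_def ins by (simp add: d distrib_left)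
    also have "\<dots> = (\<integral>z. h (LR k z) * (LR k z)\<^sup>2 \<partial>PS k) + (\<integral>z. h (LR k z) * (\<Sum>i\<in>{1..<k}. (corr k z i k)\<^sup>2) \<partial>PS k)"
      by (intro P.bm_int_add bm h)
    finally show ?thesis by simp
  qed simp
  ultimately show ?thesis by simp
qed

lemma row_step_wt:
  assumes "real k * c \<le> B"
  shows "row_step \<nu> ev od c k (spin_vecs k) (wt k z) B"
proof -
  have "0 < (\<Sum>x\<in>spin_vecs k. wt k z x)" using LR_pos by (simp add: LR_def)
  then show ?thesis
    by (intro row_step.intro edge_law_axioms row_step_axioms.intro finite_spin_vecs)
       (use assms wt_pos spin_vecsD in \<open>auto simp: less_imp_le\<close>)
qed

lemma row_observables:
  assumes B: "real k * c \<le> B"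
  shows "row_step.L (spin_vecs k) (wt k z) = LR k z"
    and "row_step.L1 ev od k (spin_vecs k) (wt k z) y = LR (Suc k) (glue k z y)"
    and "i \<in> {1..k} \<Longrightarrow> row_step.g ev od k (spin_vecs k) (wt k z) i y = corr (Suc k) (glue k z y) i (Suc k)"
    and "row_step.m (spin_vecs k) (wt k z) i j = corr k z i j"
    and "row_step.Lam2 k (spin_vecs k) (wt k z) = (\<Sum>i\<in>{1..k}. \<Sum>j\<in>{1..k}. (corr k z i j)\<^sup>2)"
proof -
  interpret R: row_step \<nu> ev od c k "spin_vecs k" "wt k z" B by (rule row_step_wt[OF B])
  show "R.L = LR k z" by (simp add: R.L_def LR_def)
  show "R.L1 y = LR (Suc k) (glue k z y)"
    unfolding LR_def sum_spin_vecs_Suc R.L1_def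
    by (intro sum.cong refl) (simp add: wt_glue R.cosh_part_def field_simps)
  show "R.g i y = corr (Suc k) (glue k z y) i (Suc k)" if "i \<in> {1..k}"
    unfolding corr_def sum_spin_vecs_Suc R.g_def
    by (intro sum.cong refl) (use that in \<open>simp add: wt_glue R.sinh_part_def field_simps\<close>)
  show m: "R.m i j = corr k z i j" for i j by (simp add: R.m_def corr_def)
  show "R.Lam2 = (\<Sum>i\<in>{1..k}. \<Sum>j\<in>{1..k}. (corr k z i j)\<^sup>2)"
    by (simp add: R.Lam2_def m)
qed

text \<open>The exponential moment of the squared overlap of two replicas. Integrating out the last row replaces the
  parameter \<open>\<zeta> = \<theta> + 2 \<eta>\<close> by \<open>\<zeta> + \<zeta>\<^sup>2\<close>, so \<open>1 / \<zeta>\<close> drops by at most \<open>1\<close> in each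
  step; this is where the condition that the signal is below the threshold enters.\<close>

definition replica_exp :: "nat \<Rightarrow> real \<Rightarrow> real" where
  "replica_exp k \<eta> = (\<integral>z. (\<Sum>x\<in>spin_vecs k. \<Sum>x'\<in>spin_vecs k. wt k z x * wt k z x' * exp (\<eta> * (overlap k x x')\<^sup>2)) \<partial>PS k)"

lemma cosh_le_exp: "cosh (x::real) \<le> exp (x\<^sup>2 / 2)"
proof -
  have "\<bar>cosh x\<bar> \<le> exp (x\<^sup>2 / 2)"
  proof -
    define F where "F n = (if even n then x ^ n /\<^sub>R fact n else 0)" for n
    have F: "F sums cosh x" unfolding F_def[abs_def] by (rule cosh_converges)
    have z: "F n = 0" if "n \<notin> range (\<lambda>n. 2 * n)" for n :: nat
      using that by (auto simp: F_def elim!: evenE)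
    have "(\<lambda>n. F (2 * n)) sums cosh x \<longleftrightarrow> F sums cosh x"
      by (rule sums_mono_reindex[OF _ z]) (simp add: strict_mono_def)
    moreover have "F (2 * n) = x ^ (2 * n) / fact (2 * n)" for n
      by (simp add: F_def divide_inverse mult.commute)
    ultimately have 1: "(\<lambda>n. x ^ (2 * n) / fact (2 * n)) sums cosh x"
      using F by (simp only:)
    have 2: "(\<lambda>n. (x\<^sup>2 / 2) ^ n / fact n) sums exp (x\<^sup>2 / 2)"
    proof -
      have "(\<lambda>n. (x\<^sup>2 / 2) ^ n /\<^sub>R fact n) = (\<lambda>n. (x\<^sup>2 / 2) ^ n / fact n)"
        by (rule ext) (simp only: scaleR_conv_of_real divide_inverse of_real_inverse of_real_fact mult.commute)
      then show ?thesis using exp_converges[of "x\<^sup>2 / 2"] by (simp only:)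
    qed
    have "cosh x \<le> exp (x\<^sup>2 / 2)"
    proof (rule sums_le[OF _ 1 2])
      fix n
      have "2 ^ n * fact n \<le> (fact (2 * n) :: real)"
      proof (induction n)
        case (Suc n)
        have "2 ^ Suc n * fact (Suc n) = (2 * real (Suc n)) * (2 ^ n * fact n)" by simp
        also have "\<dots> \<le> (2 * real (Suc n)) * fact (2 * n)" using Suc by (intro mult_left_mono) auto
        also have "\<dots> \<le> (2 * real (Suc n)) * ((2 * n + 1) * fact (2 * n))" by (intro mult_left_mono) auto
        also have "\<dots> = fact (2 * Suc n)" by (simp add: algebra_simps)
        finally show ?case .
      qed simp
      then have "x ^ (2 * n) / fact (2 * n) \<le> x ^ (2 * n) / (2 ^ n * fact n)"
        by (intro divide_left_mono) (auto simp: power_mult)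
      then show "x ^ (2 * n) / fact (2 * n) \<le> (x\<^sup>2 / 2) ^ n / fact n"
        by (simp add: power_divide power_mult)
    qed
    then show ?thesis using cosh_real_pos[of x] by simp
  qed
  then show ?thesis by simp
qed

lemma replica_exp_Suc:
  assumes \<theta>: "\<theta> = pair_theta A C" and b: "real k * pair_c0 A C \<le> b" and \<eta>: "\<eta> > 0"
  shows "replica_exp (Suc k) \<eta> \<le> exp (b + \<eta>) * replica_exp k (\<eta> + (\<theta> + 2 * \<eta>)\<^sup>2 / 2)"
proof -
  interpret P: bm_prob "PS k" by (rule bm_prob_pw)
  interpret R: bm_prob "pw {1..k}" by (rule bm_prob_pw)
  define \<eta>' where "\<eta>' = \<eta> + (\<theta> + 2 * \<eta>)\<^sup>2 / 2"
  have S: "overlap (Suc k) (x(Suc k := u)) (x'(Suc k := u')) = overlap k x x' + u * u'" for x x' u u'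
  proof -
    have "(\<Sum>j\<in>{1..k}. (x(Suc k := u)) j * (x'(Suc k := u')) j) = overlap k x x'"
      unfolding overlap_def by (intro sum.cong) auto
    then show ?thesis unfolding overlap_def by simp
  qed
  have row: "(\<integral>y. (\<Sum>x\<in>spin_vecs (Suc k). \<Sum>x'\<in>spin_vecs (Suc k). wt (Suc k) (glue k z y) x * wt (Suc k) (glue k z y) x' * exp (\<eta> * (overlap (Suc k) x x')\<^sup>2)) \<partial>pw {1..k}) \<le>
     exp (b + \<eta>) * (\<Sum>x\<in>spin_vecs k. \<Sum>x'\<in>spin_vecs k. wt k z x * wt k z x' * exp (\<eta>' * (overlap k x x')\<^sup>2))" for z
  proof -
    define f where "f x x' u u' y = (wt k z x * rho k u x y / 2) * (wt k z x' * rho k u' x' y / 2) * exp (\<eta> * (overlap k x x' + u * u')\<^sup>2)" for x x' u u' y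
    have bf: "bounded_meas (pw {1..k}) (\<lambda>y. f x x' u u' y)" for x x' u u'
      unfolding f_def by (intro bm)
    have "(\<Sum>x\<in>spin_vecs (Suc k). \<Sum>x'\<in>spin_vecs (Suc k). wt (Suc k) (glue k z y) x * wt (Suc k) (glue k z y) x' * exp (\<eta> * (overlap (Suc k) x x')\<^sup>2)) =
       (\<Sum>x\<in>spin_vecs k. \<Sum>x'\<in>spin_vecs k. (f x x' 1 1 y + f x x' 1 (- 1) y) + (f x x' (- 1) 1 y + f x x' (- 1) (- 1) y))" for y
      unfolding sum_spin_vecs_Suc S f_def
      by (simp add: wt_glue sum.distrib)
    then have "(\<integral>y. (\<Sum>x\<in>spin_vecs (Suc k). \<Sum>x'\<in>spin_vecs (Suc k). wt (Suc k) (glue k z y) x * wt (Suc k) (glue k z y) x' * exp (\<eta> * (overlap (Suc k) x x')\<^sup>2)) \<partial>pw {1..k}) =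
       (\<Sum>x\<in>spin_vecs k. \<Sum>x'\<in>spin_vecs k. ((\<integral>y. f x x' 1 1 y \<partial>pw {1..k}) + (\<integral>y. f x x' 1 (- 1) y \<partial>pw {1..k})) + ((\<integral>y. f x x' (- 1) 1 y \<partial>pw {1..k}) + (\<integral>y. f x x' (- 1) (- 1) y \<partial>pw {1..k})))"
      by (simp add: R.bm_int_sum R.bm_int_add bm bf)
    also have "\<dots> \<le> (\<Sum>x\<in>spin_vecs k. \<Sum>x'\<in>spin_vecs k. exp (b + \<eta>) * (wt k z x * wt k z x' * exp (\<eta>' * (overlap k x x')\<^sup>2)))"
    proof (intro sum_mono)
      fix x x' assume x: "x \<in> spin_vecs k" "x' \<in> spin_vecs k"
      define s where "s = overlap k x x'"
      define q where "q = wt k z x * wt k z x'"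
      have q: "q > 0" using wt_pos[OF x(1)] wt_pos[OF x(2)] by (simp add: q_def)
      have int: "(\<integral>y. f x x' u u' y \<partial>pw {1..k}) = q / 4 * (exp (k * pair_c0 A C) * exp (u * u' * (\<theta> * s))) * exp (\<eta> * (s + u * u')\<^sup>2)"
        if "u \<in> {1, - 1}" "u' \<in> {1, - 1}" for u u'
      proof -
        have feq: "f x x' u u' = (\<lambda>y. (q / 4 * exp (\<eta> * (s + u * u')\<^sup>2)) * (rho k u x y * rho k u' x' y))"
          by (rule ext) (simp add: f_def q_def s_def)
        have "(\<integral>y. rho k u x y * rho k u' x' y \<partial>pw {1..k}) = exp (k * pair_c0 A C) * exp (u * u' * (\<theta> * s))"
          unfolding \<theta> s_def by (rule rho_pair) (use that x spin_vecsD in auto)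
        then show ?thesis unfolding feq by simp
      qed
      have "((\<integral>y. f x x' 1 1 y \<partial>pw {1..k}) + (\<integral>y. f x x' 1 (- 1) y \<partial>pw {1..k})) + ((\<integral>y. f x x' (- 1) 1 y \<partial>pw {1..k}) + (\<integral>y. f x x' (- 1) (- 1) y \<partial>pw {1..k}))
        = q * exp (k * pair_c0 A C) * ((exp (\<theta> * s) * exp (\<eta> * (s + 1)\<^sup>2) + exp (- (\<theta> * s)) * exp (\<eta> * (s - 1)\<^sup>2)) / 2)"
        by (simp add: int) (simp add: field_simps)
      also have "exp (\<theta> * s) * exp (\<eta> * (s + 1)\<^sup>2) + exp (- (\<theta> * s)) * exp (\<eta> * (s - 1)\<^sup>2) = 2 * (exp (\<eta> + \<eta> * s\<^sup>2) * cosh ((\<theta> + 2 * \<eta>) * s))"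
      proof -
        have "\<theta> * s + \<eta> * (s + 1)\<^sup>2 = (\<eta> + \<eta> * s\<^sup>2) + (\<theta> + 2 * \<eta>) * s" "- (\<theta> * s) + \<eta> * (s - 1)\<^sup>2 = (\<eta> + \<eta> * s\<^sup>2) + - ((\<theta> + 2 * \<eta>) * s)"
          by (simp_all add: power2_eq_square algebra_simps)
        then have "exp (\<theta> * s) * exp (\<eta> * (s + 1)\<^sup>2) = exp (\<eta> + \<eta> * s\<^sup>2) * exp ((\<theta> + 2 * \<eta>) * s)"
          "exp (- (\<theta> * s)) * exp (\<eta> * (s - 1)\<^sup>2) = exp (\<eta> + \<eta> * s\<^sup>2) * exp (- ((\<theta> + 2 * \<eta>) * s))"
          by (simp_all only: exp_add[symmetric])
        then show ?thesis unfolding cosh_field_def by (simp only:) (simp add: distrib_left)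
      qed
      also have "q * exp (k * pair_c0 A C) * (2 * (exp (\<eta> + \<eta> * s\<^sup>2) * cosh ((\<theta> + 2 * \<eta>) * s)) / 2) = (q * exp (k * pair_c0 A C) * exp (\<eta> + \<eta> * s\<^sup>2)) * cosh ((\<theta> + 2 * \<eta>) * s)"
        by simp
      also have "\<dots> \<le> (q * exp b * exp (\<eta> + \<eta> * s\<^sup>2)) * exp (((\<theta> + 2 * \<eta>) * s)\<^sup>2 / 2)"
        using q b cosh_real_nonneg by (intro mult_mono cosh_le_exp mult_right_mono mult_left_mono) auto
      also have "\<dots> = exp (b + \<eta>) * (q * exp (\<eta>' * s\<^sup>2))"
      proof -
        have "b + (\<eta> + \<eta> * s\<^sup>2) + ((\<theta> + 2 * \<eta>) * s)\<^sup>2 / 2 = (b + \<eta>) + \<eta>' * s\<^sup>2"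
          unfolding \<eta>'_def power_mult_distrib by (simp add: algebra_simps)
        then have "exp b * exp (\<eta> + \<eta> * s\<^sup>2) * exp (((\<theta> + 2 * \<eta>) * s)\<^sup>2 / 2) = exp (b + \<eta>) * exp (\<eta>' * s\<^sup>2)"
          by (simp only: exp_add[symmetric])
        then show ?thesis by (metis (no_types, opaque_lifting) mult.assoc mult.left_commute)
      qed
      finally show "((\<integral>y. f x x' 1 1 y \<partial>pw {1..k}) + (\<integral>y. f x x' 1 (- 1) y \<partial>pw {1..k})) + ((\<integral>y. f x x' (- 1) 1 y \<partial>pw {1..k}) + (\<integral>y. f x x' (- 1) (- 1) y \<partial>pw {1..k}))
        \<le> exp (b + \<eta>) * (wt k z x * wt k z x' * exp (\<eta>' * (overlap k x x')\<^sup>2))" unfolding q_def s_def .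
    qed
    finally show ?thesis by (simp add: sum_distrib_left)
  qed
  have bS: "bounded_meas (PS n) (\<lambda>z. \<Sum>x\<in>spin_vecs n. \<Sum>x'\<in>spin_vecs n. wt n z x * wt n z x' * exp (e * (overlap n x x')\<^sup>2))" for n e
    by (intro bm)
  have "replica_exp (Suc k) \<eta> = (\<integral>z. (\<integral>y. (\<Sum>x\<in>spin_vecs (Suc k). \<Sum>x'\<in>spin_vecs (Suc k). wt (Suc k) (glue k z y) x * wt (Suc k) (glue k z y) x' * exp (\<eta> * (overlap (Suc k) x x')\<^sup>2)) \<partial>pw {1..k}) \<partial>PS k)"
    unfolding replica_exp_def by (rule row_fubini[OF bS])
  also have "\<dots> \<le> (\<integral>z. exp (b + \<eta>) * (\<Sum>x\<in>spin_vecs k. \<Sum>x'\<in>spin_vecs k. wt k z x * wt k z x' * exp (\<eta>' * (overlap k x x')\<^sup>2)) \<partial>PS k)"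
    using row by (intro integral_mono' bm_integrable[OF prob_space_pw] bm_mult bm_const bS mult_nonneg_nonneg sum_nonneg) (auto intro: less_imp_le wt_pos)
  also have "\<dots> = exp (b + \<eta>) * replica_exp k \<eta>'" unfolding replica_exp_def by simp
  finally show ?thesis unfolding \<eta>'_def .
qed

lemma replica_exp_bound:
  assumes b: "\<And>j. j < k \<Longrightarrow> real j * pair_c0 A C \<le> b" and \<theta>: "\<theta> = pair_theta A C" "\<theta> \<ge> 0"
    and \<eta>: "\<eta> > 0" "real k * (\<theta> + 2 * \<eta>) < 1"
  shows "replica_exp k \<eta> \<le> exp (k * b + k * (\<theta> + 2 * \<eta>) / (2 * (1 - k * (\<theta> + 2 * \<eta>))))"
  using b \<eta>
proof (induction k arbitrary: \<eta>)
  case 0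
  interpret P: bm_prob "PS 0" by (rule bm_prob_pw)
  have "strict_upper_pairs 0 = {}" by (auto simp: strict_upper_pairs_def)
  moreover from this have "measure (pw ({} :: (nat \<times> nat) set)) (space (pw {})) = 1"
    using P.prob_space by simp
  ultimately have "replica_exp 0 \<eta> = 1"
    by (simp add: replica_exp_def spin_vecs_def wt_def overlap_def)
  then show ?case by simp
next
  case (Suc k)
  define \<zeta> where "\<zeta> = \<theta> + 2 * \<eta>"
  define \<eta>' where "\<eta>' = \<eta> + \<zeta>\<^sup>2 / 2"
  have z: "\<zeta> > 0" "(real k + 1) * \<zeta> < 1" using \<theta> Suc.prems by (auto simp: \<zeta>_def add.commute)
  have z': "\<theta> + 2 * \<eta>' = \<zeta> * (1 + \<zeta>)" by (simp add: \<eta>'_def \<zeta>_def power2_eq_square algebra_simps)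
  have pos: "0 < 1 - (real k + 1) * \<zeta>" using z by simp
  have k1: "real k * (\<zeta> * (1 + \<zeta>)) \<le> real k * \<zeta> + \<zeta> * (real k * \<zeta>)" by (simp add: algebra_simps)
  have "real k * \<zeta> < 1" using z by (simp add: algebra_simps)
  then have "\<zeta> * (real k * \<zeta>) \<le> \<zeta> * 1" using z by (intro mult_left_mono) auto
  moreover have "real k * \<zeta> + \<zeta> < 1" using z by (simp add: algebra_simps)
  ultimately have k2: "real k * (\<theta> + 2 * \<eta>') < 1" unfolding z' using k1 by linarith
  have IH: "replica_exp k \<eta>' \<le> exp (k * b + k * (\<theta> + 2 * \<eta>') / (2 * (1 - k * (\<theta> + 2 * \<eta>'))))"
    using Suc.prems z k2 by (intro Suc.IH) (auto simp: \<eta>'_def intro!: add_pos_nonneg)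
  have "k * (\<theta> + 2 * \<eta>') / (2 * (1 - k * (\<theta> + 2 * \<eta>'))) \<le> k * \<zeta> / (2 * (1 - (real k + 1) * \<zeta>))"
  proof -
    have d: "0 < 1 - k * (\<theta> + 2 * \<eta>')" using k2 by simp
    have "(k * (\<theta> + 2 * \<eta>')) * (2 * (1 - (real k + 1) * \<zeta>)) \<le> (k * \<zeta>) * (2 * (1 - k * (\<theta> + 2 * \<eta>')))"
    proof -
      have "(k * \<zeta>) * (2 * (1 - k * (\<theta> + 2 * \<eta>'))) - (k * (\<theta> + 2 * \<eta>')) * (2 * (1 - (real k + 1) * \<zeta>)) = 2 * k * \<zeta> ^ 3"
        unfolding z' by (simp add: algebra_simps power3_eq_cube)
      moreover have "0 \<le> 2 * k * \<zeta> ^ 3" using z by simp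
      ultimately show ?thesis by linarith
    qed
    moreover have "p / q \<le> r / t" if "p * t \<le> r * q" "0 < q" "0 < t" for p q r t :: real
      using that by (simp add: field_simps)
    ultimately show ?thesis using d pos by simp
  qed
  moreover have "\<eta> \<le> \<zeta> / (2 * (1 - (real k + 1) * \<zeta>))"
  proof -
    have "\<eta> \<le> \<zeta> / 2" using \<theta> by (simp add: \<zeta>_def)
    also have "\<dots> \<le> \<zeta> / (2 * (1 - (real k + 1) * \<zeta>))"
      using z pos by (intro divide_left_mono) auto
    finally show ?thesis .
  qed
  ultimately have "(b + \<eta>) + (k * b + k * (\<theta> + 2 * \<eta>') / (2 * (1 - k * (\<theta> + 2 * \<eta>')))) \<le>
     (real k + 1) * b + (k * \<zeta> / (2 * (1 - (real k + 1) * \<zeta>)) + \<zeta> / (2 * (1 - (real k + 1) * \<zeta>)))"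
    by (simp add: algebra_simps)
  also have "\<dots> = (real k + 1) * b + (real k + 1) * \<zeta> / (2 * (1 - (real k + 1) * \<zeta>))"
    by (simp add: add_divide_distrib[symmetric] algebra_simps)
  finally have ex: "(b + \<eta>) + (k * b + k * (\<theta> + 2 * \<eta>') / (2 * (1 - k * (\<theta> + 2 * \<eta>')))) \<le> (real k + 1) * b + (real k + 1) * \<zeta> / (2 * (1 - (real k + 1) * \<zeta>))" .
  have "replica_exp (Suc k) \<eta> \<le> exp (b + \<eta>) * replica_exp k \<eta>'"
    unfolding \<eta>'_def \<zeta>_def by (rule replica_exp_Suc[OF \<theta>(1)]) (use Suc.prems in auto)
  also have "\<dots> \<le> exp (b + \<eta>) * exp (k * b + k * (\<theta> + 2 * \<eta>') / (2 * (1 - k * (\<theta> + 2 * \<eta>'))))"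
    using IH by (intro mult_left_mono) auto
  also have "\<dots> \<le> exp ((real k + 1) * b + (real k + 1) * \<zeta> / (2 * (1 - (real k + 1) * \<zeta>)))"
    unfolding exp_add[symmetric] using ex by simp
  finally show ?case by (simp add: \<zeta>_def add.commute)
qed

end

section \<open>Below the threshold\<close>

context edge_law
begin

lemma glue_pair_measurable: "(\<lambda>(z, y). glue k z y) \<in> PS k \<Otimes>\<^sub>M pw {1..k} \<rightarrow>\<^sub>M PS (Suc k)"
proof -
  have 1: "(\<lambda>y. \<lambda>e\<in>new_pairs k. y (fst e)) \<in> pw {1..k} \<rightarrow>\<^sub>M pw (new_pairs k)"
    by (rule measurable_restrict) (auto simp: new_pairs_def)
  have "(\<lambda>p. (fst p, \<lambda>e\<in>new_pairs k. snd p (fst e))) \<in> PS k \<Otimes>\<^sub>M pw {1..k} \<rightarrow>\<^sub>M PS k \<Otimes>\<^sub>M pw (new_pairs k)"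
    by (rule measurable_Pair) (simp, rule measurable_compose[OF measurable_snd 1])
  from measurable_compose[OF this measurable_merge] show ?thesis
    unfolding glue_def sup_Suc(1) by (simp add: case_prod_beta')
qed

lemma bm_row_integral:
  assumes "bounded_meas (PS (Suc k)) f"
  shows "bounded_meas (PS k) (\<lambda>z. \<integral>y. f (glue k z y) \<partial>pw {1..k})"
proof -
  interpret R: bm_prob "pw {1..k}" by (rule bm_prob_pw)
  obtain a where a: "\<And>z. z \<in> space (PS (Suc k)) \<Longrightarrow> \<bar>f z\<bar> \<le> a" using bounded_measE[OF assms] by blast
  show ?thesis
  proof (rule bounded_measI[of _ _ a])
    have "(\<lambda>(z, y). f (glue k z y)) \<in> borel_measurable (PS k \<Otimes>\<^sub>M pw {1..k})"
      using measurable_compose[OF glue_pair_measurable bounded_meas_measurable[OF assms]] by (simp add: case_prod_beta')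
    then show "(\<lambda>z. \<integral>y. f (glue k z y) \<partial>pw {1..k}) \<in> borel_measurable (PS k)"
      by (rule R.borel_measurable_lebesgue_integral)
    fix z assume z: "z \<in> space (PS k)"
    have "\<bar>f (glue k z y)\<bar> \<le> a" if "y \<in> space (pw {1..k})" for y
      by (rule a) (rule measurable_space[OF glue_measurable[OF z] that])
    then have "\<bar>\<integral>y. f (glue k z y) \<partial>pw {1..k}\<bar> \<le> (\<integral>y. a \<partial>pw {1..k})"
      by (intro R.bm_int_abs_mono bm bm_compose[OF assms glue_measurable[OF z]])
    then show "\<bar>\<integral>y. f (glue k z y) \<partial>pw {1..k}\<bar> \<le> a" by simp
  qed
qed

end

text \<open>Every row up to the size \<open>N\<close> satisfies the hypotheses of a row step with the same constant
  \<open>B\<close>. The bound \<open>\<beta>\<close> separates \<open>N * C\<close> from the threshold \<open>1\<close>, and \<open>\<eta>\<close>, also of order \<open>1 / N\<close>,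
  uses up part of the remaining gap for the exponential moment of the overlap.\<close>

locale below_threshold = edge_law +
  fixes N :: nat and B \<beta> \<eta> :: real
  assumes NcB: "real N * c \<le> B" and eta_pos: "\<eta> > 0" and beta: "\<beta> < 1"
    and NC_beta: "real N * C \<le> \<beta>" and Nzeta: "real N * (pair_theta A C + 2 * \<eta>) \<le> \<beta>"
begin

lemma kcB: "k \<le> N \<Longrightarrow> real k * c \<le> B"
  using NcB c_pos mult_right_mono[of "real k" "real N" c] by linarith

lemma B0: "0 \<le> B" using kcB[of 0] by simp

lemma theta_nonneg: "0 \<le> pair_theta A C"
proof -
  have "ln (1 + A - C) \<le> ln (1 + A + C)" using A_bounds C_bounds by simp
  then show ?thesis by (simp add: pair_theta_def)
qed

lemma beta0: "0 \<le> \<beta>" using NC_beta C_bounds mult_nonneg_nonneg[of "real N" C] by linarith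

definition KE where "KE = (1 + c / \<eta> + 2 * (c / \<eta>)\<^sup>2) * exp (3 * B\<^sup>2 + \<beta> / (2 * (1 - \<beta>)))"

definition energy where "energy k z = row_step.energy c k (spin_vecs k) (wt k z)"

lemma energy_eq:
  assumes "k \<le> N"
  shows "energy k z = (LR k z)\<^sup>2 + c * (\<Sum>i\<in>{1..k}. \<Sum>j\<in>{1..k}. (corr k z i j)\<^sup>2) + c\<^sup>2 * (\<Sum>x\<in>spin_vecs k. \<Sum>x'\<in>spin_vecs k. wt k z x * wt k z x' * overlap k x x' ^ 4)"
proof -
  interpret R: row_step \<nu> ev od c k "spin_vecs k" "wt k z" B by (rule row_step_wt[OF kcB[OF assms]])
  show ?thesis unfolding energy_def R.energy_def row_observables[OF kcB[OF assms]] R.Lam4_def ..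
qed

lemma bm_energy [bm]: "k \<le> N \<Longrightarrow> bounded_meas (PS k) (energy k)"
proof -
  assume k: "k \<le> N"
  have "energy k = (\<lambda>z. (LR k z)\<^sup>2 + c * (\<Sum>i\<in>{1..k}. \<Sum>j\<in>{1..k}. (corr k z i j)\<^sup>2) + c\<^sup>2 * (\<Sum>x\<in>spin_vecs k. \<Sum>x'\<in>spin_vecs k. wt k z x * wt k z x' * overlap k x x' ^ 4))"
    by (rule ext) (rule energy_eq[OF k])
  then show "bounded_meas (PS k) (energy k)" by (simp only:) (intro bm)
qed

text \<open>The quartic polynomial in the overlap is dominated by the exponential of its square.\<close>

lemma energy_int:
  assumes k: "k \<le> N"
  shows "(\<integral>z. energy k z \<partial>PS k) \<le> KE"
proof -
  interpret P: bm_prob "PS k" by (rule bm_prob_pw)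
  define q where "q = 1 + c / \<eta> + 2 * (c / \<eta>)\<^sup>2"
  have q: "q \<ge> 0" using c_pos eta_pos by (auto simp: q_def intro!: add_nonneg_nonneg)
  have pt: "energy k z \<le> q * (\<Sum>x\<in>spin_vecs k. \<Sum>x'\<in>spin_vecs k. wt k z x * wt k z x' * exp (\<eta> * (overlap k x x')\<^sup>2))" for z
  proof -
    interpret R: row_step \<nu> ev od c k "spin_vecs k" "wt k z" B by (rule row_step_wt[OF kcB[OF k]])
    have "energy k z = (\<Sum>x\<in>spin_vecs k. \<Sum>x'\<in>spin_vecs k. wt k z x * wt k z x' * (1 + c * (overlap k x x')\<^sup>2 + c\<^sup>2 * overlap k x x' ^ 4))"
      unfolding energy_def R.energy_def R.L_sq R.Lam2_eq R.Lam4_def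
      by (simp add: sum_distrib_left sum.distrib[symmetric] algebra_simps)
    also have "\<dots> \<le> (\<Sum>x\<in>spin_vecs k. \<Sum>x'\<in>spin_vecs k. wt k z x * wt k z x' * (q * exp (\<eta> * (overlap k x x')\<^sup>2)))"
    proof (rule R.sum_pair_mono)
      fix x x' :: "nat \<Rightarrow> real"
      define t where "t = \<eta> * (overlap k x x')\<^sup>2"
      have t: "t \<ge> 0" using eta_pos by (simp add: t_def)
      have e: "1 \<le> exp t" "t \<le> exp t" "t\<^sup>2 \<le> 2 * exp t"
      proof -
        have "0 \<le> t\<^sup>2" by simp
        then show "1 \<le> exp t" "t \<le> exp t" "t\<^sup>2 \<le> 2 * exp t"
          using t exp_lower_Taylor_quadratic[OF t] by linarith+
      qed
      have "1 + c * (overlap k x x')\<^sup>2 + c\<^sup>2 * overlap k x x' ^ 4 = 1 + (c / \<eta>) * t + (c / \<eta>)\<^sup>2 * t\<^sup>2"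
        using eta_pos by (simp add: t_def power2_eq_square power4_eq_xxxx)
      also have "\<dots> \<le> exp t + (c / \<eta>) * exp t + (c / \<eta>)\<^sup>2 * (2 * exp t)"
        using e c_pos eta_pos by (intro add_mono mult_left_mono) auto
      also have "\<dots> = q * exp t" by (simp add: q_def algebra_simps)
      finally show "1 + c * (overlap k x x')\<^sup>2 + c\<^sup>2 * overlap k x x' ^ 4 \<le> q * exp (\<eta> * (overlap k x x')\<^sup>2)" by (simp add: t_def)
    qed
    also have "\<dots> = q * (\<Sum>x\<in>spin_vecs k. \<Sum>x'\<in>spin_vecs k. wt k z x * wt k z x' * exp (\<eta> * (overlap k x x')\<^sup>2))"
      by (simp add: sum_distrib_left mult_ac)
    finally show ?thesis .
  qed
  have "(\<integral>z. energy k z \<partial>PS k) \<le> (\<integral>z. q * (\<Sum>x\<in>spin_vecs k. \<Sum>x'\<in>spin_vecs k. wt k z x * wt k z x' * exp (\<eta> * (overlap k x x')\<^sup>2)) \<partial>PS k)"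
    by (intro P.bm_int_mono pt bm bm_energy[OF k])
  also have "\<dots> = q * replica_exp k \<eta>" by (simp add: replica_exp_def)
  also have "\<dots> \<le> q * exp (3 * B\<^sup>2 + \<beta> / (2 * (1 - \<beta>)))"
  proof (rule mult_left_mono[OF _ q])
    define \<zeta> where "\<zeta> = pair_theta A C + 2 * \<eta>"
    have z0: "\<zeta> > 0" using theta_nonneg eta_pos by (simp add: \<zeta>_def add_nonneg_pos)
    have kz: "real k * \<zeta> \<le> \<beta>" using Nzeta k z0 mult_right_mono[of "real k" "real N" \<zeta>] unfolding \<zeta>_def by linarith
    have c0: "pair_c0 A C \<le> 3 * c\<^sup>2"
    proof -
      have "c ^ 4 \<le> c\<^sup>2 * (1 / 16)"
      proof -
        have "c\<^sup>2 \<le> 1 / 16" using power_mono[OF c_le, of 2] c_pos by (simp add: power2_eq_square)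
        then have "c\<^sup>2 * c\<^sup>2 \<le> c\<^sup>2 * (1 / 16)" by (intro mult_left_mono) auto
        then show ?thesis by (simp add: power2_eq_square power4_eq_xxxx)
      qed
      moreover have "0 \<le> C\<^sup>2" "0 \<le> c\<^sup>2" by auto
      ultimately show ?thesis using pair_c0_bound[OF A_bounds C_bounds(1,2) c_le] A_bounds by linarith
    qed
    have b: "real j * pair_c0 A C \<le> real N * (3 * c\<^sup>2)" if "j < k" for j
    proof -
      have "real j * pair_c0 A C \<le> real j * (3 * c\<^sup>2)" using c0 by (intro mult_left_mono) auto
      also have "\<dots> \<le> real N * (3 * c\<^sup>2)" using that k by (intro mult_right_mono) auto
      finally show ?thesis .
    qed
    have "replica_exp k \<eta> \<le> exp (k * (real N * (3 * c\<^sup>2)) + k * (pair_theta A C + 2 * \<eta>) / (2 * (1 - k * (pair_theta A C + 2 * \<eta>))))"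
      using kz beta theta_nonneg eta_pos by (intro replica_exp_bound b) (auto simp: \<zeta>_def)
    also have "\<dots> \<le> exp (3 * B\<^sup>2 + \<beta> / (2 * (1 - \<beta>)))"
    proof -
      have "k * (real N * (3 * c\<^sup>2)) = 3 * ((k * c) * (real N * c))" by (simp add: power2_eq_square)
      also have "\<dots> \<le> 3 * (B * B)" using kcB[OF k] NcB c_pos B0 by (intro mult_left_mono mult_mono) auto
      finally have 1: "k * (real N * (3 * c\<^sup>2)) \<le> 3 * B\<^sup>2" by (simp add: power2_eq_square)
      have 2: "k * \<zeta> / (2 * (1 - k * \<zeta>)) \<le> \<beta> / (2 * (1 - \<beta>))"
        using kz beta beta0 by (intro frac_le) auto
      show ?thesis using 1 2 by (simp add: \<zeta>_def)
    qed
    finally show "replica_exp k \<eta> \<le> exp (3 * B\<^sup>2 + \<beta> / (2 * (1 - \<beta>)))" .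
  qed
  finally show ?thesis by (simp add: KE_def q_def)
qed

lemma energy_nonneg: "k \<le> N \<Longrightarrow> 0 \<le> energy k z" and LR_sq_le_energy: "k \<le> N \<Longrightarrow> (LR k z)\<^sup>2 \<le> energy k z"
proof -
  assume k: "k \<le> N"
  interpret R: row_step \<nu> ev od c k "spin_vecs k" "wt k z" B by (rule row_step_wt[OF kcB[OF k]])
  show "0 \<le> energy k z" unfolding energy_def by (rule R.energy_ge)
  show "(LR k z)\<^sup>2 \<le> energy k z" unfolding energy_def using R.energy_ge(1) row_observables(1)[OF kcB[OF k]] by simp
qed

lemma KE_nonneg: "0 \<le> KE"
  using c_pos eta_pos by (auto simp: KE_def intro!: add_nonneg_nonneg mult_nonneg_nonneg)

lemma LR_sq_int: "(\<integral>z. (LR N z)\<^sup>2 \<partial>PS N) \<le> KE"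
proof -
  interpret P: bm_prob "PS N" by (rule bm_prob_pw)
  have "(\<integral>z. (LR N z)\<^sup>2 \<partial>PS N) \<le> (\<integral>z. energy N z \<partial>PS N)"
    by (intro P.bm_int_mono bm LR_sq_le_energy) auto
  then show ?thesis using energy_int[of N] by simp
qed

text \<open>A row estimate that holds up to a multiple of the energy survives integration over the
  previous rows.\<close>

lemma integrate_row_bound:
  assumes k: "k \<le> N" and f: "bounded_meas (PS (Suc k)) f" and g: "bounded_meas (PS k) g" and K: "K \<ge> 0"
    and row: "\<And>z. \<bar>(\<integral>y. f (glue k z y) \<partial>pw {1..k}) - g z\<bar> \<le> K * energy k z"
  shows "\<bar>(\<integral>z. f z \<partial>PS (Suc k)) - (\<integral>z. g z \<partial>PS k)\<bar> \<le> K * KE"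
proof -
  interpret P: bm_prob "PS k" by (rule bm_prob_pw)
  note bf = bm_row_integral[OF f]
  have "(\<integral>z. f z \<partial>PS (Suc k)) - (\<integral>z. g z \<partial>PS k) = (\<integral>z. (\<integral>y. f (glue k z y) \<partial>pw {1..k}) - g z \<partial>PS k)"
    unfolding row_fubini[OF f] by (rule P.bm_int_diff[OF bf g, symmetric])
  then have "\<bar>(\<integral>z. f z \<partial>PS (Suc k)) - (\<integral>z. g z \<partial>PS k)\<bar> \<le> (\<integral>z. K * energy k z \<partial>PS k)"
    using P.bm_int_abs_mono[OF bm_diff[OF bf g] bm_mult[OF bm_const bm_energy[OF k]] row] by simp
  also have "\<dots> = K * (\<integral>z. energy k z \<partial>PS k)" by simp
  also have "\<dots> \<le> K * KE" using energy_int[OF k] K by (intro mult_left_mono)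
  finally show ?thesis .
qed

text \<open>Weighted by a function \<open>h\<close> of the likelihood ratio, \<open>J\<close> averages its square and \<open>Z\<close> the squared correlations
  with the last index.\<close>

definition J where "J h k = (\<integral>z. h (LR k z) * (LR k z)\<^sup>2 \<partial>PS k)"
definition Z where "Z h k = (\<integral>z. h (LR k z) * (\<Sum>i\<in>{1..<k}. (corr k z i k)\<^sup>2) \<partial>PS k)"

text \<open>The ratio of \<open>Z\<close> to \<open>J\<close> predicted by the recursion \<open>Z_step\<close> when all errors are dropped and \<open>J\<close> is constant.\<close>

primrec zeta :: "nat \<Rightarrow> real" where
  "zeta 0 = 0" | "zeta (Suc k) = C * k * (1 + zeta k)"

lemma kC_beta: "k \<le> N \<Longrightarrow> real k * C \<le> \<beta>"
  using NC_beta C_bounds mult_right_mono[of "real k" "real N" C] by simp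

lemma zeta_bounds: "k \<le> N \<Longrightarrow> 0 \<le> zeta k \<and> zeta k \<le> \<beta> / (1 - \<beta>)"
proof (induction k)
  case 0 show ?case using beta beta0 by simp
next
  case (Suc k)
  have "C * k * (1 + zeta k) \<le> \<beta> * (1 + \<beta> / (1 - \<beta>))"
    using Suc kC_beta[of k] C_bounds beta0 by (intro mult_mono) (auto simp: mult.commute)
  also have "\<dots> = \<beta> / (1 - \<beta>)" using beta by (simp add: field_simps)
  finally show ?case using Suc C_bounds by simp
qed

lemma gentle_nonneg: "gentle G h \<Longrightarrow> 0 \<le> G"
  unfolding gentle_def by (meson abs_ge_zero order_trans zero_less_one)

lemma bm_h: "gentle G h \<Longrightarrow> bounded_meas (PS k) (\<lambda>z. h (LR k z))"
  by (rule bm_gentle[OF _ bm_LR LR_pos])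

lemma kconst_nonneg: "0 \<le> row_step.kvar B" "0 \<le> row_step.kfrz B" "0 \<le> row_step.ktay B"
proof -
  interpret R: row_step \<nu> ev od c 0 "spin_vecs 0" "wt 0 undefined" B by (rule row_step_wt) (use B0 in simp)
  show 1: "0 \<le> R.kvar" using R.kch_nonneg B0 by (simp add: R.kvar_def)
  show "0 \<le> R.kfrz" using R.ksh_nonneg 1 by (simp add: R.kfrz_def)
  show "0 \<le> R.ktay" using R.kch_nonneg B0 by (simp add: R.ktay_def)
qed

lemma J_step:
  assumes h: "gentle G h" and k: "k \<le> N"
  shows "\<bar>J h (Suc k) - J h k\<bar> \<le> G * (6 * row_step.kvar B + 1) * sqrt c * KE"
  unfolding J_def
proof (rule integrate_row_bound[OF k])
  show "0 \<le> G * (6 * row_step.kvar B + 1) * sqrt c" using gentle_nonneg[OF h] kconst_nonneg c_pos by simp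
  fix z
  interpret R: row_step \<nu> ev od c k "spin_vecs k" "wt k z" B by (rule row_step_wt[OF kcB[OF k]])
  show "\<bar>(\<integral>y. h (LR (Suc k) (glue k z y)) * (LR (Suc k) (glue k z y))\<^sup>2 \<partial>pw {1..k}) - h (LR k z) * (LR k z)\<^sup>2\<bar> \<le> G * (6 * R.kvar + 1) * sqrt c * energy k z"
    using R.freeze_square[OF h] unfolding row_observables[OF kcB[OF k]] energy_def by (simp add: mult.assoc)
qed (intro bm bm_h[OF h])+

text \<open>Freezing \<open>h\<close> before the last row is added turns \<open>Z\<close> into \<open>C\<close> times the average of all squared
  correlations, to which exchangeability applies.\<close>

lemma Z_step:
  assumes h: "gentle G h" and k: "k \<le> N"
  shows "\<bar>Z h (Suc k) - C * k * (J h k + Z h k)\<bar> \<le> G * row_step.kfrz B * sqrt c * KE"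
proof -
  interpret P: bm_prob "PS k" by (rule bm_prob_pw)
  define \<Lambda> where "\<Lambda> z = (\<Sum>i\<in>{1..k}. \<Sum>j\<in>{1..k}. (corr k z i j)\<^sup>2)" for z
  have "C * k * (J h k + Z h k) = C * (\<integral>z. h (LR k z) * \<Lambda> z \<partial>PS k)"
    unfolding J_def Z_def \<Lambda>_def by (subst exchange_overlap[OF bm_h[OF h]]) simp
  also have "\<dots> = (\<integral>z. h (LR k z) * (C * \<Lambda> z) \<partial>PS k)"
    by (subst integral_mult_right_zero[symmetric]) (simp add: mult_ac)
  finally have eq: "C * k * (J h k + Z h k) = (\<integral>z. h (LR k z) * (C * \<Lambda> z) \<partial>PS k)" .
  show ?thesis unfolding eq unfolding Z_def
  proof (rule integrate_row_bound[OF k])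
    show "0 \<le> G * row_step.kfrz B * sqrt c" using gentle_nonneg[OF h] kconst_nonneg c_pos by simp
    show "bounded_meas (PS k) (\<lambda>z. h (LR k z) * (C * \<Lambda> z))" unfolding \<Lambda>_def by (intro bm bm_h[OF h])
    fix z
    interpret R: row_step \<nu> ev od c k "spin_vecs k" "wt k z" B by (rule row_step_wt[OF kcB[OF k]])
    have s: "(\<Sum>i\<in>{1..k}. (R.g i y)\<^sup>2) = (\<Sum>i\<in>{1..<Suc k}. (corr (Suc k) (glue k z y) i (Suc k))\<^sup>2)" for y
      by (rule sum.cong) (auto simp: row_observables(3)[OF kcB[OF k]])
    show "\<bar>(\<integral>y. h (LR (Suc k) (glue k z y)) * (\<Sum>i\<in>{1..<Suc k}. (corr (Suc k) (glue k z y) i (Suc k))\<^sup>2) \<partial>pw {1..k}) - h (LR k z) * (C * \<Lambda> z)\<bar> \<le> G * R.kfrz * sqrt c * energy k z"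
      using R.freeze_field[OF h] unfolding s row_observables(1,2,5)[OF kcB[OF k]] energy_def \<Lambda>_def by (simp add: mult.assoc)
  qed (intro bm bm_h[OF h])
qed

text \<open>Up to a vanishing error, the weighted squared correlations are a deterministic multiple of the weighted
  likelihood ratio squared. The error is contracted by the factor \<open>k * C \<le> \<beta> < 1\<close> in each
  step, hence does not accumulate.\<close>

definition kcon where "kcon = (row_step.kfrz B + \<beta> / (1 - \<beta>) * (6 * row_step.kvar B + 1)) * KE / (1 - \<beta>)"

lemma kcon_nonneg: "0 \<le> kcon"
  using kconst_nonneg KE_nonneg beta beta0 by (auto simp: kcon_def intro!: mult_nonneg_nonneg add_nonneg_nonneg divide_nonneg_nonneg)

lemma concentration:
  assumes h: "gentle G h"
  shows "k \<le> N \<Longrightarrow> \<bar>Z h k - zeta k * J h k\<bar> \<le> G * kcon * sqrt c"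
proof (induction k)
  case 0
  then show ?case using gentle_nonneg[OF h] kcon_nonneg c_pos by (simp add: Z_def)
next
  case (Suc k)
  then have k: "k \<le> N" by simp
  define q where "q = (row_step.kfrz B + \<beta> / (1 - \<beta>) * (6 * row_step.kvar B + 1)) * KE"
  have kq: "kcon = \<beta> * kcon + q"
  proof -
    have "kcon = q / (1 - \<beta>)" by (simp add: kcon_def q_def)
    then show ?thesis using beta by (simp add: field_simps)
  qed
  have "Z h (Suc k) - zeta (Suc k) * J h (Suc k) =
     (Z h (Suc k) - C * k * (J h k + Z h k)) + (k * C) * (Z h k - zeta k * J h k) - zeta (Suc k) * (J h (Suc k) - J h k)"
    by (simp add: algebra_simps)
  moreover have "\<bar>(k * C) * (Z h k - zeta k * J h k)\<bar> \<le> \<beta> * (G * kcon * sqrt c)"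
    unfolding abs_mult using Suc kC_beta[OF k] C_bounds beta0 by (intro mult_mono) auto
  moreover have "\<bar>zeta (Suc k) * (J h (Suc k) - J h k)\<bar> \<le> \<beta> / (1 - \<beta>) * (G * (6 * row_step.kvar B + 1) * sqrt c * KE)"
    unfolding abs_mult using zeta_bounds[OF Suc.prems] J_step[OF h k] beta beta0 by (intro mult_mono) auto
  ultimately have "\<bar>Z h (Suc k) - zeta (Suc k) * J h (Suc k)\<bar> \<le>
     G * row_step.kfrz B * sqrt c * KE + \<beta> * (G * kcon * sqrt c) + \<beta> / (1 - \<beta>) * (G * (6 * row_step.kvar B + 1) * sqrt c * KE)"
    using Z_step[OF h k] by linarith
  also have "\<dots> = G * (\<beta> * kcon + q) * sqrt c" by (simp add: q_def algebra_simps)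
  finally show ?case unfolding kq[symmetric] .
qed

text \<open>The relative conditional variance of the row \<open>k\<close>, and the variance of all rows still to come. Lowering the
  parameter of \<open>bs\<close> from \<open>\<tau> + tail k\<close> to \<open>\<tau> + tail (Suc k)\<close> pays for the row \<open>k\<close>.\<close>

definition sig2 where "sig2 k = k * A + C\<^sup>2 * k * zeta k / 2"
definition tail where "tail k = (\<Sum>j\<in>{k..<N}. sig2 j)"

definition ksig where "ksig = B * (1 + \<beta> / (1 - \<beta>))"

lemma ksig_nonneg: "0 \<le> ksig" using B0 beta beta0 by (simp add: ksig_def)

lemma CkB: "k \<le> N \<Longrightarrow> C\<^sup>2 * k \<le> c * B"
proof -
  assume k: "k \<le> N"
  have "C\<^sup>2 * k \<le> c\<^sup>2 * k" using C_bounds by (intro mult_right_mono power_mono) auto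
  also have "\<dots> = c * (k * c)" by (simp add: power2_eq_square)
  also have "\<dots> \<le> c * B" using kcB[OF k] c_pos by (intro mult_left_mono) auto
  finally show ?thesis .
qed

lemma sig2_bounds:
  assumes k: "k \<le> N"
  shows "0 \<le> sig2 k" "sig2 k \<le> ksig * c"
proof -
  have z: "0 \<le> zeta k" "zeta k \<le> \<beta> / (1 - \<beta>)" using zeta_bounds[OF k] by auto
  show "0 \<le> sig2 k" using z A_bounds by (simp add: sig2_def)
  have "k * A \<le> k * c\<^sup>2" using A_bounds by (intro mult_left_mono) auto
  also have "\<dots> = c * (k * c)" by (simp add: power2_eq_square)
  also have "\<dots> \<le> c * B" using kcB[OF k] c_pos by (intro mult_left_mono) auto
  finally have 1: "k * A \<le> c * B" .
  have "C\<^sup>2 * k * zeta k \<le> c * B * (\<beta> / (1 - \<beta>))"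
    by (rule mult_mono[OF CkB[OF k] z(2)]) (use c_pos B0 z in auto)
  moreover have "0 \<le> C\<^sup>2 * k * zeta k" using z by simp
  ultimately have "sig2 k \<le> c * B + c * B * (\<beta> / (1 - \<beta>))" unfolding sig2_def using 1 by linarith
  then show "sig2 k \<le> ksig * c" by (simp add: ksig_def algebra_simps)
qed

lemma tail_bounds: "0 \<le> tail k" "tail k \<le> B * ksig"
proof -
  show "0 \<le> tail k" unfolding tail_def by (intro sum_nonneg sig2_bounds) auto
  have "tail k \<le> (\<Sum>j\<in>{k..<N}. ksig * c)" unfolding tail_def by (intro sum_mono sig2_bounds) auto
  also have "\<dots> = (N - k) * (ksig * c)" by simp
  also have "\<dots> \<le> real N * (ksig * c)" using ksig_nonneg c_pos by (intro mult_right_mono) auto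
  also have "\<dots> = (real N * c) * ksig" by simp
  also have "\<dots> \<le> B * ksig" using NcB ksig_nonneg by (intro mult_right_mono) auto
  finally show "tail k \<le> B * ksig" .
qed

definition kstep where "kstep G Kv = G * row_step.ktay B * KE + Kv * ksig\<^sup>2 + B * (G * kcon)"

text \<open>The gain in the first argument, half the second derivative times \<open>row_var\<close>, and the loss in the second
  argument agree up to a multiple of \<open>Z - zeta k * J\<close>, which \<open>concentration\<close> makes small. The error
  \<open>c * sqrt c\<close> is summable over \<open>N\<close> rows because \<open>c\<close> has order \<open>1 / N\<close>.\<close>

lemma bs_row_step:
  assumes tau: "\<tau> > 0"
    and G: "\<And>v. \<tau> \<le> v \<Longrightarrow> v \<le> \<tau> + B * ksig \<Longrightarrow> gentle G (\<lambda>l. bs_gamma l v)"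
    and Kv: "0 \<le> Kv" "\<And>l v s. l > 0 \<Longrightarrow> \<tau> \<le> v \<Longrightarrow> 0 \<le> s \<Longrightarrow> \<bar>bs l (v + s) - bs l v - s * (l\<^sup>2 * bs_gamma l v / 2)\<bar> \<le> Kv * s\<^sup>2"
    and k: "k < N"
  shows "\<bar>(\<integral>z. bs (LR (Suc k) z) (\<tau> + tail (Suc k)) \<partial>PS (Suc k)) - (\<integral>z. bs (LR k z) (\<tau> + tail k) \<partial>PS k)\<bar> \<le> kstep G Kv * (c * sqrt c)"
proof -
  interpret P: bm_prob "PS k" by (rule bm_prob_pw)
  have kN: "k \<le> N" using k by simp
  define v where "v = \<tau> + tail (Suc k)"
  define s where "s = sig2 k"
  define h where "h l = bs_gamma l v" for l
  have ts: "\<tau> + tail k = v + s" using k by (simp add: v_def s_def tail_def sum.atLeast_Suc_lessThan)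
  have v: "\<tau> \<le> v" "v \<le> \<tau> + B * ksig" "v > 0" using tail_bounds[of "Suc k"] tau by (auto simp: v_def)
  have h: "gentle G h" unfolding h_def[abs_def] by (rule G[OF v(1,2)])
  have G0: "0 \<le> G" by (rule gentle_nonneg[OF h])
  have sb: "0 \<le> s" "s \<le> ksig * c" using sig2_bounds[OF kN] by (auto simp: s_def)
  have cc: "c \<le> sqrt c" using c_pos c_le real_le_rsqrt[of c c] mult_right_mono[of c 1 c] by (simp add: power2_eq_square)
  define \<Lambda> where "\<Lambda> z = (\<Sum>i\<in>{1..k}. \<Sum>j\<in>{1..k}. (corr k z i j)\<^sup>2)" for z
  define rv where "rv z = (k * A - k * C\<^sup>2 / 2) * (LR k z)\<^sup>2 + C\<^sup>2 / 2 * \<Lambda> z" for z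
  have brv: "bounded_meas (PS k) rv" unfolding rv_def[abs_def] \<Lambda>_def by (intro bm)
  have b\<Lambda>: "bounded_meas (PS k) \<Lambda>" unfolding \<Lambda>_def[abs_def] by (intro bm)
  note bh = bm_h[OF h]
  have 1: "\<bar>(\<integral>z. bs (LR (Suc k) z) v \<partial>PS (Suc k)) - (\<integral>z. bs (LR k z) v + h (LR k z) / 2 * rv z \<partial>PS k)\<bar> \<le> G * row_step.ktay B * (c * sqrt c) * KE"
  proof (rule integrate_row_bound[OF kN])
    show "0 \<le> G * row_step.ktay B * (c * sqrt c)" using G0 kconst_nonneg c_pos by simp
    fix z
    interpret R: row_step \<nu> ev od c k "spin_vecs k" "wt k z" B by (rule row_step_wt[OF kcB[OF kN]])
    have "R.row_var = rv z" unfolding R.row_var_def rv_def \<Lambda>_def row_observables[OF kcB[OF kN]] ..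
    then show "\<bar>(\<integral>y. bs (LR (Suc k) (glue k z y)) v \<partial>pw {1..k}) - (bs (LR k z) v + h (LR k z) / 2 * rv z)\<bar> \<le> G * R.ktay * (c * sqrt c) * energy k z"
      using R.row_taylor[OF v(3) h[unfolded h_def[abs_def]]] unfolding row_observables[OF kcB[OF kN]] energy_def h_def
      by (simp add: algebra_simps)
  qed (intro bm bh brv)+
  have 2: "\<bar>(\<integral>z. bs (LR k z) (v + s) \<partial>PS k) - (\<integral>z. bs (LR k z) v + s * (h (LR k z) * (LR k z)\<^sup>2) / 2 \<partial>PS k)\<bar> \<le> Kv * s\<^sup>2"
  proof -
    have "(\<integral>z. bs (LR k z) (v + s) \<partial>PS k) - (\<integral>z. bs (LR k z) v + s * (h (LR k z) * (LR k z)\<^sup>2) / 2 \<partial>PS k) =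
       (\<integral>z. bs (LR k z) (v + s) - (bs (LR k z) v + s * (h (LR k z) * (LR k z)\<^sup>2) / 2) \<partial>PS k)"
      by (rule P.bm_int_diff[symmetric]) (intro bm bh)+
    moreover have "\<bar>\<integral>z. bs (LR k z) (v + s) - (bs (LR k z) v + s * (h (LR k z) * (LR k z)\<^sup>2) / 2) \<partial>PS k\<bar> \<le> (\<integral>z. Kv * s\<^sup>2 \<partial>PS k)"
    proof (rule P.bm_int_abs_mono)
      fix z
      show "\<bar>bs (LR k z) (v + s) - (bs (LR k z) v + s * (h (LR k z) * (LR k z)\<^sup>2) / 2)\<bar> \<le> Kv * s\<^sup>2"
        using Kv(2)[OF LR_pos v(1) sb(1), of k z] by (simp add: h_def algebra_simps)
    qed (intro bm bh)+
    ultimately show ?thesis by simp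
  qed
  have "Kv * s\<^sup>2 \<le> Kv * (ksig\<^sup>2 * (c * sqrt c))"
  proof (rule mult_left_mono[OF _ Kv(1)])
    have "s\<^sup>2 \<le> (ksig * c)\<^sup>2" using sb by (intro power_mono) auto
    also have "\<dots> = ksig\<^sup>2 * (c * c)" by (simp add: power2_eq_square)
    also have "\<dots> \<le> ksig\<^sup>2 * (c * sqrt c)" using cc c_pos by (intro mult_left_mono) auto
    finally show "s\<^sup>2 \<le> ksig\<^sup>2 * (c * sqrt c)" .
  qed
  with 2 have 2: "\<bar>(\<integral>z. bs (LR k z) (v + s) \<partial>PS k) - (\<integral>z. bs (LR k z) v + s * (h (LR k z) * (LR k z)\<^sup>2) / 2 \<partial>PS k)\<bar> \<le> Kv * (ksig\<^sup>2 * (c * sqrt c))"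
    by linarith
  have 3: "(\<integral>z. bs (LR k z) v + h (LR k z) / 2 * rv z \<partial>PS k) - (\<integral>z. bs (LR k z) v + s * (h (LR k z) * (LR k z)\<^sup>2) / 2 \<partial>PS k) = C\<^sup>2 * k / 4 * (Z h k - zeta k * J h k)"
  proof -
    have a: "(\<integral>z. bs (LR k z) v + h (LR k z) / 2 * rv z \<partial>PS k) = (\<integral>z. bs (LR k z) v \<partial>PS k) + (\<integral>z. h (LR k z) / 2 * rv z \<partial>PS k)"
      by (rule P.bm_int_add) (intro bm bh brv)+
    have b: "(\<integral>z. bs (LR k z) v + s * (h (LR k z) * (LR k z)\<^sup>2) / 2 \<partial>PS k) = (\<integral>z. bs (LR k z) v \<partial>PS k) + s * J h k / 2"
      by (subst P.bm_int_add) (auto intro!: bm bh simp: J_def)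
    have "(\<integral>z. h (LR k z) / 2 * rv z \<partial>PS k) = (\<integral>z. (k * A - k * C\<^sup>2 / 2) / 2 * (h (LR k z) * (LR k z)\<^sup>2) + C\<^sup>2 / 4 * (h (LR k z) * \<Lambda> z) \<partial>PS k)"
      by (intro lint_cong refl) (simp add: rv_def field_simps)
    also have "\<dots> = (k * A - k * C\<^sup>2 / 2) / 2 * J h k + C\<^sup>2 / 4 * (\<integral>z. h (LR k z) * \<Lambda> z \<partial>PS k)"
      unfolding J_def by (subst P.bm_int_add) (auto intro!: bm bh b\<Lambda>)
    also have "(\<integral>z. h (LR k z) * \<Lambda> z \<partial>PS k) = k * (J h k + Z h k)"
      unfolding J_def Z_def \<Lambda>_def by (rule exchange_overlap[OF bh])
    finally have d: "(\<integral>z. h (LR k z) / 2 * rv z \<partial>PS k) = (k * A - k * C\<^sup>2 / 2) / 2 * J h k + C\<^sup>2 / 4 * (k * (J h k + Z h k))" .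
    show ?thesis unfolding a b d unfolding s_def sig2_def by (simp add: field_simps)
  qed
  have 4: "\<bar>C\<^sup>2 * k / 4 * (Z h k - zeta k * J h k)\<bar> \<le> (c * B) * (G * kcon * sqrt c)"
  proof -
    have "C\<^sup>2 * k / 4 \<le> c * B"
      using CkB[OF kN] C_bounds c_pos B0 mult_nonneg_nonneg[of c B] by linarith
    then show ?thesis unfolding abs_mult using concentration[OF h kN] c_pos B0 by (intro mult_mono) auto
  qed
  have "\<bar>(\<integral>z. bs (LR (Suc k) z) v \<partial>PS (Suc k)) - (\<integral>z. bs (LR k z) (v + s) \<partial>PS k)\<bar> \<le>
     G * row_step.ktay B * (c * sqrt c) * KE + Kv * (ksig\<^sup>2 * (c * sqrt c)) + (c * B) * (G * kcon * sqrt c)"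
    using 1 2 3 4 by linarith
  also have "\<dots> = kstep G Kv * (c * sqrt c)" by (simp add: kstep_def algebra_simps)
  finally show ?thesis unfolding ts v_def[symmetric] .
qed

theorem off_diagonal_bs:
  assumes tau: "\<tau> > 0"
    and G: "\<And>v. \<tau> \<le> v \<Longrightarrow> v \<le> \<tau> + B * ksig \<Longrightarrow> gentle G (\<lambda>l. bs_gamma l v)"
    and Kv: "0 \<le> Kv" "\<And>l v s. l > 0 \<Longrightarrow> \<tau> \<le> v \<Longrightarrow> 0 \<le> s \<Longrightarrow> \<bar>bs l (v + s) - bs l v - s * (l\<^sup>2 * bs_gamma l v / 2)\<bar> \<le> Kv * s\<^sup>2"
  shows "\<bar>(\<integral>z. bs (LR N z) \<tau> \<partial>PS N) - bs 1 (\<tau> + tail 0)\<bar> \<le> B * kstep G Kv * sqrt c"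
proof -
  define u where "u k = (\<integral>z. bs (LR k z) (\<tau> + tail k) \<partial>PS k)" for k
  have ks: "0 \<le> kstep G Kv"
  proof -
    have "gentle G (\<lambda>l. bs_gamma l \<tau>)" using B0 ksig_nonneg by (intro G) auto
    then have "0 \<le> G" by (rule gentle_nonneg)
    then show ?thesis unfolding kstep_def using kconst_nonneg KE_nonneg Kv B0 kcon_nonneg by simp
  qed
  have "\<bar>u k - u 0\<bar> \<le> k * (kstep G Kv * (c * sqrt c))" if "k \<le> N" for k
    using that
  proof (induction k)
    case (Suc k)
    have "\<bar>u (Suc k) - u k\<bar> \<le> kstep G Kv * (c * sqrt c)"
      unfolding u_def using Suc.prems by (intro bs_row_step[OF tau G Kv]) auto
    then have "\<bar>u (Suc k) - u 0\<bar> \<le> k * (kstep G Kv * (c * sqrt c)) + kstep G Kv * (c * sqrt c)"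
      using Suc by linarith
    then show ?case by (simp add: algebra_simps)
  qed simp
  from this[of N] have "\<bar>u N - u 0\<bar> \<le> (real N * c) * (kstep G Kv * sqrt c)" by (simp add: mult_ac)
  also have "\<dots> \<le> B * (kstep G Kv * sqrt c)" using NcB ks c_pos by (intro mult_right_mono) auto
  finally have "\<bar>u N - u 0\<bar> \<le> B * kstep G Kv * sqrt c" by (simp add: mult.assoc)
  moreover have "u 0 = bs 1 (\<tau> + tail 0)"
  proof -
    interpret P: bm_prob "PS 0" by (rule bm_prob_pw)
    show ?thesis by (simp add: u_def LR_0)
  qed
  moreover have "u N = (\<integral>z. bs (LR N z) \<tau> \<partial>PS N)" by (simp add: u_def tail_def)
  ultimately show ?thesis by simp
qed

end

section \<open>The limiting variance\<close>

text \<open>The sum of \<open>C\<^sup>2 * k * zeta k\<close> over the rows is close to a Riemann sum of \<open>u\<^sup>2 / (1 - u)\<close> over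
  \<open>u = C * k\<close>, and \<open>psi\<close> is the antiderivative.\<close>

definition psi :: "real \<Rightarrow> real" where
  "psi u = - ln (1 - u) - u - u\<^sup>2 / 2"

lemma DERIV_psi: "u < 1 \<Longrightarrow> (psi has_real_derivative u\<^sup>2 / (1 - u)) (at u)"
  unfolding psi_def[abs_def]
  by (auto intro!: derivative_eq_intros simp: field_simps power2_eq_square)

lemma psi_increment:
  assumes "0 \<le> u" "0 \<le> d" "u + d \<le> b" "b < 1"
  shows "\<bar>psi (u + d) - psi u - d * (u\<^sup>2 / (1 - u))\<bar> \<le> d\<^sup>2 / (1 - b)\<^sup>2"
proof (cases "d = 0")
  case False
  then have d: "d > 0" using assms by simp
  obtain x where x: "u < x" "x < u + d" "psi (u + d) - psi u = (u + d - u) * (x\<^sup>2 / (1 - x))"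
    using MVT2[of u "u + d" psi "\<lambda>x. x\<^sup>2 / (1 - x)"] d assms DERIV_psi by fastforce
  have xb: "x < 1" "u < 1" "x \<le> b" "u \<le> b" using x assms by auto
  have m1: "(1 - x) * (1 - u) \<le> 1" using x xb assms by (intro mult_le_one) auto
  have eq: "x\<^sup>2 / (1 - x) - u\<^sup>2 / (1 - u) = (x - u) * (1 - (1 - x) * (1 - u)) / ((1 - x) * (1 - u))"
    using xb by (simp add: divide_simps) (simp add: power2_eq_square algebra_simps)
  have "(x - u) * (1 - (1 - x) * (1 - u)) / ((1 - x) * (1 - u)) \<le> (d * 1) / ((1 - b) * (1 - b))"
    using x xb assms m1 by (intro frac_le mult_mono) auto
  moreover have "0 \<le> (x - u) * (1 - (1 - x) * (1 - u)) / ((1 - x) * (1 - u))"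
    using x xb assms m1 by (intro divide_nonneg_nonneg mult_nonneg_nonneg) auto
  ultimately have "\<bar>x\<^sup>2 / (1 - x) - u\<^sup>2 / (1 - u)\<bar> \<le> d / ((1 - b) * (1 - b))"
    unfolding eq by (simp only: abs_of_nonneg mult_1_right)
  then have 1: "\<bar>x\<^sup>2 / (1 - x) - u\<^sup>2 / (1 - u)\<bar> \<le> d / (1 - b)\<^sup>2"
    by (simp only: power2_eq_square[of "1 - b"])
  have "psi (u + d) - psi u - d * (u\<^sup>2 / (1 - u)) = d * (x\<^sup>2 / (1 - x) - u\<^sup>2 / (1 - u))"
    unfolding x(3) by (simp add: algebra_simps)
  then have "\<bar>psi (u + d) - psi u - d * (u\<^sup>2 / (1 - u))\<bar> = d * \<bar>x\<^sup>2 / (1 - x) - u\<^sup>2 / (1 - u)\<bar>"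
    using d by (simp add: abs_mult)
  also have "\<dots> \<le> d * (d / (1 - b)\<^sup>2)" using 1 d by (intro mult_left_mono) auto
  finally show ?thesis by (simp add: power2_eq_square)
qed simp

text \<open>The constants of the off-diagonal estimate written as functions of parameters that stay fixed while the size grows;
  only the quotient of \<open>c\<close> and \<open>\<eta>\<close> enters.\<close>

definition ke0 :: "real \<Rightarrow> real \<Rightarrow> real \<Rightarrow> real" where
  "ke0 r B \<beta> = (1 + r + 2 * r\<^sup>2) * exp (3 * B\<^sup>2 + \<beta> / (2 * (1 - \<beta>)))"

definition kstep0 :: "real \<Rightarrow> real \<Rightarrow> real \<Rightarrow> real \<Rightarrow> real \<Rightarrow> real" where
  "kstep0 B \<beta> E G Kv = G * row_step.ktay B * E + Kv * (B * (1 + \<beta> / (1 - \<beta>)))\<^sup>2 +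
     B * (G * ((row_step.kfrz B + \<beta> / (1 - \<beta>) * (6 * row_step.kvar B + 1)) * E / (1 - \<beta>)))"

context below_threshold
begin

lemma KE_eq: "KE = ke0 (c / \<eta>) B \<beta>"
  unfolding KE_def ke0_def ..

lemma kstep_eq: "kstep G Kv = kstep0 B \<beta> KE G Kv"
  unfolding kstep_def kstep0_def ksig_def kcon_def ..

text \<open>For constant \<open>k\<close> the recursion has the fixed point \<open>C * k / (1 - C * k)\<close>, which moves slowly with
  \<open>k\<close> and is attracting below the threshold.\<close>

lemma zeta_approx:
  assumes "k \<le> N"
  shows "\<bar>zeta k - C * k / (1 - C * k)\<bar> \<le> c / (1 - \<beta>) ^ 3"
  using assms
proof (induction k)
  case 0
  then show ?case using c_pos beta by simp
next
  case (Suc k)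
  define u where "u = C * k"
  have u: "0 \<le> u" "u \<le> \<beta>" "u + C \<le> \<beta>"
    using kC_beta[of k] kC_beta[of "Suc k"] Suc.prems C_bounds by (auto simp: u_def algebra_simps)
  have k1: "C * real (Suc k) = u + C" by (simp add: u_def algebra_simps)
  have eq: "zeta (Suc k) - (u + C) / (1 - (u + C)) = u * (zeta k - u / (1 - u)) - C / ((1 - (u + C)) * (1 - u))"
  proof -
    have "(u + C) / (1 - (u + C)) = u * (1 + u / (1 - u)) + C / ((1 - (u + C)) * (1 - u))"
      using u beta by (simp add: divide_simps) (simp add: algebra_simps)
    then show ?thesis by (simp add: u_def algebra_simps)
  qed
  have 1: "\<bar>u * (zeta k - u / (1 - u))\<bar> \<le> \<beta> * (c / (1 - \<beta>) ^ 3)"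
    unfolding abs_mult using Suc u by (intro mult_mono) (auto simp: u_def)
  have 2: "\<bar>C / ((1 - (u + C)) * (1 - u))\<bar> \<le> c / ((1 - \<beta>) * (1 - \<beta>))"
  proof -
    have p: "0 < (1 - (u + C)) * (1 - u)" using u beta by simp
    have "C / ((1 - (u + C)) * (1 - u)) \<le> c / ((1 - \<beta>) * (1 - \<beta>))"
      using u beta C_bounds c_pos by (intro frac_le mult_mono) auto
    then show ?thesis using p C_bounds by simp
  qed
  have "\<beta> * (c / (1 - \<beta>) ^ 3) + c / ((1 - \<beta>) * (1 - \<beta>)) = c / (1 - \<beta>) ^ 3"
  proof -
    have "(1 - s) * (c / s ^ 3) + c / (s * s) = c / s ^ 3" if "s > 0" for s
      using that by (simp add: field_simps power3_eq_cube)
    from this[of "1 - \<beta>"] show ?thesis using beta by simp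
  qed
  then show ?case unfolding k1 eq using 1 2 by linarith
qed

lemma tail_approx:
  "\<bar>tail 0 - ((real N)\<^sup>2 * A / 2 + psi (real N * C) / 2)\<bar> \<le> (B + B / (1 - \<beta>)\<^sup>2 + B * \<beta> / (1 - \<beta>) ^ 3) * c"
proof -
  define e where "e = c\<^sup>2 / (1 - \<beta>)\<^sup>2 + c * \<beta> * (c / (1 - \<beta>) ^ 3)"
  have "\<bar>(\<Sum>k<n. C\<^sup>2 * k * zeta k) - psi (n * C)\<bar> \<le> n * e" if "n \<le> N" for n
    using that
  proof (induction n)
    case 0
    then show ?case by (simp add: psi_def)
  next
    case (Suc n)
    define u where "u = C * n"
    have u: "0 \<le> u" "u \<le> \<beta>" "u + C \<le> \<beta>"
      using kC_beta[of n] kC_beta[of "Suc n"] Suc.prems C_bounds by (auto simp: u_def algebra_simps)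
    have 1: "\<bar>psi (u + C) - psi u - C * (u\<^sup>2 / (1 - u))\<bar> \<le> c\<^sup>2 / (1 - \<beta>)\<^sup>2"
    proof -
      have "C\<^sup>2 / (1 - \<beta>)\<^sup>2 \<le> c\<^sup>2 / (1 - \<beta>)\<^sup>2" using C_bounds by (intro divide_right_mono power_mono) auto
      then show ?thesis using psi_increment[OF u(1) C_bounds(1) u(3) beta] by linarith
    qed
    have 2: "\<bar>C\<^sup>2 * n * zeta n - C * (u\<^sup>2 / (1 - u))\<bar> \<le> c * \<beta> * (c / (1 - \<beta>) ^ 3)"
    proof -
      have "C\<^sup>2 * n * zeta n - C * (u\<^sup>2 / (1 - u)) = (C * u) * (zeta n - u / (1 - u))"
        by (simp add: u_def power2_eq_square algebra_simps)
      then have "\<bar>C\<^sup>2 * n * zeta n - C * (u\<^sup>2 / (1 - u))\<bar> = (C * u) * \<bar>zeta n - u / (1 - u)\<bar>"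
        using u C_bounds by (simp add: abs_mult)
      also have "\<dots> \<le> (c * \<beta>) * (c / (1 - \<beta>) ^ 3)"
        using zeta_approx[of n] Suc.prems u C_bounds c_pos beta0 by (intro mult_mono) (auto simp: u_def)
      finally show ?thesis .
    qed
    have p: "psi (real (Suc n) * C) = psi (u + C)" "psi (real n * C) = psi u" by (simp_all add: u_def algebra_simps)
    have IH: "\<bar>(\<Sum>k<n. C\<^sup>2 * k * zeta k) - psi u\<bar> \<le> n * e" using Suc unfolding p by simp
    have "\<bar>((\<Sum>k<n. C\<^sup>2 * k * zeta k) + C\<^sup>2 * n * zeta n) - psi (u + C)\<bar> \<le> n * e + e"
      using IH 1 2 unfolding e_def by linarith
    then show ?case unfolding p by (simp add: algebra_simps)
  qed
  from this[of N] have 1: "\<bar>(\<Sum>k<N. C\<^sup>2 * k * zeta k) - psi (real N * C)\<bar> \<le> real N * e" by simp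
  have 2: "(\<Sum>k<N. real k) = real N * (real N - 1) / 2"
    by (induction N) (auto simp: field_simps)
  have "tail 0 = (\<Sum>k<N. real k) * A + (\<Sum>k<N. C\<^sup>2 * k * zeta k) / 2"
    unfolding tail_def sig2_def by (simp add: lessThan_atLeast0 sum.distrib sum_distrib_right sum_divide_distrib)
  then have eq: "tail 0 - ((real N)\<^sup>2 * A / 2 + psi (real N * C) / 2) = ((\<Sum>k<N. C\<^sup>2 * k * zeta k) - psi (real N * C)) / 2 - real N * A / 2"
    unfolding 2 by (simp add: power2_eq_square field_simps)
  have 3: "0 \<le> real N * A" "real N * A \<le> B * c"
  proof -
    show "0 \<le> real N * A" using A_bounds by simp
    have "real N * A \<le> real N * c\<^sup>2" using A_bounds by (intro mult_left_mono) auto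
    also have "\<dots> = (real N * c) * c" by (simp add: power2_eq_square)
    also have "\<dots> \<le> B * c" using NcB c_pos by (intro mult_right_mono) auto
    finally show "real N * A \<le> B * c" .
  qed
  have "\<bar>x / 2 - y / 2\<bar> \<le> r + s" if "\<bar>x\<bar> \<le> r" "0 \<le> y" "y \<le> s" for x y r s :: real
    using that by (simp add: abs_le_iff)
  from this[OF 1 3] have "\<bar>tail 0 - ((real N)\<^sup>2 * A / 2 + psi (real N * C) / 2)\<bar> \<le> real N * e + B * c"
    unfolding eq .
  also have "real N * e = (real N * c) * ((1 / (1 - \<beta>)\<^sup>2 + \<beta> / (1 - \<beta>) ^ 3) * c)"
    by (simp add: e_def power2_eq_square algebra_simps)
  also have "\<dots> \<le> B * ((1 / (1 - \<beta>)\<^sup>2 + \<beta> / (1 - \<beta>) ^ 3) * c)"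
    using NcB beta beta0 c_pos by (intro mult_right_mono) auto
  finally show ?thesis by (simp add: algebra_simps)
qed

end

section \<open>The diagonal entries\<close>

lemma bm_iterated:
  assumes N: "prob_space N" and f: "bounded_meas (M \<Otimes>\<^sub>M N) f"
  shows "bounded_meas M (\<lambda>z. \<integral>t. f (z, t) \<partial>N)"
proof -
  interpret N: bm_prob N by (rule bm_probI[OF N])
  obtain a where a: "\<And>p. p \<in> space (M \<Otimes>\<^sub>M N) \<Longrightarrow> \<bar>f p\<bar> \<le> a" using bounded_measE[OF f] by blast
  show ?thesis
  proof (rule bounded_measI[of _ _ a])
    show "(\<lambda>z. \<integral>t. f (z, t) \<partial>N) \<in> borel_measurable M"
      by (rule N.borel_measurable_lebesgue_integral) (use bounded_meas_measurable[OF f] in simp)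
    fix z assume z: "z \<in> space M"
    have "\<bar>f (z, t)\<bar> \<le> a" if "t \<in> space N" for t using z that by (intro a) (auto simp: space_pair_measure)
    then have "\<bar>\<integral>t. f (z, t) \<partial>N\<bar> \<le> (\<integral>t. a \<partial>N)"
      by (intro N.bm_int_abs_mono bm bm_compose[OF f]) (use z in auto)
    then show "\<bar>\<integral>t. f (z, t) \<partial>N\<bar> \<le> a" by simp
  qed
qed

locale diag_law = noise_law +
  fixes dg :: "real \<Rightarrow> real"
  assumes bm_dg [bm]: "bounded_meas \<nu> dg" and dg_pos: "\<And>t. 0 < 1 + dg t" and int_dg: "(\<integral>t. dg t \<partial>\<nu>) = 0"
begin

definition D where "D = (\<integral>t. (dg t)\<^sup>2 \<partial>\<nu>)"
definition T3 where "T3 = (\<integral>t. \<bar>dg t\<bar> ^ 3 \<partial>\<nu>)"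

lemma D_nonneg: "0 \<le> D" and T3_nonneg: "0 \<le> T3"
  by (simp_all add: D_def T3_def)

lemma diag_sq:
  assumes "finite J"
  shows "(\<integral>t. (\<Prod>j\<in>J. 1 + dg (t j))\<^sup>2 \<partial>pw J) = (1 + D) ^ card J"
proof -
  have "(\<integral>t. (\<Prod>j\<in>J. 1 + dg (t j))\<^sup>2 \<partial>pw J) = (\<integral>t. (\<Prod>j\<in>J. (1 + dg (t j))\<^sup>2) \<partial>pw J)"
    by (simp add: prod_power_distrib)
  also have "\<dots> = (\<Prod>j\<in>J. \<integral>t. (1 + dg t)\<^sup>2 \<partial>\<nu>)"
    using assms by (intro pw_prod) (auto intro!: bm)
  also have "(\<integral>t. (1 + dg t)\<^sup>2 \<partial>\<nu>) = (\<integral>t. 1 + (2 * dg t + (dg t)\<^sup>2) \<partial>\<nu>)"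
    by (intro lint_cong refl) (simp add: power2_eq_square algebra_simps)
  also have "\<dots> = 1 + D" by (simp add: bm_int_add bm int_dg D_def)
  finally show ?thesis by simp
qed

text \<open>A factor \<open>1 + dg t\<close> of mean one shifts the variance parameter by its second moment. The cubic bound on the Taylor
  remainder makes the third absolute moment the error.\<close>

lemma bs_diag_step:
  assumes v: "v > 0" and G: "gentle G (\<lambda>l. bs_gamma l v)" and l: "l > 0"
    and Kv: "\<bar>bs l (v + D) - bs l v - D * (l\<^sup>2 * bs_gamma l v / 2)\<bar> \<le> Kv * D\<^sup>2"
  shows "\<bar>(\<integral>t. bs (l * (1 + dg t)) v \<partial>\<nu>) - bs l (v + D)\<bar> \<le> G * T3 * l\<^sup>2 + Kv * D\<^sup>2"
proof -
  have G0: "0 \<le> G" using G unfolding gentle_def by (meson abs_ge_zero order_trans zero_less_one)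
  define rem where "rem t = bs (l * (1 + dg t)) v - bs l v - bs_delta l v * (l * dg t) - bs_gamma l v * (l * dg t)\<^sup>2 / 2" for t
  have br: "bounded_meas \<nu> rem" unfolding rem_def[abs_def] by (intro bm)
  have pt: "\<bar>rem t\<bar> \<le> G * l\<^sup>2 * \<bar>dg t\<bar> ^ 3" for t
  proof -
    have lp: "l * (1 + dg t) > 0" using l dg_pos by simp
    have e: "l * (1 + dg t) - l = l * dg t" by (simp add: algebra_simps)
    have "\<bar>rem t\<bar> \<le> G * min ((l * dg t)\<^sup>2) (\<bar>l * dg t\<bar> ^ 3 / l)"
      using bs_taylor[OF v G l lp] unfolding e rem_def .
    also have "\<dots> \<le> G * (\<bar>l * dg t\<bar> ^ 3 / l)" using G0 by (intro mult_left_mono) auto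
    also have "\<dots> = G * l\<^sup>2 * \<bar>dg t\<bar> ^ 3" using l by (simp add: abs_mult power_mult_distrib power2_eq_square power3_eq_cube)
    finally show ?thesis .
  qed
  have 1: "\<bar>\<integral>t. rem t \<partial>\<nu>\<bar> \<le> G * l\<^sup>2 * T3"
    using bm_int_abs_mono[OF br _ pt] by (simp add: bm T3_def)
  have "(\<integral>t. rem t \<partial>\<nu>) = (\<integral>t. bs (l * (1 + dg t)) v \<partial>\<nu>) - bs l v - bs_gamma l v * (l\<^sup>2 * D) / 2"
    unfolding rem_def by (simp add: bm_int_diff bm int_dg D_def power_mult_distrib)
  then have "(\<integral>t. bs (l * (1 + dg t)) v \<partial>\<nu>) - bs l (v + D) = (\<integral>t. rem t \<partial>\<nu>) - (bs l (v + D) - bs l v - D * (l\<^sup>2 * bs_gamma l v / 2))"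
    by (simp add: algebra_simps)
  then show ?thesis using 1 Kv by (simp add: algebra_simps)
qed

text \<open>The diagonal factors are removed one by one; the likelihood ratio \<open>l\<close> grows only through second moments
  of the earlier factors.\<close>

lemma bs_diag:
  assumes J: "finite J" and tau: "\<tau> > 0" "\<tau> \<le> v" "v + card J * D \<le> V"
    and G: "\<And>v. \<tau> \<le> v \<Longrightarrow> v \<le> V \<Longrightarrow> gentle G (\<lambda>l. bs_gamma l v)" "0 \<le> G"
    and Kv: "0 \<le> Kv" "\<And>l v s. l > 0 \<Longrightarrow> \<tau> \<le> v \<Longrightarrow> 0 \<le> s \<Longrightarrow> \<bar>bs l (v + s) - bs l v - s * (l\<^sup>2 * bs_gamma l v / 2)\<bar> \<le> Kv * s\<^sup>2"
    and l: "l > 0"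
  shows "\<bar>(\<integral>t. bs (l * (\<Prod>j\<in>J. 1 + dg (t j))) v \<partial>pw J) - bs l (v + card J * D)\<bar> \<le> card J * (G * T3 * l\<^sup>2 * (1 + D) ^ card J + Kv * D\<^sup>2)"
  using J tau(2,3)
proof (induction J arbitrary: v)
  case empty
  interpret P: bm_prob "pw ({} :: 'a set)" by (rule bm_prob_pw)
  show ?case by simp
next
  case (insert i J)
  interpret P: bm_prob "pw J" by (rule bm_prob_pw)
  define pr where "pr t = l * (\<Prod>j\<in>J. 1 + dg (t j))" for t
  have pr: "pr t > 0" for t unfolding pr_def using l dg_pos by (simp add: prod_pos)
  have bpr: "bounded_meas (pw J) pr" unfolding pr_def[abs_def] by (intro bm)
  have bf: "bounded_meas (pw (insert i J)) (\<lambda>t. bs (l * (\<Prod>j\<in>insert i J. 1 + dg (t j))) v)" by (intro bm)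
  have cJ: "card (insert i J) = Suc (card J)" using insert.hyps by simp
  have vb: "v \<le> V" "v + D + card J * D \<le> V" "\<tau> \<le> v + D"
  proof -
    have "0 \<le> card J * D" using D_nonneg by simp
    moreover have "v + (D + card J * D) \<le> V" using insert.prems unfolding cJ by (simp add: algebra_simps)
    ultimately show "v \<le> V" "v + D + card J * D \<le> V" "\<tau> \<le> v + D" using insert.prems(1) D_nonneg by linarith+
  qed
  have upd: "l * (\<Prod>j\<in>insert i J. 1 + dg ((t(i := s)) j)) = pr t * (1 + dg s)" for t s
  proof -
    have "(\<Prod>j\<in>J. 1 + dg ((t(i := s)) j)) = (\<Prod>j\<in>J. 1 + dg (t j))"
      by (rule prod.cong[OF refl]) (use insert.hyps in auto)
    then show ?thesis using insert.hyps by (simp add: pr_def)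
  qed
  have f1: "(\<integral>t. bs (l * (\<Prod>j\<in>insert i J. 1 + dg (t j))) v \<partial>pw (insert i J)) = (\<integral>t. (\<integral>s. bs (pr t * (1 + dg s)) v \<partial>\<nu>) \<partial>pw J)"
    unfolding pw_insert[OF insert.hyps bf] upd ..
  have f2: "\<bar>(\<integral>t. (\<integral>s. bs (pr t * (1 + dg s)) v \<partial>\<nu>) \<partial>pw J) - (\<integral>t. bs (pr t) (v + D) \<partial>pw J)\<bar> \<le> G * T3 * l\<^sup>2 * (1 + D) ^ card J + Kv * D\<^sup>2"
  proof -
    have st: "\<bar>(\<integral>s. bs (pr t * (1 + dg s)) v \<partial>\<nu>) - bs (pr t) (v + D)\<bar> \<le> G * T3 * (pr t)\<^sup>2 + Kv * D\<^sup>2" for t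
      using insert.prems tau(1) vb(1) D_nonneg by (intro bs_diag_step G(1) pr Kv(2)) auto
    have bi: "bounded_meas (pw J) (\<lambda>t. \<integral>s. bs (pr t * (1 + dg s)) v \<partial>\<nu>)"
    proof -
      have "bounded_meas (pw J \<Otimes>\<^sub>M \<nu>) (\<lambda>p. bs (pr (fst p) * (1 + dg (snd p))) v)"
        by (intro bm bm_compose[OF bpr measurable_fst] bm_compose[OF bm_dg measurable_snd])
      from bm_iterated[OF prob_space_axioms this] show ?thesis by simp
    qed
    have bb: "bounded_meas (pw J) (\<lambda>t. bs (pr t) (v + D))" by (intro bm bpr)
    have "\<bar>\<integral>t. (\<integral>s. bs (pr t * (1 + dg s)) v \<partial>\<nu>) - bs (pr t) (v + D) \<partial>pw J\<bar> \<le> (\<integral>t. G * T3 * (pr t)\<^sup>2 + Kv * D\<^sup>2 \<partial>pw J)"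
      by (intro P.bm_int_abs_mono bm_diff bi bb st bm bpr)
    also have "\<dots> = G * T3 * (\<integral>t. (pr t)\<^sup>2 \<partial>pw J) + Kv * D\<^sup>2"
      by (simp add: P.bm_int_add bm bpr)
    also have "(\<integral>t. (pr t)\<^sup>2 \<partial>pw J) = l\<^sup>2 * (1 + D) ^ card J"
      unfolding pr_def power_mult_distrib using diag_sq[OF insert.hyps(1)] by simp
    finally show ?thesis using P.bm_int_diff[OF bi bb] by (simp add: mult.assoc)
  qed
  have f3: "\<bar>(\<integral>t. bs (pr t) (v + D) \<partial>pw J) - bs l (v + D + card J * D)\<bar> \<le> card J * (G * T3 * l\<^sup>2 * (1 + D) ^ card J + Kv * D\<^sup>2)"
    unfolding pr_def by (rule insert.IH[OF vb(3,2)])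
  have f4: "bs l (v + D + card J * D) = bs l (v + card (insert i J) * D)" unfolding cJ by (simp add: algebra_simps)
  have f5: "(G * T3 * l\<^sup>2 * (1 + D) ^ card J + Kv * D\<^sup>2) + card J * (G * T3 * l\<^sup>2 * (1 + D) ^ card J + Kv * D\<^sup>2) \<le>
     card (insert i J) * (G * T3 * l\<^sup>2 * (1 + D) ^ card (insert i J) + Kv * D\<^sup>2)"
  proof -
    have "(G * T3 * l\<^sup>2) * (1 + D) ^ card J \<le> (G * T3 * l\<^sup>2) * (1 + D) ^ Suc (card J)"
      using G(2) T3_nonneg D_nonneg by (intro mult_left_mono power_increasing) auto
    from add_right_mono[OF this, of "Kv * D\<^sup>2"] have "(real (card J) + 1) * (G * T3 * l\<^sup>2 * (1 + D) ^ card J + Kv * D\<^sup>2) \<le> (real (card J) + 1) * (G * T3 * l\<^sup>2 * (1 + D) ^ Suc (card J) + Kv * D\<^sup>2)"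
      by (rule mult_left_mono) simp
    then show ?thesis unfolding cJ by (simp add: algebra_simps)
  qed
  have "x = y \<Longrightarrow> \<bar>y - p\<bar> \<le> e \<Longrightarrow> \<bar>p - q\<bar> \<le> n \<Longrightarrow> q = q' \<Longrightarrow> e + n \<le> m \<Longrightarrow> \<bar>x - q'\<bar> \<le> m" for x y p q q' e n m :: real
    by linarith
  from this[OF f1 f2 f3 f4 f5] show ?case .
qed

end

section \<open>The limit of the expected payoff\<close>

lemma bm_min1 [bm]: "bounded_meas M f \<Longrightarrow> bounded_meas M (\<lambda>x. min 1 (f x))"
proof -
  assume f: "bounded_meas M f"
  obtain a where a: "\<And>x. x \<in> space M \<Longrightarrow> \<bar>f x\<bar> \<le> a" using bounded_measE[OF f] by blast
  show "bounded_meas M (\<lambda>x. min 1 (f x))"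
  proof (rule bounded_measI[of _ _ "a + 1"])
    show "(\<lambda>x. min 1 (f x)) \<in> borel_measurable M" using bounded_meas_measurable[OF f] by measurable
    show "\<bar>min 1 (f x)\<bar> \<le> a + 1" if "x \<in> space M" for x using a[OF that] by linarith
  qed
qed

lemma sqrt_diff_le:
  assumes "0 \<le> x" "0 \<le> y" shows "\<bar>sqrt x - sqrt y\<bar> \<le> sqrt \<bar>x - y\<bar>"
proof -
  have "sqrt x \<le> sqrt y + sqrt (x - y)" if "0 \<le> y" "y \<le> x" for x y :: real
    using sqrt_add_le_add_sqrt[of y "x - y"] that by simp
  from this[of x y] this[of y x] show ?thesis
    using assms real_sqrt_le_iff[of x y] real_sqrt_le_iff[of y x] by (cases "x \<le> y") (auto simp: abs_if)
qed

text \<open>The gap \<open>1 - \<alpha>\<close> is divided into parts: half of it is kept as \<open>1 - \<beta>\<close>, the rest absorbs the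
  fluctuation of \<open>N * C\<close>, the difference between \<open>C\<close> and \<open>pair_theta A C\<close>, and \<open>2 * N * \<eta>\<close>.\<close>

lemma off_diagonal_instance:
  fixes \<nu> :: "real measure" and ev od :: "real \<Rightarrow> real" and N :: nat and B \<alpha> :: real
  assumes nu: "noise_law \<nu>" and b: "bounded_meas \<nu> ev" "bounded_meas \<nu> od"
    and pos: "\<And>t u. u \<in> {1, - 1} \<Longrightarrow> 0 < 1 + ev t + u * od t"
    and int: "(\<integral>t. ev t \<partial>\<nu>) = 0" "(\<integral>t. od t \<partial>\<nu>) = 0" "(\<integral>t. ev t * od t \<partial>\<nu>) = 0" "(\<integral>t. od t ^ 3 \<partial>\<nu>) = 0"
    and B: "1 \<le> B" "N * (\<integral>t. (od t)\<^sup>2 \<partial>\<nu>) \<le> B" "(real N)\<^sup>2 * (\<integral>t. od t ^ 4 \<partial>\<nu>) \<le> B"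
      "(real N)\<^sup>2 * (\<integral>t. (ev t)\<^sup>2 \<partial>\<nu>) \<le> B" "real N ^ 4 * (\<integral>t. ev t ^ 4 \<partial>\<nu>) \<le> B"
    and N: "4 * B \<le> N"
    and \<alpha>: "0 \<le> \<alpha>" "\<alpha> < 1" "N * (\<integral>t. (od t)\<^sup>2 \<partial>\<nu>) \<le> \<alpha> + (1 - \<alpha>) / 8" "4 * B\<^sup>2 / N \<le> (1 - \<alpha>) / 8"
  shows "below_threshold \<nu> ev od (B / N) N B ((1 + \<alpha>) / 2) ((1 - \<alpha>) / (16 * N))"
proof -
  have N0: "real N > 0" using N B by linarith
  have BB: "B \<le> B\<^sup>2" "B \<le> B ^ 4" using B(1) by (simp_all add: self_le_power)
  have c4: "B / N \<le> 1 / 4" using N N0 by (simp add: field_simps)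
  interpret noise_law \<nu> by fact
  interpret edge_law \<nu> ev od "B / N"
  proof (unfold_locales, fact b, fact b, fact pos, fact int, fact int, fact int, fact int)
    show "(\<integral>t. (od t)\<^sup>2 \<partial>\<nu>) \<le> B / N" using B(2) N0 by (simp add: field_simps)
    show "(\<integral>t. od t ^ 4 \<partial>\<nu>) \<le> (B / N)\<^sup>2" using B(3) BB N0 by (simp add: power_divide field_simps)
    show "(\<integral>t. (ev t)\<^sup>2 \<partial>\<nu>) \<le> (B / N)\<^sup>2" using B(4) BB N0 by (simp add: power_divide field_simps)
    show "(\<integral>t. ev t ^ 4 \<partial>\<nu>) \<le> (B / N) ^ 4" using B(5) BB N0 by (simp add: power_divide field_simps)
    show "0 < B / N" using B(1) N0 by simp
    show "B / N \<le> 1 / 4" by (rule c4)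
  qed
  show ?thesis
  proof unfold_locales
    show "real N * (B / N) \<le> B" using N0 by simp
    show "0 < (1 - \<alpha>) / (16 * N)" using \<alpha> N0 by simp
    show "(1 + \<alpha>) / 2 < 1" using \<alpha> by simp
    have NC: "real N * C \<le> \<alpha> + (1 - \<alpha>) / 8" using \<alpha>(3) by (simp add: C_def)
    then show "real N * C \<le> (1 + \<alpha>) / 2" using \<alpha>(2) by (simp add: field_simps)
    have "pair_theta A C \<le> C + 4 * (B / N)\<^sup>2"
      using pair_theta_bound[OF A_bounds C_bounds(1,2) c4] by linarith
    then have "real N * pair_theta A C \<le> real N * (C + 4 * (B / N)\<^sup>2)" by (intro mult_left_mono) auto
    also have "\<dots> = real N * C + 4 * B\<^sup>2 / N" using N0 by (simp add: power2_eq_square field_simps)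
    finally have "real N * pair_theta A C \<le> \<alpha> + (1 - \<alpha>) / 8 + (1 - \<alpha>) / 8" using NC \<alpha>(4) by linarith
    moreover have "real N * (2 * ((1 - \<alpha>) / (16 * N))) = (1 - \<alpha>) / 8" using N0 by (simp add: field_simps)
    ultimately have "real N * (pair_theta A C + 2 * ((1 - \<alpha>) / (16 * N))) \<le> \<alpha> + (1 - \<alpha>) / 8 + (1 - \<alpha>) / 8 + (1 - \<alpha>) / 8"
      unfolding distrib_left by linarith
    also have "\<dots> \<le> (1 + \<alpha>) / 2" using \<alpha>(2) by (simp add: field_simps)
    finally show "real N * (pair_theta A C + 2 * ((1 - \<alpha>) / (16 * N))) \<le> (1 + \<alpha>) / 2" .
  qed
qed

text \<open>The starting value \<open>\<tau>\<close> of the variance parameter smooths the payoff at the cost \<open>sqrt \<tau>\<close>; afterwards it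
  collects the variance of the diagonal and then that of the rows.\<close>

lemma payoff_bound:
  fixes \<nu> \<nu>' :: "real measure" and ev od dg :: "real \<Rightarrow> real" and Dg :: "'i set"
  assumes off: "below_threshold \<nu> ev od c N B \<beta> \<eta>" and dia: "diag_law \<nu>' dg"
    and Dg: "finite Dg" "card Dg = N"
    and tau: "0 < \<tau>" and V: "\<tau> + N * (\<integral>t. (dg t)\<^sup>2 \<partial>\<nu>') + B * (B * (1 + \<beta> / (1 - \<beta>))) \<le> V"
    and G: "\<And>v. \<tau> \<le> v \<Longrightarrow> v \<le> V \<Longrightarrow> gentle G (\<lambda>l. bs_gamma l v)"
    and Kv: "0 \<le> Kv" "\<And>l v s. l > 0 \<Longrightarrow> \<tau> \<le> v \<Longrightarrow> 0 \<le> s \<Longrightarrow> \<bar>bs l (v + s) - bs l v - s * (l\<^sup>2 * bs_gamma l v / 2)\<bar> \<le> Kv * s\<^sup>2"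
  defines "a \<equiv> (\<integral>z. (\<integral>t. min 1 (pair_LR ev od N z * (\<Prod>j\<in>Dg. 1 + dg (t j))) \<partial>PiM Dg (\<lambda>_. \<nu>')) \<partial>PiM (strict_upper_pairs N) (\<lambda>_. \<nu>))"
    and "D \<equiv> (\<integral>t. (dg t)\<^sup>2 \<partial>\<nu>')" and "T3 \<equiv> (\<integral>t. \<bar>dg t\<bar> ^ 3 \<partial>\<nu>')" and "E \<equiv> ke0 (c / \<eta>) B \<beta>"
  shows "\<exists>w\<ge>0. \<bar>w - (N * D + ((real N)\<^sup>2 * (\<integral>t. (ev t)\<^sup>2 \<partial>\<nu>) / 2 + psi (N * (\<integral>t. (od t)\<^sup>2 \<partial>\<nu>)) / 2))\<bar> \<le> (B + B / (1 - \<beta>)\<^sup>2 + B * \<beta> / (1 - \<beta>) ^ 3) * c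
     \<and> \<bar>a - erfc (sqrt ((\<tau> + w) / 8))\<bar> \<le> sqrt \<tau> + (N * (G * T3 * E * (1 + D) ^ N + Kv * D\<^sup>2) + B * kstep0 B \<beta> E G Kv * sqrt c)"
proof -
  interpret O: below_threshold \<nu> ev od c N B \<beta> \<eta> by fact
  interpret Di: diag_law \<nu>' dg by fact
  interpret P: bm_prob "O.PS N" by (rule O.bm_prob_pw)
  interpret Q: bm_prob "Di.pw Dg" by (rule Di.bm_prob_pw)
  define w where "w = N * D + O.tail 0"
  have DD: "D = Di.D" "T3 = Di.T3" by (simp_all add: D_def Di.D_def T3_def Di.T3_def)
  have w0: "0 \<le> w" using O.tail_bounds(1)[of 0] Di.D_nonneg by (simp add: w_def DD)
  have E: "O.KE = E" by (simp add: E_def O.KE_eq)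
  have ND0: "0 \<le> N * D" using Di.D_nonneg by (simp add: DD)
  have Bk: "0 \<le> B * O.ksig" using O.B0 O.ksig_nonneg by simp
  have V': "\<tau> + N * D + B * O.ksig \<le> V" using V by (simp add: D_def O.ksig_def)
  have G0: "0 \<le> G"
  proof -
    have "gentle G (\<lambda>l. bs_gamma l \<tau>)" using V' ND0 Bk by (intro G) auto
    then show ?thesis by (rule O.gentle_nonneg)
  qed
  define pr where "pr t = (\<Prod>j\<in>Dg. 1 + dg (t j))" for t
  have bpr: "bounded_meas (Di.pw Dg) pr" unfolding pr_def[abs_def] by (intro bm Di.bm_dg)
  have pr0: "pr t > 0" for t unfolding pr_def by (intro prod_pos) (simp add: Di.dg_pos)
  have bp: "bounded_meas (O.PS N \<Otimes>\<^sub>M Di.pw Dg) (\<lambda>p. O.LR N (fst p) * pr (snd p))"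
    by (intro bm_mult bm_compose[OF O.bm_LR measurable_fst] bm_compose[OF bpr measurable_snd])
  have bz: "bounded_meas (Di.pw Dg) (\<lambda>t. O.LR N z * pr t)" for z by (intro bm bpr)
  define a' where "a' z = (\<integral>t. min 1 (O.LR N z * pr t) \<partial>Di.pw Dg)" for z
  define b' where "b' z = (\<integral>t. bs (O.LR N z * pr t) \<tau> \<partial>Di.pw Dg)" for z
  have ba: "bounded_meas (O.PS N) a'"
    unfolding a'_def[abs_def] using bm_iterated[OF Di.prob_space_pw bm_min1[OF bp]] by simp
  have bb: "bounded_meas (O.PS N) b'"
    unfolding b'_def[abs_def] using bm_iterated[OF Di.prob_space_pw bm_bs[OF bp]] by simp
  have aeq: "a = (\<integral>z. a' z \<partial>O.PS N)" by (simp add: a_def a'_def pr_def)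
  have 1: "\<bar>a - (\<integral>z. b' z \<partial>O.PS N)\<bar> \<le> sqrt \<tau>"
  proof -
    have "\<bar>a' z - b' z\<bar> \<le> sqrt \<tau>" for z
    proof -
      have "\<bar>\<integral>t. min 1 (O.LR N z * pr t) - bs (O.LR N z * pr t) \<tau> \<partial>Di.pw Dg\<bar> \<le> (\<integral>t. sqrt \<tau> \<partial>Di.pw Dg)"
      proof (rule Q.bm_int_abs_mono)
        show "\<bar>min 1 (O.LR N z * pr t) - bs (O.LR N z * pr t) \<tau>\<bar> \<le> sqrt \<tau>" for t
          using bs_near_min[OF mult_pos_pos[OF O.LR_pos pr0] tau, of N z t] by linarith
      qed (intro bm bz)+
      then show ?thesis unfolding a'_def b'_def by (subst (asm) Q.bm_int_diff) (auto intro!: bm bz)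
    qed
    then have "\<bar>\<integral>z. a' z - b' z \<partial>O.PS N\<bar> \<le> (\<integral>z. sqrt \<tau> \<partial>O.PS N)"
      by (intro P.bm_int_abs_mono bm_diff ba bb bm_const)
    then show ?thesis unfolding aeq by (simp add: P.bm_int_diff ba bb)
  qed
  have 2: "\<bar>(\<integral>z. b' z \<partial>O.PS N) - (\<integral>z. bs (O.LR N z) (\<tau> + N * D) \<partial>O.PS N)\<bar> \<le> N * (G * T3 * E * (1 + D) ^ N + Kv * D\<^sup>2)"
  proof -
    have pt: "\<bar>b' z - bs (O.LR N z) (\<tau> + N * D)\<bar> \<le> N * (G * T3 * (O.LR N z)\<^sup>2 * (1 + D) ^ N + Kv * D\<^sup>2)" for z
      unfolding b'_def pr_def DD Dg(2)[symmetric]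
      by (rule Di.bs_diag[OF Dg(1) tau order_refl _ G G0 Kv O.LR_pos]) (use V' Bk in \<open>auto simp: Dg DD\<close>)
    have "\<bar>\<integral>z. b' z - bs (O.LR N z) (\<tau> + N * D) \<partial>O.PS N\<bar> \<le> (\<integral>z. N * (G * T3 * (O.LR N z)\<^sup>2 * (1 + D) ^ N + Kv * D\<^sup>2) \<partial>O.PS N)"
      by (intro P.bm_int_abs_mono bm bb O.bm_LR pt)
    also have "\<dots> = N * (G * T3 * (\<integral>z. (O.LR N z)\<^sup>2 \<partial>O.PS N) * (1 + D) ^ N + Kv * D\<^sup>2)"
      by (simp add: P.bm_int_add bm O.bm_LR)
    also have "\<dots> \<le> N * (G * T3 * E * (1 + D) ^ N + Kv * D\<^sup>2)"
      using O.LR_sq_int G0 Di.T3_nonneg Di.D_nonneg unfolding E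
      by (intro mult_left_mono add_right_mono mult_right_mono) (auto simp: DD)
    finally show ?thesis by (simp add: P.bm_int_diff bb bm O.bm_LR)
  qed
  have 3: "\<bar>(\<integral>z. bs (O.LR N z) (\<tau> + N * D) \<partial>O.PS N) - bs 1 (\<tau> + N * D + O.tail 0)\<bar> \<le> B * O.kstep G Kv * sqrt c"
  proof (rule O.off_diagonal_bs)
    show "0 < \<tau> + N * D" using tau ND0 by linarith
    show "gentle G (\<lambda>l. bs_gamma l v)" if "\<tau> + N * D \<le> v" "v \<le> \<tau> + N * D + B * O.ksig" for v
      using that ND0 V' by (intro G) auto
    show "\<bar>bs l (v + s) - bs l v - s * (l\<^sup>2 * bs_gamma l v / 2)\<bar> \<le> Kv * s\<^sup>2" if "l > 0" "\<tau> + N * D \<le> v" "0 \<le> s" for l v s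
      using that ND0 by (intro Kv(2)) auto
  qed (fact Kv(1))
  have 4: "bs 1 (\<tau> + N * D + O.tail 0) = erfc (sqrt ((\<tau> + w) / 8))"
    using bs_at_1[of "\<tau> + w"] tau w0 by (simp add: w_def add.assoc)
  have "\<bar>w - (N * D + ((real N)\<^sup>2 * (\<integral>t. (ev t)\<^sup>2 \<partial>\<nu>) / 2 + psi (N * (\<integral>t. (od t)\<^sup>2 \<partial>\<nu>)) / 2))\<bar> \<le> (B + B / (1 - \<beta>)\<^sup>2 + B * \<beta> / (1 - \<beta>) ^ 3) * c"
    using O.tail_approx by (simp add: w_def O.A_def O.C_def)
  moreover have "\<bar>a - erfc (sqrt ((\<tau> + w) / 8))\<bar> \<le> sqrt \<tau> + (N * (G * T3 * E * (1 + D) ^ N + Kv * D\<^sup>2) + B * kstep0 B \<beta> E G Kv * sqrt c)"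
    using 1 2 3 unfolding 4 O.kstep_eq E by linarith
  ultimately show ?thesis using w0 by blast
qed

text \<open>The size tends to infinity first, for fixed \<open>\<tau>\<close>, and then \<open>\<tau>\<close> tends to zero.\<close>

theorem payoff_limit:
  fixes \<nu> \<nu>' :: "real measure" and ev od dg :: "nat \<Rightarrow> real \<Rightarrow> real" and Dg :: "nat \<Rightarrow> 'i set"
  assumes nu: "noise_law \<nu>"
    and b: "\<And>N. N \<ge> 1 \<Longrightarrow> bounded_meas \<nu> (ev N)" "\<And>N. N \<ge> 1 \<Longrightarrow> bounded_meas \<nu> (od N)"
    and pos: "\<And>N t u. N \<ge> 1 \<Longrightarrow> u \<in> {1, - 1} \<Longrightarrow> 0 < 1 + ev N t + u * od N t"
    and int: "\<And>N. N \<ge> 1 \<Longrightarrow> (\<integral>t. ev N t \<partial>\<nu>) = 0" "\<And>N. N \<ge> 1 \<Longrightarrow> (\<integral>t. od N t \<partial>\<nu>) = 0"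
      "\<And>N. N \<ge> 1 \<Longrightarrow> (\<integral>t. ev N t * od N t \<partial>\<nu>) = 0" "\<And>N. N \<ge> 1 \<Longrightarrow> (\<integral>t. od N t ^ 3 \<partial>\<nu>) = 0"
    and dia: "\<And>N. N \<ge> 1 \<Longrightarrow> diag_law \<nu>' (dg N)"
    and Dg: "\<And>N. finite (Dg N)" "\<And>N. card (Dg N) = N"
    and lim: "(\<lambda>N. N * (\<integral>t. (od N t)\<^sup>2 \<partial>\<nu>)) \<longlonglongrightarrow> \<alpha>" "(\<lambda>N. (real N)\<^sup>2 * (\<integral>t. (ev N t)\<^sup>2 \<partial>\<nu>)) \<longlonglongrightarrow> \<gamma>"
      "(\<lambda>N. N * (\<integral>t. (dg N t)\<^sup>2 \<partial>\<nu>')) \<longlonglongrightarrow> \<delta>" "(\<lambda>N. N * (\<integral>t. \<bar>dg N t\<bar> ^ 3 \<partial>\<nu>')) \<longlonglongrightarrow> 0"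
    and four: "\<And>N. N \<ge> 1 \<Longrightarrow> (real N)\<^sup>2 * (\<integral>t. od N t ^ 4 \<partial>\<nu>) \<le> K4" "\<And>N. N \<ge> 1 \<Longrightarrow> real N ^ 4 * (\<integral>t. ev N t ^ 4 \<partial>\<nu>) \<le> K4"
    and \<alpha>: "\<alpha> < 1"
  shows "(\<lambda>N. \<integral>z. (\<integral>t. min 1 (pair_LR (ev N) (od N) N z * (\<Prod>j\<in>Dg N. 1 + dg N (t j))) \<partial>PiM (Dg N) (\<lambda>_. \<nu>')) \<partial>PiM (strict_upper_pairs N) (\<lambda>_. \<nu>))
     \<longlonglongrightarrow> erfc (sqrt ((\<delta> + (\<gamma> / 2 + psi \<alpha> / 2)) / 8))"
proof -
  define a where "a N = (\<integral>z. (\<integral>t. min 1 (pair_LR (ev N) (od N) N z * (\<Prod>j\<in>Dg N. 1 + dg N (t j))) \<partial>PiM (Dg N) (\<lambda>_. \<nu>')) \<partial>PiM (strict_upper_pairs N) (\<lambda>_. \<nu>))" for N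
  define C where "C N = (\<integral>t. (od N t)\<^sup>2 \<partial>\<nu>)" for N
  define A where "A N = (\<integral>t. (ev N t)\<^sup>2 \<partial>\<nu>)" for N
  define D where "D N = (\<integral>t. (dg N t)\<^sup>2 \<partial>\<nu>')" for N
  define T3 where "T3 N = (\<integral>t. \<bar>dg N t\<bar> ^ 3 \<partial>\<nu>')" for N
  define v where "v = \<delta> + (\<gamma> / 2 + psi \<alpha> / 2)"
  define w0 where "w0 N = N * D N + ((real N)\<^sup>2 * A N / 2 + psi (N * C N) / 2)" for N
  note lim = lim[folded C_def A_def D_def T3_def]
  have \<alpha>0: "0 \<le> \<alpha>" by (rule LIMSEQ_le_const[OF lim(1)]) (auto simp: C_def)
  have w0v: "w0 \<longlonglongrightarrow> v"
  proof -
    have "isCont psi \<alpha>" using DERIV_psi[OF \<alpha>] DERIV_isCont by blast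
    from isCont_tendsto_compose[OF this lim(1)] show ?thesis
      unfolding w0_def[abs_def] v_def by (intro tendsto_intros lim) auto
  qed
  obtain B1 where B1: "\<And>N. \<bar>N * C N\<bar> \<le> B1" using Bseq_conv_Bfun lim(1) convergent_imp_Bseq[OF convergentI[OF lim(1)]] unfolding Bseq_def by auto
  obtain B2 where B2: "\<And>N. \<bar>(real N)\<^sup>2 * A N\<bar> \<le> B2" using convergent_imp_Bseq[OF convergentI[OF lim(2)]] unfolding Bseq_def by auto
  obtain B3 where B3: "\<And>N. \<bar>N * D N\<bar> \<le> B3" using convergent_imp_Bseq[OF convergentI[OF lim(3)]] unfolding Bseq_def by auto
  define B where "B = max 1 (max B1 (max B2 K4))"
  have B: "1 \<le> B" "B1 \<le> B" "B2 \<le> B" "K4 \<le> B" by (auto simp: B_def)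
  define \<beta> where "\<beta> = (1 + \<alpha>) / 2"
  define E where "E = ke0 (16 * B / (1 - \<alpha>)) B \<beta>"
  define Kt where "Kt = B + B / (1 - \<beta>)\<^sup>2 + B * \<beta> / (1 - \<beta>) ^ 3"
  have invN: "(\<lambda>N. x / real N) \<longlonglongrightarrow> 0" for x by (rule lim_const_over_n)
  have ev1: "\<forall>\<^sub>F N in sequentially. N \<ge> 1 \<and> 4 * B \<le> real N \<and> N * C N \<le> \<alpha> + (1 - \<alpha>) / 8 \<and> 4 * B\<^sup>2 / N \<le> (1 - \<alpha>) / 8"
  proof -
    have "\<forall>\<^sub>F N in sequentially. N * C N < \<alpha> + (1 - \<alpha>) / 8" using lim(1) \<alpha> by (intro order_tendstoD) auto
    moreover have "\<forall>\<^sub>F N in sequentially. 4 * B\<^sup>2 / real N < (1 - \<alpha>) / 8" using invN \<alpha> by (intro order_tendstoD) auto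
    moreover have "\<forall>\<^sub>F N in sequentially. 4 * B \<le> real N"
      using filterlim_real_sequentially by (auto simp: filterlim_at_top)
    moreover have "\<forall>\<^sub>F N in sequentially. N \<ge> (1::nat)" by (rule eventually_ge_at_top)
    ultimately show ?thesis by eventually_elim auto
  qed
  have main: "\<exists>er. er \<longlonglongrightarrow> 0 \<and> (\<forall>\<^sub>F N in sequentially. \<exists>w\<ge>0. \<bar>w - w0 N\<bar> \<le> Kt * (B / N) \<and> \<bar>a N - erfc (sqrt ((\<tau> + w) / 8))\<bar> \<le> sqrt \<tau> + er N)"
    if tau: "\<tau> > 0" for \<tau>
  proof -
    define V where "V = \<tau> + B3 + B * (B * (1 + \<beta> / (1 - \<beta>)))"
    obtain G where G: "G > 0" "\<And>v. \<tau> \<le> v \<Longrightarrow> v \<le> V \<Longrightarrow> gentle G (\<lambda>l. bs_gamma l v)"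
      using bs_gamma_gentle[OF tau] by metis
    obtain Kv where Kv: "Kv > 0" "\<And>l v s. l > 0 \<Longrightarrow> \<tau> \<le> v \<Longrightarrow> 0 \<le> s \<Longrightarrow> \<bar>bs l (v + s) - bs l v - s * (l\<^sup>2 * bs_gamma l v / 2)\<bar> \<le> Kv * s\<^sup>2"
      using bs_variance_shift[OF tau] by metis
    define er where "er N = G * E * exp B3 * (N * T3 N) + Kv * ((N * D N)\<^sup>2 / N) + B * kstep0 B \<beta> E G Kv * sqrt (B / N)" for N
    have E0: "0 \<le> E" using B \<alpha> by (auto simp: E_def ke0_def intro!: mult_nonneg_nonneg add_nonneg_nonneg)
    have "er \<longlonglongrightarrow> G * E * exp B3 * 0 + Kv * 0 + B * kstep0 B \<beta> E G Kv * sqrt 0"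
    proof -
      have "(\<lambda>N. (N * D N)\<^sup>2 * (1 / real N)) \<longlonglongrightarrow> \<delta>\<^sup>2 * 0" by (intro tendsto_intros lim invN)
      then have "(\<lambda>N. (N * D N)\<^sup>2 / real N) \<longlonglongrightarrow> 0" by simp
      then show ?thesis unfolding er_def[abs_def] by (intro tendsto_intros lim invN)
    qed
    then have er0: "er \<longlonglongrightarrow> 0" by simp
    have "\<forall>\<^sub>F N in sequentially. \<exists>w\<ge>0. \<bar>w - w0 N\<bar> \<le> Kt * (B / N) \<and> \<bar>a N - erfc (sqrt ((\<tau> + w) / 8))\<bar> \<le> sqrt \<tau> + er N"
      using ev1
    proof eventually_elim
      case (elim N)
      then have N: "N \<ge> 1" by simp
      have bt: "below_threshold \<nu> (ev N) (od N) (B / N) N B \<beta> ((1 - \<alpha>) / (16 * N))"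
        unfolding \<beta>_def
      proof (rule off_diagonal_instance[OF nu b(1)[OF N] b(2)[OF N] pos[OF N] int(1)[OF N] int(2)[OF N] int(3)[OF N] int(4)[OF N] B(1)])
        show "N * (\<integral>t. (od N t)\<^sup>2 \<partial>\<nu>) \<le> B" using B1[of N] B(2) by (simp add: C_def)
        show "(real N)\<^sup>2 * (\<integral>t. (ev N t)\<^sup>2 \<partial>\<nu>) \<le> B" using B2[of N] B(3) by (simp add: A_def)
        show "(real N)\<^sup>2 * (\<integral>t. od N t ^ 4 \<partial>\<nu>) \<le> B" using four(1)[OF N] B(4) by simp
        show "real N ^ 4 * (\<integral>t. ev N t ^ 4 \<partial>\<nu>) \<le> B" using four(2)[OF N] B(4) by simp
      qed (use elim \<alpha> \<alpha>0 in \<open>auto simp: C_def\<close>)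
      have r: "(B / N) / ((1 - \<alpha>) / (16 * N)) = 16 * B / (1 - \<alpha>)" using N \<alpha> by (simp add: field_simps)
      have "\<tau> + N * (\<integral>t. (dg N t)\<^sup>2 \<partial>\<nu>') + B * (B * (1 + \<beta> / (1 - \<beta>))) \<le> V"
        using B3[of N] by (simp add: V_def D_def)
      from payoff_bound[OF bt dia[OF N] Dg(1,2)[of N] tau this G(2) less_imp_le[OF Kv(1)] Kv(2), unfolded r, folded a_def A_def C_def D_def T3_def E_def Kt_def]
      obtain w where w: "w \<ge> 0" "\<bar>w - w0 N\<bar> \<le> Kt * (B / N)"
        "\<bar>a N - erfc (sqrt ((\<tau> + w) / 8))\<bar> \<le> sqrt \<tau> + (N * (G * T3 N * E * (1 + D N) ^ N + Kv * (D N)\<^sup>2) + B * kstep0 B \<beta> E G Kv * sqrt (B / N))"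
        unfolding w0_def by blast
      have "N * (G * T3 N * E * (1 + D N) ^ N + Kv * (D N)\<^sup>2) + B * kstep0 B \<beta> E G Kv * sqrt (B / N) \<le> er N"
      proof -
        have "(1 + D N) ^ N \<le> exp (D N) ^ N" by (intro power_mono) (auto simp: D_def)
        also have "\<dots> = exp (N * D N)" by (simp add: exp_of_nat_mult)
        also have "\<dots> \<le> exp B3" using B3[of N] by simp
        finally have "(G * E * (N * T3 N)) * (1 + D N) ^ N \<le> (G * E * (N * T3 N)) * exp B3"
          using G E0 by (intro mult_left_mono) (auto simp: T3_def)
        moreover have "N * (Kv * (D N)\<^sup>2) = Kv * ((N * D N)\<^sup>2 / N)" using N by (simp add: power2_eq_square)
        ultimately show ?thesis unfolding er_def by (simp add: algebra_simps)
      qed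
      with w show ?case by (intro exI[of _ w]) auto
    qed
    with er0 show ?thesis by blast
  qed
  have v0: "0 \<le> v"
  proof -
    obtain er where er: "\<forall>\<^sub>F N in sequentially. \<exists>w\<ge>0. \<bar>w - w0 N\<bar> \<le> Kt * (B / N) \<and> \<bar>a N - erfc (sqrt ((1 + w) / 8))\<bar> \<le> sqrt 1 + er N"
      using main[of 1] by auto
    have "(\<lambda>N. w0 N + Kt * (B / N)) \<longlonglongrightarrow> v + Kt * 0" by (intro tendsto_intros w0v invN)
    then have "(\<lambda>N. w0 N + Kt * (B / N)) \<longlonglongrightarrow> v" by simp
    moreover have "\<forall>\<^sub>F N in sequentially. 0 \<le> w0 N + Kt * (B / N)"
      using er by (rule eventually_mono) force
    ultimately show ?thesis by (intro tendsto_lowerbound[of _ v sequentially]) auto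
  qed
  have "a \<longlonglongrightarrow> erfc (sqrt (v / 8))"
  proof (rule LIMSEQ_I)
    fix e :: real assume e: "e > 0"
    define \<tau> where "\<tau> = (e / 4)\<^sup>2"
    have tau: "\<tau> > 0" "sqrt \<tau> = e / 4" using e by (auto simp: \<tau>_def)
    obtain er where er: "er \<longlonglongrightarrow> 0" "\<forall>\<^sub>F N in sequentially. \<exists>w\<ge>0. \<bar>w - w0 N\<bar> \<le> Kt * (B / N) \<and> \<bar>a N - erfc (sqrt ((\<tau> + w) / 8))\<bar> \<le> sqrt \<tau> + er N"
      using main[OF tau(1)] by auto
    have "(\<lambda>N. sqrt (\<tau> + (Kt * (B / N) + \<bar>w0 N - v\<bar>))) \<longlonglongrightarrow> sqrt (\<tau> + (Kt * 0 + \<bar>v - v\<bar>))"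
      by (intro tendsto_intros w0v invN)
    then have "(\<lambda>N. sqrt (\<tau> + (Kt * (B / N) + \<bar>w0 N - v\<bar>))) \<longlonglongrightarrow> e / 4" using tau by simp
    then have "\<forall>\<^sub>F N in sequentially. sqrt (\<tau> + (Kt * (B / N) + \<bar>w0 N - v\<bar>)) < e / 2"
      using e by (intro order_tendstoD) auto
    moreover have "\<forall>\<^sub>F N in sequentially. er N < e / 4" using er(1) e by (intro order_tendstoD) auto
    ultimately have "\<forall>\<^sub>F N in sequentially. norm (a N - erfc (sqrt (v / 8))) < e"
      using er(2)
    proof eventually_elim
      case (elim N)
      then obtain w where w: "w \<ge> 0" "\<bar>w - w0 N\<bar> \<le> Kt * (B / N)" "\<bar>a N - erfc (sqrt ((\<tau> + w) / 8))\<bar> \<le> sqrt \<tau> + er N" by blast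
      have "\<bar>erfc (sqrt ((\<tau> + w) / 8)) - erfc (sqrt (v / 8))\<bar> \<le> 2 * \<bar>sqrt ((\<tau> + w) / 8) - sqrt (v / 8)\<bar>" by (rule erfc_lipschitz)
      also have "\<dots> \<le> 2 * sqrt \<bar>(\<tau> + w) / 8 - v / 8\<bar>" using w tau v0 by (intro mult_left_mono sqrt_diff_le) auto
      also have "\<dots> = sqrt (4 * \<bar>(\<tau> + w) / 8 - v / 8\<bar>)" by (simp add: real_sqrt_mult)
      also have "\<dots> \<le> sqrt (\<tau> + (Kt * (B / N) + \<bar>w0 N - v\<bar>))"
      proof -
        have "(\<tau> + w) / 8 - v / 8 = (\<tau> + w - v) / 8" by (simp add: diff_divide_distrib)
        then have "4 * \<bar>(\<tau> + w) / 8 - v / 8\<bar> = \<bar>\<tau> + w - v\<bar> / 2" unfolding \<open>(\<tau> + w) / 8 - v / 8 = (\<tau> + w - v) / 8\<close> abs_divide by simp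
        also have "\<dots> \<le> \<bar>\<tau> + w - v\<bar>" by simp
        also have "\<dots> \<le> \<tau> + (Kt * (B / N) + \<bar>w0 N - v\<bar>)" using w tau by linarith
        finally show ?thesis by simp
      qed
      finally show ?case using elim w tau unfolding real_norm_def by linarith
    qed
    then show "\<exists>no. \<forall>N\<ge>no. norm (a N - erfc (sqrt (v / 8))) < e" by (simp add: eventually_sequentially)
  qed
  then show ?thesis unfolding a_def[abs_def] v_def .
qed

section \<open>Truncated density ratios\<close>

locale shift_density =
  fixes q q1 q2 :: "real \<Rightarrow> real" and \<omega> K r :: real
  assumes q_pos: "q x > 0" and q_even: "q (- x) = q x"
    and D1: "(q has_real_derivative q1 x) (at x)" and D2: "(q1 has_real_derivative q2 x) (at x)"
    and q2_cont: "isCont q2 x"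
    and r_pos: "r > 0" and K_pos: "K > 0" and om_pos: "\<omega> > 0"
    and q1_le: "\<bar>q1 x / q x\<bar> \<le> K * (1 + \<bar>x\<bar> powr r)" and q2_le: "\<bar>q2 x / q x\<bar> \<le> K * (1 + \<bar>x\<bar> powr r)"
    and prob_q: "prob_space (density lborel q)"
    and mom: "D > 0 \<Longrightarrow> integrable (density lborel q) (\<lambda>x. \<bar>x\<bar> powr D)"
begin

abbreviation "\<nu> \<equiv> density lborel q"

sublocale noise_law \<nu>
  by (intro noise_law.intro bm_probI prob_q)

lemma prob_UNIV [simp]: "prob UNIV = 1"
  using prob_space by simp

lemma q_cont: "continuous_on S q"
  by (meson D1 DERIV_continuous continuous_at_imp_continuous_on)

lemma q_meas [measurable]: "q \<in> borel_measurable borel"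
  by (rule borel_measurable_continuous_onI[OF q_cont])

lemma q1_meas [measurable]: "q1 \<in> borel_measurable borel"
  by (rule borel_measurable_continuous_onI) (meson D2 DERIV_continuous continuous_at_imp_continuous_on)

lemma q2_meas [measurable]: "q2 \<in> borel_measurable borel"
  by (rule borel_measurable_continuous_onI) (meson q2_cont continuous_at_imp_continuous_on)

text \<open>An entry of the matrix is shifted by \<open>\<plusminus> sh N\<close>. The width of the window is chosen such that
  \<open>cut N powr r\<close>, the growth of the logarithmic derivative at its boundary, is the inverse order
  \<open>sqrt N\<close> of the shift.\<close>

definition sh :: "nat \<Rightarrow> real" where "sh N = sqrt (\<omega> / N)"
definition cut :: "nat \<Rightarrow> real" where "cut N = real N powr (1 / (2 * r))"
definition ratio :: "nat \<Rightarrow> real \<Rightarrow> real \<Rightarrow> real" where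
  "ratio N u z = (if \<bar>z\<bar> \<le> cut N then q (z - u * sh N) / q z else 1)"

definition Q where "Q = sqrt \<omega> * (K * (1 + (1 + sqrt \<omega>) powr r))"
definition M where "M = exp Q"

lemma Q_nonneg: "0 \<le> Q" using K_pos om_pos by (auto simp: Q_def intro!: mult_nonneg_nonneg add_nonneg_nonneg)
lemma M_ge: "1 \<le> M" using Q_nonneg by (simp add: M_def)

lemma sh_nonneg: "0 \<le> sh N" and sh_le: "N \<ge> 1 \<Longrightarrow> sh N \<le> sqrt \<omega>"
  and sh_sq: "N \<ge> 1 \<Longrightarrow> real N * (sh N)\<^sup>2 = \<omega>" and sh_sqrt: "N \<ge> 1 \<Longrightarrow> sqrt N * sh N = sqrt \<omega>"
  using om_pos by (auto simp: sh_def real_sqrt_divide divide_le_eq mult_le_cancel_left1 power_divide)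

lemma powr_mono_abs: "\<bar>x\<bar> \<le> y \<Longrightarrow> \<bar>x\<bar> powr r \<le> y powr r"
  using r_pos by (intro powr_mono2) auto

lemma growth:
  assumes N: "N \<ge> 1" and z: "\<bar>z\<bar> \<le> cut N" and h: "\<bar>y - z\<bar> \<le> sh N"
  shows "sh N * (K * (1 + \<bar>y\<bar> powr r)) \<le> Q"
proof -
  have c1: "1 \<le> cut N" using N r_pos by (simp add: cut_def ge_one_powr_ge_zero)
  have s0: "0 \<le> sqrt \<omega>" using om_pos by simp
  have "\<bar>y\<bar> \<le> cut N + sqrt \<omega>" using z h sh_le[OF N] by linarith
  also have "\<dots> \<le> cut N * (1 + sqrt \<omega>)"
    using mult_right_mono[OF c1 s0] by (simp add: algebra_simps)
  finally have "\<bar>y\<bar> powr r \<le> (cut N * (1 + sqrt \<omega>)) powr r" by (rule powr_mono_abs)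
  also have "\<dots> = cut N powr r * (1 + sqrt \<omega>) powr r" using c1 s0 by (intro powr_mult)
  also have "cut N powr r = sqrt N" using N r_pos by (simp add: cut_def powr_powr powr_half_sqrt)
  finally have y: "\<bar>y\<bar> powr r \<le> sqrt N * (1 + sqrt \<omega>) powr r" .
  have "1 \<le> sqrt N" using N by simp
  then have "1 + \<bar>y\<bar> powr r \<le> sqrt N * (1 + (1 + sqrt \<omega>) powr r)" using y unfolding distrib_left by linarith
  then have "sh N * (K * (1 + \<bar>y\<bar> powr r)) \<le> sh N * (K * (sqrt N * (1 + (1 + sqrt \<omega>) powr r)))"
    using K_pos sh_nonneg[of N] by (intro mult_left_mono) auto
  also have "\<dots> = (sqrt N * sh N) * (K * (1 + (1 + sqrt \<omega>) powr r))" by (simp only: mult_ac)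
  also have "\<dots> = Q" unfolding sh_sqrt[OF N] Q_def ..
  finally show ?thesis .
qed

text \<open>On the truncation window the logarithmic derivative is at most of the order of the inverse shift, so
  a shifted density stays within a constant factor of the original one.\<close>

lemma ratio_bound:
  assumes N: "N \<ge> 1" and z: "\<bar>z\<bar> \<le> cut N" and y: "\<bar>y - z\<bar> \<le> sh N"
  shows "q y \<le> M * q z" "q z \<le> M * q y"
proof -
  have "norm (ln (q y) - ln (q z)) \<le> (Q / sh N) * norm (y - z)"
  proof (rule field_differentiable_bound[of "closed_segment z y" "\<lambda>x. ln (q x)" "\<lambda>x. q1 x / q x"])
    fix x assume x: "x \<in> closed_segment z y"
    show "((\<lambda>x. ln (q x)) has_real_derivative q1 x / q x) (at x within closed_segment z y)"
      by (rule has_field_derivative_at_within) (use D1 q_pos in \<open>auto intro!: derivative_eq_intros simp: divide_inverse\<close>)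
    have "\<bar>x - z\<bar> \<le> \<bar>y - z\<bar>" using x by (auto simp: closed_segment_eq_real_ivl split: if_splits)
    then have "sh N * (K * (1 + \<bar>x\<bar> powr r)) \<le> Q" using growth[OF N z, of x] y by simp
    moreover have "sh N > 0" using N om_pos by (simp add: sh_def)
    ultimately show "norm (q1 x / q x) \<le> Q / sh N"
      using order_trans[OF mult_left_mono[OF q1_le[of x] sh_nonneg[of N]]] by (simp only: real_norm_def pos_le_divide_eq mult.commute)
  qed auto
  also have "\<dots> \<le> (Q / sh N) * sh N" using y Q_nonneg sh_nonneg by (intro mult_left_mono) auto
  also have "\<dots> \<le> Q" using Q_nonneg by simp
  finally have "ln (q y) \<le> Q + ln (q z)" "ln (q z) \<le> Q + ln (q y)" by auto
  then have "exp (ln (q y)) \<le> exp (Q + ln (q z))" "exp (ln (q z)) \<le> exp (Q + ln (q y))" by auto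
  then show "q y \<le> M * q z" "q z \<le> M * q y" using q_pos by (auto simp: M_def exp_add)
qed

definition W where "W z = 1 + (\<bar>z\<bar> + sqrt \<omega>) powr r"

lemma W_ge: "1 \<le> W z" by (simp add: W_def)

lemma W_meas [measurable]: "W \<in> borel_measurable borel" unfolding W_def by measurable

lemma deriv_le:
  assumes N: "N \<ge> 1" and z: "\<bar>z\<bar> \<le> cut N" and y: "\<bar>y - z\<bar> \<le> sh N"
  shows "\<bar>q1 y\<bar> \<le> K * W z * M * q z" "\<bar>q2 y\<bar> \<le> K * W z * M * q z"
proof -
  have "\<bar>y\<bar> \<le> \<bar>z\<bar> + sqrt \<omega>" using y sh_le[OF N] by linarith
  then have w: "K * (1 + \<bar>y\<bar> powr r) \<le> K * W z" unfolding W_def using powr_mono_abs K_pos by simp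
  have "\<bar>d\<bar> \<le> K * W z * M * q z" if "\<bar>d / q y\<bar> \<le> K * (1 + \<bar>y\<bar> powr r)" for d
  proof -
    have "\<bar>d\<bar> = \<bar>d / q y\<bar> * q y" using q_pos[of y] by simp
    also have "\<dots> \<le> (K * W z) * (M * q z)"
      using order_trans[OF that w] ratio_bound(1)[OF N z y] q_pos[of y] K_pos W_ge[of z] by (intro mult_mono) auto
    finally show ?thesis by simp
  qed
  from this[OF q1_le] this[OF q2_le] show "\<bar>q1 y\<bar> \<le> K * W z * M * q z" "\<bar>q2 y\<bar> \<le> K * W z * M * q z" by auto
qed

lemma first_diff:
  assumes N: "N \<ge> 1" and z: "\<bar>z\<bar> \<le> cut N" and y: "\<bar>y - z\<bar> \<le> sh N"
  shows "\<bar>q y - q z\<bar> \<le> K * W z * M * q z * sh N"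
proof -
  have nn: "0 \<le> K * W z * M * q z" using K_pos W_ge[of z] M_ge q_pos[of z] by simp
  have "norm (q y - q z) \<le> (K * W z * M * q z) * norm (y - z)"
  proof (rule field_differentiable_bound[of "closed_segment z y" q q1])
    fix x assume x: "x \<in> closed_segment z y"
    show "(q has_real_derivative q1 x) (at x within closed_segment z y)"
      by (rule has_field_derivative_at_within[OF D1])
    have "\<bar>x - z\<bar> \<le> \<bar>y - z\<bar>" using x by (auto simp: closed_segment_eq_real_ivl split: if_splits)
    then show "norm (q1 x) \<le> K * W z * M * q z" using deriv_le(1)[OF N z, of x] y by simp
  qed auto
  also have "\<dots> \<le> (K * W z * M * q z) * sh N" using y nn by (intro mult_left_mono) auto
  finally show ?thesis by simp
qed

lemma second_taylor:
  assumes "h \<noteq> 0"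
  shows "\<exists>x. \<bar>x - z\<bar> \<le> \<bar>h\<bar> \<and> q (z + h) = q z + q1 z * h + q2 x / 2 * h\<^sup>2"
proof -
  define d where "d m = (if m = 0 then q else if m = 1 then q1 else q2)" for m :: nat
  have "\<exists>t. (if z + h < z then z + h < t \<and> t < z else z < t \<and> t < z + h) \<and>
      q (z + h) = (\<Sum>m<2. d m z / fact m * (z + h - z) ^ m) + d 2 t / fact 2 * (z + h - z) ^ 2"
  proof (rule Taylor[of 2 d q "min z (z + h)" "max z (z + h)"])
    show "\<forall>m t. m < 2 \<and> min z (z + h) \<le> t \<and> t \<le> max z (z + h) \<longrightarrow> (d m has_real_derivative d (Suc m) t) (at t)"
      using D1 D2 by (auto simp: d_def less_2_cases_iff)
  qed (use assms in \<open>auto simp: d_def\<close>)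
  then obtain t where t: "if z + h < z then z + h < t \<and> t < z else z < t \<and> t < z + h"
    "q (z + h) = (\<Sum>m<2. d m z / fact m * (z + h - z) ^ m) + d 2 t / fact 2 * (z + h - z) ^ 2" by blast
  show ?thesis
  proof (intro exI conjI)
    show "\<bar>t - z\<bar> \<le> \<bar>h\<bar>" using t(1) by (auto split: if_splits)
    show "q (z + h) = q z + q1 z * h + q2 t / 2 * h\<^sup>2" using t(2) by (simp add: d_def numeral_2_eq_2 lessThan_Suc One_nat_def)
  qed
qed

lemma second_diff:
  assumes N: "N \<ge> 1" and z: "\<bar>z\<bar> \<le> cut N"
  shows "\<bar>q (z - sh N) + q (z + sh N) - 2 * q z\<bar> \<le> K * W z * M * q z * (sh N)\<^sup>2"
proof -
  have s: "sh N > 0" using N om_pos by (simp add: sh_def)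
  obtain x where x: "\<bar>x - z\<bar> \<le> sh N" "q (z + sh N) = q z + q1 z * sh N + q2 x / 2 * (sh N)\<^sup>2"
    using second_taylor[of "sh N" z] s by auto
  obtain y where y: "\<bar>y - z\<bar> \<le> sh N" "q (z - sh N) = q z - q1 z * sh N + q2 y / 2 * (sh N)\<^sup>2"
    using second_taylor[of "- sh N" z] s by auto
  have e: "q (z - sh N) + q (z + sh N) - 2 * q z = (q2 x + q2 y) / 2 * (sh N)\<^sup>2"
    unfolding x(2) y(2) by (simp add: field_simps)
  have "\<bar>q (z - sh N) + q (z + sh N) - 2 * q z\<bar> = \<bar>q2 x + q2 y\<bar> / 2 * (sh N)\<^sup>2"
    unfolding e by (simp add: abs_mult)
  also have "\<dots> \<le> K * W z * M * q z * (sh N)\<^sup>2"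
  proof (rule mult_right_mono)
    show "\<bar>q2 x + q2 y\<bar> / 2 \<le> K * W z * M * q z"
      using deriv_le(2)[OF N z x(1)] deriv_le(2)[OF N z y(1)] by simp
  qed simp
  finally show ?thesis .
qed

lemma ratio_pos: "0 < ratio N u z" using q_pos by (simp add: ratio_def)

lemma ratio_bounds:
  assumes N: "N \<ge> 1" and u: "u \<in> {1, - 1}"
  shows "ratio N u z \<le> M" "1 / M \<le> ratio N u z"
proof -
  have "q (z - u * sh N) / q z \<le> M" "1 / M \<le> q (z - u * sh N) / q z" if z: "\<bar>z\<bar> \<le> cut N"
  proof -
    have y: "\<bar>(z - u * sh N) - z\<bar> \<le> sh N" using u sh_nonneg[of N] by auto
    show "q (z - u * sh N) / q z \<le> M" "1 / M \<le> q (z - u * sh N) / q z"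
      using ratio_bound[OF N z y] q_pos[of z] M_ge by (auto simp: divide_le_eq le_divide_eq field_simps)
  qed
  then show "ratio N u z \<le> M" "1 / M \<le> ratio N u z" unfolding ratio_def using M_ge by auto
qed

lemma ratio_meas [measurable]: "ratio N u \<in> borel_measurable borel"
  unfolding ratio_def by measurable

lemma bm_ratio: "N \<ge> 1 \<Longrightarrow> u \<in> {1, - 1} \<Longrightarrow> bounded_meas \<nu> (ratio N u)"
  using ratio_bounds(1)[of N u] ratio_pos by (intro bounded_measI[of _ _ M]) (auto simp: abs_of_pos)

lemma ratio_flip: "ratio N u (- z) = ratio N (- u) z"
  using q_even[of "z + u * sh N"] q_even[of z] by (simp add: ratio_def)

lemma int_flip:
  fixes g :: "real \<Rightarrow> real"
  assumes [measurable]: "g \<in> borel_measurable borel"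
  shows "(\<integral>z. g z \<partial>\<nu>) = (\<integral>z. g (- z) \<partial>\<nu>)"
proof -
  have "(\<integral>z. g z \<partial>\<nu>) = (\<integral>z. q z * g z \<partial>lborel)"
    using q_pos by (subst integral_real_density) (auto intro: less_imp_le)
  also have "\<dots> = (\<integral>z. q (- z) * g (- z) \<partial>lborel)"
    using lborel_integral_real_affine[of "-1" "\<lambda>z. q z * g z" 0] by simp
  also have "\<dots> = (\<integral>z. q z * g (- z) \<partial>lborel)" by (simp add: q_even)
  also have "\<dots> = (\<integral>z. g (- z) \<partial>\<nu>)"
    using q_pos by (subst integral_real_density) (auto intro: less_imp_le)
  finally show ?thesis .
qed

lemma int_odd:
  fixes g :: "real \<Rightarrow> real"
  assumes "g \<in> borel_measurable borel" "\<And>z. g (- z) = - g z"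
  shows "(\<integral>z. g z \<partial>\<nu>) = 0"
  using int_flip[OF assms(1)] assms(2) by simp

text \<open>Truncation destroys the normalisation of the ratio; dividing by \<open>kap\<close> restores it.\<close>

definition kap :: "nat \<Rightarrow> real" where "kap N = (\<integral>z. ratio N 1 z \<partial>\<nu>)"

lemma kap_flip: "u \<in> {1, - 1} \<Longrightarrow> (\<integral>z. ratio N u z \<partial>\<nu>) = kap N"
  using int_flip[of "ratio N 1"] by (auto simp: kap_def ratio_flip)

lemma kap_ge: "N \<ge> 1 \<Longrightarrow> 1 / M \<le> kap N"
proof -
  assume N: "N \<ge> 1"
  have "(\<integral>z. 1 / M \<partial>\<nu>) \<le> (\<integral>z. ratio N 1 z \<partial>\<nu>)"
    by (intro bm_int_mono bm bm_ratio[OF N] ratio_bounds(2)[OF N]) auto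
  then show ?thesis by (simp add: kap_def)
qed

lemma kap_pos: "N \<ge> 1 \<Longrightarrow> 0 < kap N"
  by (rule less_le_trans[OF _ kap_ge]) (use M_ge in auto)

lemma shifted_mom:
  assumes D: "D > 0"
  shows "integrable \<nu> (\<lambda>z. (\<bar>z\<bar> + sqrt \<omega>) powr D)"
proof (rule Bochner_Integration.integrable_bound)
  show "integrable \<nu> (\<lambda>z. 2 powr D * \<bar>z\<bar> powr D + 2 powr D * sqrt \<omega> powr D)"
    using mom[OF D] bm_integrable[OF prob_space_axioms bm_const] by (intro Bochner_Integration.integrable_add integrable_mult_right) auto
  show "AE z in \<nu>. norm ((\<bar>z\<bar> + sqrt \<omega>) powr D) \<le> norm (2 powr D * \<bar>z\<bar> powr D + 2 powr D * sqrt \<omega> powr D)"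
  proof (rule AE_I2)
    fix z
    have s: "0 \<le> sqrt \<omega>" using om_pos by simp
    have "(\<bar>z\<bar> + sqrt \<omega>) powr D \<le> (2 * max \<bar>z\<bar> (sqrt \<omega>)) powr D" using D s by (intro powr_mono2) auto
    also have "\<dots> = 2 powr D * max \<bar>z\<bar> (sqrt \<omega>) powr D" by (rule powr_mult)
    also have "\<dots> \<le> 2 powr D * (\<bar>z\<bar> powr D + sqrt \<omega> powr D)"
      by (intro mult_left_mono) (auto simp: max_def)
    finally show "norm ((\<bar>z\<bar> + sqrt \<omega>) powr D) \<le> norm (2 powr D * \<bar>z\<bar> powr D + 2 powr D * sqrt \<omega> powr D)" by (simp add: algebra_simps)
  qed
qed measurable

text \<open>The exponent \<open>6 * r\<close> makes tail probabilities of order \<open>1 / N\<^sup>3\<close>, which stays summable over the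
  at most \<open>N\<^sup>2\<close> entries.\<close>

definition Kt where "Kt = 2 * (\<integral>z. (\<bar>z\<bar> + sqrt \<omega>) powr (6 * r) \<partial>\<nu>)"

lemma Kt_nonneg: "0 \<le> Kt" by (simp add: Kt_def)

lemma cut_pow: "N \<ge> 1 \<Longrightarrow> cut N powr (6 * r) = real N ^ 3"
  using r_pos powr_numeral[of "real N" "num.Bit1 num.One"] by (simp add: cut_def powr_powr)

lemma tail_indicator:
  assumes N: "N \<ge> 1" and z: "cut N < \<bar>z\<bar> + sqrt \<omega>"
  shows "1 \<le> (\<bar>z\<bar> + sqrt \<omega>) powr (6 * r) / real N ^ 3"
proof -
  have "cut N powr (6 * r) \<le> (\<bar>z\<bar> + sqrt \<omega>) powr (6 * r)" using z r_pos by (intro powr_mono2) (auto simp: cut_def)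
  then show ?thesis unfolding cut_pow[OF N] using N by (simp add: le_divide_eq)
qed

text \<open>The mass lost by truncating is a tail probability, hence of smaller order than any
  power of the size; the third power suffices.\<close>

lemma kap_near_1:
  assumes N: "N \<ge> 1"
  shows "\<bar>kap N - 1\<bar> \<le> Kt / real N ^ 3"
proof -
  define I where "I = (\<lambda>z::real. indicator {z. \<bar>z\<bar> \<le> cut N} z :: real)"
  have Im [measurable]: "I \<in> borel_measurable borel" unfolding I_def by measurable
  have I01: "0 \<le> I z" "I z \<le> 1" for z by (auto simp: I_def indicator_def)
  have bI: "bounded_meas \<nu> (\<lambda>z. I (z + a))" for a
    by (rule bounded_measI[of _ _ 1]) (use I01 in \<open>auto simp: abs_of_nonneg\<close>)
  have bI0: "bounded_meas \<nu> I" using bI[of 0] by simp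
  have "kap N = (\<integral>z. I z * ratio N 1 z + (1 - I z) \<partial>\<nu>)"
    unfolding kap_def by (intro lint_cong refl) (auto simp: I_def indicator_def ratio_def)
  also have "\<dots> = (\<integral>z. I z * ratio N 1 z \<partial>\<nu>) + 1 - (\<integral>z. I z \<partial>\<nu>)"
    by (simp add: bm_int_add bm_int_diff bm bI0 bm_ratio[OF N])
  also have "(\<integral>z. I z * ratio N 1 z \<partial>\<nu>) = (\<integral>z. I (z + sh N) \<partial>\<nu>)"
  proof -
    have "(\<integral>z. I z * ratio N 1 z \<partial>\<nu>) = (\<integral>z. q z * (I z * ratio N 1 z) \<partial>lborel)"
      using q_pos by (subst integral_real_density) (auto intro: less_imp_le)
    also have "\<dots> = (\<integral>z. q (z - sh N) * I z \<partial>lborel)"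
      using q_pos by (intro lint_cong refl) (auto simp: I_def indicator_def ratio_def less_imp_neq[THEN not_sym])
    also have "\<dots> = (\<integral>z. q z * I (z + sh N) \<partial>lborel)"
      using lborel_integral_real_affine[of 1 "\<lambda>z. q (z - sh N) * I z" "sh N"] by (simp add: add.commute)
    also have "\<dots> = (\<integral>z. I (z + sh N) \<partial>\<nu>)"
      using q_pos by (subst integral_real_density) (auto intro: less_imp_le)
    finally show ?thesis .
  qed
  finally have k: "kap N - 1 = (\<integral>z. I (z + sh N) - I z \<partial>\<nu>)"
    by (simp add: bm_int_diff bI bI0)
  have "\<bar>\<integral>z. I (z + sh N) - I z \<partial>\<nu>\<bar> \<le> (\<integral>z. 2 * ((\<bar>z\<bar> + sqrt \<omega>) powr (6 * r) / real N ^ 3) \<partial>\<nu>)"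
  proof (rule order_trans[OF integral_abs_bound integral_mono])
    show "integrable \<nu> (\<lambda>z. \<bar>I (z + sh N) - I z\<bar>)"
      by (intro bm_integrable[OF prob_space_axioms] bm bI bI0)
    show "integrable \<nu> (\<lambda>z. 2 * ((\<bar>z\<bar> + sqrt \<omega>) powr (6 * r) / real N ^ 3))"
      using shifted_mom[of "6 * r"] r_pos by (intro integrable_mult_right integrable_divide) auto
    fix z
    show "\<bar>I (z + sh N) - I z\<bar> \<le> 2 * ((\<bar>z\<bar> + sqrt \<omega>) powr (6 * r) / real N ^ 3)"
    proof (cases "cut N < \<bar>z\<bar> + sqrt \<omega>")
      case True
      have "\<bar>I (z + sh N) - I z\<bar> \<le> 2" using I01[of z] I01[of "z + sh N"] by linarith
      then show ?thesis using tail_indicator[OF N True] by linarith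
    next
      case False
      then have "\<bar>z\<bar> \<le> cut N" "\<bar>z + sh N\<bar> \<le> cut N" using sh_le[OF N] sh_nonneg[of N] om_pos by auto
      then show ?thesis by (simp add: I_def)
    qed
  qed
  also have "\<dots> = Kt / real N ^ 3" by (simp add: Kt_def)
  finally show ?thesis unfolding k .
qed

lemma inv_kap:
  assumes N: "N \<ge> 1"
  shows "\<bar>1 / kap N - 1\<bar> \<le> M * Kt / real N ^ 3" "0 < 1 / kap N" "1 / kap N \<le> M"
proof -
  show 1: "0 < 1 / kap N" using kap_pos[OF N] by simp
  show 2: "1 / kap N \<le> M" using kap_ge[OF N] kap_pos[OF N] M_ge by (simp add: field_simps)
  have "\<bar>1 / kap N - 1\<bar> = (1 / kap N) * \<bar>kap N - 1\<bar>"
    using kap_pos[OF N] by (simp add: diff_divide_distrib[symmetric] abs_divide field_simps abs_minus_commute)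
  also have "\<dots> \<le> M * (Kt / real N ^ 3)" using 1 2 kap_near_1[OF N] M_ge by (intro mult_mono) auto
  finally show "\<bar>1 / kap N - 1\<bar> \<le> M * Kt / real N ^ 3" by simp
qed

text \<open>The decomposition of the truncated ratio into its parts that are even and odd in the direction of the signal, centred and
  normalised. On the diagonal the direction is fixed and no decomposition is needed.\<close>

definition even_part where "even_part N z = (ratio N 1 z + ratio N (- 1) z) / (2 * kap N) - 1"
definition odd_part where "odd_part N z = (ratio N 1 z - ratio N (- 1) z) / (2 * kap N)"
definition full_part where "full_part N z = ratio N 1 z / kap N - 1"

lemma parts_meas [measurable]: "even_part N \<in> borel_measurable borel" "odd_part N \<in> borel_measurable borel" "full_part N \<in> borel_measurable borel"
  unfolding even_part_def[abs_def] odd_part_def[abs_def] full_part_def[abs_def] by measurable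

lemma parts_bm: "N \<ge> 1 \<Longrightarrow> bounded_meas \<nu> (even_part N)" "N \<ge> 1 \<Longrightarrow> bounded_meas \<nu> (odd_part N)" "N \<ge> 1 \<Longrightarrow> bounded_meas \<nu> (full_part N)"
  unfolding even_part_def[abs_def] odd_part_def[abs_def] full_part_def[abs_def]
  by (intro bm bm_ratio; simp)+

lemma parts_ratio: "u \<in> {1, - 1} \<Longrightarrow> 1 + even_part N z + u * odd_part N z = ratio N u z / kap N"
  by (auto simp: even_part_def odd_part_def add_divide_distrib diff_divide_distrib)

lemma parts_pos: "N \<ge> 1 \<Longrightarrow> u \<in> {1, - 1} \<Longrightarrow> 0 < 1 + even_part N z + u * odd_part N z"
  unfolding parts_ratio using ratio_pos kap_pos by simp

text \<open>Symmetry of the density: reflecting \<open>z\<close> reverses the signal, so \<open>odd_part\<close> is an odd function of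
  \<open>z\<close> and \<open>even_part\<close> an even one.\<close>

lemma parts_int:
  assumes N: "N \<ge> 1"
  shows "(\<integral>z. even_part N z \<partial>\<nu>) = 0" "(\<integral>z. odd_part N z \<partial>\<nu>) = 0" "(\<integral>z. even_part N z * odd_part N z \<partial>\<nu>) = 0"
    "(\<integral>z. odd_part N z ^ 3 \<partial>\<nu>) = 0" "(\<integral>z. full_part N z \<partial>\<nu>) = 0"
proof -
  have fl: "even_part N (- z) = even_part N z" "odd_part N (- z) = - odd_part N z" for z
    by (simp_all add: even_part_def odd_part_def ratio_flip add.commute minus_divide_left)
  show "(\<integral>z. even_part N z \<partial>\<nu>) = 0"
    unfolding even_part_def using bm_ratio[OF N] kap_pos[OF N] by (simp add: bm_int_add bm_int_diff bm kap_flip)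
  show "(\<integral>z. full_part N z \<partial>\<nu>) = 0"
    unfolding full_part_def using bm_ratio[OF N] kap_pos[OF N] by (simp add: bm_int_diff bm kap_flip)
  show "(\<integral>z. odd_part N z \<partial>\<nu>) = 0" "(\<integral>z. even_part N z * odd_part N z \<partial>\<nu>) = 0" "(\<integral>z. odd_part N z ^ 3 \<partial>\<nu>) = 0"
    by (intro int_odd; simp add: fl)+
qed

lemma cut_at_top: "filterlim cut at_top sequentially"
proof -
  have "filterlim (\<lambda>N. exp (1 / (2 * r) * ln (real N))) at_top sequentially"
    using r_pos by (intro filterlim_compose[OF exp_at_top] filterlim_tendsto_pos_mult_at_top[OF tendsto_const]
        filterlim_compose[OF ln_at_top filterlim_real_sequentially]) auto
  then show ?thesis
    by (rule filterlim_mono_eventually) (auto simp: cut_def powr_def intro: eventually_sequentiallyI[of 1])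
qed

lemma sh_lim: "sh \<longlonglongrightarrow> 0"
proof -
  have "(\<lambda>N. sqrt (\<omega> / real N)) \<longlonglongrightarrow> sqrt 0" by (intro tendsto_intros lim_const_over_n)
  then show ?thesis by (simp add: sh_def[abs_def])
qed

lemma window: "\<forall>\<^sub>F N in sequentially. N \<ge> 1 \<and> \<bar>z\<bar> \<le> cut N"
  using cut_at_top eventually_ge_at_top[of "1::nat"] by (intro eventually_conj) (auto simp: filterlim_at_top)

lemma inv_kap_lim: "(\<lambda>N. real N ^ 2 * (1 / kap N - 1)) \<longlonglongrightarrow> 0" "(\<lambda>N. 1 / kap N) \<longlonglongrightarrow> 1"
proof -
  have "(\<lambda>N. M * Kt / real N) \<longlonglongrightarrow> 0" by (rule lim_const_over_n)
  moreover have "\<forall>\<^sub>F N in sequentially. norm (real N ^ 2 * (1 / kap N - 1)) \<le> M * Kt / real N"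
    using eventually_ge_at_top[of "1::nat"]
  proof eventually_elim
    case (elim N)
    have "norm (real N ^ 2 * (1 / kap N - 1)) \<le> real N ^ 2 * (M * Kt / real N ^ 3)"
      unfolding real_norm_def abs_mult using inv_kap(1)[OF elim] by (intro mult_mono) auto
    also have "\<dots> = M * Kt / real N" using elim by (simp add: power2_eq_square power3_eq_cube)
    finally show ?case .
  qed
  ultimately show 1: "(\<lambda>N. real N ^ 2 * (1 / kap N - 1)) \<longlonglongrightarrow> 0" by (rule Lim_null_comparison[rotated])
  have "\<forall>\<^sub>F N in sequentially. norm (1 / kap N - 1) \<le> M * Kt / real N"
    using eventually_ge_at_top[of "1::nat"]
  proof eventually_elim
    case (elim N)
    have "M * Kt / real N ^ 3 \<le> M * Kt / real N"
      using elim Kt_nonneg M_ge by (intro divide_left_mono) (auto simp: self_le_power)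
    then show ?case using inv_kap(1)[OF elim] by simp
  qed
  then have "(\<lambda>N. 1 / kap N - 1) \<longlonglongrightarrow> 0" using lim_const_over_n by (rule Lim_null_comparison)
  from tendsto_add[OF this tendsto_const[of 1]] show "(\<lambda>N. 1 / kap N) \<longlonglongrightarrow> 1" by simp
qed

lemma diff_quot: "(\<lambda>N. sqrt N * (q (z + u * sh N) - q z)) \<longlonglongrightarrow> sqrt \<omega> * u * q1 z" if u: "u \<in> {1, - 1}"
proof -
  have "((\<lambda>h. (q (z + h) - q z) / h) \<longlongrightarrow> q1 z) (at 0)" using D1[of z] unfolding DERIV_def .
  moreover have "filterlim (\<lambda>N. u * sh N) (at 0) sequentially"
    unfolding filterlim_at
  proof
    have "(\<lambda>N. u * sh N) \<longlonglongrightarrow> u * 0" by (intro tendsto_intros sh_lim)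
    then show "(\<lambda>N. u * sh N) \<longlonglongrightarrow> 0" by simp
    show "\<forall>\<^sub>F N in sequentially. u * sh N \<in> UNIV \<and> u * sh N \<noteq> 0"
      using eventually_ge_at_top[of "1::nat"] by eventually_elim (use u om_pos in \<open>auto simp: sh_def\<close>)
  qed
  ultimately have "(\<lambda>N. (q (z + u * sh N) - q z) / (u * sh N)) \<longlonglongrightarrow> q1 z" by (rule filterlim_compose)
  then have "(\<lambda>N. sqrt \<omega> * u * ((q (z + u * sh N) - q z) / (u * sh N))) \<longlonglongrightarrow> sqrt \<omega> * u * q1 z" by (intro tendsto_intros)
  moreover have "\<forall>\<^sub>F N in sequentially. sqrt \<omega> * u * ((q (z + u * sh N) - q z) / (u * sh N)) = sqrt N * (q (z + u * sh N) - q z)"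
    using eventually_ge_at_top[of "1::nat"]
  proof eventually_elim
    case (elim N)
    have "sh N > 0" using elim om_pos by (simp add: sh_def)
    then show ?case unfolding sh_sqrt[OF elim, symmetric] using u by auto
  qed
  ultimately show ?thesis by (rule Lim_transform_eventually)
qed

lemma second_quot: "(\<lambda>N. real N * (q (z - sh N) + q (z + sh N) - 2 * q z)) \<longlonglongrightarrow> \<omega> * q2 z"
proof -
  have "\<exists>x y. \<bar>x - z\<bar> \<le> sh N \<and> \<bar>y - z\<bar> \<le> sh N \<and> real N * (q (z - sh N) + q (z + sh N) - 2 * q z) = \<omega> * ((q2 x + q2 y) / 2)" if N: "N \<ge> 1" for N
  proof -
    have s: "sh N > 0" using N om_pos by (simp add: sh_def)
    obtain x where x: "\<bar>x - z\<bar> \<le> sh N" "q (z + sh N) = q z + q1 z * sh N + q2 x / 2 * (sh N)\<^sup>2"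
      using second_taylor[of "sh N" z] s by auto
    obtain y where y: "\<bar>y - z\<bar> \<le> sh N" "q (z - sh N) = q z - q1 z * sh N + q2 y / 2 * (sh N)\<^sup>2"
      using second_taylor[of "- sh N" z] s by auto
    have "real N * (q (z - sh N) + q (z + sh N) - 2 * q z) = (real N * (sh N)\<^sup>2) * ((q2 x + q2 y) / 2)"
      unfolding x(2) y(2) by (simp add: field_simps)
    then show ?thesis unfolding sh_sq[OF N] using x(1) y(1) by blast
  qed
  then obtain x y where xy: "\<And>N. N \<ge> 1 \<Longrightarrow> \<bar>x N - z\<bar> \<le> sh N \<and> \<bar>y N - z\<bar> \<le> sh N \<and> real N * (q (z - sh N) + q (z + sh N) - 2 * q z) = \<omega> * ((q2 (x N) + q2 (y N)) / 2)"
    by metis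
  have to: "w \<longlonglongrightarrow> z" if "\<And>N. N \<ge> 1 \<Longrightarrow> \<bar>w N - z\<bar> \<le> sh N" for w
  proof -
    have "\<forall>\<^sub>F N in sequentially. norm (w N - z) \<le> sh N" using eventually_ge_at_top[of "1::nat"] by eventually_elim (use that in auto)
    then have "(\<lambda>N. w N - z) \<longlonglongrightarrow> 0" using sh_lim by (rule Lim_null_comparison)
    then show ?thesis by (simp add: LIM_zero_iff)
  qed
  have "(\<lambda>N. \<omega> * ((q2 (x N) + q2 (y N)) / 2)) \<longlonglongrightarrow> \<omega> * ((q2 z + q2 z) / 2)"
    using xy by (intro tendsto_intros isCont_tendsto_compose[OF q2_cont] to) auto
  moreover have "\<forall>\<^sub>F N in sequentially. \<omega> * ((q2 (x N) + q2 (y N)) / 2) = real N * (q (z - sh N) + q (z + sh N) - 2 * q z)"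
    using eventually_ge_at_top[of "1::nat"] by eventually_elim (use xy in auto)
  ultimately have "(\<lambda>N. real N * (q (z - sh N) + q (z + sh N) - 2 * q z)) \<longlonglongrightarrow> \<omega> * ((q2 z + q2 z) / 2)"
    by (rule Lim_transform_eventually)
  then show ?thesis by simp
qed

lemma sqrt_inv_kap: "(\<lambda>N. sqrt N * (1 / kap N - 1)) \<longlonglongrightarrow> 0" "(\<lambda>N. real N * (1 / kap N - 1)) \<longlonglongrightarrow> 0"
proof -
  have 1: "norm (c * (1 / kap N - 1)) \<le> norm (real N ^ 2 * (1 / kap N - 1))" if "0 \<le> c" "c \<le> real N ^ 2" for c :: real and N
    unfolding real_norm_def abs_mult using that by (intro mult_right_mono) auto
  have "sqrt N \<le> real N ^ 2" "real N \<le> real N ^ 2" for N :: nat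
  proof -
    show "real N \<le> real N ^ 2" by (cases "N = 0") (auto simp: self_le_power)
    moreover have "sqrt N \<le> real N" by (cases "N = 0") (auto intro!: real_le_lsqrt simp: self_le_power)
    ultimately show "sqrt N \<le> real N ^ 2" by linarith
  qed
  then show "(\<lambda>N. sqrt N * (1 / kap N - 1)) \<longlonglongrightarrow> 0" "(\<lambda>N. real N * (1 / kap N - 1)) \<longlonglongrightarrow> 0"
    using 1 by (auto intro!: Lim_null_comparison[OF _ tendsto_norm_zero[OF inv_kap_lim(1)]] always_eventually)
qed

text \<open>To leading order the odd part is the first derivative in the shift and the even part the second one; the correction
  by \<open>kap\<close> is negligible.\<close>

lemma odd_lim: "(\<lambda>N. sqrt N * odd_part N z) \<longlonglongrightarrow> - sqrt \<omega> * (q1 z / q z)"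
proof -
  have "(\<lambda>N. (sqrt N * (q (z + (- 1) * sh N) - q z) - sqrt N * (q (z + 1 * sh N) - q z)) / (2 * q z) * (1 / kap N)) \<longlonglongrightarrow>
     (sqrt \<omega> * (- 1) * q1 z - sqrt \<omega> * 1 * q1 z) / (2 * q z) * 1"
    using q_pos[of z] by (intro tendsto_intros diff_quot inv_kap_lim) auto
  moreover have "\<forall>\<^sub>F N in sequentially. (sqrt N * (q (z + (- 1) * sh N) - q z) - sqrt N * (q (z + 1 * sh N) - q z)) / (2 * q z) * (1 / kap N) = sqrt N * odd_part N z"
    using window[of z] by eventually_elim (use q_pos[of z] in \<open>simp add: odd_part_def ratio_def field_simps\<close>)
  ultimately have "(\<lambda>N. sqrt N * odd_part N z) \<longlonglongrightarrow> (sqrt \<omega> * (- 1) * q1 z - sqrt \<omega> * 1 * q1 z) / (2 * q z) * 1"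
    by (rule Lim_transform_eventually)
  then show ?thesis by simp
qed

lemma even_lim: "(\<lambda>N. real N * even_part N z) \<longlonglongrightarrow> \<omega> / 2 * (q2 z / q z)"
proof -
  have "(\<lambda>N. (real N * (q (z - sh N) + q (z + sh N) - 2 * q z)) / (2 * q z) * (1 / kap N) + real N * (1 / kap N - 1)) \<longlonglongrightarrow>
     (\<omega> * q2 z) / (2 * q z) * 1 + 0"
    using q_pos[of z] by (intro tendsto_intros second_quot inv_kap_lim sqrt_inv_kap) auto
  moreover have "\<forall>\<^sub>F N in sequentially. (real N * (q (z - sh N) + q (z + sh N) - 2 * q z)) / (2 * q z) * (1 / kap N) + real N * (1 / kap N - 1) = real N * even_part N z"
    using window[of z]
  proof eventually_elim
    case (elim N)
    then show ?case using q_pos[of z] kap_pos[of N] by (simp add: even_part_def ratio_def field_simps)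
  qed
  ultimately have "(\<lambda>N. real N * even_part N z) \<longlonglongrightarrow> (\<omega> * q2 z) / (2 * q z) * 1 + 0"
    by (rule Lim_transform_eventually)
  then show ?thesis by simp
qed

lemma full_lim: "(\<lambda>N. sqrt N * full_part N z) \<longlonglongrightarrow> - sqrt \<omega> * (q1 z / q z)"
proof -
  have "(\<lambda>N. (sqrt N * (q (z + (- 1) * sh N) - q z)) / q z * (1 / kap N) + sqrt N * (1 / kap N - 1)) \<longlonglongrightarrow>
     (sqrt \<omega> * (- 1) * q1 z) / q z * 1 + 0"
    using q_pos[of z] by (intro tendsto_intros diff_quot inv_kap_lim sqrt_inv_kap) auto
  moreover have "\<forall>\<^sub>F N in sequentially. (sqrt N * (q (z + (- 1) * sh N) - q z)) / q z * (1 / kap N) + sqrt N * (1 / kap N - 1) = sqrt N * full_part N z"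
    using window[of z]
  proof eventually_elim
    case (elim N)
    then show ?case using q_pos[of z] kap_pos[of N] by (simp add: full_part_def ratio_def field_simps)
  qed
  ultimately have "(\<lambda>N. sqrt N * full_part N z) \<longlonglongrightarrow> (sqrt \<omega> * (- 1) * q1 z) / q z * 1 + 0"
    by (rule Lim_transform_eventually)
  then show ?thesis by simp
qed

text \<open>A polynomially growing bound that dominates the rescaled parts for all sizes at once.\<close>

definition U where "U z = (\<omega> + sqrt \<omega>) * K * M\<^sup>2 * W z + M * Kt"

lemma U_nonneg: "0 \<le> U z"
  using K_pos om_pos W_ge[of z] M_ge Kt_nonneg by (auto simp: U_def intro!: add_nonneg_nonneg mult_nonneg_nonneg)

lemma parts_dom:
  shows "\<bar>sqrt N * odd_part N z\<bar> \<le> U z" "\<bar>real N * even_part N z\<bar> \<le> U z" "\<bar>sqrt N * full_part N z\<bar> \<le> U z"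
proof -
  have "\<bar>sqrt N * odd_part N z\<bar> \<le> U z \<and> \<bar>real N * even_part N z\<bar> \<le> U z \<and> \<bar>sqrt N * full_part N z\<bar> \<le> U z"
  proof (cases "N \<ge> 1")
    case False
    then have "N = 0" by simp
    then show ?thesis using U_nonneg by simp
  next
    case N: True
    define k where "k = 1 / kap N"
    have k: "0 < k" "k \<le> M" "\<bar>k - 1\<bar> \<le> M * Kt / real N ^ 3" using inv_kap[OF N] by (auto simp: k_def)
    have kN: "real N * \<bar>k - 1\<bar> \<le> M * Kt" "sqrt N * \<bar>k - 1\<bar> \<le> M * Kt"
    proof -
      have "real N * \<bar>k - 1\<bar> \<le> real N * (M * Kt / real N ^ 3)" using k by (intro mult_left_mono) auto
      also have "\<dots> = M * Kt / real N ^ 2" using N by (simp add: power2_eq_square power3_eq_cube)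
      also have "\<dots> \<le> M * Kt / 1" using N M_ge Kt_nonneg by (intro divide_left_mono) auto
      finally show 1: "real N * \<bar>k - 1\<bar> \<le> M * Kt" by simp
      have "sqrt N \<le> real N" using N by (auto intro!: real_le_lsqrt simp: self_le_power)
      then have "sqrt N * \<bar>k - 1\<bar> \<le> real N * \<bar>k - 1\<bar>" by (intro mult_right_mono) auto
      with 1 show "sqrt N * \<bar>k - 1\<bar> \<le> M * Kt" by linarith
    qed
    define R where "R = K * W z * M"
    have R: "0 \<le> R" using K_pos W_ge[of z] M_ge by (simp add: R_def)
    have U1: "sqrt \<omega> * R * M + M * Kt \<le> U z" "\<omega> * R * M + M * Kt \<le> U z" "sqrt \<omega> * R * M \<le> U z" "M * Kt \<le> U z"
    proof -
      have "0 \<le> sqrt \<omega> * R * M" "0 \<le> \<omega> * R * M" "0 \<le> M * Kt" using R M_ge om_pos Kt_nonneg by auto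
      moreover have "U z = \<omega> * R * M + sqrt \<omega> * R * M + M * Kt" by (simp add: U_def R_def power2_eq_square algebra_simps)
      ultimately show "sqrt \<omega> * R * M + M * Kt \<le> U z" "\<omega> * R * M + M * Kt \<le> U z" "sqrt \<omega> * R * M \<le> U z" "M * Kt \<le> U z" by linarith+
    qed
    have qz: "q z > 0" by (rule q_pos)
    show ?thesis
    proof (cases "\<bar>z\<bar> \<le> cut N")
      case True
      have d: "\<bar>(q (z - u * sh N) - q z) / q z\<bar> \<le> R * sh N" if "u \<in> {1, - 1}" for u
        using first_diff[OF N True, of "z - u * sh N"] that sh_nonneg[of N] qz by (auto simp: R_def abs_divide divide_le_eq mult_ac)
      have d2: "\<bar>(q (z - sh N) + q (z + sh N) - 2 * q z) / q z\<bar> \<le> R * (sh N)\<^sup>2"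
        using second_diff[OF N True] qz by (simp add: R_def abs_divide divide_le_eq mult_ac)
      have o: "odd_part N z = ((q (z - 1 * sh N) - q z) / q z - (q (z - (- 1) * sh N) - q z) / q z) / 2 * k"
        using True qz by (simp add: odd_part_def ratio_def k_def field_simps)
      have e: "even_part N z = ((q (z - sh N) + q (z + sh N) - 2 * q z) / q z) / 2 * k + (k - 1)"
        using True qz kap_pos[OF N] by (simp add: even_part_def ratio_def k_def field_simps)
      have f: "full_part N z = ((q (z - 1 * sh N) - q z) / q z) * k + (k - 1)"
        using True qz kap_pos[OF N] by (simp add: full_part_def ratio_def k_def field_simps)
      have "\<bar>sqrt N * odd_part N z\<bar> \<le> sqrt \<omega> * R * M"
      proof -
        have "\<bar>(x - y) / 2\<bar> \<le> t" if "\<bar>x\<bar> \<le> t" "\<bar>y\<bar> \<le> t" for x y t :: real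
        proof -
          have "\<bar>x - y\<bar> \<le> 2 * t" using that by linarith
          then show ?thesis unfolding abs_divide by simp
        qed
        from this[OF d[of 1] d[of "- 1"]]
        have "\<bar>odd_part N z\<bar> \<le> (R * sh N) * M" unfolding o abs_mult using k by (intro mult_mono) auto
        then have "\<bar>sqrt N * odd_part N z\<bar> \<le> sqrt N * ((R * sh N) * M)" by (simp add: abs_mult mult_left_mono)
        also have "\<dots> = (sqrt N * sh N) * R * M" by (simp only: mult_ac)
        finally show ?thesis unfolding sh_sqrt[OF N] .
      qed
      moreover have "\<bar>real N * even_part N z\<bar> \<le> \<omega> * R * M + M * Kt"
      proof -
        have half: "\<bar>a / 2\<bar> \<le> b" if "\<bar>a\<bar> \<le> b" for a b :: real using that by simp
        have "\<bar>((q (z - sh N) + q (z + sh N) - 2 * q z) / q z) / 2 * k\<bar> \<le> (R * (sh N)\<^sup>2) * M"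
          unfolding abs_mult[of _ k] using k half[OF d2] R by (intro mult_mono) auto
        then have "\<bar>even_part N z\<bar> \<le> (R * (sh N)\<^sup>2) * M + \<bar>k - 1\<bar>" unfolding e by linarith
        then have "\<bar>real N * even_part N z\<bar> \<le> real N * ((R * (sh N)\<^sup>2) * M + \<bar>k - 1\<bar>)" by (simp add: abs_mult mult_left_mono)
        also have "\<dots> = (real N * (sh N)\<^sup>2) * R * M + real N * \<bar>k - 1\<bar>" by (simp add: algebra_simps)
        finally show ?thesis unfolding sh_sq[OF N] using kN by linarith
      qed
      moreover have "\<bar>sqrt N * full_part N z\<bar> \<le> sqrt \<omega> * R * M + M * Kt"
      proof -
        have "\<bar>((q (z - 1 * sh N) - q z) / q z) * k\<bar> \<le> (R * sh N) * M"
          unfolding abs_mult using k d[of 1] R sh_nonneg[of N] by (intro mult_mono) auto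
        then have "\<bar>full_part N z\<bar> \<le> (R * sh N) * M + \<bar>k - 1\<bar>" unfolding f by linarith
        then have "\<bar>sqrt N * full_part N z\<bar> \<le> sqrt N * ((R * sh N) * M + \<bar>k - 1\<bar>)" by (simp add: abs_mult mult_left_mono)
        also have "\<dots> = (sqrt N * sh N) * R * M + sqrt N * \<bar>k - 1\<bar>" by (simp add: algebra_simps)
        finally show ?thesis unfolding sh_sqrt[OF N] using kN by linarith
      qed
      ultimately show ?thesis using U1 by linarith
    next
      case False
      then have "odd_part N z = 0" "even_part N z = k - 1" "full_part N z = k - 1"
        using kap_pos[OF N] by (auto simp: odd_part_def even_part_def full_part_def ratio_def k_def)
      then show ?thesis using kN U1 U_nonneg[of z] by (simp add: abs_mult)
    qed
  qed
  then show "\<bar>sqrt N * odd_part N z\<bar> \<le> U z" "\<bar>real N * even_part N z\<bar> \<le> U z" "\<bar>sqrt N * full_part N z\<bar> \<le> U z" by auto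
qed

lemma U_meas [measurable]: "U \<in> borel_measurable borel" unfolding U_def by measurable

lemma U_pow_integrable: "integrable \<nu> (\<lambda>z. U z ^ n)"
proof (rule Bochner_Integration.integrable_bound)
  define a where "a = (\<omega> + sqrt \<omega>) * K * M\<^sup>2 + M * Kt"
  have a: "0 \<le> a" using K_pos om_pos M_ge Kt_nonneg by (auto simp: a_def intro!: add_nonneg_nonneg mult_nonneg_nonneg)
  have s: "0 < sqrt \<omega>" using om_pos by simp
  show "integrable \<nu> (\<lambda>z. (2 * a) ^ n + (2 * a) ^ n * (\<bar>z\<bar> + sqrt \<omega>) powr (r * real (Suc n)))"
    using shifted_mom[of "r * real (Suc n)"] r_pos bm_integrable[OF prob_space_axioms bm_const]
    by (intro Bochner_Integration.integrable_add integrable_mult_right) auto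
  show "AE z in \<nu>. norm (U z ^ n) \<le> norm ((2 * a) ^ n + (2 * a) ^ n * (\<bar>z\<bar> + sqrt \<omega>) powr (r * real (Suc n)))"
  proof (rule AE_I2)
    fix z
    define t where "t = (\<bar>z\<bar> + sqrt \<omega>) powr r"
    have "\<bar>z\<bar> + sqrt \<omega> > 0" using s by (intro add_nonneg_pos) auto
    then have t0: "t > 0" by (simp add: t_def)
    have tn: "(\<bar>z\<bar> + sqrt \<omega>) powr (r * real (Suc n)) = t ^ Suc n"
      using t0 s by (subst powr_realpow[symmetric]) (auto simp: t_def powr_powr)
    have W: "W z = 1 + t" by (simp add: W_def t_def)
    have "U z \<le> a * W z"
    proof -
      have "M * Kt * 1 \<le> M * Kt * W z" using W_ge[of z] M_ge Kt_nonneg by (intro mult_left_mono) auto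
      then show ?thesis by (simp add: U_def a_def algebra_simps)
    qed
    also have "\<dots> \<le> a * (2 * max 1 t)" unfolding W using a by (intro mult_left_mono) auto
    finally have "U z ^ n \<le> (a * (2 * max 1 t)) ^ n" using U_nonneg by (intro power_mono) auto
    also have "\<dots> = (2 * a) ^ n * max 1 t ^ n" by (simp add: power_mult_distrib)
    also have "\<dots> \<le> (2 * a) ^ n * (1 + t ^ Suc n)"
    proof (rule mult_left_mono)
      show "max 1 t ^ n \<le> 1 + t ^ Suc n"
      proof (cases "t \<le> 1")
        case True then show ?thesis using t0 by (simp add: max_def)
      next
        case False
        then have "t ^ n \<le> t ^ Suc n" by (intro power_increasing) auto
        moreover have "max 1 t = t" using False by (simp add: max_def)
        ultimately show ?thesis by (simp only: add_increasing zero_le_one)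
      qed
    qed (use a in auto)
    finally have "U z ^ n \<le> (2 * a) ^ n + (2 * a) ^ n * t ^ Suc n" unfolding distrib_left mult_1_right .
    then show "norm (U z ^ n) \<le> norm ((2 * a) ^ n + (2 * a) ^ n * (\<bar>z\<bar> + sqrt \<omega>) powr (r * real (Suc n)))"
      unfolding tn using U_nonneg[of z] by simp
  qed
qed measurable

lemma pow_dct:
  assumes [measurable]: "\<And>N. s N \<in> borel_measurable borel" "l \<in> borel_measurable borel"
    and lim: "\<And>z. (\<lambda>N. s N z) \<longlonglongrightarrow> l z" and dom: "\<And>N z. \<bar>s N z\<bar> \<le> U z"
  shows "(\<lambda>N. \<integral>z. s N z ^ n \<partial>\<nu>) \<longlonglongrightarrow> (\<integral>z. l z ^ n \<partial>\<nu>)"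
proof (rule integral_dominated_convergence[OF _ _ U_pow_integrable[of n]])
  show "AE z in \<nu>. (\<lambda>N. s N z ^ n) \<longlonglongrightarrow> l z ^ n" by (rule AE_I2) (intro tendsto_intros lim)
  show "AE z in \<nu>. norm (s N z ^ n) \<le> U z ^ n" for N
    by (rule AE_I2) (use dom in \<open>simp add: power_abs power_mono\<close>)
qed measurable

lemma odd_moments:
  "(\<lambda>N. N * (\<integral>z. (odd_part N z)\<^sup>2 \<partial>\<nu>)) \<longlonglongrightarrow> \<omega> * (\<integral>z. (q1 z / q z)\<^sup>2 \<partial>\<nu>)"
  "(\<lambda>N. (real N)\<^sup>2 * (\<integral>z. odd_part N z ^ 4 \<partial>\<nu>)) \<longlonglongrightarrow> \<omega>\<^sup>2 * (\<integral>z. (q1 z / q z) ^ 4 \<partial>\<nu>)"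
proof -
  note L = pow_dct[of "\<lambda>N z. sqrt N * odd_part N z" "\<lambda>z. - sqrt \<omega> * (q1 z / q z)", OF _ _ odd_lim parts_dom(1), simplified power_mult_distrib, simplified]
  have 4: "sqrt x ^ 4 = x\<^sup>2" if "0 \<le> x" for x :: real
  proof -
    have "sqrt x ^ 4 = (sqrt x * sqrt x) * (sqrt x * sqrt x)" by (simp only: power4_eq_xxxx mult_ac)
    then show ?thesis using that by (simp add: power2_eq_square)
  qed
  show "(\<lambda>N. N * (\<integral>z. (odd_part N z)\<^sup>2 \<partial>\<nu>)) \<longlonglongrightarrow> \<omega> * (\<integral>z. (q1 z / q z)\<^sup>2 \<partial>\<nu>)"
    using L[of 2] om_pos by (simp add: power_mult_distrib power_divide)
  show "(\<lambda>N. (real N)\<^sup>2 * (\<integral>z. odd_part N z ^ 4 \<partial>\<nu>)) \<longlonglongrightarrow> \<omega>\<^sup>2 * (\<integral>z. (q1 z / q z) ^ 4 \<partial>\<nu>)"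
    using L[of 4] om_pos by (simp add: power_mult_distrib power_divide 4)
qed

lemma even_moments:
  "(\<lambda>N. (real N)\<^sup>2 * (\<integral>z. (even_part N z)\<^sup>2 \<partial>\<nu>)) \<longlonglongrightarrow> \<omega>\<^sup>2 / 4 * (\<integral>z. (q2 z / q z)\<^sup>2 \<partial>\<nu>)"
  "(\<lambda>N. real N ^ 4 * (\<integral>z. even_part N z ^ 4 \<partial>\<nu>)) \<longlonglongrightarrow> \<omega> ^ 4 / 16 * (\<integral>z. (q2 z / q z) ^ 4 \<partial>\<nu>)"
proof -
  note L = pow_dct[of "\<lambda>N z. real N * even_part N z" "\<lambda>z. \<omega> / 2 * (q2 z / q z)", OF _ _ even_lim parts_dom(2), simplified power_mult_distrib, simplified]
  show "(\<lambda>N. (real N)\<^sup>2 * (\<integral>z. (even_part N z)\<^sup>2 \<partial>\<nu>)) \<longlonglongrightarrow> \<omega>\<^sup>2 / 4 * (\<integral>z. (q2 z / q z)\<^sup>2 \<partial>\<nu>)"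
    using L[of 2] by (simp add: power_mult_distrib power_divide)
  show "(\<lambda>N. real N ^ 4 * (\<integral>z. even_part N z ^ 4 \<partial>\<nu>)) \<longlonglongrightarrow> \<omega> ^ 4 / 16 * (\<integral>z. (q2 z / q z) ^ 4 \<partial>\<nu>)"
    using L[of 4] by (simp add: power_mult_distrib power_divide)
qed

lemma full_moments:
  "(\<lambda>N. N * (\<integral>z. (full_part N z)\<^sup>2 \<partial>\<nu>)) \<longlonglongrightarrow> \<omega> * (\<integral>z. (q1 z / q z)\<^sup>2 \<partial>\<nu>)"
  "(\<lambda>N. N * (\<integral>z. \<bar>full_part N z\<bar> ^ 3 \<partial>\<nu>)) \<longlonglongrightarrow> 0"
proof -
  note L = pow_dct[of "\<lambda>N z. sqrt N * full_part N z" "\<lambda>z. - sqrt \<omega> * (q1 z / q z)", OF _ _ full_lim parts_dom(3), simplified power_mult_distrib, simplified]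
  show "(\<lambda>N. N * (\<integral>z. (full_part N z)\<^sup>2 \<partial>\<nu>)) \<longlonglongrightarrow> \<omega> * (\<integral>z. (q1 z / q z)\<^sup>2 \<partial>\<nu>)"
    using L[of 2] om_pos by (simp add: power_mult_distrib power_divide)
  have "(\<lambda>N. \<integral>z. \<bar>sqrt N * full_part N z\<bar> ^ 3 \<partial>\<nu>) \<longlonglongrightarrow> (\<integral>z. \<bar>- sqrt \<omega> * (q1 z / q z)\<bar> ^ 3 \<partial>\<nu>)"
    by (rule pow_dct) (measurable, intro tendsto_intros full_lim, use parts_dom(3) in simp)
  then have "(\<lambda>N. (\<integral>z. \<bar>sqrt N * full_part N z\<bar> ^ 3 \<partial>\<nu>) * (1 / sqrt N)) \<longlonglongrightarrow> (\<integral>z. \<bar>- sqrt \<omega> * (q1 z / q z)\<bar> ^ 3 \<partial>\<nu>) * 0"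
  proof (rule tendsto_mult)
    have "(\<lambda>N. sqrt (1 / real N)) \<longlonglongrightarrow> sqrt 0" by (intro tendsto_intros lim_const_over_n)
    then show "(\<lambda>N. 1 / sqrt (real N)) \<longlonglongrightarrow> 0" by (simp add: real_sqrt_divide)
  qed
  moreover have "(\<integral>z. \<bar>sqrt N * full_part N z\<bar> ^ 3 \<partial>\<nu>) * (1 / sqrt N) = N * (\<integral>z. \<bar>full_part N z\<bar> ^ 3 \<partial>\<nu>)" for N :: nat
  proof (cases "N = 0")
    case False
    have "sqrt N ^ 3 * (1 / sqrt N) = N" using False by (simp add: power3_eq_cube)
    then have "sqrt N ^ 3 * x * (1 / sqrt N) = N * x" for x :: real
      by (subst mult.assoc, subst mult.commute[of x], subst mult.assoc[symmetric]) simp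
    then show ?thesis by (simp add: abs_mult power_mult_distrib)
  qed simp
  ultimately show "(\<lambda>N. N * (\<integral>z. \<bar>full_part N z\<bar> ^ 3 \<partial>\<nu>)) \<longlonglongrightarrow> 0" by simp
qed

lemma info_eq:
  assumes [measurable]: "g \<in> borel_measurable borel"
  shows "(\<integral>z. (g z / q z)\<^sup>2 \<partial>\<nu>) = (\<integral>z. (g z)\<^sup>2 / q z \<partial>lborel)"
proof -
  have "(\<integral>z. (g z / q z)\<^sup>2 \<partial>\<nu>) = (\<integral>z. q z * (g z / q z)\<^sup>2 \<partial>lborel)"
    using q_pos by (subst integral_real_density) (auto intro: less_imp_le)
  also have "\<dots> = (\<integral>z. (g z)\<^sup>2 / q z \<partial>lborel)"
    using q_pos by (intro lint_cong refl) (simp add: power2_eq_square less_imp_neq[THEN not_sym])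
  finally show ?thesis .
qed

end

section \<open>Shifting a product measure\<close>

lemma shift_density_emeasure:
  fixes f :: "real \<Rightarrow> real"
  assumes [measurable]: "f \<in> borel_measurable borel" "A \<in> sets borel" and pos: "\<And>t. 0 < f t"
  shows "emeasure (density lborel f) {t. t + c \<in> A} = (\<integral>\<^sup>+t. ennreal (f (t - c) / f t) * indicator A t \<partial>density lborel f)"
proof -
  have "(\<integral>\<^sup>+t. ennreal (f (t - c) / f t) * indicator A t \<partial>density lborel f)
      = (\<integral>\<^sup>+t. ennreal (f t) * (ennreal (f (t - c) / f t) * indicator A t) \<partial>lborel)"
    by (rule nn_integral_density) auto
  also have "\<dots> = (\<integral>\<^sup>+t. ennreal (f (t - c)) * indicator A t \<partial>lborel)"
    using pos by (intro nn_integral_cong) (simp add: mult.assoc[symmetric] ennreal_mult[symmetric] less_imp_le less_imp_neq[THEN not_sym])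
  also have "\<dots> = (\<integral>\<^sup>+t. ennreal (f t) * indicator A (t + c) \<partial>lborel)"
    by (subst nn_integral_real_affine[of _ 1 c]) (auto simp: add.commute)
  also have "\<dots> = (\<integral>\<^sup>+t. ennreal (f t) * indicator {t. t + c \<in> A} t \<partial>lborel)"
    by (intro nn_integral_cong) (auto simp: indicator_def)
  also have "\<dots> = emeasure (density lborel f) {t. t + c \<in> A}" by (rule emeasure_density[symmetric]) auto
  finally show ?thesis ..
qed

text \<open>Both sides are the product of the shifted one-dimensional laws, as is seen on rectangles.\<close>

lemma product_shift:
  fixes f :: "'i \<Rightarrow> real \<Rightarrow> real"
  assumes fin: "finite J" and [measurable]: "\<And>i. f i \<in> borel_measurable borel" and pos: "\<And>i t. 0 < f i t"
    and prob: "\<And>i. prob_space (density lborel (f i))"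
  shows "distr (PiM J (\<lambda>i. density lborel (f i))) (PiM J (\<lambda>i. density lborel (f i))) (\<lambda>z. \<lambda>i\<in>J. z i + c i)
    = density (PiM J (\<lambda>i. density lborel (f i))) (\<lambda>z. ennreal (\<Prod>i\<in>J. f i (z i - c i) / f i (z i)))" (is "?D = ?E")
proof -
  define m where "m i = density lborel (f i)" for i
  define n where "n i = distr (m i) borel (\<lambda>t. t + c i)" for i
  have sm [measurable_cong]: "sets (m i) = sets borel" for i by (simp add: m_def)
  have sn [measurable_cong]: "sets (n i) = sets borel" for i by (simp add: n_def)
  have pm: "prob_space (m i)" for i unfolding m_def by (rule prob)
  have pn: "prob_space (n i)" for i unfolding n_def by (rule prob_space.prob_space_distr[OF pm]) measurable
  interpret m: product_sigma_finite m by (rule product_sigma_finite.intro) (rule prob_space_imp_sigma_finite[OF pm])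
  interpret n: product_sigma_finite n by (rule product_sigma_finite.intro) (rule prob_space_imp_sigma_finite[OF pn])
  have eq: "emeasure (n i) A = emeasure (m i) {t. t + c i \<in> A}" if [measurable]: "A \<in> sets borel" for i A
    unfolding n_def by (subst emeasure_distr) (auto simp: m_def vimage_def)
  have sets: "sets (PiM J m) = sets (PiM J n)" by (rule sets_PiM_cong) (auto simp: sm sn)
  have "distr (PiM J m) (PiM J m) (\<lambda>z. \<lambda>i\<in>J. z i + c i) = PiM J n"
  proof (rule n.PiM_eqI[OF fin])
    show "sets (distr (PiM J m) (PiM J m) (\<lambda>z. \<lambda>i\<in>J. z i + c i)) = sets (PiM J n)" by (simp add: sets)
    fix A assume A: "\<And>i. i \<in> J \<Longrightarrow> A i \<in> sets (n i)"
    have Ab [measurable]: "A i \<in> sets borel" if "i \<in> J" for i using A[OF that] by (simp add: sn)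
    have "emeasure (distr (PiM J m) (PiM J m) (\<lambda>z. \<lambda>i\<in>J. z i + c i)) (Pi\<^sub>E J A)
        = emeasure (PiM J m) ((\<lambda>z. \<lambda>i\<in>J. z i + c i) -` Pi\<^sub>E J A \<inter> space (PiM J m))"
      using fin Ab by (intro emeasure_distr) (auto intro!: sets_PiM_I_finite simp: sm)
    also have "(\<lambda>z. \<lambda>i\<in>J. z i + c i) -` Pi\<^sub>E J A \<inter> space (PiM J m) = Pi\<^sub>E J (\<lambda>i. {t. t + c i \<in> A i})"
      by (auto simp: space_PiM m_def PiE_iff)
    also have "emeasure (PiM J m) \<dots> = (\<Prod>i\<in>J. emeasure (m i) {t. t + c i \<in> A i})"
      by (intro m.emeasure_PiM fin) (use Ab in \<open>simp add: sm\<close>)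
    also have "\<dots> = (\<Prod>i\<in>J. emeasure (n i) (A i))" using Ab by (intro prod.cong refl) (simp add: eq)
    finally show "emeasure (distr (PiM J m) (PiM J m) (\<lambda>z. \<lambda>i\<in>J. z i + c i)) (Pi\<^sub>E J A) = (\<Prod>i\<in>J. emeasure (n i) (A i))" .
  qed
  moreover have "density (PiM J m) (\<lambda>z. ennreal (\<Prod>i\<in>J. f i (z i - c i) / f i (z i))) = PiM J n"
  proof (rule n.PiM_eqI[OF fin])
    show "sets (density (PiM J m) (\<lambda>z. ennreal (\<Prod>i\<in>J. f i (z i - c i) / f i (z i)))) = sets (PiM J n)" by (simp add: sets)
    fix A assume A: "\<And>i. i \<in> J \<Longrightarrow> A i \<in> sets (n i)"
    have Ab [measurable]: "A i \<in> sets borel" if "i \<in> J" for i using A[OF that] by (simp add: sn)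
    have "emeasure (density (PiM J m) (\<lambda>z. ennreal (\<Prod>i\<in>J. f i (z i - c i) / f i (z i)))) (Pi\<^sub>E J A)
        = (\<integral>\<^sup>+z. ennreal (\<Prod>i\<in>J. f i (z i - c i) / f i (z i)) * indicator (Pi\<^sub>E J A) z \<partial>PiM J m)"
      using fin Ab by (intro emeasure_density) (auto intro!: sets_PiM_I_finite simp: sm)
    also have "\<dots> = (\<integral>\<^sup>+z. (\<Prod>i\<in>J. ennreal (f i (z i - c i) / f i (z i)) * indicator (A i) (z i)) \<partial>PiM J m)"
    proof (rule nn_integral_cong)
      fix z assume "z \<in> space (PiM J m)"
      then have "(\<Prod>i\<in>J. indicator (A i) (z i)) = (indicator (Pi\<^sub>E J A) z :: ennreal)"
        using fin by (auto simp: space_PiM PiE_iff indicator_def prod_zero_iff)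
      then show "ennreal (\<Prod>i\<in>J. f i (z i - c i) / f i (z i)) * indicator (Pi\<^sub>E J A) z
          = (\<Prod>i\<in>J. ennreal (f i (z i - c i) / f i (z i)) * indicator (A i) (z i))"
        unfolding prod.distrib using pos by (simp add: prod_ennreal less_imp_le)
    qed
    also have "\<dots> = (\<Prod>i\<in>J. \<integral>\<^sup>+t. ennreal (f i (t - c i) / f i t) * indicator (A i) t \<partial>m i)"
      using Ab by (intro m.product_nn_integral_prod fin) measurable
    also have "\<dots> = (\<Prod>i\<in>J. emeasure (n i) (A i))"
      using Ab by (intro prod.cong refl) (simp add: eq m_def shift_density_emeasure pos)
    finally show "emeasure (density (PiM J m) (\<lambda>z. ennreal (\<Prod>i\<in>J. f i (z i - c i) / f i (z i)))) (Pi\<^sub>E J A) = (\<Prod>i\<in>J. emeasure (n i) (A i))" .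
  qed
  ultimately show ?thesis unfolding m_def by simp
qed

section \<open>The two hypotheses\<close>

definition diag_pairs :: "nat \<Rightarrow> (nat \<times> nat) set" where
  "diag_pairs N = (\<lambda>k. (k, k)) ` {1..N}"

lemma upper_pairs_split:
  "upper_pairs N = strict_upper_pairs N \<union> diag_pairs N" "strict_upper_pairs N \<inter> diag_pairs N = {}"
  "finite (diag_pairs N)" "card (diag_pairs N) = N" "finite (upper_pairs N)"
proof -
  show 1: "upper_pairs N = strict_upper_pairs N \<union> diag_pairs N"
    by (auto simp: upper_pairs_def strict_upper_pairs_def diag_pairs_def image_iff)
  show "strict_upper_pairs N \<inter> diag_pairs N = {}" by (auto simp: strict_upper_pairs_def diag_pairs_def)
  show 2: "finite (diag_pairs N)" by (simp add: diag_pairs_def)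
  show "card (diag_pairs N) = N" unfolding diag_pairs_def by (subst card_image) (auto simp: inj_on_def)
  show "finite (upper_pairs N)" unfolding 1 using 2 finite_sup by simp
qed

lemma card_upper_pairs: "card (upper_pairs N) \<le> N\<^sup>2"
proof -
  have "card (upper_pairs N) \<le> card ({1..N} \<times> {1..N})" by (intro card_mono) (auto simp: upper_pairs_def)
  then show ?thesis by (simp add: power2_eq_square)
qed

locale spiked_densities =
  off: shift_density p p1 p2 \<omega> K r + diag: shift_density pd pd1 pd2 \<omega> K r
  for p p1 p2 pd pd1 pd2 \<omega> K r
begin

definition dn :: "nat \<times> nat \<Rightarrow> real \<Rightarrow> real" where "dn e = (if fst e < snd e then p else pd)"
definition law :: "nat \<times> nat \<Rightarrow> real measure" where "law e = density lborel (dn e)"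

lemma dn_pos: "0 < dn e t" by (simp add: dn_def off.q_pos diag.q_pos)
lemma dn_meas [measurable]: "dn e \<in> borel_measurable borel" by (simp add: dn_def)
lemma sets_law [simp, measurable_cong]: "sets (law e) = sets borel" and space_law [simp]: "space (law e) = UNIV"
  by (simp_all add: law_def)
lemma prob_law: "prob_space (law e)" by (simp add: law_def dn_def off.prob_q diag.prob_q)
lemma law_strict: "e \<in> strict_upper_pairs N \<Longrightarrow> law e = off.\<nu>" "e \<in> diag_pairs N \<Longrightarrow> law e = diag.\<nu>"
  by (auto simp: law_def dn_def strict_upper_pairs_def diag_pairs_def)

sublocale Q: product_sigma_finite law
  by (rule product_sigma_finite.intro) (rule prob_space_imp_sigma_finite[OF prob_law])

abbreviation "Q0 N \<equiv> PiM (upper_pairs N) law"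

lemma bm_prob_Q0: "bm_prob (Q0 N)"
  by (intro bm_probI prob_space_PiM prob_law)

definition spin_shift :: "nat \<Rightarrow> (nat \<Rightarrow> real) \<Rightarrow> nat \<times> nat \<Rightarrow> real" where
  "spin_shift N s e = s (fst e) * s (snd e) * off.sh N"

definition spin_ratio :: "nat \<Rightarrow> (nat \<Rightarrow> real) \<Rightarrow> (nat \<times> nat \<Rightarrow> real) \<Rightarrow> real" where
  "spin_ratio N s z = (\<Prod>e\<in>upper_pairs N. dn e (z e - spin_shift N s e) / dn e (z e))"

definition full_LR :: "nat \<Rightarrow> (nat \<times> nat \<Rightarrow> real) \<Rightarrow> real" where
  "full_LR N z = (\<Sum>s\<in>spin_vecs N. spin_ratio N s z) / 2 ^ N"

lemma spin_ratio_pos: "0 < spin_ratio N s z"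
  unfolding spin_ratio_def by (intro prod_pos divide_pos_pos dn_pos)

lemma full_LR_nonneg: "0 \<le> full_LR N z"
  unfolding full_LR_def using spin_ratio_pos by (intro divide_nonneg_nonneg sum_nonneg) (auto intro: less_imp_le)

lemma spin_ratio_meas [measurable]: "spin_ratio N s \<in> borel_measurable (PiM (upper_pairs N) (\<lambda>_. borel))"
  unfolding spin_ratio_def[abs_def] by measurable

lemma full_LR_meas [measurable]: "full_LR N \<in> borel_measurable (PiM (upper_pairs N) (\<lambda>_. borel))"
  unfolding full_LR_def[abs_def] by measurable

lemma sets_Q0 [measurable_cong]: "sets (Q0 N) = sets (PiM (upper_pairs N) (\<lambda>_. borel))"
  by (rule sets_PiM_cong) auto

lemma spin_square: "s \<in> spin_vecs N \<Longrightarrow> i \<in> {1..N} \<Longrightarrow> s i * s i = 1"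
  using spin_vecsD[of s N i] by auto

lemma pair_spin: "s \<in> spin_vecs N \<Longrightarrow> e \<in> upper_pairs N \<Longrightarrow> s (fst e) * s (snd e) \<in> {1, - 1}"
  using spin_vecsD[of s N "fst e"] spin_vecsD[of s N "snd e"] by (auto simp: upper_pairs_def)

lemma spin_ratio_split:
  assumes "s \<in> spin_vecs N"
  shows "spin_ratio N s z = (\<Prod>e\<in>strict_upper_pairs N. p (z e - spin_shift N s e) / p (z e)) *
    (\<Prod>e\<in>diag_pairs N. pd (z e - off.sh N) / pd (z e))"
proof -
  have "spin_ratio N s z = (\<Prod>e\<in>strict_upper_pairs N. dn e (z e - spin_shift N s e) / dn e (z e)) *
    (\<Prod>e\<in>diag_pairs N. dn e (z e - spin_shift N s e) / dn e (z e))"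
    unfolding spin_ratio_def upper_pairs_split(1) by (intro prod.union_disjoint finite_sup upper_pairs_split)
  also have "(\<Prod>e\<in>strict_upper_pairs N. dn e (z e - spin_shift N s e) / dn e (z e)) = (\<Prod>e\<in>strict_upper_pairs N. p (z e - spin_shift N s e) / p (z e))"
    by (intro prod.cong refl) (auto simp: dn_def strict_upper_pairs_def)
  also have "(\<Prod>e\<in>diag_pairs N. dn e (z e - spin_shift N s e) / dn e (z e)) = (\<Prod>e\<in>diag_pairs N. pd (z e - off.sh N) / pd (z e))"
    using spin_square[OF assms] by (intro prod.cong refl) (auto simp: dn_def diag_pairs_def spin_shift_def)
  finally show ?thesis .
qed

text \<open>The substitution \<open>s = sqrt N * x\<close> turns the spike vectors into spin vectors, and the shift of an entry into
  \<open>s i * s j * sh N\<close>.\<close>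

lemma likelihood_ratio_eq:
  assumes N: "N \<ge> 1"
  shows "likelihood_ratio p pd N \<omega> A = full_LR N (\<lambda>e\<in>upper_pairs N. sqrt N * A (fst e) (snd e))"
proof -
  have N0: "sqrt (real N) \<noteq> 0" using N by simp
  define F where "F x = (\<Prod>(i, j)\<in>strict_upper_pairs N. p (sqrt N * A i j - sqrt (\<omega> * N) * x i * x j) / p (sqrt N * A i j)) *
        (\<Prod>k\<in>{1..N}. pd (sqrt N * A k k - sqrt (\<omega> * N) * (x k)\<^sup>2) / pd (sqrt N * A k k))" for x
  define z where "z = (\<lambda>e\<in>upper_pairs N. sqrt N * A (fst e) (snd e))"
  have sc: "sqrt (\<omega> * N) * (u / sqrt N) * (w / sqrt N) = u * w * off.sh N" for u w :: real
    using N off.om_pos by (simp add: off.sh_def real_sqrt_mult real_sqrt_divide field_simps)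
  have "(\<Sum>x\<in>{1..N} \<rightarrow>\<^sub>E {1 / sqrt N, - 1 / sqrt N}. F x) = (\<Sum>s\<in>spin_vecs N. spin_ratio N s z)"
  proof (rule sum.reindex_bij_witness[of _ "\<lambda>s. \<lambda>i\<in>{1..N}. s i / sqrt N" "\<lambda>x. \<lambda>i\<in>{1..N}. sqrt N * x i"])
    fix x assume x: "x \<in> {1..N} \<rightarrow>\<^sub>E {1 / sqrt N, - 1 / sqrt N}"
    let ?s = "\<lambda>i\<in>{1..N}. sqrt N * x i"
    show "(\<lambda>i\<in>{1..N}. ?s i / sqrt N) = x" using x N0 by (auto simp: PiE_iff extensional_def fun_eq_iff)
    have xi: "x i = 1 / sqrt N \<or> x i = - 1 / sqrt N" if "i \<in> {1..N}" for i using x that by auto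
    show s: "?s \<in> spin_vecs N"
      unfolding spin_vecs_def by (rule restrict_PiE_iff[THEN iffD2]) (use xi N0 in fastforce)
    have "spin_ratio N ?s z = F x"
      unfolding spin_ratio_split[OF s] F_def
    proof (rule arg_cong2[where f = "(*)"])
      show "(\<Prod>e\<in>strict_upper_pairs N. p (z e - spin_shift N ?s e) / p (z e))
         = (\<Prod>(i, j)\<in>strict_upper_pairs N. p (sqrt N * A i j - sqrt (\<omega> * N) * x i * x j) / p (sqrt N * A i j))"
      proof (rule prod.cong[OF refl])
        fix e assume e: "e \<in> strict_upper_pairs N"
        obtain i j where ij: "e = (i, j)" "i \<in> {1..N}" "j \<in> {1..N}" "e \<in> upper_pairs N"
          using e by (cases e) (auto simp: strict_upper_pairs_def upper_pairs_def)
        have "spin_shift N ?s e = sqrt (\<omega> * N) * x i * x j"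
          unfolding spin_shift_def using sc[of "sqrt N * x i" "sqrt N * x j", symmetric] N0 ij by simp
        then show "p (z e - spin_shift N ?s e) / p (z e) = (case e of (i, j) \<Rightarrow> p (sqrt N * A i j - sqrt (\<omega> * N) * x i * x j) / p (sqrt N * A i j))"
          using ij by (simp add: z_def)
      qed
      show "(\<Prod>e\<in>diag_pairs N. pd (z e - off.sh N) / pd (z e))
         = (\<Prod>k\<in>{1..N}. pd (sqrt N * A k k - sqrt (\<omega> * N) * (x k)\<^sup>2) / pd (sqrt N * A k k))"
        unfolding diag_pairs_def
      proof (subst prod.reindex, simp add: inj_on_def, rule prod.cong[OF refl])
        fix k assume k: "k \<in> {1..N}"
        have "sqrt (\<omega> * N) * (x k)\<^sup>2 = off.sh N"
          using xi[OF k] sc[of 1 1] sc[of "-1" "-1"] by (auto simp: power2_eq_square mult.assoc)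
        moreover have "z (k, k) = sqrt N * A k k" using k by (simp add: z_def upper_pairs_def)
        ultimately show "((\<lambda>e. pd (z e - off.sh N) / pd (z e)) \<circ> (\<lambda>k. (k, k))) k
           = pd (sqrt N * A k k - sqrt (\<omega> * N) * (x k)\<^sup>2) / pd (sqrt N * A k k)" by simp
      qed
    qed
    then show "spin_ratio N ?s z = F x" .
  next
    fix s assume s: "s \<in> spin_vecs N"
    show "(\<lambda>i\<in>{1..N}. sqrt N * (\<lambda>i\<in>{1..N}. s i / sqrt N) i) = s"
      using s N0 by (auto simp: spin_vecs_def PiE_iff extensional_def fun_eq_iff)
    show "(\<lambda>i\<in>{1..N}. s i / sqrt N) \<in> {1..N} \<rightarrow>\<^sub>E {1 / sqrt N, - 1 / sqrt N}"
      by (rule restrict_PiE_iff[THEN iffD2]) (use spin_vecsD[OF s] in fastforce)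
  qed
  then show ?thesis by (simp add: likelihood_ratio_def full_LR_def F_def z_def[symmetric])
qed

text \<open>Under the alternative with spins \<open>s\<close>, the noise law is reweighted by the corresponding
  product of density ratios.\<close>

lemma shifted_prob:
  assumes A [measurable]: "A \<in> sets (Q0 N)"
  shows "measure (Q0 N) ((\<lambda>z. \<lambda>e\<in>upper_pairs N. z e + spin_shift N s e) -` A \<inter> space (Q0 N)) = (\<integral>z. spin_ratio N s z * indicator A z \<partial>Q0 N)"
    and "integrable (Q0 N) (\<lambda>z. spin_ratio N s z * indicator A z)"
proof -
  interpret prob_space "Q0 N" using bm_prob_Q0 by (simp add: bm_prob_def)
  have T [measurable]: "(\<lambda>z. \<lambda>e\<in>upper_pairs N. z e + spin_shift N s e) \<in> Q0 N \<rightarrow>\<^sub>M Q0 N" by measurable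
  have "emeasure (Q0 N) ((\<lambda>z. \<lambda>e\<in>upper_pairs N. z e + spin_shift N s e) -` A \<inter> space (Q0 N))
     = emeasure (distr (Q0 N) (Q0 N) (\<lambda>z. \<lambda>e\<in>upper_pairs N. z e + spin_shift N s e)) A" by (rule emeasure_distr[symmetric]) measurable
  also have "\<dots> = emeasure (density (Q0 N) (\<lambda>z. ennreal (spin_ratio N s z))) A"
    using product_shift[of "upper_pairs N" dn "spin_shift N s", OF upper_pairs_split(5) dn_meas dn_pos prob_law[unfolded law_def]]
    by (simp add: law_def[abs_def] spin_ratio_def)
  also have "\<dots> = (\<integral>\<^sup>+z. ennreal (spin_ratio N s z) * indicator A z \<partial>Q0 N)" by (rule emeasure_density) measurable
  also have "\<dots> = (\<integral>\<^sup>+z. ennreal (spin_ratio N s z * indicator A z) \<partial>Q0 N)"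
    by (intro nn_integral_cong) (auto simp: indicator_def)
  finally have e: "(\<integral>\<^sup>+z. ennreal (spin_ratio N s z * indicator A z) \<partial>Q0 N) =
    emeasure (Q0 N) ((\<lambda>z. \<lambda>e\<in>upper_pairs N. z e + spin_shift N s e) -` A \<inter> space (Q0 N))" ..
  have nn: "0 \<le> spin_ratio N s z * indicator A z" for z using spin_ratio_pos[of N s z] by (simp add: indicator_def)
  show "integrable (Q0 N) (\<lambda>z. spin_ratio N s z * indicator A z)"
    by (rule integrableI_nonneg) (use nn e emeasure_finite in \<open>auto simp: less_top[symmetric]\<close>)
  show "measure (Q0 N) ((\<lambda>z. \<lambda>e\<in>upper_pairs N. z e + spin_shift N s e) -` A \<inter> space (Q0 N)) = (\<integral>z. spin_ratio N s z * indicator A z \<partial>Q0 N)"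
    unfolding measure_def e[symmetric] by (rule integral_eq_nn_integral[symmetric]) (use nn in auto)
qed

end

context spiked_densities
begin

lemma noise_distr:
  fixes P :: "nat \<Rightarrow> 'a measure"
  assumes W: "wigner_noise P H p pd" and N: "N \<ge> 1"
  shows "(\<lambda>\<xi>. \<lambda>e\<in>upper_pairs N. sqrt N * H N (fst e) (snd e) \<xi>) \<in> P N \<rightarrow>\<^sub>M PiM (upper_pairs N) (\<lambda>_. borel)"
    and "distr (P N) (PiM (upper_pairs N) (\<lambda>_. borel)) (\<lambda>\<xi>. \<lambda>e\<in>upper_pairs N. sqrt N * H N (fst e) (snd e) \<xi>) = Q0 N"
proof -
  let ?U = "upper_pairs N"
  from W N have P: "prob_space (P N)"
    and ind: "prob_space.indep_vars (P N) (\<lambda>_. borel) (\<lambda>(i, j). H N i j) ?U"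
    and off: "\<And>i j. (i, j) \<in> strict_upper_pairs N \<Longrightarrow> distributed (P N) lborel (\<lambda>\<xi>. sqrt N * H N i j \<xi>) (\<lambda>x. ennreal (p x))"
    and dia: "\<And>i. i \<in> {1..N} \<Longrightarrow> distributed (P N) lborel (\<lambda>\<xi>. sqrt N * H N i i \<xi>) (\<lambda>x. ennreal (pd x))"
    unfolding wigner_noise_def by fast+
  interpret prob_space "P N" by fact
  have "indep_vars (\<lambda>_. borel) (\<lambda>e \<xi>. sqrt N * (\<lambda>(i, j). H N i j) e \<xi>) ?U"
    by (rule indep_vars_compose2[OF ind]) measurable
  then have ind': "indep_vars (\<lambda>_. borel) (\<lambda>e \<xi>. sqrt N * H N (fst e) (snd e) \<xi>) ?U" by (simp add: case_prod_beta)
  have rv: "random_variable borel (\<lambda>\<xi>. sqrt N * H N (fst e) (snd e) \<xi>)" if "e \<in> ?U" for e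
    using ind' that unfolding indep_vars_def by blast
  show "(\<lambda>\<xi>. \<lambda>e\<in>?U. sqrt N * H N (fst e) (snd e) \<xi>) \<in> P N \<rightarrow>\<^sub>M PiM ?U (\<lambda>_. borel)"
    by (rule measurable_restrict) (rule rv)
  have ne: "?U \<noteq> {}" using N by (auto simp: upper_pairs_def intro!: exI[of _ "1::nat"])
  have "distr (P N) (PiM ?U (\<lambda>_. borel)) (\<lambda>\<xi>. \<lambda>e\<in>?U. sqrt N * H N (fst e) (snd e) \<xi>)
     = PiM ?U (\<lambda>e. distr (P N) borel (\<lambda>\<xi>. sqrt N * H N (fst e) (snd e) \<xi>))"
    using indep_vars_iff_distr_eq_PiM'[OF ne rv] ind' by simp
  also have "\<dots> = Q0 N"
  proof (rule PiM_cong[OF refl])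
    fix e assume e: "e \<in> ?U"
    have *: "distr (P N) borel Y = density lborel f" if "distributed (P N) lborel Y f" for Y :: "'a \<Rightarrow> real" and f
      using distributed_distr_eq_density[OF that] by (subst distr_cong[of _ "P N" _ lborel Y Y]) auto
    show "distr (P N) borel (\<lambda>\<xi>. sqrt N * H N (fst e) (snd e) \<xi>) = law e"
    proof (cases "e \<in> strict_upper_pairs N")
      case True
      then show ?thesis using *[OF off[of "fst e" "snd e"]] by (simp add: law_strict(1)[OF True])
    next
      case False
      then have "e \<in> diag_pairs N" using e upper_pairs_split(1) by blast
      then obtain k where "k \<in> {1..N}" "e = (k, k)" by (auto simp: diag_pairs_def)
      then show ?thesis using *[OF dia[of k]] law_strict(2)[OF \<open>e \<in> diag_pairs N\<close>] by simp
    qed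
  qed
  finally show "distr (P N) (PiM ?U (\<lambda>_. borel)) (\<lambda>\<xi>. \<lambda>e\<in>?U. sqrt N * H N (fst e) (snd e) \<xi>) = Q0 N" .
qed

lemma spike_distr:
  fixes P :: "nat \<Rightarrow> 'a measure"
  assumes P: "prob_space (P N)" and S: "rademacher_spike P H X" and N: "N \<ge> 1"
  shows "s \<in> spin_vecs N \<Longrightarrow> measure (P N) {\<xi> \<in> space (P N). \<forall>i\<in>{1..N}. sqrt N * X N i \<xi> = s i} = 1 / 2 ^ N"
    and "AE \<xi> in P N. \<exists>!s. s \<in> spin_vecs N \<and> (\<forall>i\<in>{1..N}. sqrt N * X N i \<xi> = s i)"
    and "i \<in> {1..N} \<Longrightarrow> X N i \<in> borel_measurable (P N)"
proof -
  interpret prob_space "P N" by fact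
  from S N have ind: "indep_vars (\<lambda>_. borel) (X N) {1..N}"
    and half: "\<And>i. i \<in> {1..N} \<Longrightarrow> prob {\<xi> \<in> space (P N). sqrt N * X N i \<xi> = 1} = 1 / 2"
      "\<And>i. i \<in> {1..N} \<Longrightarrow> prob {\<xi> \<in> space (P N). sqrt N * X N i \<xi> = - 1} = 1 / 2"
    unfolding rademacher_spike_def by fast+
  have meas [measurable]: "X N i \<in> borel_measurable (P N)" if "i \<in> {1..N}" for i
    using ind that unfolding indep_vars_def by blast
  then show "i \<in> {1..N} \<Longrightarrow> X N i \<in> borel_measurable (P N)" for i .
  have N0: "sqrt (real N) \<noteq> 0" using N by simp
  show "prob {\<xi> \<in> space (P N). \<forall>i\<in>{1..N}. sqrt N * X N i \<xi> = s i} = 1 / 2 ^ N" if s: "s \<in> spin_vecs N" for s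
  proof -
    have "{\<xi> \<in> space (P N). \<forall>i\<in>{1..N}. sqrt N * X N i \<xi> = s i} = (\<Inter>i\<in>{1..N}. X N i -` {s i / sqrt N} \<inter> space (P N))"
      using N N0 by (auto simp: field_simps)
    also have "prob \<dots> = (\<Prod>i\<in>{1..N}. prob (X N i -` {s i / sqrt N} \<inter> space (P N)))"
      using N by (intro indep_varsD_finite[OF ind]) auto
    also have "\<dots> = (\<Prod>i\<in>{1..N}. 1 / 2)"
    proof (rule prod.cong[OF refl])
      fix i assume i: "i \<in> {1..N}"
      have "X N i -` {s i / sqrt N} \<inter> space (P N) = {\<xi> \<in> space (P N). sqrt N * X N i \<xi> = s i}"
        using N0 by (auto simp: field_simps)
      then show "prob (X N i -` {s i / sqrt N} \<inter> space (P N)) = 1 / 2"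
        using half[OF i] spin_vecsD[OF s i] by auto
    qed
    finally show ?thesis by (simp add: power_one_over)
  qed
  have "AE \<xi> in P N. \<forall>i\<in>{1..N}. sqrt N * X N i \<xi> = 1 \<or> sqrt N * X N i \<xi> = - 1"
  proof (rule AE_finite_allI)
    fix i assume i: "i \<in> {1..N}"
    note [measurable] = meas[OF i]
    have "prob ({\<xi> \<in> space (P N). sqrt N * X N i \<xi> = 1} \<union> {\<xi> \<in> space (P N). sqrt N * X N i \<xi> = - 1}) = 1"
      by (subst finite_measure_Union) (auto simp: half[OF i])
    then have "AE \<xi> in P N. \<xi> \<in> {\<xi> \<in> space (P N). sqrt N * X N i \<xi> = 1} \<union> {\<xi> \<in> space (P N). sqrt N * X N i \<xi> = - 1}"
      by (rule AE_prob_1)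
    then show "AE \<xi> in P N. sqrt N * X N i \<xi> = 1 \<or> sqrt N * X N i \<xi> = - 1" by auto
  qed simp
  then show "AE \<xi> in P N. \<exists>!s. s \<in> spin_vecs N \<and> (\<forall>i\<in>{1..N}. sqrt N * X N i \<xi> = s i)"
  proof eventually_elim
    case (elim \<xi>)
    let ?s = "\<lambda>i\<in>{1..N}. sqrt N * X N i \<xi>"
    show ?case
    proof (rule ex1I[of _ ?s])
      show "?s \<in> spin_vecs N \<and> (\<forall>i\<in>{1..N}. sqrt N * X N i \<xi> = ?s i)"
        using elim by (auto simp: spin_vecs_def)
      show "s = ?s" if "s \<in> spin_vecs N \<and> (\<forall>i\<in>{1..N}. sqrt N * X N i \<xi> = s i)" for s
        using that by (auto simp: spin_vecs_def PiE_iff extensional_def fun_eq_iff)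
    qed
  qed
qed

text \<open>Under the null hypothesis the test rejects on \<open>L > 1\<close>. Under the alternative, conditioning on the spike and
  undoing the shift gives the integral of \<open>L\<close> over \<open>L \<le> 1\<close>. Together these are the integral of \<open>min 1 L\<close>.\<close>

lemma lrt_error_eq:
  fixes P :: "nat \<Rightarrow> 'a measure"
  assumes W: "wigner_noise P H p pd" and S: "rademacher_spike P H X" and N: "N \<ge> 1"
  shows "lrt_error P H X p pd \<omega> N = (\<integral>z. min 1 (full_LR N z) \<partial>Q0 N)"
proof -
  let ?U = "upper_pairs N"
  define B where "B = PiM ?U (\<lambda>_. borel :: real measure)"
  have P: "prob_space (P N)" using W N unfolding wigner_noise_def by fast
  interpret prob_space "P N" by fact
  interpret Q: bm_prob "Q0 N" by (rule bm_prob_Q0)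
  have sB [measurable_cong]: "sets (Q0 N) = sets B" unfolding B_def by (rule sets_Q0)
  have spB: "space (Q0 N) = space B" by (rule sets_eq_imp_space_eq[OF sB])
  have Lm [measurable]: "full_LR N \<in> borel_measurable B" unfolding B_def by measurable
  define Z where "Z \<xi> = (\<lambda>e\<in>?U. sqrt N * H N (fst e) (snd e) \<xi>)" for \<xi>
  have Zm [measurable]: "Z \<in> P N \<rightarrow>\<^sub>M B" and Zd: "distr (P N) B Z = Q0 N"
    using noise_distr[OF W N] by (simp_all add: Z_def[abs_def] B_def)
  note Xm [measurable] = spike_distr(3)[OF P S N]
  define T where "T s z = (\<lambda>e\<in>?U. z e + spin_shift N s e)" for s and z :: "nat \<times> nat \<Rightarrow> real"
  have Tm [measurable]: "T s \<in> B \<rightarrow>\<^sub>M B" for s unfolding T_def[abs_def] B_def by measurable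
  have null: "likelihood_ratio p pd N \<omega> (data_matrix 0 (H N) (X N) \<xi>) = full_LR N (Z \<xi>)" for \<xi>
    by (simp add: likelihood_ratio_eq[OF N] data_matrix_def Z_def)
  \<comment> \<open>The alternative in terms of the spike itself; on the event that the spike has the signs
    \<open>s\<close> it is the translate \<open>T s (Z \<xi>)\<close>.\<close>
  define Y where "Y \<xi> = (\<lambda>e\<in>?U. Z \<xi> e + sqrt N * sqrt \<omega> * X N (fst e) \<xi> * X N (snd e) \<xi>)" for \<xi>
  have alt: "likelihood_ratio p pd N \<omega> (data_matrix \<omega> (H N) (X N) \<xi>) = full_LR N (Y \<xi>)" for \<xi>
    unfolding likelihood_ratio_eq[OF N] by (rule arg_cong[of _ _ "full_LR N"])
      (auto simp: data_matrix_def Z_def Y_def fun_eq_iff algebra_simps)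
  have Ym [measurable]: "Y \<in> P N \<rightarrow>\<^sub>M B"
    unfolding Y_def[abs_def] B_def
  proof (rule measurable_restrict)
    fix e assume e: "e \<in> ?U"
    have [measurable]: "(\<lambda>\<xi>. Z \<xi> e) \<in> borel_measurable (P N)"
      using measurable_compose[OF Zm[unfolded B_def] measurable_component_singleton[OF e]] .
    have [measurable]: "X N (fst e) \<in> borel_measurable (P N)" "X N (snd e) \<in> borel_measurable (P N)"
      using e by (auto simp: upper_pairs_def intro!: Xm)
    show "(\<lambda>\<xi>. Z \<xi> e + sqrt N * sqrt \<omega> * X N (fst e) \<xi> * X N (snd e) \<xi>) \<in> borel_measurable (P N)" by measurable
  qed
  have YT: "Y \<xi> = T s (Z \<xi>)" if "\<forall>i\<in>{1..N}. sqrt N * X N i \<xi> = s i" for \<xi> s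
  proof -
    have "sqrt N * sqrt \<omega> * X N i \<xi> * X N j \<xi> = s i * s j * off.sh N" if "i \<in> {1..N}" "j \<in> {1..N}" for i j
    proof -
      have si: "s i = sqrt N * X N i \<xi>" "s j = sqrt N * X N j \<xi>"
        using \<open>\<forall>i\<in>{1..N}. sqrt N * X N i \<xi> = s i\<close> that by auto
      have "s i * s j * off.sh N = sqrt N * (sqrt N * off.sh N) * X N i \<xi> * X N j \<xi>"
        unfolding si by (simp only: mult_ac)
      then show ?thesis unfolding off.sh_sqrt[OF N] ..
    qed
    then show ?thesis by (auto simp: Y_def T_def spin_shift_def fun_eq_iff upper_pairs_def)
  qed
  have one: "prob {\<xi> \<in> space (P N). full_LR N (Z \<xi>) > 1} = (\<integral>z. indicator {z. full_LR N z > 1} z \<partial>Q0 N)"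
  proof -
    have "prob {\<xi> \<in> space (P N). full_LR N (Z \<xi>) > 1} = measure (distr (P N) B Z) {z \<in> space B. full_LR N z > 1}"
      using measurable_space[OF Zm] by (subst measure_distr) (auto intro!: arg_cong[of _ _ prob])
    also have "\<dots> = (\<integral>z. indicator {z \<in> space (Q0 N). full_LR N z > 1} z \<partial>Q0 N)" unfolding Zd spB[symmetric] by simp
    also have "\<dots> = (\<integral>z. indicator {z. full_LR N z > 1} z \<partial>Q0 N)"
      by (intro lint_cong refl) (auto simp: indicator_def)
    finally show ?thesis .
  qed
  define A where "A = {z \<in> space B. full_LR N z \<le> 1}"
  have Am: "A \<in> sets (Q0 N)" unfolding A_def sB by measurable
  define E where "E s = {\<xi> \<in> space (P N). \<forall>i\<in>{1..N}. sqrt N * X N i \<xi> = s i}" for s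
  have Em: "E s \<in> events" for s
  proof -
    have "E s = {\<xi> \<in> space (P N). \<forall>i\<in>{1..N}. \<xi> \<in> {\<xi> \<in> space (P N). sqrt N * X N i \<xi> = s i}}" by (auto simp: E_def)
    also have "\<dots> \<in> events" by (rule sets.sets_Collect_finite_All) (use Xm in \<open>auto intro: borel_measurable_eq\<close>)
    finally show ?thesis .
  qed
  have piece: "prob (E s \<inter> {\<xi> \<in> space (P N). full_LR N (T s (Z \<xi>)) \<le> 1}) = (\<integral>z. spin_ratio N s z * indicator A z \<partial>Q0 N) / 2 ^ N"
    if s: "s \<in> spin_vecs N" for s
  proof -
    have ind: "indep_set (sets (vimage_algebra (space (P N)) (\<lambda>\<xi>. \<lambda>(i, j)\<in>?U. H N i j \<xi>) B))
      (sets (vimage_algebra (space (P N)) (\<lambda>\<xi>. \<lambda>i\<in>{1..N}. X N i \<xi>) (PiM {1..N} (\<lambda>_. borel))))"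
      using S N unfolding rademacher_spike_def B_def by fast
    define G where "G = {y \<in> space B. full_LR N (T s (\<lambda>e\<in>?U. sqrt N * y e)) \<le> 1}"
    have "(\<lambda>y. \<lambda>e\<in>?U. sqrt N * y e) \<in> B \<rightarrow>\<^sub>M B" unfolding B_def by measurable
    then have Gm: "G \<in> sets B" unfolding G_def by measurable
    have "{\<xi> \<in> space (P N). full_LR N (T s (Z \<xi>)) \<le> 1} = (\<lambda>\<xi>. \<lambda>(i, j)\<in>?U. H N i j \<xi>) -` G \<inter> space (P N)"
    proof -
      have "Z \<xi> = (\<lambda>e\<in>?U. sqrt N * (\<lambda>(i, j)\<in>?U. H N i j \<xi>) e)" for \<xi>
        by (auto simp: Z_def fun_eq_iff)
      moreover have "(\<lambda>(i, j)\<in>?U. H N i j \<xi>) \<in> space B" for \<xi> by (simp add: B_def space_PiM)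
      ultimately show ?thesis by (auto simp: G_def)
    qed
    then have 1: "{\<xi> \<in> space (P N). full_LR N (T s (Z \<xi>)) \<le> 1} \<in> sets (vimage_algebra (space (P N)) (\<lambda>\<xi>. \<lambda>(i, j)\<in>?U. H N i j \<xi>) B)"
      using in_vimage_algebra[OF Gm] by simp
    define G' where "G' = {y \<in> space (PiM {1..N} (\<lambda>_. borel :: real measure)). \<forall>i\<in>{1..N}. sqrt N * y i = s i}"
    have Gm': "G' \<in> sets (PiM {1..N} (\<lambda>_. borel))" unfolding G'_def by measurable
    have "E s = (\<lambda>\<xi>. \<lambda>i\<in>{1..N}. X N i \<xi>) -` G' \<inter> space (P N)"
      by (auto simp: E_def G'_def space_PiM)
    then have 2: "E s \<in> sets (vimage_algebra (space (P N)) (\<lambda>\<xi>. \<lambda>i\<in>{1..N}. X N i \<xi>) (PiM {1..N} (\<lambda>_. borel)))"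
      using in_vimage_algebra[OF Gm'] by simp
    have "prob (E s \<inter> {\<xi> \<in> space (P N). full_LR N (T s (Z \<xi>)) \<le> 1}) = prob {\<xi> \<in> space (P N). full_LR N (T s (Z \<xi>)) \<le> 1} * prob (E s)"
      using indep_setD[OF ind 1 2] by (simp add: Int_commute)
    also have "prob (E s) = 1 / 2 ^ N" unfolding E_def by (rule spike_distr(1)[OF P S N s])
    also have "prob {\<xi> \<in> space (P N). full_LR N (T s (Z \<xi>)) \<le> 1} = measure (distr (P N) B Z) (T s -` A \<inter> space B)"
      using measurable_space[OF Zm] measurable_space[OF Tm] Am Tm[of s]
      by (subst measure_distr) (auto simp: A_def sB[symmetric] spB[symmetric] intro!: arg_cong[of _ _ prob] measurable_sets[OF Tm])
    also have "\<dots> = (\<integral>z. spin_ratio N s z * indicator A z \<partial>Q0 N)"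
      unfolding Zd spB[symmetric] T_def[abs_def] by (rule shifted_prob(1)[OF Am])
    finally show ?thesis by simp
  qed
  have "prob {\<xi> \<in> space (P N). full_LR N (Y \<xi>) \<le> 1} = (\<Sum>s\<in>spin_vecs N. prob {\<xi> \<in> space (P N). \<xi> \<in> E s \<and> full_LR N (T s (Z \<xi>)) \<le> 1})"
  proof (rule prob_sum)
    show "{\<xi> \<in> space (P N). \<xi> \<in> E s \<and> full_LR N (T s (Z \<xi>)) \<le> 1} \<in> events" for s
      using Em by measurable
    show "AE \<xi> in P N. (\<forall>s\<in>spin_vecs N. \<xi> \<in> E s \<and> full_LR N (T s (Z \<xi>)) \<le> 1 \<longrightarrow> full_LR N (Y \<xi>) \<le> 1) \<and>
       (full_LR N (Y \<xi>) \<le> 1 \<longrightarrow> (\<exists>!s\<in>spin_vecs N. \<xi> \<in> E s \<and> full_LR N (T s (Z \<xi>)) \<le> 1))"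
      using spike_distr(2)[OF P S N] AE_space
    proof eventually_elim
      case (elim \<xi>)
      have "\<xi> \<in> E s \<longleftrightarrow> (\<forall>i\<in>{1..N}. sqrt N * X N i \<xi> = s i)" for s using elim by (simp add: E_def)
      then have "\<exists>!s. s \<in> spin_vecs N \<and> \<xi> \<in> E s" "\<And>s. \<xi> \<in> E s \<Longrightarrow> Y \<xi> = T s (Z \<xi>)" using elim(1) YT by auto
      then show ?case by metis
    qed
    show "{\<xi> \<in> space (P N). full_LR N (Y \<xi>) \<le> 1} \<in> events" by measurable
  qed (rule finite_spin_vecs)
  also have "\<dots> = (\<Sum>s\<in>spin_vecs N. (\<integral>z. spin_ratio N s z * indicator A z \<partial>Q0 N) / 2 ^ N)"
  proof (rule sum.cong[OF refl])
    fix s assume "s \<in> spin_vecs N"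
    moreover have "{\<xi> \<in> space (P N). \<xi> \<in> E s \<and> full_LR N (T s (Z \<xi>)) \<le> 1} = E s \<inter> {\<xi> \<in> space (P N). full_LR N (T s (Z \<xi>)) \<le> 1}" by auto
    ultimately show "prob {\<xi> \<in> space (P N). \<xi> \<in> E s \<and> full_LR N (T s (Z \<xi>)) \<le> 1} = (\<integral>z. spin_ratio N s z * indicator A z \<partial>Q0 N) / 2 ^ N"
      using piece by simp
  qed
  also have "\<dots> = (\<integral>z. (\<Sum>s\<in>spin_vecs N. spin_ratio N s z * indicator A z / 2 ^ N) \<partial>Q0 N)"
    using shifted_prob(2)[OF Am] by (subst Bochner_Integration.integral_sum) auto
  also have "\<dots> = (\<integral>z. full_LR N z * indicator A z \<partial>Q0 N)"
    by (simp add: full_LR_def sum_distrib_right sum_divide_distrib)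
  finally have two: "prob {\<xi> \<in> space (P N). full_LR N (Y \<xi>) \<le> 1} = (\<integral>z. full_LR N z * indicator A z \<partial>Q0 N)" .
  have "lrt_error P H X p pd \<omega> N = prob {\<xi> \<in> space (P N). full_LR N (Z \<xi>) > 1} + prob {\<xi> \<in> space (P N). full_LR N (Y \<xi>) \<le> 1}"
    by (simp add: lrt_error_def lrt_rejects_def null alt not_less)
  also have "\<dots> = (\<integral>z. indicator {z. full_LR N z > 1} z + full_LR N z * indicator A z \<partial>Q0 N)"
    unfolding one two
  proof (rule Bochner_Integration.integral_add[symmetric])
    show "integrable (Q0 N) (indicator {z. full_LR N z > 1} :: _ \<Rightarrow> real)"
      by (rule Q.integrable_const_bound[of _ 1]) (auto simp: indicator_def)
    show "integrable (Q0 N) (\<lambda>z. full_LR N z * indicator A z)"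
      using full_LR_nonneg[of N] Am by (intro Q.integrable_const_bound[of _ 1]) (auto simp: indicator_def A_def)
  qed
  also have "\<dots> = (\<integral>z. min 1 (full_LR N z) \<partial>Q0 N)"
    by (intro lint_cong refl) (auto simp: A_def indicator_def spB)
  finally show ?thesis .
qed

end

section \<open>Removing the truncation\<close>

lemma min_1_scale:
  fixes a x :: real
  assumes "0 \<le> a" "0 \<le> x"
  shows "\<bar>min 1 (a * x) - min 1 x\<bar> \<le> \<bar>a - 1\<bar>"
proof -
  have mm: "0 \<le> min 1 x" "min 1 x \<le> 1" using assms by auto
  have "min 1 (a * x) \<le> max 1 a * min 1 x" "min 1 a * min 1 x \<le> min 1 (a * x)"
  proof -
    have "a * x \<le> max 1 a * x" using assms by (intro mult_right_mono) auto
    then show "min 1 (a * x) \<le> max 1 a * min 1 x" by (auto simp: min_def)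
    have "min 1 a * x \<le> a * x" using assms by (intro mult_right_mono) auto
    moreover have "min 1 a * min 1 x \<le> min 1 a * x" "min 1 a * min 1 x \<le> 1"
      using assms by (auto intro!: mult_left_mono mult_le_one)
    ultimately show "min 1 a * min 1 x \<le> min 1 (a * x)" by simp
  qed
  moreover have "max 1 a * min 1 x \<le> min 1 x + \<bar>a - 1\<bar>"
  proof -
    have "(max 1 a - 1) * min 1 x \<le> \<bar>a - 1\<bar> * 1" using mm by (intro mult_mono) auto
    then show ?thesis by (simp add: algebra_simps)
  qed
  moreover have "min 1 x - \<bar>a - 1\<bar> \<le> min 1 a * min 1 x"
  proof -
    have "(1 - min 1 a) * min 1 x \<le> \<bar>a - 1\<bar> * 1" using mm by (intro mult_mono) auto
    then show ?thesis by (simp add: algebra_simps)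
  qed
  ultimately show ?thesis by linarith
qed

context shift_density
begin

lemma tail_prob: "N \<ge> 1 \<Longrightarrow> measure \<nu> {t. \<bar>t\<bar> > cut N} \<le> Kt / real N ^ 3"
proof -
  assume N: "N \<ge> 1"
  have "measure \<nu> {t. \<bar>t\<bar> > cut N} = (\<integral>t. indicator {t. \<bar>t\<bar> > cut N} t \<partial>\<nu>)" by simp
  also have "\<dots> \<le> (\<integral>t. 2 * ((\<bar>t\<bar> + sqrt \<omega>) powr (6 * r) / real N ^ 3) \<partial>\<nu>)"
  proof (rule integral_mono)
    show "integrable \<nu> (indicator {t. \<bar>t\<bar> > cut N} :: real \<Rightarrow> real)"
      by (rule integrable_const_bound[of _ 1]) (auto simp: indicator_def)
    show "integrable \<nu> (\<lambda>t. 2 * ((\<bar>t\<bar> + sqrt \<omega>) powr (6 * r) / real N ^ 3))"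
      using shifted_mom[of "6 * r"] r_pos by (intro integrable_mult_right integrable_divide) auto
    show "indicator {t. \<bar>t\<bar> > cut N} t \<le> 2 * ((\<bar>t\<bar> + sqrt \<omega>) powr (6 * r) / real N ^ 3)" for t
    proof (cases "\<bar>t\<bar> > cut N")
      case True
      then have "cut N < \<bar>t\<bar> + sqrt \<omega>" using real_sqrt_gt_zero[OF om_pos] by linarith
      from tail_indicator[OF N this] show ?thesis using True by simp
    qed simp
  qed
  also have "\<dots> = Kt / real N ^ 3" by (simp add: Kt_def)
  finally show ?thesis .
qed

lemma ln_kap: "N \<ge> 1 \<Longrightarrow> \<bar>ln (kap N)\<bar> \<le> M * Kt / real N ^ 3"
proof -
  assume N: "N \<ge> 1"
  have "Kt / real N ^ 3 \<le> M * (Kt / real N ^ 3)"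
    using mult_right_mono[OF M_ge, of "Kt / real N ^ 3"] Kt_nonneg by (simp only: mult_1_left zero_le_divide_iff zero_le_power of_nat_0_le_iff simp_thms)
  then have "ln (kap N) \<le> M * Kt / real N ^ 3"
    using ln_le_minus_one[OF kap_pos[OF N]] kap_near_1[OF N] unfolding times_divide_eq_right by linarith
  moreover have "ln (1 / kap N) \<le> 1 / kap N - 1" using kap_pos[OF N] by (intro ln_le_minus_one) auto
  then have "- ln (kap N) \<le> M * Kt / real N ^ 3" using inv_kap(1)[OF N] ln_inverse[of "kap N"] unfolding inverse_eq_divide by linarith
  ultimately show ?thesis by linarith
qed

lemma diag_law_full:
  assumes N: "N \<ge> 1" shows "diag_law \<nu> (full_part N)"
proof (unfold_locales, rule parts_bm(3)[OF N])
  show "0 < 1 + full_part N t" for t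
    using divide_pos_pos[OF ratio_pos[of N 1 t] kap_pos[OF N]] by (simp add: full_part_def)
qed (rule parts_int(5)[OF N])

end

context spiked_densities
begin

definition trunc_LR :: "nat \<Rightarrow> (nat \<times> nat \<Rightarrow> real) \<Rightarrow> real" where
  "trunc_LR N z = pair_LR (off.even_part N) (off.odd_part N) N z * (\<Prod>e\<in>diag_pairs N. 1 + diag.full_part N (z e))"

definition norm_const :: "nat \<Rightarrow> real" where
  "norm_const N = off.kap N ^ card (strict_upper_pairs N) * diag.kap N ^ N"

lemma norm_const_pos: "N \<ge> 1 \<Longrightarrow> 0 < norm_const N"
  by (simp add: norm_const_def off.kap_pos diag.kap_pos)

lemma full_trunc:
  assumes N: "N \<ge> 1" and z: "\<And>e. e \<in> upper_pairs N \<Longrightarrow> \<bar>z e\<bar> \<le> off.cut N"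
  shows "full_LR N z = norm_const N * trunc_LR N z"
proof -
  have "spin_ratio N s z = norm_const N * ((\<Prod>e\<in>strict_upper_pairs N. 1 + off.even_part N (z e) + s (fst e) * s (snd e) * off.odd_part N (z e)) *
     (\<Prod>e\<in>diag_pairs N. 1 + diag.full_part N (z e)))" if s: "s \<in> spin_vecs N" for s
  proof -
    have "(\<Prod>e\<in>strict_upper_pairs N. p (z e - spin_shift N s e) / p (z e))
      = (\<Prod>e\<in>strict_upper_pairs N. off.kap N * (1 + off.even_part N (z e) + s (fst e) * s (snd e) * off.odd_part N (z e)))"
    proof (rule prod.cong[OF refl])
      fix e assume e: "e \<in> strict_upper_pairs N"
      then have U: "e \<in> upper_pairs N" unfolding upper_pairs_split(1) by simp
      show "p (z e - spin_shift N s e) / p (z e) = off.kap N * (1 + off.even_part N (z e) + s (fst e) * s (snd e) * off.odd_part N (z e))"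
        unfolding off.parts_ratio[OF pair_spin[OF s U]] using z[OF U] off.kap_pos[OF N]
        by (simp add: off.ratio_def spin_shift_def)
    qed
    moreover have "(\<Prod>e\<in>diag_pairs N. pd (z e - off.sh N) / pd (z e)) = (\<Prod>e\<in>diag_pairs N. diag.kap N * (1 + diag.full_part N (z e)))"
    proof (rule prod.cong[OF refl])
      fix e assume "e \<in> diag_pairs N"
      then have "e \<in> upper_pairs N" unfolding upper_pairs_split(1) by simp
      then show "pd (z e - off.sh N) / pd (z e) = diag.kap N * (1 + diag.full_part N (z e))"
        using z[of e] diag.kap_pos[OF N] by (simp add: diag.full_part_def diag.ratio_def)
    qed
    ultimately show ?thesis
      unfolding spin_ratio_split[OF s] norm_const_def by (simp add: prod.distrib upper_pairs_split(4))
  qed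
  then show ?thesis
    unfolding full_LR_def trunc_LR_def pair_LR_def pair_weight_def
    by (simp add: sum_divide_distrib sum_distrib_left sum_distrib_right mult_ac)
qed

lemma bm_trunc_LR: "N \<ge> 1 \<Longrightarrow> bounded_meas (Q0 N) (trunc_LR N)"
  unfolding trunc_LR_def[abs_def] pair_LR_def pair_weight_def
  by (intro bm bm_component[of law])
     (auto intro!: off.parts_bm diag.parts_bm simp: law_strict(1) law_strict(2) upper_pairs_split(1))

lemma trunc_LR_nonneg: "N \<ge> 1 \<Longrightarrow> 0 \<le> trunc_LR N z"
proof -
  assume N: "N \<ge> 1"
  have "0 \<le> pair_weight (off.even_part N) (off.odd_part N) N z s" if s: "s \<in> spin_vecs N" for s
    unfolding pair_weight_def
    using off.parts_pos[OF N pair_spin[OF s]] by (intro divide_nonneg_nonneg prod_nonneg) (auto simp: upper_pairs_split(1) less_imp_le)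
  then show ?thesis
    unfolding trunc_LR_def pair_LR_def using diag_law.dg_pos[OF diag.diag_law_full[OF N]]
    by (intro mult_nonneg_nonneg sum_nonneg prod_nonneg) (auto intro: less_imp_le)
qed

text \<open>Unless some entry leaves the window, the two likelihood ratios differ by the deterministic factor
  \<open>norm_const N\<close>; a union bound over the entries handles the exception.\<close>

lemma truncation_error:
  assumes N: "N \<ge> 1"
  shows "\<bar>(\<integral>z. min 1 (full_LR N z) \<partial>Q0 N) - (\<integral>z. min 1 (trunc_LR N z) \<partial>Q0 N)\<bar>
    \<le> \<bar>norm_const N - 1\<bar> + (off.Kt + diag.Kt) / N"
proof -
  interpret Q: bm_prob "Q0 N" by (rule bm_prob_Q0)
  define b where "b t = (indicator {t. \<bar>t\<bar> > off.cut N} t :: real)" for t :: real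
  have b [measurable]: "b \<in> borel_measurable borel" unfolding b_def[abs_def] by measurable
  have bb: "bounded_meas (law e) b" for e by (rule bounded_measI[of _ _ 1]) (auto simp: b_def indicator_def)
  have bU: "bounded_meas (Q0 N) (\<lambda>z. b (z e))" if "e \<in> upper_pairs N" for e by (rule bm_component[OF bb that])
  have bf: "bounded_meas (Q0 N) (\<lambda>z. min 1 (full_LR N z))"
    by (rule bounded_measI[of _ _ 1]) (use full_LR_nonneg[of N] in \<open>auto simp: min_def\<close>)
  have int_b: "(\<integral>z. b (z e) \<partial>Q0 N) \<le> (off.Kt + diag.Kt) / real N ^ 3" if e: "e \<in> upper_pairs N" for e
  proof -
    have "(\<integral>z. b (z e) \<partial>Q0 N) = (\<integral>t. b t \<partial>distr (Q0 N) (law e) (\<lambda>z. z e))"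
      using e by (subst integral_distr) auto
    also have "distr (Q0 N) (law e) (\<lambda>z. z e) = law e"
      using prob_law upper_pairs_split(5) e by (intro distr_PiM_component) auto
    also have "(\<integral>t. b t \<partial>law e) = measure (law e) {t. \<bar>t\<bar> > off.cut N}" by (simp add: b_def[abs_def])
    also have "\<dots> \<le> (off.Kt + diag.Kt) / real N ^ 3"
    proof -
      have "0 \<le> off.Kt / real N ^ 3" "0 \<le> diag.Kt / real N ^ 3" by (simp_all add: off.Kt_nonneg diag.Kt_nonneg)
      moreover have "law e = off.\<nu> \<or> law e = diag.\<nu>" using e law_strict(1)[of e N] law_strict(2)[of e N] by (auto simp: upper_pairs_split(1))
      ultimately show ?thesis
        using off.tail_prob[OF N] diag.tail_prob[OF N] unfolding add_divide_distrib by auto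
    qed
    finally show ?thesis .
  qed
  have "\<bar>\<integral>z. min 1 (full_LR N z) - min 1 (trunc_LR N z) \<partial>Q0 N\<bar> \<le> (\<integral>z. \<bar>norm_const N - 1\<bar> + (\<Sum>e\<in>upper_pairs N. b (z e)) \<partial>Q0 N)"
  proof (rule Q.bm_int_abs_mono)
    fix z
    have b0: "0 \<le> b t" for t by (simp add: b_def)
    show "\<bar>min 1 (full_LR N z) - min 1 (trunc_LR N z)\<bar> \<le> \<bar>norm_const N - 1\<bar> + (\<Sum>e\<in>upper_pairs N. b (z e))"
    proof (cases "\<forall>e\<in>upper_pairs N. \<bar>z e\<bar> \<le> off.cut N")
      case True
      have "\<bar>min 1 (full_LR N z) - min 1 (trunc_LR N z)\<bar> \<le> \<bar>norm_const N - 1\<bar>"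
        using full_trunc[OF N] True min_1_scale[OF _ trunc_LR_nonneg[OF N]] norm_const_pos[OF N] by (simp add: less_imp_le)
      moreover have "0 \<le> (\<Sum>e\<in>upper_pairs N. b (z e))" by (intro sum_nonneg b0)
      ultimately show ?thesis by linarith
    next
      case False
      then obtain e where e: "e \<in> upper_pairs N" "\<not> \<bar>z e\<bar> \<le> off.cut N" by blast
      have "b (z e) \<le> (\<Sum>e\<in>upper_pairs N. b (z e))" using e upper_pairs_split(5) b0 by (intro member_le_sum) auto
      moreover have "b (z e) = 1" using e by (simp add: b_def)
      moreover have "0 \<le> min 1 (full_LR N z)" "0 \<le> min 1 (trunc_LR N z)" "min 1 (full_LR N z) \<le> 1" "min 1 (trunc_LR N z) \<le> 1"
        using full_LR_nonneg trunc_LR_nonneg[OF N] by auto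
      ultimately show ?thesis by linarith
    qed
  qed (intro bm bf bm_min1 bm_trunc_LR N bU; simp)+
  also have "\<dots> = \<bar>norm_const N - 1\<bar> + (\<Sum>e\<in>upper_pairs N. \<integral>z. b (z e) \<partial>Q0 N)"
    by (subst Q.bm_int_add) (auto intro!: bm_sum bm_const bU simp: Q.bm_int_sum bU)
  finally have 1: "\<bar>\<integral>z. min 1 (full_LR N z) - min 1 (trunc_LR N z) \<partial>Q0 N\<bar> \<le> \<bar>norm_const N - 1\<bar> + (\<Sum>e\<in>upper_pairs N. \<integral>z. b (z e) \<partial>Q0 N)" .
  have "(\<Sum>e\<in>upper_pairs N. \<integral>z. b (z e) \<partial>Q0 N) \<le> card (upper_pairs N) * ((off.Kt + diag.Kt) / real N ^ 3)"
    using int_b by (rule sum_bounded_above)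
  also have "card (upper_pairs N) * ((off.Kt + diag.Kt) / real N ^ 3) \<le> (real N)\<^sup>2 * ((off.Kt + diag.Kt) / real N ^ 3)"
    using card_upper_pairs[of N] off.Kt_nonneg diag.Kt_nonneg by (intro mult_right_mono) (auto simp flip: of_nat_power)
  also have "\<dots> = (off.Kt + diag.Kt) / N" using N by (simp add: power2_eq_square power3_eq_cube)
  finally have 2: "(\<Sum>e\<in>upper_pairs N. \<integral>z. b (z e) \<partial>Q0 N) \<le> (off.Kt + diag.Kt) / N" .
  have "(\<integral>z. min 1 (full_LR N z) - min 1 (trunc_LR N z) \<partial>Q0 N) = (\<integral>z. min 1 (full_LR N z) \<partial>Q0 N) - (\<integral>z. min 1 (trunc_LR N z) \<partial>Q0 N)"
    by (rule Q.bm_int_diff[OF bf bm_min1[OF bm_trunc_LR[OF N]]])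
  with 1 2 show ?thesis by linarith
qed

lemma norm_const_lim: "norm_const \<longlonglongrightarrow> 1"
proof -
  define E where "E N = real (card (strict_upper_pairs N)) * ln (off.kap N) + real N * ln (diag.kap N)" for N
  define K where "K = off.M * off.Kt + diag.M * diag.Kt"
  have "\<forall>\<^sub>F N in sequentially. norm (E N) \<le> K / N"
    using eventually_ge_at_top[of "1::nat"]
  proof eventually_elim
    case (elim N)
    have c: "real (card (strict_upper_pairs N)) \<le> (real N)\<^sup>2" "real N \<le> (real N)\<^sup>2"
    proof -
      have "card (strict_upper_pairs N) \<le> card (upper_pairs N)"
        by (rule card_mono[OF upper_pairs_split(5)]) (auto simp: upper_pairs_split(1))
      then show "real (card (strict_upper_pairs N)) \<le> (real N)\<^sup>2" using card_upper_pairs[of N] by (simp flip: of_nat_power)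
      show "real N \<le> (real N)\<^sup>2" using elim by (simp add: self_le_power)
    qed
    have "norm (E N) \<le> real (card (strict_upper_pairs N)) * \<bar>ln (off.kap N)\<bar> + real N * \<bar>ln (diag.kap N)\<bar>"
      unfolding E_def real_norm_def by (rule order_trans[OF abs_triangle_ineq]) (simp add: abs_mult)
    also have "\<dots> \<le> (real N)\<^sup>2 * (off.M * off.Kt / real N ^ 3) + (real N)\<^sup>2 * (diag.M * diag.Kt / real N ^ 3)"
      using c off.ln_kap[OF elim] diag.ln_kap[OF elim] by (intro add_mono mult_mono) auto
    also have "\<dots> = K / N" using elim by (simp add: K_def power2_eq_square power3_eq_cube add_divide_distrib)
    finally show ?case .
  qed
  then have "E \<longlonglongrightarrow> 0" using lim_const_over_n by (rule Lim_null_comparison)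
  then have "(\<lambda>N. exp (E N)) \<longlonglongrightarrow> exp 0" by (intro tendsto_intros)
  moreover have "\<forall>\<^sub>F N in sequentially. exp (E N) = norm_const N"
    using eventually_ge_at_top[of "1::nat"]
    by eventually_elim (simp add: E_def norm_const_def exp_add exp_of_nat_mult off.kap_pos diag.kap_pos)
  ultimately show ?thesis by (simp add: Lim_transform_eventually)
qed

lemma trunc_iterated:
  assumes N: "N \<ge> 1"
  shows "(\<integral>z. min 1 (trunc_LR N z) \<partial>Q0 N) = (\<integral>z. (\<integral>t. min 1 (pair_LR (off.even_part N) (off.odd_part N) N z *
     (\<Prod>e\<in>diag_pairs N. 1 + diag.full_part N (t e))) \<partial>PiM (diag_pairs N) (\<lambda>_. diag.\<nu>)) \<partial>PiM (strict_upper_pairs N) (\<lambda>_. off.\<nu>))"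
proof -
  interpret Q: bm_prob "Q0 N" by (rule bm_prob_Q0)
  have "integrable (PiM (strict_upper_pairs N \<union> diag_pairs N) law) (\<lambda>z. min 1 (trunc_LR N z))"
    using bm_integrable[OF Q.prob_space_axioms bm_min1[OF bm_trunc_LR[OF N]]] by (simp add: upper_pairs_split(1))
  from Q.product_integral_fold[OF upper_pairs_split(2) finite_sup upper_pairs_split(3) this]
  have "(\<integral>z. min 1 (trunc_LR N z) \<partial>Q0 N) = (\<integral>z. (\<integral>t. min 1 (trunc_LR N (merge (strict_upper_pairs N) (diag_pairs N) (z, t)))
     \<partial>PiM (diag_pairs N) law) \<partial>PiM (strict_upper_pairs N) law)"
    by (simp add: upper_pairs_split(1))
  also have "PiM (diag_pairs N) law = PiM (diag_pairs N) (\<lambda>_. diag.\<nu>)" by (rule PiM_cong) (auto simp: law_strict(2))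
  also have "PiM (strict_upper_pairs N) law = PiM (strict_upper_pairs N) (\<lambda>_. off.\<nu>)" by (rule PiM_cong) (auto simp: law_strict(1))
  finally have 1: "(\<integral>z. min 1 (trunc_LR N z) \<partial>Q0 N) = (\<integral>z. (\<integral>t. min 1 (trunc_LR N (merge (strict_upper_pairs N) (diag_pairs N) (z, t)))
     \<partial>PiM (diag_pairs N) (\<lambda>_. diag.\<nu>)) \<partial>PiM (strict_upper_pairs N) (\<lambda>_. off.\<nu>))" .
  have "trunc_LR N (merge (strict_upper_pairs N) (diag_pairs N) (z, t)) =
     pair_LR (off.even_part N) (off.odd_part N) N z * (\<Prod>e\<in>diag_pairs N. 1 + diag.full_part N (t e))" for z t
  proof -
    let ?m = "merge (strict_upper_pairs N) (diag_pairs N) (z, t)"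
    have "?m e = z e" if "e \<in> strict_upper_pairs N" for e using that by (simp add: merge_def)
    moreover have "?m e = t e" if "e \<in> diag_pairs N" for e using that upper_pairs_split(2)[of N] by (auto simp: merge_def)
    ultimately show ?thesis by (simp add: trunc_LR_def pair_LR_def pair_weight_def)
  qed
  then show ?thesis unfolding 1 by simp
qed

lemma full_payoff_limit:
  assumes al: "\<omega> * (\<integral>x. (p1 x)\<^sup>2 / p x \<partial>lborel) < 1"
  shows "(\<lambda>N. \<integral>z. min 1 (full_LR N z) \<partial>Q0 N) \<longlonglongrightarrow>
    erfc (sqrt ((\<omega> * (\<integral>x. (pd1 x)\<^sup>2 / pd x \<partial>lborel) + (\<omega>\<^sup>2 / 4 * (\<integral>x. (p2 x)\<^sup>2 / p x \<partial>lborel) / 2 +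
      psi (\<omega> * (\<integral>x. (p1 x)\<^sup>2 / p x \<partial>lborel)) / 2)) / 8))"
proof -
  obtain B1 where B1: "\<And>N. \<bar>(real N)\<^sup>2 * (\<integral>z. off.odd_part N z ^ 4 \<partial>off.\<nu>)\<bar> \<le> B1"
    using convergent_imp_Bseq[OF convergentI[OF off.odd_moments(2)]] unfolding Bseq_def by auto
  obtain B2 where B2: "\<And>N. \<bar>real N ^ 4 * (\<integral>z. off.even_part N z ^ 4 \<partial>off.\<nu>)\<bar> \<le> B2"
    using convergent_imp_Bseq[OF convergentI[OF off.even_moments(2)]] unfolding Bseq_def by auto
  have lim: "(\<lambda>N. \<integral>z. (\<integral>t. min 1 (pair_LR (off.even_part N) (off.odd_part N) N z *
     (\<Prod>e\<in>diag_pairs N. 1 + diag.full_part N (t e))) \<partial>PiM (diag_pairs N) (\<lambda>_. diag.\<nu>)) \<partial>PiM (strict_upper_pairs N) (\<lambda>_. off.\<nu>))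
    \<longlonglongrightarrow> erfc (sqrt ((\<omega> * (\<integral>x. (pd1 x)\<^sup>2 / pd x \<partial>lborel) + (\<omega>\<^sup>2 / 4 * (\<integral>x. (p2 x)\<^sup>2 / p x \<partial>lborel) / 2 +
      psi (\<omega> * (\<integral>x. (p1 x)\<^sup>2 / p x \<partial>lborel)) / 2)) / 8))"
  proof (rule payoff_limit[where ?K4.0 = "max B1 B2"])
    show "noise_law off.\<nu>" by unfold_locales
    show "(\<lambda>N. N * (\<integral>t. (off.odd_part N t)\<^sup>2 \<partial>off.\<nu>)) \<longlonglongrightarrow> \<omega> * (\<integral>x. (p1 x)\<^sup>2 / p x \<partial>lborel)"
      using off.odd_moments(1) by (simp only: off.info_eq[OF off.q1_meas])
    show "(\<lambda>N. (real N)\<^sup>2 * (\<integral>t. (off.even_part N t)\<^sup>2 \<partial>off.\<nu>)) \<longlonglongrightarrow> \<omega>\<^sup>2 / 4 * (\<integral>x. (p2 x)\<^sup>2 / p x \<partial>lborel)"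
      using off.even_moments(1) by (simp only: off.info_eq[OF off.q2_meas])
    show "(\<lambda>N. N * (\<integral>t. (diag.full_part N t)\<^sup>2 \<partial>diag.\<nu>)) \<longlonglongrightarrow> \<omega> * (\<integral>x. (pd1 x)\<^sup>2 / pd x \<partial>lborel)"
      using diag.full_moments(1) by (simp only: diag.info_eq[OF diag.q1_meas])
    show "(\<lambda>N. N * (\<integral>t. \<bar>diag.full_part N t\<bar> ^ 3 \<partial>diag.\<nu>)) \<longlonglongrightarrow> 0" by (rule diag.full_moments)
    show "(real N)\<^sup>2 * (\<integral>t. off.odd_part N t ^ 4 \<partial>off.\<nu>) \<le> max B1 B2" for N using B1[of N] by linarith
    show "real N ^ 4 * (\<integral>t. off.even_part N t ^ 4 \<partial>off.\<nu>) \<le> max B1 B2" for N using B2[of N] by linarith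
  qed (auto simp: off.parts_bm off.parts_int off.parts_pos diag.diag_law_full upper_pairs_split al simp del: insert_iff)
  have diff: "(\<lambda>N. (\<integral>z. min 1 (full_LR N z) \<partial>Q0 N) - (\<integral>z. (\<integral>t. min 1 (pair_LR (off.even_part N) (off.odd_part N) N z *
     (\<Prod>e\<in>diag_pairs N. 1 + diag.full_part N (t e))) \<partial>PiM (diag_pairs N) (\<lambda>_. diag.\<nu>)) \<partial>PiM (strict_upper_pairs N) (\<lambda>_. off.\<nu>))) \<longlonglongrightarrow> 0"
  proof (rule Lim_null_comparison)
    have "(\<lambda>N. \<bar>norm_const N - 1\<bar> + (off.Kt + diag.Kt) / real N) \<longlonglongrightarrow> \<bar>1 - 1\<bar> + 0"
      by (intro tendsto_intros norm_const_lim lim_const_over_n)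
    then show "(\<lambda>N. \<bar>norm_const N - 1\<bar> + (off.Kt + diag.Kt) / real N) \<longlonglongrightarrow> 0" by simp
    show "\<forall>\<^sub>F N in sequentially. norm ((\<integral>z. min 1 (full_LR N z) \<partial>Q0 N) - (\<integral>z. (\<integral>t. min 1 (pair_LR (off.even_part N) (off.odd_part N) N z *
     (\<Prod>e\<in>diag_pairs N. 1 + diag.full_part N (t e))) \<partial>PiM (diag_pairs N) (\<lambda>_. diag.\<nu>)) \<partial>PiM (strict_upper_pairs N) (\<lambda>_. off.\<nu>)))
      \<le> \<bar>norm_const N - 1\<bar> + (off.Kt + diag.Kt) / real N"
      using eventually_ge_at_top[of "1::nat"]
      by eventually_elim (use truncation_error trunc_iterated in simp)
  qed
  from tendsto_add[OF lim diff] show ?thesis by simp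
qed

end

section \<open>The limiting error\<close>

lemma shift_density_noise:
  assumes nd: "noise_densities p pd" and q: "q \<in> {p, pd}" and om: "\<omega> > 0" and K: "K > 0" "r > 0"
    and growth: "\<And>x. \<bar>deriv q x / q x\<bar> \<le> K * (1 + \<bar>x\<bar> powr r)" "\<And>x. \<bar>deriv (deriv q) x / q x\<bar> \<le> K * (1 + \<bar>x\<bar> powr r)"
    and Z: "distributed \<Omega> lborel Z (\<lambda>x. ennreal (q x))" "prob_space \<Omega>" "\<And>D. D > 0 \<Longrightarrow> integrable \<Omega> (\<lambda>\<xi>. \<bar>Z \<xi>\<bar> powr D)"
  shows "shift_density q (deriv q) (deriv (deriv q)) \<omega> K r"
proof (rule shift_density.intro)
  have diff: "(deriv ^^ n) q differentiable (at x)" for n x using nd q unfolding noise_densities_def by blast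
  show "q x > 0" "q (- x) = q x" for x using nd q unfolding noise_densities_def by blast+
  have D: "((deriv ^^ n) q has_real_derivative deriv ((deriv ^^ n) q) x) (at x)" for n x
    using diff[of n x] by (simp add: DERIV_deriv_iff_real_differentiable)
  show "(q has_real_derivative deriv q x) (at x)" "(deriv q has_real_derivative deriv (deriv q) x) (at x)" for x
    using D[of 0] D[of 1] by (simp_all add: One_nat_def)
  show "isCont (deriv (deriv q)) x" for x
    using DERIV_isCont[OF D[of 2 x]] by (simp add: numeral_2_eq_2)
  interpret \<Omega>: prob_space \<Omega> by fact
  have d: "distr \<Omega> lborel Z = density lborel q" using distributed_distr_eq_density[OF Z(1)] .
  have m: "Z \<in> \<Omega> \<rightarrow>\<^sub>M lborel" using Z(1) by (rule distributed_measurable)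
  show "prob_space (density lborel q)" unfolding d[symmetric] by (rule \<Omega>.prob_space_distr[OF m])
  show "integrable (density lborel q) (\<lambda>x. \<bar>x\<bar> powr D)" if "D > 0" for D
    unfolding d[symmetric] by (subst integrable_distr_eq[OF m]) (auto intro: Z(3)[OF that])
qed (use om K growth in auto)

lemma noise_growth:
  assumes "noise_densities p pd"
  obtains K r where "K > 0" "r > 0" "\<And>q x. q \<in> {p, pd} \<Longrightarrow> \<bar>deriv q x / q x\<bar> \<le> K * (1 + \<bar>x\<bar> powr r)"
    "\<And>q x. q \<in> {p, pd} \<Longrightarrow> \<bar>deriv (deriv q) x / q x\<bar> \<le> K * (1 + \<bar>x\<bar> powr r)"
proof -
  have "\<exists>C>0. \<exists>r>0. \<forall>x. \<forall>q\<in>{p, pd}. \<bar>(deriv ^^ s) q x / q x\<bar> \<le> C * (1 + \<bar>x\<bar> powr r)" if "s \<ge> 1" for s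
    using assms that unfolding noise_densities_def by blast
  note C = this
  obtain C1 r1 where 1: "C1 > 0" "r1 > 0" "\<And>q x. q \<in> {p, pd} \<Longrightarrow> \<bar>deriv q x / q x\<bar> \<le> C1 * (1 + \<bar>x\<bar> powr r1)"
    using C[of 1] by (auto simp: One_nat_def)
  obtain C2 r2 where 2: "C2 > 0" "r2 > 0" "\<And>q x. q \<in> {p, pd} \<Longrightarrow> \<bar>deriv (deriv q) x / q x\<bar> \<le> C2 * (1 + \<bar>x\<bar> powr r2)"
    using C[of 2] by (auto simp: numeral_2_eq_2 One_nat_def)
  have le: "C * (1 + \<bar>x\<bar> powr r) \<le> 2 * (C1 + C2) * (1 + \<bar>x\<bar> powr max r1 r2)"
    if "0 \<le> C" "C \<le> C1 + C2" "0 \<le> r" "r \<le> max r1 r2" for C r x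
  proof -
    have "\<bar>x\<bar> powr r \<le> 1 + \<bar>x\<bar> powr max r1 r2"
    proof (cases "\<bar>x\<bar> \<le> 1")
      case True
      then have "\<bar>x\<bar> powr r \<le> 1 powr r" using that by (intro powr_mono2) auto
      then show ?thesis by (simp add: add_increasing2)
    next
      case False
      then have "\<bar>x\<bar> powr r \<le> \<bar>x\<bar> powr max r1 r2" using that by (intro powr_mono) auto
      then show ?thesis by simp
    qed
    then have "1 + \<bar>x\<bar> powr r \<le> 2 * (1 + \<bar>x\<bar> powr max r1 r2)" using powr_ge_zero[of "\<bar>x\<bar>" "max r1 r2"] unfolding distrib_left by linarith
    then have "C * (1 + \<bar>x\<bar> powr r) \<le> (C1 + C2) * (2 * (1 + \<bar>x\<bar> powr max r1 r2))"
      using that by (intro mult_mono) auto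
    then show ?thesis by (simp only: mult.assoc mult.left_commute[of 2])
  qed
  show thesis
  proof (rule that[of "2 * (C1 + C2)" "max r1 r2"])
    show "0 < 2 * (C1 + C2)" "0 < max r1 r2" using 1(1,2) 2(1,2) by (auto simp: less_max_iff_disj)
    fix q x assume q: "q \<in> {p, pd}"
    show "\<bar>deriv q x / q x\<bar> \<le> 2 * (C1 + C2) * (1 + \<bar>x\<bar> powr max r1 r2)"
      by (rule order_trans[OF 1(3)[OF q] le]) (use 1(1,2) 2(1,2) in auto)
    show "\<bar>deriv (deriv q) x / q x\<bar> \<le> 2 * (C1 + C2) * (1 + \<bar>x\<bar> powr max r1 r2)"
      by (rule order_trans[OF 2(3)[OF q] le]) (use 1(1,2) 2(1,2) in auto)
  qed
qed

lemma lrt_rho_eq: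
  "(\<omega> * info_F pd + (\<omega>\<^sup>2 / 4 * info_G p / 2 + psi (\<omega> * info_F p) / 2)) / 8 = lrt_rho p pd \<omega> / 4"
proof -
  have "(w * Fd + (w2 / 4 * G / 2 + (- l - w * F - w2 * F2 / 2) / 2)) / 8 =
    - (1 / 4) * (l + w * (F - 2 * Fd) + w2 / 4 * (2 * F2 - G)) / 4" for w w2 F F2 Fd G l :: real
    by (simp add: algebra_simps add_divide_distrib diff_divide_distrib)
  then show ?thesis unfolding lrt_rho_def psi_def Let_def power_mult_distrib .
qed

lemma wigner_noiseD:
  assumes W: "wigner_noise P H p pd" and N: "N \<ge> 1"
  shows "prob_space (P N)"
    and "(i, j) \<in> strict_upper_pairs N \<Longrightarrow> distributed (P N) lborel (\<lambda>\<xi>. sqrt N * H N i j \<xi>) (\<lambda>x. ennreal (p x))"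
    and "i \<in> {1..N} \<Longrightarrow> distributed (P N) lborel (\<lambda>\<xi>. sqrt N * H N i i \<xi>) (\<lambda>x. ennreal (pd x))"
    and "D > 0 \<Longrightarrow> (i, j) \<in> upper_pairs N \<Longrightarrow> integrable (P N) (\<lambda>\<xi>. \<bar>sqrt N * H N i j \<xi>\<bar> powr D)"
proof -
  show "prob_space (P N)"
    and "(i, j) \<in> strict_upper_pairs N \<Longrightarrow> distributed (P N) lborel (\<lambda>\<xi>. sqrt N * H N i j \<xi>) (\<lambda>x. ennreal (p x))"
    and "i \<in> {1..N} \<Longrightarrow> distributed (P N) lborel (\<lambda>\<xi>. sqrt N * H N i i \<xi>) (\<lambda>x. ennreal (pd x))"
    using W N unfolding wigner_noise_def by fast+
  assume D: "D > 0" and ij: "(i, j) \<in> upper_pairs N"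
  have "\<forall>D>0. \<exists>C. \<forall>N\<ge>1. \<forall>(i, j)\<in>upper_pairs N. integrable (P N) (\<lambda>\<xi>. \<bar>H N i j \<xi>\<bar> powr D) \<and>
      real N powr (D / 2) * prob_space.expectation (P N) (\<lambda>\<xi>. \<bar>H N i j \<xi>\<bar> powr D) \<le> C"
    using W unfolding wigner_noise_def by (elim conjE)
  with D N ij have "integrable (P N) (\<lambda>\<xi>. \<bar>H N i j \<xi>\<bar> powr D)" by fast
  then have "integrable (P N) (\<lambda>\<xi>. sqrt N powr D * \<bar>H N i j \<xi>\<bar> powr D)" by (rule integrable_mult_right)
  then show "integrable (P N) (\<lambda>\<xi>. \<bar>sqrt N * H N i j \<xi>\<bar> powr D)" by (simp add: abs_mult powr_mult)
qed

theorem corollary2p5: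
  fixes P :: "nat \<Rightarrow> 'a measure"
    and H :: "nat \<Rightarrow> nat \<Rightarrow> nat \<Rightarrow> 'a \<Rightarrow> real"
    and X :: "nat \<Rightarrow> nat \<Rightarrow> 'a \<Rightarrow> real"
    and p pd :: "real \<Rightarrow> real"
    and \<omega> :: real
  assumes "noise_densities p pd"
    and "wigner_noise P H p pd"
    and "rademacher_spike P H X"
    and "\<omega> > 0"
    and "\<omega> * info_F p < 1"
  shows "(\<lambda>N. lrt_error P H X p pd \<omega> N) \<longlonglongrightarrow> erfc (sqrt (lrt_rho p pd \<omega>) / 2)"
proof -
  obtain K r where Kr: "K > 0" "r > 0" "\<And>q x. q \<in> {p, pd} \<Longrightarrow> \<bar>deriv q x / q x\<bar> \<le> K * (1 + \<bar>x\<bar> powr r)"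
    "\<And>q x. q \<in> {p, pd} \<Longrightarrow> \<bar>deriv (deriv q) x / q x\<bar> \<le> K * (1 + \<bar>x\<bar> powr r)"
    using noise_growth[OF assms(1)] by blast
  \<comment> \<open>Size two already has entries of both kinds, and their laws show that both densities are probability
    densities with all moments.\<close>
  note W = wigner_noiseD[OF assms(2), of 2, simplified]
  have "(1, 2) \<in> strict_upper_pairs 2" "(1, 2) \<in> upper_pairs 2" "(1, 1) \<in> upper_pairs 2"
    by (simp_all add: strict_upper_pairs_def upper_pairs_def)
  note pairs = this
  have off: "shift_density p (deriv p) (deriv (deriv p)) \<omega> K r"
    by (rule shift_density_noise[OF assms(1) _ assms(4) Kr(1,2) Kr(3,4)[of p] W(2)[OF pairs(1)] W(1) W(4)[OF _ pairs(2)]]) auto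
  have dia: "shift_density pd (deriv pd) (deriv (deriv pd)) \<omega> K r"
    by (rule shift_density_noise[OF assms(1) _ assms(4) Kr(1,2) Kr(3,4)[of pd] W(3)[of 1] W(1) W(4)[OF _ pairs(3)]]) auto
  interpret spiked_densities p "deriv p" "deriv (deriv p)" pd "deriv pd" "deriv (deriv pd)" \<omega> K r
    by (intro spiked_densities.intro off dia)
  have "(\<lambda>N. \<integral>z. min 1 (full_LR N z) \<partial>Q0 N) \<longlonglongrightarrow> erfc (sqrt (lrt_rho p pd \<omega> / 4))"
    using full_payoff_limit[folded info_F_def info_G_def, OF assms(5)] unfolding lrt_rho_eq .
  moreover have "\<forall>\<^sub>F N in sequentially. (\<integral>z. min 1 (full_LR N z) \<partial>Q0 N) = lrt_error P H X p pd \<omega> N"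
    using eventually_ge_at_top[of "1::nat"] by eventually_elim (simp add: lrt_error_eq[OF assms(2,3)])
  ultimately show ?thesis by (simp add: real_sqrt_divide Lim_transform_eventually)
qed

end
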